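(* Let $A$ be a finite-dimensional connected algebra over a field $K$, with simple modules $L_1,\dots,L_n$ (up to isomorphism, without repetition), projective covers $P_i$ and injective hulls $Q_i$ of $L_i$. Suppose that $\dim_K\operatorname{End}_A(L_i)=1$ for every $i$. Assume that (B1) $\operatorname{LL}(P_i)=\operatorname{LL}(Q_i)=:l_i$ for all $1\le i\le n$; and (B2) $[P'_{k,l}:L'_{i,j}]=[P^{S_A}_{k,l_k-l+1}:L^{S_A}_{i,l_i-j+1}]$ for all $1\le i,k\le n$, $1\le j\le l_i$ and $1\le l\le l_k$. Then: 1. all the Loewy lengths $l_i$ are equal (i.e. $l_i=l_k$ for all $i,k$); 2. each projective $P_i$ is rigid; 3. each injective $Q_i$ is rigid. Here $P'_{k,l},L'_{k,l}$ are the indecomposable projective and simple modules of the Ringel dual $\mathcal{R}(R_A)$ of the ADR algebra $R_A$, and $P^{S_A}_{k,l},L^{S_A}_{k,l}$ are those of $S_A\cong(R_{A^{op}})^{op}$.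
   Context: Modules are finitely generated left modules. $[M:L]$ is the multiplicity of the simple module $L$ as a composition factor of $M$. $\operatorname{Rad}^j M$ and $\operatorname{Soc}_j M$ are the terms of the radical and socle series, $\operatorname{LL}(M)$ is the Loewy length. A module is rigid if its radical series coincides with its socle series. Quasihereditary algebras. Let $B$ be an algebra whose simple modules $L_i$ are labelled by a finite poset $(\Phi,\sqsubseteq)$, with projective covers $P_i$ and injective hulls $Q_i$. The standard module $\Delta(i)$ is the largest quotient of $P_i$ with all composition factors $L_j$, $j\sqsubseteq i$; the costandard module $\nabla(i)$ is the largest submodule of $Q_i$ with all composition factors $L_j$, $j\sqsubseteq i$. $\mathcal{F}(\Delta)$ (resp. $\mathcal{F}(\nabla)$) is the category of modules filtered by standard (resp. costandard) modules. $(B,\Phi,\sqsubseteq)$ is quasihereditary if for all $i$: $[\Delta(i):L_i]=1$; $P_i\in\mathcal{F}(\Delta)$; $\Delta(i)$ occurs once in a $\Delta$-filtration of $P_i$ and any other factor $\Delta(j)$ satisfies $j\sqsupseteq i$. The indecomposable modules in $\mathcal{F}(\Delta)\cap\mathcal{F}(\nabla)$ are modules $T(i)$, $i\in\Phi$, where there is a monomorphism $\Delta(i)\to T(i)$ with cokernel filtered by modules $\Delta(j)$, $j\sqsubset i$. Put $T=\bigoplus_{i\in\Phi}T(i)$; the Ringel dual is $\mathcal{R}(B)=\operatorname{End}_B(T)^{op}$. ADR algebra. With $l_i=\operatorname{LL}(P_i)$ let $G=\bigoplus_{i=1}^n\bigoplus_{j=1}^{l_i}P_i/\operatorname{Rad}^jP_i$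 and $R_A=\operatorname{End}_A(G)^{op}$. Its indecomposable projectives $P_{i,j}=\operatorname{Hom}_A(G,P_i/\operatorname{Rad}^jP_i)$ are labelled by $\Lambda=\{(i,j):1\le i\le n,1\le j\le l_i\}$, ordered by $(i,j)\lhd(k,l)\Leftrightarrow j>l$; it is known that $(R_A,\Lambda,\unlhd)$ is quasihereditary. With $T(i,j)$ the indecomposable tilting modules of $R_A$ and $T=\bigoplus_{(i,j)\in\Lambda} T(i,j)$, put $P'_{i,j}=\operatorname{Hom}_{R_A}(T,T(i,j))$ (an indecomposable projective $\mathcal{R}(R_A)$-module) and $L'_{i,j}=\operatorname{Top}P'_{i,j}$. The algebra $S_A$. Let $C=\bigoplus_{i=1}^n\bigoplus_{j=1}^{\operatorname{LL}(Q_i)}\operatorname{Soc}_jQ_i$ and $S_A=\operatorname{End}_A(C)^{op}$ (which is isomorphic to $(R_{A^{op}})^{op}$). Put $P^{S_A}_{i,j}=\operatorname{Hom}_A(C,\operatorname{Soc}_jQ_i)$ for $1\le i\le n$, $1\le j\le\operatorname{LL}(Q_i)$ and $L^{S_A}_{i,j}=\operatorname{Top}P^{S_A}_{i,j}$. *)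

theory Defs
  imports "HOL-Algebra.Module" "HOL-Algebra.Ideal"
begin

section \<open>Left modules over a ring that need not be commutative\<close>

text \<open>The library locale \<open>module\<close> is restricted to commutative rings. We reuse its record
  type (the fields \<open>mult\<close> and \<open>one\<close> play no role for a module) and its locale \<open>submodule\<close>,
  which does not mention commutativity of the ring.\<close>

locale left_module = R?: ring R + M?: abelian_group M
  for R :: "('r, 'e) ring_scheme" (structure) and M :: "('r, 'm, 'f) module_scheme" (structure) +
  assumes smult_closed [simp, intro]:
      "\<lbrakk>a \<in> carrier R; x \<in> carrier M\<rbrakk> \<Longrightarrow> a \<odot>\<^bsub>M\<^esub> x \<in> carrier M"
    and smult_l_distr:
      "\<lbrakk>a \<in> carrier R; b \<in> carrier R; x \<in> carrier M\<rbrakk> \<Longrightarrow>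
      (a \<oplus> b) \<odot>\<^bsub>M\<^esub> x = a \<odot>\<^bsub>M\<^esub> x \<oplus>\<^bsub>M\<^esub> b \<odot>\<^bsub>M\<^esub> x"
    and smult_r_distr:
      "\<lbrakk>a \<in> carrier R; x \<in> carrier M; y \<in> carrier M\<rbrakk> \<Longrightarrow>
      a \<odot>\<^bsub>M\<^esub> (x \<oplus>\<^bsub>M\<^esub> y) = a \<odot>\<^bsub>M\<^esub> x \<oplus>\<^bsub>M\<^esub> a \<odot>\<^bsub>M\<^esub> y"
    and smult_assoc1:
      "\<lbrakk>a \<in> carrier R; b \<in> carrier R; x \<in> carrier M\<rbrakk> \<Longrightarrow>
      (a \<otimes> b) \<odot>\<^bsub>M\<^esub> x = a \<odot>\<^bsub>M\<^esub> (b \<odot>\<^bsub>M\<^esub> x)"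
    and smult_one [simp]:
      "x \<in> carrier M \<Longrightarrow> \<one> \<odot>\<^bsub>M\<^esub> x = x"

definition span_in :: "('r, 'e) ring_scheme \<Rightarrow> ('r, 'm) module \<Rightarrow> 'm set \<Rightarrow> 'm set" where
  "span_in R M S = \<Inter>{N. submodule N R M \<and> S \<subseteq> N}"

definition fin_gen :: "('r, 'e) ring_scheme \<Rightarrow> ('r, 'm) module \<Rightarrow> bool" where
  "fin_gen R M \<longleftrightarrow> (\<exists>S. finite S \<and> S \<subseteq> carrier M \<and> span_in R M S = carrier M)"

definition fg_module :: "('r, 'e) ring_scheme \<Rightarrow> ('r, 'm) module \<Rightarrow> bool" where
  "fg_module R M \<longleftrightarrow> left_module R M \<and> fin_gen R M"

text \<open>Over a field: \<open>V\<close> has a basis with \<open>d\<close> elements.\<close>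

definition has_dim :: "('k, 'e) ring_scheme \<Rightarrow> ('k, 'v) module \<Rightarrow> nat \<Rightarrow> bool" where
  "has_dim K V d \<longleftrightarrow> (\<exists>B. finite B \<and> B \<subseteq> carrier V \<and> card B = d \<and>
     span_in K V B = carrier V \<and> (\<forall>b\<in>B. b \<notin> span_in K V (B - {b})))"

text \<open>A finite-dimensional unital associative algebra; the record \<open>A\<close> carries both the ring
  structure and the scalar multiplication by elements of \<open>K\<close>.\<close>

locale fd_algebra = K?: field K + module K A + A?: ring A
  for K :: "('k, 'e) ring_scheme" (structure) and A :: "('k, 'a) module" (structure) +
  assumes smult_mult_left:
      "\<lbrakk>c \<in> carrier K; x \<in> carrier A; y \<in> carrier A\<rbrakk> \<Longrightarrow>
      (c \<odot>\<^bsub>A\<^esub> x) \<otimes>\<^bsub>A\<^esub> y = c \<odot>\<^bsub>A\<^esub> (x \<otimes>\<^bsub>A\<^esub> y)"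
    and smult_mult_right:
      "\<lbrakk>c \<in> carrier K; x \<in> carrier A; y \<in> carrier A\<rbrakk> \<Longrightarrow>
      x \<otimes>\<^bsub>A\<^esub> (c \<odot>\<^bsub>A\<^esub> y) = c \<odot>\<^bsub>A\<^esub> (x \<otimes>\<^bsub>A\<^esub> y)"
    and finite_dim: "fin_gen K A"

text \<open>Connected: nonzero and not a direct product of two nonzero algebras.\<close>

definition connected_alg :: "('k, 'a) module \<Rightarrow> bool" where
  "connected_alg A \<longleftrightarrow> \<one>\<^bsub>A\<^esub> \<noteq> \<zero>\<^bsub>A\<^esub> \<and>
     (\<forall>I J. ideal I A \<and> ideal J A \<and> I \<inter> J = {\<zero>\<^bsub>A\<^esub>} \<and> I <+>\<^bsub>A\<^esub> J = carrier A
        \<longrightarrow> I = {\<zero>\<^bsub>A\<^esub>} \<or> J = {\<zero>\<^bsub>A\<^esub>})"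

subsection \<open>Homomorphisms, quotients, direct sums\<close>

text \<open>Homomorphisms are extensional functions, so that equality in a Hom space is equality
  on the carrier.\<close>

definition lhom :: "('r, 'e) ring_scheme \<Rightarrow> ('r, 'm) module \<Rightarrow> ('r, 'n) module \<Rightarrow> ('m \<Rightarrow> 'n) set" where
  "lhom R M N = {f \<in> carrier M \<rightarrow>\<^sub>E carrier N.
     (\<forall>x\<in>carrier M. \<forall>y\<in>carrier M. f (x \<oplus>\<^bsub>M\<^esub> y) = f x \<oplus>\<^bsub>N\<^esub> f y) \<and>
     (\<forall>r\<in>carrier R. \<forall>x\<in>carrier M. f (r \<odot>\<^bsub>M\<^esub> x) = r \<odot>\<^bsub>N\<^esub> f x)}"

definition isomorphic :: "('r, 'e) ring_scheme \<Rightarrow> ('r, 'm) module \<Rightarrow> ('r, 'n) module \<Rightarrow> bool" where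
  "isomorphic R M N \<longleftrightarrow> (\<exists>f\<in>lhom R M N. bij_betw f (carrier M) (carrier N))"

abbreviation restr :: "('r, 'm) module \<Rightarrow> 'm set \<Rightarrow> ('r, 'm) module" where
  "restr M N \<equiv> M\<lparr>carrier := N\<rparr>"

definition quot :: "('r, 'm) module \<Rightarrow> 'm set \<Rightarrow> ('r, 'm set) module" where
  "quot M N = \<lparr>carrier = a_rcosets\<^bsub>M\<^esub> N, mult = undefined, one = undefined, zero = N,
     add = (\<lambda>S S'. S <+>\<^bsub>M\<^esub> S'), smult = (\<lambda>r S. \<Union>x\<in>S. N +>\<^bsub>M\<^esub> (r \<odot>\<^bsub>M\<^esub> x))\<rparr>"

text \<open>Direct sum over a finite index set.\<close>

definition dsum :: "'i set \<Rightarrow> ('i \<Rightarrow> ('r, 'm) module) \<Rightarrow> ('r, 'i \<Rightarrow> 'm) module" where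
  "dsum I M = \<lparr>carrier = (\<Pi>\<^sub>E i\<in>I. carrier (M i)), mult = undefined, one = undefined,
     zero = (\<lambda>i\<in>I. \<zero>\<^bsub>M i\<^esub>), add = (\<lambda>x y. \<lambda>i\<in>I. x i \<oplus>\<^bsub>M i\<^esub> y i),
     smult = (\<lambda>r x. \<lambda>i\<in>I. r \<odot>\<^bsub>M i\<^esub> x i)\<rparr>"

text \<open>The algebra of endomorphisms of a module \<open>M\<close> over a \<open>K\<close>-algebra \<open>A\<close>; here \<open>K\<close> acts
  on \<open>M\<close> through the structure map \<open>c \<mapsto> c 1\<close> of \<open>A\<close>.\<close>

definition end_alg :: "('k, 'a) module \<Rightarrow> ('a, 'm) module \<Rightarrow> ('k, 'm \<Rightarrow> 'm) module" where
  "end_alg A M = \<lparr>carrier = lhom A M M, mult = compose (carrier M), one = (\<lambda>x\<in>carrier M. x),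
     zero = (\<lambda>x\<in>carrier M. \<zero>\<^bsub>M\<^esub>), add = (\<lambda>f g. \<lambda>x\<in>carrier M. f x \<oplus>\<^bsub>M\<^esub> g x),
     smult = (\<lambda>c f. \<lambda>x\<in>carrier M. (c \<odot>\<^bsub>A\<^esub> \<one>\<^bsub>A\<^esub>) \<odot>\<^bsub>M\<^esub> f x)\<rparr>"

definition op_alg :: "('k, 'a) module \<Rightarrow> ('k, 'a) module" where
  "op_alg A = A\<lparr>mult := (\<lambda>x y. y \<otimes>\<^bsub>A\<^esub> x)\<rparr>"

text \<open>\<open>Hom(G, V)\<close> as a left module over the opposite of the endomorphism algebra of \<open>G\<close>,
  which acts by composition on the right.\<close>

definition hom_mod :: "('r, 'e) ring_scheme \<Rightarrow> ('r, 'g) module \<Rightarrow> ('r, 'x) module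
    \<Rightarrow> ('g \<Rightarrow> 'g, 'g \<Rightarrow> 'x) module" where
  "hom_mod R G V = \<lparr>carrier = lhom R G V, mult = undefined, one = undefined,
     zero = (\<lambda>x\<in>carrier G. \<zero>\<^bsub>V\<^esub>), add = (\<lambda>f g. \<lambda>x\<in>carrier G. f x \<oplus>\<^bsub>V\<^esub> g x),
     smult = (\<lambda>s f. compose (carrier G) f s)\<rparr>"

subsection \<open>Simple modules, radical and socle series\<close>

definition simple_mod :: "('r, 'e) ring_scheme \<Rightarrow> ('r, 'm) module \<Rightarrow> bool" where
  "simple_mod R M \<longleftrightarrow> left_module R M \<and> carrier M \<noteq> {\<zero>\<^bsub>M\<^esub>} \<and>
     (\<forall>N. submodule N R M \<longrightarrow> N = {\<zero>\<^bsub>M\<^esub>} \<or> N = carrier M)"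

definition indecomposable :: "('r, 'e) ring_scheme \<Rightarrow> ('r, 'm) module \<Rightarrow> bool" where
  "indecomposable R M \<longleftrightarrow> carrier M \<noteq> {\<zero>\<^bsub>M\<^esub>} \<and>
     (\<forall>N N'. submodule N R M \<and> submodule N' R M \<and> N \<inter> N' = {\<zero>\<^bsub>M\<^esub>} \<and> N <+>\<^bsub>M\<^esub> N' = carrier M
        \<longrightarrow> N = {\<zero>\<^bsub>M\<^esub>} \<or> N' = {\<zero>\<^bsub>M\<^esub>})"

definition maximal_submodule :: "('r, 'e) ring_scheme \<Rightarrow> ('r, 'm) module \<Rightarrow> 'm set \<Rightarrow> bool" where
  "maximal_submodule R M N \<longleftrightarrow> submodule N R M \<and> N \<noteq> carrier M \<and>
     (\<forall>N'. submodule N' R M \<and> N \<subseteq> N' \<longrightarrow> N' = N \<or> N' = carrier M)"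

definition rad :: "('r, 'e) ring_scheme \<Rightarrow> ('r, 'm) module \<Rightarrow> 'm set" where
  "rad R M = carrier M \<inter> \<Inter>{N. maximal_submodule R M N}"

definition soc :: "('r, 'e) ring_scheme \<Rightarrow> ('r, 'm) module \<Rightarrow> 'm set" where
  "soc R M = span_in R M (\<Union>{N. submodule N R M \<and> simple_mod R (restr M N)})"

definition top_mod :: "('r, 'e) ring_scheme \<Rightarrow> ('r, 'm) module \<Rightarrow> ('r, 'm set) module" where
  "top_mod R M = quot M (rad R M)"

primrec rad_pow :: "('r, 'e) ring_scheme \<Rightarrow> ('r, 'm) module \<Rightarrow> nat \<Rightarrow> 'm set" where
  "rad_pow R M 0 = carrier M"
| "rad_pow R M (Suc j) = rad R (restr M (rad_pow R M j))"

text \<open>The elements of a submodule of \<open>quot M N\<close> are cosets of \<open>N\<close>, so its preimage in \<open>M\<close>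
  is their union.\<close>

primrec soc_pow :: "('r, 'e) ring_scheme \<Rightarrow> ('r, 'm) module \<Rightarrow> nat \<Rightarrow> 'm set" where
  "soc_pow R M 0 = {\<zero>\<^bsub>M\<^esub>}"
| "soc_pow R M (Suc j) = \<Union>(soc R (quot M (soc_pow R M j)))"

definition loewy_length :: "('r, 'e) ring_scheme \<Rightarrow> ('r, 'm) module \<Rightarrow> nat" where
  "loewy_length R M = (LEAST m. rad_pow R M m = {\<zero>\<^bsub>M\<^esub>})"

definition rigid :: "('r, 'e) ring_scheme \<Rightarrow> ('r, 'm) module \<Rightarrow> bool" where
  "rigid R M \<longleftrightarrow>
     (\<forall>j\<le>loewy_length R M. rad_pow R M j = soc_pow R M (loewy_length R M - j))"

subsection \<open>Filtrations and composition multiplicities\<close>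

text \<open>A filtration is the list of its terms, from the zero submodule up to the whole module;
  \<open>filt_factor M Ns i\<close> is the subquotient \<open>Ns\<^sub>i\<^sub>+\<^sub>1 / Ns\<^sub>i\<close>, for \<open>Suc i < length Ns\<close>.\<close>

definition filtration :: "('r, 'e) ring_scheme \<Rightarrow> ('r, 'm) module \<Rightarrow> 'm set list \<Rightarrow> bool" where
  "filtration R M Ns \<longleftrightarrow> Ns \<noteq> [] \<and> hd Ns = {\<zero>\<^bsub>M\<^esub>} \<and> last Ns = carrier M \<and>
     (\<forall>N\<in>set Ns. submodule N R M) \<and> (\<forall>i. Suc i < length Ns \<longrightarrow> Ns ! i \<subseteq> Ns ! Suc i)"

definition filt_factor :: "('r, 'm) module \<Rightarrow> 'm set list \<Rightarrow> nat \<Rightarrow> ('r, 'm set) module" where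
  "filt_factor M Ns i = quot (restr M (Ns ! Suc i)) (Ns ! i)"

definition filtered_by :: "('r, 'e) ring_scheme \<Rightarrow> ('i \<Rightarrow> ('r, 'x) module) \<Rightarrow> 'i set
    \<Rightarrow> ('r, 'm) module \<Rightarrow> bool" where
  "filtered_by R D I M \<longleftrightarrow> (\<exists>Ns. filtration R M Ns \<and>
     (\<forall>i. Suc i < length Ns \<longrightarrow> (\<exists>j\<in>I. isomorphic R (filt_factor M Ns i) (D j))))"

definition comp_series :: "('r, 'e) ring_scheme \<Rightarrow> ('r, 'm) module \<Rightarrow> 'm set list \<Rightarrow> bool" where
  "comp_series R M Ns \<longleftrightarrow> filtration R M Ns \<and>
     (\<forall>i. Suc i < length Ns \<longrightarrow> simple_mod R (filt_factor M Ns i))"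

text \<open>\<open>[M : L]\<close>; by the Jordan--Hoelder theorem the number does not depend on the series.\<close>

definition multiplicity_of :: "('r, 'e) ring_scheme \<Rightarrow> ('r, 'm) module \<Rightarrow> ('r, 'l) module \<Rightarrow> nat" where
  "multiplicity_of R M L = (THE m. \<exists>Ns. comp_series R M Ns \<and>
     m = card {i. Suc i < length Ns \<and> isomorphic R (filt_factor M Ns i) L})"

definition comp_factors_among :: "('r, 'e) ring_scheme \<Rightarrow> ('i \<Rightarrow> ('r, 'l) module) \<Rightarrow> 'i set
    \<Rightarrow> ('r, 'm) module \<Rightarrow> bool" where
  "comp_factors_among R L I M \<longleftrightarrow> (\<exists>Ns. comp_series R M Ns \<and>
     (\<forall>i. Suc i < length Ns \<longrightarrow> (\<exists>j\<in>I. isomorphic R (filt_factor M Ns i) (L j))))"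

subsection \<open>Projective covers and injective hulls\<close>

text \<open>A definition cannot quantify over types, so the test modules must live on one type.
  Every finitely generated left \<open>R\<close>-module is isomorphic to a quotient of some \<open>R\<^sup>n\<close>, hence to a
  module whose elements are sets of functions \<open>nat \<Rightarrow> 'r\<close>. Testing against the finitely
  generated modules on that type is therefore testing against all of them;
  see lemma \<open>fg_module_small\<close>.\<close>

type_synonym 'r small_module = "('r, (nat \<Rightarrow> 'r) set) module"

lemma left_moduleI:
  assumes "ring R" "abelian_group M"
    "\<And>a x. \<lbrakk>a \<in> carrier R; x \<in> carrier M\<rbrakk> \<Longrightarrow> a \<odot>\<^bsub>M\<^esub> x \<in> carrier M"
    "\<And>a b x. \<lbrakk>a \<in> carrier R; b \<in> carrier R; x \<in> carrier M\<rbrakk> \<Longrightarrow>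
      (a \<oplus>\<^bsub>R\<^esub> b) \<odot>\<^bsub>M\<^esub> x = a \<odot>\<^bsub>M\<^esub> x \<oplus>\<^bsub>M\<^esub> b \<odot>\<^bsub>M\<^esub> x"
    "\<And>a x y. \<lbrakk>a \<in> carrier R; x \<in> carrier M; y \<in> carrier M\<rbrakk> \<Longrightarrow>
      a \<odot>\<^bsub>M\<^esub> (x \<oplus>\<^bsub>M\<^esub> y) = a \<odot>\<^bsub>M\<^esub> x \<oplus>\<^bsub>M\<^esub> a \<odot>\<^bsub>M\<^esub> y"
    "\<And>a b x. \<lbrakk>a \<in> carrier R; b \<in> carrier R; x \<in> carrier M\<rbrakk> \<Longrightarrow>
      (a \<otimes>\<^bsub>R\<^esub> b) \<odot>\<^bsub>M\<^esub> x = a \<odot>\<^bsub>M\<^esub> (b \<odot>\<^bsub>M\<^esub> x)"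
    "\<And>x. x \<in> carrier M \<Longrightarrow> \<one>\<^bsub>R\<^esub> \<odot>\<^bsub>M\<^esub> x = x"
  shows "left_module R M"
  by (intro left_module.intro left_module_axioms.intro assms; simp add: assms)

lemma submodule_intro:
  assumes "H \<subseteq> carrier M" "\<zero>\<^bsub>M\<^esub> \<in> H" "\<And>a. a \<in> H \<Longrightarrow> \<ominus>\<^bsub>M\<^esub> a \<in> H"
    "\<And>a b. \<lbrakk>a \<in> H; b \<in> H\<rbrakk> \<Longrightarrow> a \<oplus>\<^bsub>M\<^esub> b \<in> H"
    "\<And>a x. \<lbrakk>a \<in> carrier R; x \<in> H\<rbrakk> \<Longrightarrow> a \<odot>\<^bsub>M\<^esub> x \<in> H"
  shows "submodule H R M"
  using assms by (auto intro!: submodule.intro subgroup.intro simp: submodule_axioms_def a_inv_def)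

lemma submodule_elims:
  assumes "submodule H R M"
  shows "H \<subseteq> carrier M" "\<zero>\<^bsub>M\<^esub> \<in> H" "\<And>a. a \<in> H \<Longrightarrow> \<ominus>\<^bsub>M\<^esub> a \<in> H"
    "\<And>a b. \<lbrakk>a \<in> H; b \<in> H\<rbrakk> \<Longrightarrow> a \<oplus>\<^bsub>M\<^esub> b \<in> H"
    "\<And>a x. \<lbrakk>a \<in> carrier R; x \<in> H\<rbrakk> \<Longrightarrow> a \<odot>\<^bsub>M\<^esub> x \<in> H"
  using subgroup.subset[OF submodule.axioms(1)[OF assms]] subgroup.one_closed[OF submodule.axioms(1)[OF assms]]
   subgroup.m_inv_closed[OF submodule.axioms(1)[OF assms]]
   subgroup.m_closed[OF submodule.axioms(1)[OF assms]] submodule.smult_closed[OF assms]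
  by (auto simp: a_inv_def)

lemma left_module_transport:
  fixes R :: "('r,'e) ring_scheme" and M :: "('r,'m) module" and g :: "'m \<Rightarrow> 'n"
  assumes M: "left_module R M" and g: "inj_on g (carrier M)"
  obtains N :: "('r,'n) module" where "left_module R N" "carrier N = g ` carrier M"
    "restrict g (carrier M) \<in> lhom R M N" "isomorphic R M N"
proof -
  interpret left_module R M by fact
  define h where "h = the_inv_into (carrier M) g"
  have h[simp]: "h (g x) = x" if "x \<in> carrier M" for x
    using the_inv_into_f_f[OF g that] h_def by simp
  define N :: "('r,'n) module" where "N = \<lparr>carrier = g ` carrier M, mult = undefined, one = undefined,
     zero = g \<zero>\<^bsub>M\<^esub>, add = (\<lambda>x y. g (h x \<oplus>\<^bsub>M\<^esub> h y)), smult = (\<lambda>r x. g (r \<odot>\<^bsub>M\<^esub> h x))\<rparr>"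
  have N: "left_module R N"
    apply (rule left_moduleI)
          apply (rule R.ring_axioms)
         apply (rule abelian_groupI)
    by (auto simp: N_def smult_l_distr smult_r_distr smult_assoc1 M.a_ac M.r_neg intro!: 
        bexI[where x="\<ominus>\<^bsub>M\<^esub> _"])
  have L: "restrict g (carrier M) \<in> lhom R M N"
    by (auto simp: lhom_def N_def)
  have cN: "carrier N = g ` carrier M" by (simp add: N_def)
  have "bij_betw (restrict g (carrier M)) (carrier M) (carrier N)"
    using g unfolding cN by (auto simp: bij_betw_def inj_on_def)
  with L have "isomorphic R M N" unfolding isomorphic_def by blast
  then show ?thesis using that[OF N cN L] by blast
qed


lemma span_finite:
  assumes "left_module R M" "s ` {..<n::nat} \<subseteq> carrier M" "x \<in> span_in R M (s ` {..<n})"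
  shows "\<exists>v\<in>{..<n} \<rightarrow>\<^sub>E carrier R. x = (\<Oplus>\<^bsub>M\<^esub>i\<in>{..<n}. v i \<odot>\<^bsub>M\<^esub> s i)"
proof -
  interpret left_module R M by fact
  have [simp]: "s i \<in> carrier M" if "i < n" for i using subsetD[OF assms(2) imageI[of i "{..<n}" s]] that by simp
  have fs: "\<And>r i. r \<in> {..<n} \<rightarrow>\<^sub>E carrier R \<Longrightarrow> i < n \<Longrightarrow> r i \<in> carrier R" by (erule PiE_mem) simp
  let ?c = "\<lambda>v. \<Oplus>\<^bsub>M\<^esub>i\<in>{..<n}. v i \<odot>\<^bsub>M\<^esub> s i"
  let ?V = "{..<n} \<rightarrow>\<^sub>E carrier R"
  have cl: "?c v \<in> carrier M" if "v \<in> ?V" for v by (rule M.finsum_closed) (use that in \<open>simp add: Pi_iff fs\<close>)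
  have [simp]: "\<zero>\<^bsub>R\<^esub> \<odot>\<^bsub>M\<^esub> x = \<zero>\<^bsub>M\<^esub>" if "x \<in> carrier M" for x
    using smult_l_distr[of "\<zero>\<^bsub>R\<^esub>" "\<zero>\<^bsub>R\<^esub>" x] that by (simp add: M.add.l_cancel_one')
  have r0: "a \<odot>\<^bsub>M\<^esub> \<zero>\<^bsub>M\<^esub> = \<zero>\<^bsub>M\<^esub>" if "a \<in> carrier R" for a
    using smult_r_distr[of a "\<zero>\<^bsub>M\<^esub>" "\<zero>\<^bsub>M\<^esub>"] that by (simp add: M.add.l_cancel_one')
  have smul: "a \<odot>\<^bsub>M\<^esub> finsum M f F = (\<Oplus>\<^bsub>M\<^esub>i\<in>F. a \<odot>\<^bsub>M\<^esub> f i)"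
    if "finite F" "a \<in> carrier R" "f \<in> F \<rightarrow> carrier M" for a f and F :: "nat set"
    using that by (induction F) (auto simp: r0 Pi_def smult_r_distr)
  have ad: "?c v \<oplus>\<^bsub>M\<^esub> ?c w = ?c (\<lambda>i\<in>{..<n}. v i \<oplus>\<^bsub>R\<^esub> w i)" if "v \<in> ?V" "w \<in> ?V" for v w
  proof -
    note [simp] = fs[OF that(1)] fs[OF that(2)]
    have "?c (\<lambda>i\<in>{..<n}. v i \<oplus>\<^bsub>R\<^esub> w i) = (\<Oplus>\<^bsub>M\<^esub>i\<in>{..<n}. v i \<odot>\<^bsub>M\<^esub> s i \<oplus>\<^bsub>M\<^esub> w i \<odot>\<^bsub>M\<^esub> s i)"
      by (rule M.finsum_cong') (simp_all add: smult_l_distr)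
    also have "\<dots> = ?c v \<oplus>\<^bsub>M\<^esub> ?c w" by (rule M.finsum_addf) simp_all
    finally show ?thesis by simp
  qed
  have sm: "a \<odot>\<^bsub>M\<^esub> ?c v = ?c (\<lambda>i\<in>{..<n}. a \<otimes>\<^bsub>R\<^esub> v i)" if "v \<in> ?V" "a \<in> carrier R" for v a
  proof -
    note [simp] = fs[OF that(1)] that(2)
    have "?c (\<lambda>i\<in>{..<n}. a \<otimes>\<^bsub>R\<^esub> v i) = (\<Oplus>\<^bsub>M\<^esub>i\<in>{..<n}. a \<odot>\<^bsub>M\<^esub> (v i \<odot>\<^bsub>M\<^esub> s i))"
      by (rule M.finsum_cong') (simp_all add: smult_assoc1)
    also have "\<dots> = a \<odot>\<^bsub>M\<^esub> ?c v" by (rule smul[symmetric]) simp_all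
    finally show ?thesis by simp
  qed
  have mm: "\<ominus>\<^bsub>M\<^esub> y = (\<ominus>\<^bsub>R\<^esub> \<one>\<^bsub>R\<^esub>) \<odot>\<^bsub>M\<^esub> y" if "y \<in> carrier M" for y
  proof -
    have "(\<ominus>\<^bsub>R\<^esub> \<one>\<^bsub>R\<^esub>) \<odot>\<^bsub>M\<^esub> y \<oplus>\<^bsub>M\<^esub> y = \<zero>\<^bsub>M\<^esub>"
      using smult_l_distr[of "\<ominus>\<^bsub>R\<^esub> \<one>\<^bsub>R\<^esub>" "\<one>\<^bsub>R\<^esub>" y] that by (simp add: R.l_neg)
    then show ?thesis using that by (intro M.minus_equality) auto
  qed
  have smc: "a \<odot>\<^bsub>M\<^esub> y \<in> ?c ` ?V" if y: "y \<in> ?c ` ?V" "a \<in> carrier R" for a y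
  proof -
    obtain v where v: "y = ?c v" "v \<in> ?V" using y(1) by (rule imageE)
    have "(\<lambda>i\<in>{..<n}. a \<otimes>\<^bsub>R\<^esub> v i) \<in> ?V" using fs[OF v(2)] y(2) by simp
    with sm[OF v(2) y(2)] show ?thesis unfolding v(1) by (rule image_eqI)
  qed
  have sub: "submodule (?c ` ?V) R M"
  proof (rule submodule_intro)
    show "?c ` ?V \<subseteq> carrier M" by (rule image_subsetI) (erule cl)
    have "?c (\<lambda>i\<in>{..<n}. \<zero>\<^bsub>R\<^esub>) = (\<Oplus>\<^bsub>M\<^esub>i\<in>{..<n}. \<zero>\<^bsub>M\<^esub>)"
      by (rule M.finsum_cong') simp_all
    then have "\<zero>\<^bsub>M\<^esub> = ?c (\<lambda>i\<in>{..<n}. \<zero>\<^bsub>R\<^esub>)" by simp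
    moreover have "(\<lambda>i\<in>{..<n}. \<zero>\<^bsub>R\<^esub>) \<in> ?V" by simp
    ultimately show "\<zero>\<^bsub>M\<^esub> \<in> ?c ` ?V" by (rule image_eqI)
    fix a assume a: "a \<in> ?c ` ?V"
    then have "a \<in> carrier M" by (elim imageE) (simp only: cl)
    from mm[OF this] smc[OF a, of "\<ominus>\<^bsub>R\<^esub> \<one>\<^bsub>R\<^esub>"] show "\<ominus>\<^bsub>M\<^esub> a \<in> ?c ` ?V" by simp
    fix b assume b: "b \<in> ?c ` ?V"
    obtain v where v: "a = ?c v" "v \<in> ?V" using a by (rule imageE)
    obtain w where w: "b = ?c w" "w \<in> ?V" using b by (rule imageE)
    have "(\<lambda>i\<in>{..<n}. v i \<oplus>\<^bsub>R\<^esub> w i) \<in> ?V" using fs[OF v(2)] fs[OF w(2)] by simp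
    with ad[OF v(2) w(2)] show "a \<oplus>\<^bsub>M\<^esub> b \<in> ?c ` ?V" unfolding v(1) w(1) by (rule image_eqI)
  qed (rule smc)
  have gen: "s k \<in> ?c ` ?V" if k: "k < n" for k
  proof -
    let ?e = "\<lambda>i\<in>{..<n}. if i = k then \<one>\<^bsub>R\<^esub> else \<zero>\<^bsub>R\<^esub>"
    have "?c ?e = (\<Oplus>\<^bsub>M\<^esub>i\<in>{..<n}. if k = i then s i else \<zero>\<^bsub>M\<^esub>)"
      by (rule M.finsum_cong') simp_all
    also have "\<dots> = s k" using k by (intro M.finsum_singleton) simp_all
    finally have "s k = ?c ?e" by (rule sym)
    moreover have "?e \<in> ?V" by simp
    ultimately show ?thesis by (rule image_eqI)
  qed
  have "span_in R M (s ` {..<n}) \<subseteq> ?c ` ?V"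
    unfolding span_in_def using sub gen by (intro Inter_lower) blast
  with assms(3) show ?thesis by blast
qed

lemma fin_gen_image:
  assumes "left_module R M" "left_module R N" "f \<in> lhom R M N" "f ` carrier M = carrier N" "fin_gen R M"
  shows "fin_gen R N"
proof -
  interpret M: left_module R M by fact
  interpret N: left_module R N by fact
  have f: "f (x \<oplus>\<^bsub>M\<^esub> y) = f x \<oplus>\<^bsub>N\<^esub> f y" if "x \<in> carrier M" "y \<in> carrier M" for x y
    using assms(3) that unfolding lhom_def by blast
  have fr: "f (r \<odot>\<^bsub>M\<^esub> x) = r \<odot>\<^bsub>N\<^esub> f x" if "r \<in> carrier R" "x \<in> carrier M" for x r
    using assms(3) that unfolding lhom_def by blast
  have fc: "f x \<in> carrier N" if "x \<in> carrier M" for x using assms(4) that by blast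
  have f0: "f \<zero>\<^bsub>M\<^esub> = \<zero>\<^bsub>N\<^esub>" using f[of "\<zero>\<^bsub>M\<^esub>" "\<zero>\<^bsub>M\<^esub>"] fc[of "\<zero>\<^bsub>M\<^esub>"]
    by (simp add: N.M.add.l_cancel_one')
  have fm: "f (\<ominus>\<^bsub>M\<^esub> x) = \<ominus>\<^bsub>N\<^esub> f x" if "x \<in> carrier M" for x
  proof -
    have "f (\<ominus>\<^bsub>M\<^esub> x) \<oplus>\<^bsub>N\<^esub> f x = \<zero>\<^bsub>N\<^esub>"
      using that f[of "\<ominus>\<^bsub>M\<^esub> x" x] by (simp add: M.M.l_neg f0)
    then show ?thesis using that fc by (intro N.M.minus_equality[symmetric]) auto
  qed
  obtain S where S: "finite S" "S \<subseteq> carrier M" "span_in R M S = carrier M"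
    using assms(5) by (auto simp: fin_gen_def)
  have "carrier N \<subseteq> U" if U: "submodule U R N" "f ` S \<subseteq> U" for U
  proof -
    note u = submodule_elims[OF U(1)]
    have "submodule {x \<in> carrier M. f x \<in> U} R M"
      by (rule submodule_intro) (auto simp: f fr f0 fm u)
    moreover have "S \<subseteq> {x \<in> carrier M. f x \<in> U}" using S U by auto
    ultimately have "span_in R M S \<subseteq> {x \<in> carrier M. f x \<in> U}" unfolding span_in_def by blast
    then have "f ` carrier M \<subseteq> U" unfolding S(3) by auto
    then show ?thesis unfolding assms(4) .
  qed
  moreover have "submodule (carrier N) R N" by (rule submodule_intro) auto
  moreover have "f ` S \<subseteq> carrier N" using S(2) by (auto intro: fc)
  ultimately have "span_in R N (f ` S) = carrier N"
    unfolding span_in_def by (intro equalityI Inter_lower Inter_greatest) auto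
  then show ?thesis unfolding fin_gen_def using S(1) \<open>f ` S \<subseteq> _\<close> by (intro exI[of _ "f ` S"]) simp
qed

lemma fg_module_small:
  fixes R :: "('r, 'e) ring_scheme" and M :: "('r, 'm) module"
  assumes "fg_module R M"
  shows "\<exists>N :: 'r small_module. fg_module R N \<and> isomorphic R M N"
proof -
  from assms have M: "left_module R M" by (simp add: fg_module_def)
  from assms obtain S where S: "finite S" "S \<subseteq> carrier M" "span_in R M S = carrier M"
    by (auto simp: fg_module_def fin_gen_def)
  from S(1) obtain s and n :: nat where s: "S = s ` {..<n}"
    by (metis finite_imp_nat_seg_image_inj_on lessThan_def)
  define g where "g x = {v \<in> {..<n} \<rightarrow>\<^sub>E carrier R. x = (\<Oplus>\<^bsub>M\<^esub>i\<in>{..<n}. v i \<odot>\<^bsub>M\<^esub> s i)}" for x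
  have inj: "inj_on g (carrier M)"
  proof (rule inj_onI)
    fix x y assume "x \<in> carrier M" "y \<in> carrier M" and e: "g x = g y"
    then have "x \<in> span_in R M (s ` {..<n})" using S(3) s by simp
    with span_finite[OF M, of s n x] S(2) s obtain v where v: "v \<in> g x" by (auto simp: g_def)
    with e have "v \<in> g y" by blast
    with v show "x = y" by (simp add: g_def)
  qed
  obtain N :: "'r small_module" where N: "left_module R N" "carrier N = g ` carrier M"
    "restrict g (carrier M) \<in> lhom R M N" "isomorphic R M N"
    using left_module_transport[OF M inj] by blast
  have "fin_gen R N"
    by (rule fin_gen_image[OF M N(1,3)]) (use N(2) assms in \<open>simp_all add: fg_module_def\<close>)
  with N show ?thesis unfolding fg_module_def by blast
qed

definition simple_modules :: "('r, 'e) ring_scheme \<Rightarrow> 'i set \<Rightarrow> ('i \<Rightarrow> ('r, 'l) module) \<Rightarrow> bool" where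
  "simple_modules R I L \<longleftrightarrow> (\<forall>i\<in>I. simple_mod R (L i)) \<and>
     (\<forall>i\<in>I. \<forall>j\<in>I. isomorphic R (L i) (L j) \<longrightarrow> i = j) \<and>
     (\<forall>S :: 'r small_module. simple_mod R S \<longrightarrow> (\<exists>i\<in>I. isomorphic R S (L i)))"

definition projective :: "('r, 'e) ring_scheme \<Rightarrow> ('r, 'p) module \<Rightarrow> bool" where
  "projective R P \<longleftrightarrow> fg_module R P \<and>
     (\<forall>(M :: 'r small_module) (N :: 'r small_module). \<forall>f\<in>lhom R M N. \<forall>g\<in>lhom R P N.
        fg_module R M \<and> fg_module R N \<and> f ` carrier M = carrier N \<longrightarrow>
        (\<exists>h\<in>lhom R P M. \<forall>x\<in>carrier P. f (h x) = g x))"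

definition injective :: "('r, 'e) ring_scheme \<Rightarrow> ('r, 'q) module \<Rightarrow> bool" where
  "injective R Q \<longleftrightarrow> fg_module R Q \<and>
     (\<forall>(M :: 'r small_module) (N :: 'r small_module). \<forall>f\<in>lhom R M N. \<forall>g\<in>lhom R M Q.
        fg_module R M \<and> fg_module R N \<and> inj_on f (carrier M) \<longrightarrow>
        (\<exists>h\<in>lhom R N Q. \<forall>x\<in>carrier M. h (f x) = g x))"

text \<open>A projective module with an epimorphism onto \<open>M\<close> whose kernel is superfluous.\<close>

definition projective_cover :: "('r, 'e) ring_scheme \<Rightarrow> ('r, 'p) module \<Rightarrow> ('r, 'm) module \<Rightarrow> bool" where
  "projective_cover R P M \<longleftrightarrow> projective R P \<and>
     (\<exists>f\<in>lhom R P M. f ` carrier P = carrier M \<and>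
        (\<forall>U. submodule U R P \<and> U <+>\<^bsub>P\<^esub> a_kernel P M f = carrier P \<longrightarrow> U = carrier P))"

text \<open>An injective module with a monomorphism from \<open>M\<close> whose image is essential.\<close>

definition injective_hull :: "('r, 'e) ring_scheme \<Rightarrow> ('r, 'q) module \<Rightarrow> ('r, 'm) module \<Rightarrow> bool" where
  "injective_hull R Q M \<longleftrightarrow> injective R Q \<and>
     (\<exists>f\<in>lhom R M Q. inj_on f (carrier M) \<and>
        (\<forall>U. submodule U R Q \<and> U \<inter> f ` carrier M = {\<zero>\<^bsub>Q\<^esub>} \<longrightarrow> U = {\<zero>\<^bsub>Q\<^esub>}))"

section \<open>Standard, costandard and tilting modules\<close>

text \<open>In the following, \<open>L i\<close>, \<open>P i\<close>, \<open>Q i\<close> for \<open>i \<in> \<Phi>\<close> are the simple modules, their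
  projective covers and their injective hulls, and \<open>leq\<close> is the partial order on \<open>\<Phi>\<close>.
  The largest quotient with a given property is the one by the least submodule.\<close>

definition standard :: "('r, 'e) ring_scheme \<Rightarrow> 'i set \<Rightarrow> ('i \<Rightarrow> 'i \<Rightarrow> bool) \<Rightarrow> ('i \<Rightarrow> ('r, 'l) module)
    \<Rightarrow> ('i \<Rightarrow> ('r, 'p) module) \<Rightarrow> 'i \<Rightarrow> ('r, 'p set) module" where
  "standard R \<Phi> leq L P i = quot (P i)
     (LEAST U. submodule U R (P i) \<and> comp_factors_among R L {j \<in> \<Phi>. leq j i} (quot (P i) U))"

definition costandard :: "('r, 'e) ring_scheme \<Rightarrow> 'i set \<Rightarrow> ('i \<Rightarrow> 'i \<Rightarrow> bool) \<Rightarrow> ('i \<Rightarrow> ('r, 'l) module)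
    \<Rightarrow> ('i \<Rightarrow> ('r, 'q) module) \<Rightarrow> 'i \<Rightarrow> ('r, 'q) module" where
  "costandard R \<Phi> leq L Q i = restr (Q i)
     (GREATEST U. submodule U R (Q i) \<and> comp_factors_among R L {j \<in> \<Phi>. leq j i} (restr (Q i) U))"

definition is_tilting :: "('r, 'e) ring_scheme \<Rightarrow> 'i set \<Rightarrow> ('i \<Rightarrow> 'i \<Rightarrow> bool)
    \<Rightarrow> ('i \<Rightarrow> ('r, 'd) module) \<Rightarrow> ('i \<Rightarrow> ('r, 'n) module) \<Rightarrow> 'i \<Rightarrow> ('r, 't) module \<Rightarrow> bool" where
  "is_tilting R \<Phi> leq std costd i T \<longleftrightarrow> fg_module R T \<and> indecomposable R T \<and>
     filtered_by R std \<Phi> T \<and> filtered_by R costd \<Phi> T \<and>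
     (\<exists>f\<in>lhom R (std i) T. inj_on f (carrier (std i)) \<and>
        filtered_by R std {j \<in> \<Phi>. leq j i \<and> j \<noteq> i} (quot T (f ` carrier (std i))))"

text \<open>The Ringel dual of \<open>B\<close> for the indecomposable tilting modules \<open>T i\<close>, and its
  indecomposable projective and simple modules.\<close>

definition ringel_dual :: "('k, 'b) module \<Rightarrow> 'i set \<Rightarrow> ('i \<Rightarrow> ('b, 't) module)
    \<Rightarrow> ('k, ('i \<Rightarrow> 't) \<Rightarrow> ('i \<Rightarrow> 't)) module" where
  "ringel_dual B \<Phi> T = op_alg (end_alg B (dsum \<Phi> T))"

definition ringel_proj :: "('k, 'b) module \<Rightarrow> 'i set \<Rightarrow> ('i \<Rightarrow> ('b, 't) module) \<Rightarrow> 'i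
    \<Rightarrow> (('i \<Rightarrow> 't) \<Rightarrow> ('i \<Rightarrow> 't), ('i \<Rightarrow> 't) \<Rightarrow> 't) module" where
  "ringel_proj B \<Phi> T i = hom_mod B (dsum \<Phi> T) (T i)"

definition ringel_simple :: "('k, 'b) module \<Rightarrow> 'i set \<Rightarrow> ('i \<Rightarrow> ('b, 't) module) \<Rightarrow> 'i
    \<Rightarrow> (('i \<Rightarrow> 't) \<Rightarrow> ('i \<Rightarrow> 't), (('i \<Rightarrow> 't) \<Rightarrow> 't) set) module" where
  "ringel_simple B \<Phi> T i = top_mod (ringel_dual B \<Phi> T) (ringel_proj B \<Phi> T i)"

section \<open>The ADR algebra\<close>

text \<open>\<open>P i\<close> for \<open>i \<in> {1..n}\<close> are the indecomposable projective \<open>A\<close>-modules.\<close>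

type_synonym 'p adr_carrier = "nat \<times> nat \<Rightarrow> 'p set"

definition adr_index :: "('k, 'a) module \<Rightarrow> nat \<Rightarrow> (nat \<Rightarrow> ('a, 'p) module) \<Rightarrow> (nat \<times> nat) set" where
  "adr_index A n P = {(i, j). 1 \<le> i \<and> i \<le> n \<and> 1 \<le> j \<and> j \<le> loewy_length A (P i)}"

definition adr_summand :: "('k, 'a) module \<Rightarrow> (nat \<Rightarrow> ('a, 'p) module) \<Rightarrow> nat \<times> nat
    \<Rightarrow> ('a, 'p set) module" where
  "adr_summand A P = (\<lambda>(i, j). quot (P i) (rad_pow A (P i) j))"

definition adr_gen :: "('k, 'a) module \<Rightarrow> nat \<Rightarrow> (nat \<Rightarrow> ('a, 'p) module)
    \<Rightarrow> ('a, 'p adr_carrier) module" where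
  "adr_gen A n P = dsum (adr_index A n P) (adr_summand A P)"

definition adr_alg :: "('k, 'a) module \<Rightarrow> nat \<Rightarrow> (nat \<Rightarrow> ('a, 'p) module)
    \<Rightarrow> ('k, 'p adr_carrier \<Rightarrow> 'p adr_carrier) module" where
  "adr_alg A n P = op_alg (end_alg A (adr_gen A n P))"

definition adr_proj :: "('k, 'a) module \<Rightarrow> nat \<Rightarrow> (nat \<Rightarrow> ('a, 'p) module) \<Rightarrow> nat \<times> nat
    \<Rightarrow> ('p adr_carrier \<Rightarrow> 'p adr_carrier, 'p adr_carrier \<Rightarrow> 'p set) module" where
  "adr_proj A n P ij = hom_mod A (adr_gen A n P) (adr_summand A P ij)"

definition adr_simple :: "('k, 'a) module \<Rightarrow> nat \<Rightarrow> (nat \<Rightarrow> ('a, 'p) module) \<Rightarrow> nat \<times> nat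
    \<Rightarrow> ('p adr_carrier \<Rightarrow> 'p adr_carrier, ('p adr_carrier \<Rightarrow> 'p set) set) module" where
  "adr_simple A n P ij = top_mod (adr_alg A n P) (adr_proj A n P ij)"

definition adr_le :: "nat \<times> nat \<Rightarrow> nat \<times> nat \<Rightarrow> bool" where
  "adr_le x y \<longleftrightarrow> x = y \<or> snd x > snd y"

definition adr_standard :: "('k, 'a) module \<Rightarrow> nat \<Rightarrow> (nat \<Rightarrow> ('a, 'p) module) \<Rightarrow> nat \<times> nat
    \<Rightarrow> ('p adr_carrier \<Rightarrow> 'p adr_carrier, ('p adr_carrier \<Rightarrow> 'p set) set) module" where
  "adr_standard A n P =
     standard (adr_alg A n P) (adr_index A n P) adr_le (adr_simple A n P) (adr_proj A n P)"

text \<open>\<open>H x\<close> is an injective hull of the simple module \<open>adr_simple A n P x\<close>.\<close>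

definition adr_costandard :: "('k, 'a) module \<Rightarrow> nat \<Rightarrow> (nat \<Rightarrow> ('a, 'p) module)
    \<Rightarrow> (nat \<times> nat \<Rightarrow> ('p adr_carrier \<Rightarrow> 'p adr_carrier, 'h) module) \<Rightarrow> nat \<times> nat
    \<Rightarrow> ('p adr_carrier \<Rightarrow> 'p adr_carrier, 'h) module" where
  "adr_costandard A n P H =
     costandard (adr_alg A n P) (adr_index A n P) adr_le (adr_simple A n P) H"

section \<open>The algebra defined by the socle series of the injective modules\<close>

text \<open>\<open>Q i\<close> for \<open>i \<in> {1..n}\<close> are the indecomposable injective \<open>A\<close>-modules.\<close>

definition s_index :: "('k, 'a) module \<Rightarrow> nat \<Rightarrow> (nat \<Rightarrow> ('a, 'q) module) \<Rightarrow> (nat \<times> nat) set" where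
  "s_index A n Q = {(i, j). 1 \<le> i \<and> i \<le> n \<and> 1 \<le> j \<and> j \<le> loewy_length A (Q i)}"

definition s_summand :: "('k, 'a) module \<Rightarrow> (nat \<Rightarrow> ('a, 'q) module) \<Rightarrow> nat \<times> nat
    \<Rightarrow> ('a, 'q) module" where
  "s_summand A Q = (\<lambda>(i, j). restr (Q i) (soc_pow A (Q i) j))"

definition s_gen :: "('k, 'a) module \<Rightarrow> nat \<Rightarrow> (nat \<Rightarrow> ('a, 'q) module)
    \<Rightarrow> ('a, nat \<times> nat \<Rightarrow> 'q) module" where
  "s_gen A n Q = dsum (s_index A n Q) (s_summand A Q)"

definition s_alg :: "('k, 'a) module \<Rightarrow> nat \<Rightarrow> (nat \<Rightarrow> ('a, 'q) module)
    \<Rightarrow> ('k, (nat \<times> nat \<Rightarrow> 'q) \<Rightarrow> (nat \<times> nat \<Rightarrow> 'q)) module" where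
  "s_alg A n Q = op_alg (end_alg A (s_gen A n Q))"

definition s_proj :: "('k, 'a) module \<Rightarrow> nat \<Rightarrow> (nat \<Rightarrow> ('a, 'q) module) \<Rightarrow> nat \<times> nat
    \<Rightarrow> ((nat \<times> nat \<Rightarrow> 'q) \<Rightarrow> (nat \<times> nat \<Rightarrow> 'q), (nat \<times> nat \<Rightarrow> 'q) \<Rightarrow> 'q) module" where
  "s_proj A n Q ij = hom_mod A (s_gen A n Q) (s_summand A Q ij)"

definition s_simple :: "('k, 'a) module \<Rightarrow> nat \<Rightarrow> (nat \<Rightarrow> ('a, 'q) module) \<Rightarrow> nat \<times> nat
    \<Rightarrow> ((nat \<times> nat \<Rightarrow> 'q) \<Rightarrow> (nat \<times> nat \<Rightarrow> 'q), ((nat \<times> nat \<Rightarrow> 'q) \<Rightarrow> 'q) set) module" where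
  "s_simple A n Q ij = top_mod (s_alg A n Q) (s_proj A n Q ij)"

end

theory Submission
  imports Defs
begin

text \<open>Let \<open>R\<close> be the ADR algebra and \<open>H(i, j)\<close> the injective hull of its simple module \<open>L(i, j)\<close>. Relative
  to submodules on whose quotient the maps \<open>e(k, l) M \<rightarrow> e(k, l + 1) M\<close> are injective, a costandardly filtered module behaves
  like an injective one. Hence \<open>T(i, j)\<close> is isomorphic to the largest submodule of \<open>H(i, l\<^sub>i)\<close> without composition
  factor \<open>L(i, j - 1)\<close>, and \<open>dim Hom(M, T(i, j)) = [M : L(i, l\<^sub>i)] - [M : L(i, j - 1)]\<close> for every \<open>M\<close> with these maps
  injective, in particular for every tilting module. So (B2) compares multiplicities in the radical layers of the \<open>P\<^sub>k\<close>
  with those in the socle layers of the \<open>Q\<^sub>k\<close>. For \<open>j = 1\<close> and \<open>l = 1\<close> it shows that \<open>l\<^sub>i = l\<^sub>k\<close> whenever \<open>L\<^sub>i\<close> occurs in the second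
  radical layer of \<open>P\<^sub>k\<close>; as \<open>A\<close> is connected, all \<open>l\<^sub>i\<close> agree. Then (B2) gives the radical and the socle series the
  same dimensions, and one inclusion between them always holds.\<close>

text \<open>As \<open>End(L_i) = K\<close>, each simple module has an idempotent \<open>e_i\<close>
  with \<open>[M : L_i] = dim e_i M\<close>, and all later formulas are dimension counts. One
  formula, \<open>[Hom(G, U) : top Hom(G, V_x)] = dim Hom(V_x, U)\<close>, serves three endomorphism
  algebras: of the sums of all \<open>P_i/Rad^j P_i\<close>, of all \<open>Soc_j Q_i\<close> and of
  all \<open>T(i, j)\<close>. The obstacle is that \<open>T(i, j)\<close> is known only through its
  filtrations. A map to the submodule \<open>X\<close> of \<open>H(i, l_i)\<close> comes from a
  dimension count; a map back comes from a complement in \<open>X x T(i, j)\<close> that is its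
  graph. The complement exists if \<open>X\<close> modulo the standard module still has injective
  structure maps. These can fail only at a vector of weight \<open>(i, j - 1)\<close> carried into
  the standard module, which is why \<open>L(i, j - 1)\<close> is excluded. For \<open>j = 1\<close>
  and for \<open>l = 1\<close>, (B2) says
  \<open>[Soc_s Q_i : L_k] = [Rad^(l_k - s) Q_i : L_k]\<close> and
  \<open>[Soc_s P_k : L_i] = [Rad^(l_i - s) P_k : L_i]\<close>. The exponents contain the Loewy
  length of the other index, so the equality of all \<open>l_i\<close> must precede
  rigidity.\<close>

lemmas subD = submodule_elims

abbreviation (input) smult_in ("(_ *[_]/ _)" [70, 0, 71] 70) where "a *[M] x \<equiv> a \<odot>\<^bsub>M\<^esub> x"
abbreviation (input) add_in ("(_ +[_]/ _)" [65, 0, 66] 65) where "x +[M] y \<equiv> x \<oplus>\<^bsub>M\<^esub> y"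
abbreviation (input) minus_in ("(_ -[_]/ _)" [65, 0, 66] 65) where "x -[M] y \<equiv> x \<ominus>\<^bsub>M\<^esub> y"
abbreviation (input) uminus_in ("-[_]/ _" [0, 81] 80) where "-[M] x \<equiv> \<ominus>\<^bsub>M\<^esub> x"
abbreviation (input) mult_in ("(_ \<otimes>[_]/ _)" [70, 0, 71] 70) where "x \<otimes>[M] y \<equiv> x \<otimes>\<^bsub>M\<^esub> y"
abbreviation (input) zero_in ("0[_]") where "0[M] \<equiv> \<zero>\<^bsub>M\<^esub>"
abbreviation (input) one_in ("1[_]") where "1[M] \<equiv> \<one>\<^bsub>M\<^esub>"
abbreviation (input) "car \<equiv> carrier"

section \<open>Submodules, homomorphisms and quotients\<close>

locale lmod = left_module R M
 for R :: "('r, 'e) ring_scheme" (structure) and M :: "('r, 'm) module" (structure)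

declare lmod_def [simp]

context lmod
begin

lemmas left = left_module_axioms

lemma smult_l_null [simp]: "x : car M ==> \<zero> *[M] x = 0[M]"
 using smult_l_distr[of \<zero> \<zero> x] by (simp add: M.add.l_cancel_one')

lemma smult_r_null [simp]: "a : car R ==> a *[M] 0[M] = 0[M]"
 using smult_r_distr[of a "0[M]" "0[M]"] by (simp add: M.add.l_cancel_one')

lemma smult_l_minus: "[|a : car R; x : car M|] ==> (\<ominus> a) *[M] x = -[M] (a *[M] x)"
 using smult_l_distr[of "\<ominus> a" a x] by (simp add: R.l_neg M.minus_equality)

lemma smult_r_minus: "[|a : car R; x : car M|] ==> a *[M] (-[M] x) = -[M] (a *[M] x)"
 using smult_r_distr[of a "-[M] x" x] by (simp add: M.l_neg M.minus_equality)

lemma smult_r_diff: "[|a : car R; x : car M; y : car M|] ==>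
  a *[M] (x -[M] y) = a *[M] x -[M] a *[M] y"
 by (simp add: a_minus_def smult_r_distr smult_r_minus)

lemma smult_l_diff: "[|a : car R; b : car R; x : car M|] ==>
  (a \<ominus> b) *[M] x = a *[M] x -[M] b *[M] x"
 by (simp add: a_minus_def smult_l_distr smult_l_minus)

lemma diff_add_cancel [simp]: "[|x : car M; y : car M|] ==> (x -[M] y) +[M] y = x"
 by (simp add: a_minus_def M.a_assoc M.l_neg)

lemma add_diff_cancel [simp]: "[|x : car M; y : car M|] ==> (x +[M] y) -[M] y = x"
 by (simp add: a_minus_def M.a_assoc M.r_neg)

lemma diff_zero_iff: "[|x : car M; y : car M|] ==> x -[M] y = 0[M] \<longleftrightarrow> x = y"
 by (metis M.minus_closed M.l_zero diff_add_cancel add_diff_cancel M.zero_closed)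

lemma diff_zero [simp]: "x : car M ==> x -[M] 0[M] = x"
 by (simp add: a_minus_def)

lemma submoduleI:
 assumes "N <= car M" "0[M] : N" "!!x y. [|x : N; y : N|] ==> x +[M] y : N"
  "!!a x. [|a : car R; x : N|] ==> a *[M] x : N"
 shows "submodule N R M"
proof (rule submodule_intro[OF assms(1,2)])
 fix x assume "x : N"
 thus "-[M] x : N" using assms(1) assms(4)[of "\<ominus> \<one>" x] smult_l_minus[of \<one> x] by auto
qed (use assms in auto)

text \<open>\<open>X\<close> absorbs multiplication from the right, so
  \<open>g r (a m) = g (r a) m\<close> stays in \<open>B\<close>. Closure of \<open>B\<close> under
  addition is enough, because \<open>submoduleI\<close> gets negatives from the scalar
  \<open>-1\<close>. Applied below with \<open>B\<close> the image of a weight space and with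
  \<open>B\<close> a radical power.\<close>

lemma colon_submodule:
 assumes g: "g : car R" and X: "X <= car R" "!!r x. [|r : X; x : car R|] ==> r \<otimes> x : X"
  and B: "0[M] : B" "!!x y. [|x : B; y : B|] ==> x +[M] y : B"
 shows "submodule {m : car M. ALL r:X. g *[M] (r *[M] m) : B} R M"
proof (rule submoduleI)
 fix a m assume a: "a : car R" and m: "m : {m : car M. ALL r:X. g *[M] (r *[M] m) : B}"
 have "r *[M] (a *[M] m) = (r \<otimes> a) *[M] m" if "r : X" for r using smult_assoc1[of r a m] that X(1) a m by auto
 thus "a *[M] m : {m : car M. ALL r:X. g *[M] (r *[M] m) : B}" using a m X(2)[OF _ a] by simp
next
 fix x y assume "x : {m : car M. ALL r:X. g *[M] (r *[M] m) : B}" "y : {m : car M. ALL r:X. g *[M] (r *[M] m) : B}"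
 thus "x +[M] y : {m : car M. ALL r:X. g *[M] (r *[M] m) : B}"
  using g B(2) subsetD[OF X(1)] by (simp add: smult_r_distr)
qed (use g B(1) subsetD[OF X(1)] in auto)

lemma sub_mem: "[|submodule N R M; x : N|] ==> x : car M"
 by (auto dest: subD)

lemma sub_carrier: "submodule (car M) R M"
 by (rule submoduleI) auto

lemma sub_zero: "submodule {0[M]} R M"
 by (rule submoduleI) auto

lemma sub_Int: "[|submodule N R M; submodule N' R M|] ==> submodule (N \<inter> N') R M"
 by (rule submoduleI) (auto dest: subD)

lemma submodule_Inter: "[|!!N. N : \<N> ==> submodule N R M; \<N> ~= {}|] ==> submodule (\<Inter>\<N>) R M"
 by (rule submoduleI) (auto dest: subD)

lemma mem_set_add: "z : N <+>\<^bsub>M\<^esub> N' \<longleftrightarrow> (EX x:N. EX y:N'. z = x +[M] y)"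
 by (auto simp: set_add_def set_mult_def)

lemma set_addI: "[|x : N; y : N'|] ==> x +[M] y : N <+>\<^bsub>M\<^esub> N'"
 by (auto simp: mem_set_add)

lemma sub_minus: "[|submodule N R M; x : N; y : N|] ==> x -[M] y : N"
 by (simp add: a_minus_def subD)

lemma submodule_add_iff: "[|submodule N R M; x : N; y : car M|] ==> x +[M] y : N \<longleftrightarrow> y : N"
proof
 assume a: "submodule N R M" "x : N" "y : car M" "x +[M] y : N"
 have "x : car M" using subD(1)[OF a(1)] a(2) by auto
 hence "y = (x +[M] y) -[M] x" using a(3) by (metis add_diff_cancel M.a_comm)
 thus "y : N" using sub_minus[OF a(1,4,2)] by simp
qed (simp add: subD)

lemma sub_sum:
 assumes "submodule N R M" "submodule N' R M"
 shows "submodule (N <+>\<^bsub>M\<^esub> N') R M"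
proof (rule submoduleI)
 note n = subD[OF assms(1)] and n' = subD[OF assms(2)]
 show "N <+>\<^bsub>M\<^esub> N' <= car M" using sub_mem[OF assms(1)] sub_mem[OF assms(2)] by (auto simp: mem_set_add)
 show "0[M] : N <+>\<^bsub>M\<^esub> N'" using n(2) n'(2) by (force simp: mem_set_add)
 fix x y assume "x : N <+>\<^bsub>M\<^esub> N'" "y : N <+>\<^bsub>M\<^esub> N'"
 then obtain a b c d where "a : N" "b : N'" "c : N" "d : N'" "x = a +[M] b" "y = c +[M] d"
  by (auto simp: mem_set_add)
 moreover hence "x +[M] y = (a +[M] c) +[M] (b +[M] d)"
  using sub_mem[OF assms(1)] sub_mem[OF assms(2)] by (simp add: M.a_ac)
 ultimately show "x +[M] y : N <+>\<^bsub>M\<^esub> N'" using n(4) n'(4) by (simp add: set_addI)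
next
 fix a x assume a: "a : car R" "x : N <+>\<^bsub>M\<^esub> N'"
 then obtain b c where "b : N" "c : N'" "x = b +[M] c" by (auto simp: mem_set_add)
 moreover hence "a *[M] x = a *[M] b +[M] a *[M] c"
  using a sub_mem[OF assms(1)] sub_mem[OF assms(2)]
  by (simp add: smult_r_distr)
 ultimately show "a *[M] x : N <+>\<^bsub>M\<^esub> N'"
  using a subD(5)[OF assms(1)] subD(5)[OF assms(2)] by (simp add: set_addI)
qed

lemma sum_upper1: "[|submodule N R M; submodule N' R M|] ==> N <= N <+>\<^bsub>M\<^esub> N'"
 using set_addI[of _ N "0[M]" N'] subD(2)[of N' R M] sub_mem[of N] by fastforce

lemma sum_upper2: "[|submodule N R M; submodule N' R M|] ==> N' <= N <+>\<^bsub>M\<^esub> N'"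
 using set_addI[of "0[M]" N _ N'] subD(2)[of N R M] sub_mem[of N'] by fastforce

lemma sum_least: assumes "submodule U R M" "N <= U" "N' <= U" shows "N <+>\<^bsub>M\<^esub> N' <= U"
proof
 fix z assume "z : N <+>\<^bsub>M\<^esub> N'"
 then obtain x y where "x : N" "y : N'" "z = x +[M] y" by (auto simp: mem_set_add)
 thus "z : U" using assms subD(4)[OF assms(1), of x y] by blast
qed

lemma sub_left:
 assumes "submodule N R M" shows "left_module R (restr M N)"
proof -
 note n = subD[OF assms] sub_mem[OF assms]
 show ?thesis
 proof (rule left_moduleI)
  show "abelian_group (restr M N)"
  proof (rule abelian_groupI)
   fix x assume "x : car (restr M N)"
   thus "EX y:car (restr M N). y +[restr M N] x = 0[restr M N]"
    using n(3)[of x] n(6)[of x] M.l_neg[of x] by auto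
  qed (use n(2,4,6) M.a_assoc M.a_comm in auto)
 qed (simp_all add: n R.ring_axioms smult_l_distr smult_r_distr smult_assoc1)
qed

lemma sub_restr_iff:
 assumes "submodule N R M"
 shows "submodule U R (restr M N) \<longleftrightarrow> submodule U R M & U <= N"
proof -
 interpret N: lmod R "restr M N" using sub_left[OF assms] by simp
 show ?thesis
  using subD(2,4,5)[of U R M] subD(1,2,4,5)[of U R "restr M N"]
   subD(1)[OF assms]
  by (intro iffI conjI submoduleI; (elim conjE)?) (auto intro!: N.submoduleI)
qed

lemma restr_minus:
 assumes "submodule N R M" "x : N" "y : N"
 shows "x -[restr M N] y = x -[M] y"
proof -
 interpret N: lmod R "restr M N" using sub_left[OF assms(1)] by simp
 have "-[restr M N] y = -[M] y"
  using N.smult_l_minus[of \<one> y] smult_l_minus[of \<one> y] assms subD(1)[OF assms(1)] by auto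
 thus ?thesis by (simp add: a_minus_def)
qed

lemma span_sub: "S <= car M ==> submodule (span_in R M S) R M"
 unfolding span_in_def using sub_carrier by (intro submodule_Inter) auto

lemma span_superset: "S <= span_in R M S"
 unfolding span_in_def by auto

lemma span_least: "[|submodule N R M; S <= N|] ==> span_in R M S <= N"
 unfolding span_in_def by auto

definition cyc :: "'m => 'm set" where "cyc x = (%a. a *[M] x) ` car R"

lemma cyc_sub: "x : car M ==> submodule (cyc x) R M"
proof (rule submoduleI)
 assume x: "x : car M"
 show "cyc x <= car M" "0[M] : cyc x" using x by (auto simp: cyc_def intro: image_eqI[of _ _ \<zero>])
 fix u v assume "u : cyc x" "v : cyc x"
 thus "u +[M] v : cyc x" using x by (auto simp: cyc_def smult_l_distr[symmetric])
next
 assume x: "x : car M"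
 fix a u assume "a : car R" "u : cyc x"
 thus "a *[M] u : cyc x" using x by (auto simp: cyc_def smult_assoc1[symmetric])
qed

lemma cyc_self: "x : car M ==> x : cyc x"
 by (auto simp: cyc_def intro!: image_eqI[of _ _ \<one>])

lemma cyc_least: "[|submodule N R M; x : N|] ==> cyc x <= N"
 by (auto simp: cyc_def subD)

end

lemma lhomI:
 assumes "!!x. x : car M ==> f x : car N" "f : extensional (car M)"
  "!!x y. [|x : car M; y : car M|] ==> f (x +[M] y) = f x +[N] f y"
  "!!r x. [|r : car R; x : car M|] ==> f (r *[M] x) = r *[N] f x"
 shows "f : lhom R M N"
 using assms by (auto simp: lhom_def PiE_def)

lemma lhomD:
 assumes "f : lhom R M N"
 shows lhom_mem: "!!x. x : car M ==> f x : car N"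
  and lhom_ext: "f : extensional (car M)"
  and lhom_add: "!!x y. [|x : car M; y : car M|] ==> f (x +[M] y) = f x +[N] f y"
  and lhom_smult: "!!r x. [|r : car R; x : car M|] ==> f (r *[M] x) = r *[N] f x"
 using assms by (auto simp: lhom_def PiE_def)

lemma lhom_eqI:
 "[|f : lhom R M N; g : lhom R M N; !!x. x : car M ==> f x = g x|] ==> f = g"
 by (rule extensionalityI[of _ "car M"]) (auto dest: lhom_ext)

lemma lhom_restr_target: "f : lhom R M (restr N U) ==> U <= car N ==> f : lhom R M N"
 by (auto simp: lhom_def PiE_def)

lemma lhom_restrict_source:
 assumes f: "f : lhom R M N" and U: "submodule U R M"
 shows "restrict f U : lhom R (restr M U) N"
proof -
 have "x : car M" if "x : U" for x using subD(1)[OF U] that by blast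
 thus ?thesis by (intro lhomI) (simp_all add: lhomD[OF f] subD(4,5)[OF U])
qed

lemma lhom_comp:
 assumes "f : lhom R M N" "g : lhom R N U" "left_module R M"
 shows "compose (car M) g f : lhom R M U"
proof -
 interpret left_module R M by fact
 show ?thesis by (rule lhomI) (simp_all add: compose_def lhomD[OF assms(1)] lhomD[OF assms(2)])
qed

lemma lhom_image_target: "[|f : lhom R M N; f ` car M <= U|] ==> f : lhom R M (restr N U)"
 by (auto simp: lhom_def PiE_def image_subset_iff)

lemma lhom_restrict: "[|f : lhom R M N; submodule U R M; f ` U <= V|]
  ==> restrict f U : lhom R (restr M U) (restr N V)"
 by (rule lhom_image_target) (auto intro: lhom_restrict_source)

locale two_mods = M: lmod R M + N: lmod R N
 for R :: "('r, 'e) ring_scheme" and M :: "('r, 'm) module" and N :: "('r, 'n) module"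

declare two_mods_def [simp]

context two_mods
begin

lemma lhom_zero: "f : lhom R M N ==> f 0[M] = 0[N]"
 using lhom_smult[of f R M N "0[R]" "0[M]"] lhom_mem[of f R M N "0[M]"] by simp

lemma lhom_neg: "[|f : lhom R M N; x : car M|] ==> f (-[M] x) = -[N] f x"
 using lhom_smult[of f R M N "-[R] 1[R]" x] lhom_mem[of f R M N x]
 by (simp add: M.smult_l_minus N.smult_l_minus)

lemma lhom_minus: "[|f : lhom R M N; x : car M; y : car M|] ==> f (x -[M] y) = f x -[N] f y"
 by (simp add: a_minus_def lhom_neg lhom_add)

lemma lhom_preimage: "[|f : lhom R M N; submodule U R N|] ==> submodule {x : car M. f x : U} R M"
 by (rule M.submoduleI) (auto simp: lhom_zero lhom_add lhom_smult subD)

lemma lhom_kernel: "f : lhom R M N ==> submodule {x : car M. f x = 0[N]} R M"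
 using lhom_preimage[OF _ N.sub_zero] by simp

lemma lhom_image: assumes "f : lhom R M N" "submodule U R M" shows "submodule (f ` U) R N"
proof -
 note u = subD[OF assms(2)] and f = lhomD[OF assms(1)]
 have "f ` U <= car N" "0[N] : f ` U"
  using u f(1) lhom_zero[OF assms(1)] by (auto simp: image_iff subset_eq intro!: bexI[of _ "0[M]"])
 moreover have "f x +[N] f y : f ` U" if "x : U" "y : U" for x y
  using that u(1) f(3)[of x y] u(4) by (metis image_eqI subsetD)
 moreover have "a *[N] f x : f ` U" if "x : U" "a : car R" for a x
  using that u(1) f(4)[of a x] u(5) by (metis image_eqI subsetD)
 ultimately show ?thesis by (intro N.submoduleI) auto
qed

lemma lhom_simple_surj:
 assumes "simple_mod R N" "f : lhom R M N" "submodule U R M" "u : U" "f u ~= 0[N]"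
 shows "f ` U = car N"
proof -
 have "f ` U = {0[N]} | f ` U = car N" using assms(1) lhom_image[OF assms(2,3)] by (simp add: simple_mod_def)
 thus ?thesis using assms(4,5) by blast
qed

lemma lhom_inj_iff: assumes "f : lhom R M N"
 shows "inj_on f (car M) \<longleftrightarrow> (ALL x:car M. f x = 0[N] --> x = 0[M])"
proof
 assume "inj_on f (car M)"
 thus "ALL x:car M. f x = 0[N] --> x = 0[M]"
  using lhom_zero[OF assms] by (metis M.zero_closed inj_onD)
next
 assume a: "ALL x:car M. f x = 0[N] --> x = 0[M]"
 show "inj_on f (car M)"
 proof (rule inj_onI)
  fix x y assume b: "x : car M" "y : car M" "f x = f y"
  hence "f (x -[M] y) = 0[N]"
   using lhom_mem[OF assms] by (simp add: lhom_minus[OF assms] N.diff_zero_iff)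
  hence "x -[M] y = 0[M]" using a b by (simp)
  thus "x = y" using b by (simp add: M.diff_zero_iff)
 qed
qed

lemma lhom_inverse:
 assumes f: "f : lhom R M N" and b: "bij_betw f (car M) (car N)"
 shows "restrict (the_inv_into (car M) f) (car N) : lhom R N M"
proof -
 let ?g = "the_inv_into (car M) f"
 have i: "inj_on f (car M)" using b by (simp add: bij_betw_def)
 have g: "?g y : car M" "f (?g y) = y" if "y : car N" for y
  using that b f_the_inv_into_f[OF i, of y] the_inv_into_into[OF i, of y "car M"]
  by (auto simp: bij_betw_def)
 have gf: "?g (f x) = x" if "x : car M" for x using the_inv_into_f_f[OF i that] .
 show ?thesis
 proof (rule lhomI)
  fix x y assume a: "x : car N" "y : car N"
  have "?g (f (?g x +[M] ?g y)) = ?g x +[M] ?g y" using a g by (intro gf) simp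
  thus "restrict ?g (car N) (x +[N] y) = restrict ?g (car N) x +[M] restrict ?g (car N) y"
   using a g by (simp add: lhom_add[OF f])
 next
  fix r x assume a: "r : car R" "x : car N"
  have "?g (f (r *[M] ?g x)) = r *[M] ?g x" using a g by (intro gf) simp
  thus "restrict ?g (car N) (r *[N] x) = r *[M] restrict ?g (car N) x"
   using a g by (simp add: lhom_smult[OF f])
 qed (use g in auto)
qed

lemma lhom_factor:
 assumes f: "f : lhom R M N" "f ` car M = car N" and U: "left_module R U"
  and g: "g : lhom R M U" and k: "!!x. [|x : car M; f x = 0[N]|] ==> g x = 0[U]"
 obtains h where "h : lhom R N U" "!!x. x : car M ==> h (f x) = g x"
proof -
 interpret U: two_mods R M U using U by (simp add: M.left)
 define h where "h = (\<lambda>y\<in>car N. g (SOME x. x : car M & f x = y))"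
 have h: "h (f x) = g x" if x: "x : car M" for x
 proof -
  let ?z = "SOME z. z : car M & f z = f x"
  have z: "?z : car M" "f ?z = f x" using someI[of "%z. z : car M & f z = f x" x] x by auto
  have "f (?z -[M] x) = 0[N]" using z x lhom_mem[OF f(1)] by (simp add: lhom_minus[OF f(1)] N.diff_zero_iff)
  hence "g ?z -[U] g x = 0[U]" using k[of "?z -[M] x"] z x by (simp add: U.lhom_minus[OF g])
  thus ?thesis using z x lhom_mem[OF g] lhom_mem[OF f(1)] by (simp add: h_def U.N.diff_zero_iff)
 qed
 have "h : lhom R N U"
 proof (rule lhomI)
  fix y assume "y : car N"
  then obtain a where "a : car M" "y = f a" using f(2) by blast
  thus "h y : car U" using h lhom_mem[OF g] by simp
 next
  fix x y assume "x : car N" "y : car N"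
  then obtain a b where ab: "a : car M" "b : car M" "x = f a" "y = f b" using f(2) by blast
  hence "h (f (a +[M] b)) = h x +[U] h y" by (simp add: h[OF M.M.a_closed] h lhom_add[OF g])
  thus "h (x +[N] y) = h x +[U] h y" using ab by (simp add: lhom_add[OF f(1)])
 next
  fix r x assume "r : car R" "x : car N"
  then obtain a where ab: "a : car M" "x = f a" and r: "r : car R" using f(2) by blast
  hence "h (f (r *[M] a)) = r *[U] h x" by (simp add: h[OF M.smult_closed] h lhom_smult[OF g])
  thus "h (r *[N] x) = r *[U] h x" using ab r by (simp add: lhom_smult[OF f(1)])
 qed (auto simp: h_def)
 thus ?thesis using h that by blast
qed

end

lemma lhom_id: "left_module R M ==> (\<lambda>x\<in>car M. x) : lhom R M M"
 by (rule lhomI) (auto simp: left_module.smult_closed left_module_def abelian_group_def abelian_monoid.a_closed)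

lemma isomorphic_sym:
 assumes "left_module R M" "left_module R N" "isomorphic R M N" shows "isomorphic R N M"
proof -
 interpret two_mods R M N using assms by simp
 from assms(3) obtain f where f: "f : lhom R M N" "bij_betw f (car M) (car N)"
  by (auto simp: isomorphic_def)
 have "bij_betw (restrict (the_inv_into (car M) f) (car N)) (car N) (car M)"
  using bij_betw_the_inv_into[OF f(2)] unfolding bij_betw_def inj_on_restrict_eq image_restrict_eq .
 with lhom_inverse[OF f] show ?thesis unfolding isomorphic_def by blast
qed

lemma isomorphic_trans:
 assumes "isomorphic R M N" "isomorphic R N U" "left_module R M" shows "isomorphic R M U"
proof -
 from assms obtain f g where "f : lhom R M N" "bij_betw f (car M) (car N)"
  "g : lhom R N U" "bij_betw g (car N) (car U)" by (auto simp: isomorphic_def)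
 hence "compose (car M) g f : lhom R M U" "bij_betw (compose (car M) g f) (car M) (car U)"
  using assms(3) by (auto intro: lhom_comp bij_betw_compose)
 thus ?thesis by (auto simp: isomorphic_def)
qed

context lmod
begin

lemma submodule_abelian_subgroup: "submodule N R M ==> abelian_subgroup N M"
 by (intro abelian_subgroupI3 additive_subgroup.intro submodule.axioms M.abelian_group_axioms)

definition qmap :: "'m set => 'm => 'm set" where
 "qmap N = (\<lambda>x\<in>car M. N +>\<^bsub>M\<^esub> x)"

lemma quot_facts:
 fixes N assumes N: "submodule N R M"
 shows quot_left: "left_module R (quot M N)"
  and qmap_lhom: "qmap N : lhom R M (quot M N)"
  and qmap_surj: "qmap N ` car M = car (quot M N)"
  and qmap_eq_iff: "!!x y. [|x : car M; y : car M|] ==> qmap N x = qmap N y \<longleftrightarrow> x -[M] y : N"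
  and qmap_zero: "!!x. x : car M ==> qmap N x = 0[quot M N] \<longleftrightarrow> x : N"
  and qmap_mem: "!!x. x : car M ==> x : qmap N x"
  and qmap_of_mem: "!!x y. [|x : car M; y : qmap N x|] ==> y : car M & qmap N y = qmap N x"
proof -
 interpret S: abelian_subgroup N M by (rule submodule_abelian_subgroup[OF N])
 note n = subD[OF N]
 have eq: "N +>\<^bsub>M\<^esub> x = N +>\<^bsub>M\<^esub> y \<longleftrightarrow> x -[M] y : N" if "x : car M" "y : car M" for x y
  by (metis S.a_rcos_self[OF that(1)] S.a_repr_independence'[of x y] S.a_rcos_module[OF that(2,1)] a_minus_def that)
 have add: "(N +>\<^bsub>M\<^esub> x) <+>\<^bsub>M\<^esub> (N +>\<^bsub>M\<^esub> y) = N +>\<^bsub>M\<^esub> (x +[M] y)" if "x : car M" "y : car M" for x y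
  using S.a_rcos_sum that .
 have mem: "y : car M & N +>\<^bsub>M\<^esub> y = N +>\<^bsub>M\<^esub> x" if "x : car M" "y : N +>\<^bsub>M\<^esub> x" for x y
  using S.a_repr_independence'[OF that(2,1)] S.a_elemrcos_carrier[OF that] by simp
 have sm: "smult (quot M N) r (N +>\<^bsub>M\<^esub> x) = N +>\<^bsub>M\<^esub> (r *[M] x)" if "r : car R" "x : car M" for r x
 proof -
  have "N +>\<^bsub>M\<^esub> (r *[M] y) = N +>\<^bsub>M\<^esub> (r *[M] x)" if y: "y : N +>\<^bsub>M\<^esub> x" for y
  proof -
   have yc: "y : car M" "N +>\<^bsub>M\<^esub> y = N +>\<^bsub>M\<^esub> x" using mem[OF `x : _` y] by auto
   hence "y -[M] x : N" using eq `x : _` by blast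
   hence "r *[M] y -[M] r *[M] x : N" using n(5)[OF `r : _`] yc `x : _` `r : _`
    by (simp add: smult_r_diff[symmetric])
   thus ?thesis using eq yc `x : _` `r : _` by simp
  qed
  moreover have "N +>\<^bsub>M\<^esub> x ~= {}" using S.a_rcos_self `x : _` by blast
  ultimately have "(\<Union>y\<in>N +>\<^bsub>M\<^esub> x. N +>\<^bsub>M\<^esub> (r *[M] y)) = N +>\<^bsub>M\<^esub> (r *[M] x)" by (rule SUP_eq_const[rotated])
  thus ?thesis by (simp add: quot_def)
 qed
 have car: "car (quot M N) = (%x. N +>\<^bsub>M\<^esub> x) ` car M"
  by (auto simp: quot_def A_RCOSETS_def RCOSETS_def a_r_coset_def)
 have z: "N = N +>\<^bsub>M\<^esub> 0[M]" using n(1) by (simp add: M.a_coset_add_zero)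
 have zero: "0[quot M N] = N +>\<^bsub>M\<^esub> 0[M]" using z by (simp add: quot_def)
 have ad: "(N +>\<^bsub>M\<^esub> x) +[quot M N] (N +>\<^bsub>M\<^esub> y) = N +>\<^bsub>M\<^esub> (x +[M] y)" if "x : car M" "y : car M" for x y
  using add[OF that] by (simp add: quot_def)
 show "left_module R (quot M N)"
 proof (rule left_moduleI)
  show "abelian_group (quot M N)"
  proof (rule abelian_groupI)
   fix x assume "x : car (quot M N)"
   then obtain a where a: "a : car M" "x = N +>\<^bsub>M\<^esub> a" by (auto simp: car)
   show "EX y:car (quot M N). y +[quot M N] x = 0[quot M N]"
    by (rule bexI[of _ "N +>\<^bsub>M\<^esub> (-[M] a)"]) (use a in \<open>auto simp: car ad zero M.l_neg\<close>)
  qed (auto simp: car ad zero M.a_ac)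
 qed (auto simp: car ad sm smult_l_distr smult_r_distr smult_assoc1 R.ring_axioms)
 show "qmap N : lhom R M (quot M N)"
  by (rule lhomI) (auto simp: qmap_def car ad sm)
 show "qmap N ` car M = car (quot M N)" by (auto simp: qmap_def car)
 show "!!x y. [|x : car M; y : car M|] ==> qmap N x = qmap N y \<longleftrightarrow> x -[M] y : N"
  by (simp add: qmap_def eq)
 show "!!x. x : car M ==> qmap N x = 0[quot M N] \<longleftrightarrow> x : N"
  unfolding zero by (simp add: qmap_def eq)
 show "!!x. x : car M ==> x : qmap N x" by (simp add: qmap_def S.a_rcos_self)
 show "!!x y. [|x : car M; y : qmap N x|] ==> y : car M & qmap N y = qmap N x"
  unfolding qmap_def using mem by (metis restrict_apply')
qed

lemma isomorphic_quotI:
 assumes g: "g : lhom R M U" "g ` car M = car U" and U: "left_module R U"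
  and N: "N = {x : car M. g x = 0[U]}"
 shows "isomorphic R (quot M N) U"
proof -
 interpret two_mods R M U using U by (simp add: left_module_axioms)
 have sub: "submodule N R M" unfolding N by (rule lhom_kernel[OF g(1)])
 interpret Q: lmod R "quot M N" using quot_left[OF sub] by simp
 interpret MQ: two_mods R M "quot M N" ..
 interpret QU: two_mods R "quot M N" U ..
 obtain h where h: "h : lhom R (quot M N) U" "!!x. x : car M ==> h (qmap N x) = g x"
  using MQ.lhom_factor[OF qmap_lhom[OF sub] qmap_surj[OF sub] U g(1)] qmap_zero[OF sub] N by blast
 have "inj_on h (car (quot M N))"
  unfolding QU.lhom_inj_iff[OF h(1)]
 proof (intro ballI impI)
  fix y assume "y : car (quot M N)" "h y = 0[U]"
  moreover from this(1) obtain x where "x : car M" "y = qmap N x" using qmap_surj[OF sub] by blast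
  ultimately show "y = 0[quot M N]"
   using h(2)[of x] qmap_zero[OF sub, of x] N by simp
 qed
 moreover have "h ` car (quot M N) = car U"
  unfolding qmap_surj[OF sub, symmetric] g(2)[symmetric] using h(2) by (auto simp: image_image)
 ultimately show ?thesis using h(1) by (auto simp: isomorphic_def bij_betw_def)
qed

lemma isomorphic_quotE:
 assumes N: "submodule N R M" and U: "left_module R U" and i: "isomorphic R (quot M N) U"
 obtains g where "g : lhom R M U" "g ` car M = car U" "N = {x : car M. g x = 0[U]}"
proof -
 interpret Q: lmod R "quot M N" using quot_left[OF N] by simp
 interpret QU: two_mods R "quot M N" U by (simp add: U Q.left)
 from i obtain h where h: "h : lhom R (quot M N) U" "inj_on h (car (quot M N))" "h ` car (quot M N) = car U"
  by (auto simp: isomorphic_def bij_betw_def)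
 have c: "qmap N x : car (quot M N)" if "x : car M" for x using qmap_surj[OF N] that by blast
 let ?g = "compose (car M) h (qmap N)"
 have "?g : lhom R M U" by (rule lhom_comp[OF qmap_lhom[OF N] h(1) left_module_axioms])
 moreover have "?g ` car M = car U" unfolding h(3)[symmetric] qmap_surj[OF N, symmetric]
  by (auto simp: compose_def image_image)
 moreover have "?g x = 0[U] \<longleftrightarrow> x : N" if x: "x : car M" for x
  using x qmap_zero[OF N x] c[OF x] h(2) QU.lhom_zero[OF h(1)]
  by (auto simp: compose_def QU.lhom_inj_iff[OF h(1)])
 hence "N = {x : car M. ?g x = 0[U]}" using subD(1)[OF N] by auto
 ultimately show ?thesis by (rule that)
qed

end

section \<open>Length\<close>

text \<open>Length is measured by the largest finite chain of submodules; over a field this is the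
  dimension. A chain with \<open>d\<close> proper steps has \<open>d + 1\<close> members, whence the
  \<open>- 1\<close> in \<open>len\<close>.\<close>

definition schain :: "('r, 'e) ring_scheme => ('r, 'm) module => 'm set set => bool" where
 "schain R M C \<longleftrightarrow> finite C & (ALL X:C. submodule X R M) & (ALL X:C. ALL Y:C. X <= Y | Y <= X)"

definition flen :: "('r, 'e) ring_scheme => ('r, 'm) module => bool" where
 "flen R M \<longleftrightarrow> (EX d. ALL C. schain R M C --> card C <= d)"

definition len :: "('r, 'e) ring_scheme => ('r, 'm) module => nat" where
 "len R M = Max (card ` {C. schain R M C}) - 1"

text \<open>Along the chain every step is strict for \<open>\<phi>\<close> or for
  \<open>\<psi>\<close>, so removing the largest member lowers the size of at least one of the two
  images.\<close>

lemma card_chain_split: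
 fixes C :: "'c set set" and \<phi> :: "'c set => 'a set" and \<psi> :: "'c set => 'b set"
 assumes "finite C" "C ~= {}" "!!X Y. [|X : C; Y : C|] ==> X <= Y | Y <= X"
  "!!X Y. [|X : C; Y : C; X <= Y|] ==> \<phi> X <= \<phi> Y & \<psi> X <= \<psi> Y"
  "!!X Y. [|X : C; Y : C; X <= Y; \<phi> X = \<phi> Y; \<psi> X = \<psi> Y|] ==> X = Y"
 shows "card C + 1 <= card (\<phi> ` C) + card (\<psi> ` C)"
 using assms
proof (induction "card C" arbitrary: C rule: less_induct)
 case less
 obtain m where m: "m : C" "!!X. X : C ==> X <= m"
  using finite_has_maximal[OF less.prems(1,2)] less.prems(3) by metis
 define D where "D = C - {m}"
 have D: "finite D" "D <= C" "C = insert m D" "m ~: D" "card C = Suc (card D)"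
  using less.prems(1) m(1) card.remove[of C m] by (auto simp: D_def)
 show ?case
 proof (cases "D = {}")
  case True
  thus ?thesis by (simp add: D(3))
 next
  case False
  obtain m' where m': "m' : D" "!!X. X : D ==> X <= m'"
   using finite_has_maximal[OF D(1) False] less.prems(3) D(2) by (metis subsetD)
  have IH: "card D + 1 <= card (\<phi> ` D) + card (\<psi> ` D)"
   by (rule less.hyps) (use D False less.prems(3-5) in auto)
  have c: "card (\<phi> ` D) <= card (\<phi> ` C)" "card (\<psi> ` D) <= card (\<psi> ` C)"
   using D(2) less.prems(1) by (auto intro!: card_mono)
  have new: "\<chi> m ~: \<chi> ` D" if "\<chi> m' ~= \<chi> m" "!!X Y. [|X : C; Y : C; X <= Y|] ==> \<chi> X <= \<chi> Y" for \<chi> :: "'c set => 'x set"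
  proof
   assume "\<chi> m : \<chi> ` D"
   then obtain X where X: "X : D" "\<chi> m = \<chi> X" by blast
   have "m' : C" "X : C" using D(2) m'(1) X(1) by auto
   hence "\<chi> X <= \<chi> m'" "\<chi> m' <= \<chi> m" using that(2) m'(2)[OF X(1)] m by auto
   with X(2) that(1) show False by blast
  qed
  have "\<phi> m' ~= \<phi> m | \<psi> m' ~= \<psi> m" using less.prems(5)[of m' m] m(1) m(2)[of m'] m'(1) D(2,4) by auto
  thus ?thesis
  proof
   assume "\<phi> m' ~= \<phi> m"
   hence "\<phi> m ~: \<phi> ` D" by (rule new) (use less.prems(4) in blast)
   hence "card (\<phi> ` C) = Suc (card (\<phi> ` D))" using D(1,3) by simp
   thus ?thesis using IH c D(5) by simp
  next
   assume "\<psi> m' ~= \<psi> m"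
   hence "\<psi> m ~: \<psi> ` D" by (rule new) (use less.prems(4) in blast)
   hence "card (\<psi> ` C) = Suc (card (\<psi> ` D))" using D(1,3) by simp
   thus ?thesis using IH c D(5) by simp
  qed
 qed
qed

context lmod
begin

lemma schain_zero: "schain R M {{0[M]}}"
 by (simp add: schain_def sub_zero)

lemma len_bound: assumes "flen R M" "schain R M C" shows "card C <= Suc (len R M)"
proof -
 have "finite (card ` {C. schain R M C})"
  using assms(1) by (auto simp: flen_def finite_nat_set_iff_bounded_le)
 hence "card C <= Max (card ` {C. schain R M C})" using assms(2) by auto
 thus ?thesis by (simp add: len_def)
qed

lemma len_attained: assumes "flen R M" obtains C where "schain R M C" "card C = Suc (len R M)" "C ~= {}"
proof -
 let ?S = "card ` {C. schain R M C}"
 have fin: "finite ?S" using assms by (auto simp: flen_def finite_nat_set_iff_bounded_le)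
 have "card {{0[M]}} : ?S" using schain_zero by blast
 hence "Max ?S : ?S" "1 <= Max ?S" using fin by (auto intro!: Max_in)
 hence "Suc (len R M) : ?S" by (simp add: len_def)
 then obtain C where C: "schain R M C" "card C = Suc (len R M)" by auto
 hence "C ~= {}" by auto
 with C that show ?thesis by blast
qed

lemma len_leI: assumes "!!C. [|schain R M C; C ~= {}|] ==> card C <= Suc d"
 shows "flen R M" "len R M <= d"
proof -
 have *: "card C <= Suc d" if "schain R M C" for C using assms[OF that] by (cases "C = {}") auto
 thus f: "flen R M" unfolding flen_def by blast
 obtain C where "schain R M C" "card C = Suc (len R M)" using len_attained[OF f] by blast
 with * show "len R M <= d" by force
qed

lemma len_trivial: assumes "car M = {0[M]}" shows "flen R M" "len R M = 0"
proof -
 have "card C <= Suc 0" if "schain R M C" for C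
 proof -
  have "C <= {{0[M]}}"
  proof
   fix X assume "X : C"
   hence "submodule X R M" using that by (simp add: schain_def)
   from subD(1,2)[OF this] show "X : {{0[M]}}" using assms by blast
  qed
  thus ?thesis using card_mono[of "{{0[M]}}" C] by simp
 qed
 from len_leI[of 0] this show "flen R M" "len R M = 0" by auto
qed

lemma len_eq_0D: assumes "flen R M" "len R M = 0" shows "car M = {0[M]}"
proof (rule ccontr)
 assume "car M ~= {0[M]}"
 moreover have "schain R M {{0[M]}, car M}"
  by (auto simp: schain_def sub_zero sub_carrier)
 from len_bound[OF assms(1) this] have "card {{0[M]}, car M} <= 1" using assms(2) by simp
 ultimately show False by (simp add: card_insert_if)
qed

lemma len_simple:
 assumes "car M ~= {0[M]}" "!!N. submodule N R M ==> N = {0[M]} | N = car M"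
 shows "flen R M" "len R M = 1"
proof -
 have "card C <= Suc 1" if "schain R M C" for C
 proof -
  have "C <= {{0[M]}, car M}" using that assms(2) by (auto simp: schain_def)
  hence "card C <= card {{0[M]}, car M}" by (intro card_mono) auto
  also have "... <= Suc 1" by (simp add: card_insert_if)
  finally show ?thesis .
 qed
 from len_leI[of 1] this have *: "flen R M" "len R M <= 1" by auto
 thus "flen R M" "len R M = 1" using len_eq_0D[OF *(1)] assms(1) by linarith+
qed

lemma simple_if_len_1:
 assumes "flen R M" "len R M = 1" "submodule N R M" shows "N = {0[M]} | N = car M"
proof (rule ccontr)
 assume n: "~ (N = {0[M]} | N = car M)"
 have s: "N <= car M" "0[M] : N" using subD[OF assms(3)] by auto
 hence "schain R M {{0[M]}, N, car M}"
  using assms(3) by (auto simp: schain_def sub_zero sub_carrier)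
 from len_bound[OF assms(1) this] have "card {{0[M]}, N, car M} <= 2" using assms(2) by simp
 moreover have "{0[M]} ~= car M" using n s by blast
 ultimately show False using n by (auto simp: card_insert_if split: if_splits)
qed

end

context two_mods
begin

text \<open>A chain in \<open>M\<close> gives one in the kernel \<open>Z\<close> by intersection and
  one in \<open>N\<close> by taking images; \<open>card_chain_split\<close> applies because
  comparable submodules with the same intersection and the same image are equal. Conversely a chain
  in \<open>Z\<close> and the preimages of a chain in \<open>N\<close> fit together, with at most
  \<open>Z\<close> in common.\<close>

lemma flen_additive:
 assumes f: "f : lhom R M N" "f ` car M = car N"
 defines "Z \<equiv> {x : car M. f x = 0[N]}"
 shows "flen R M \<longleftrightarrow> flen R (restr M Z) & flen R N" (is ?A)
  and "flen R M ==> len R M = len R (restr M Z) + len R N"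
proof -
 have Z: "submodule Z R M" unfolding Z_def by (rule lhom_kernel[OF f(1)])
 interpret Z: lmod R "restr M Z" using M.sub_left[OF Z] by simp
 have up: "EX C1 C2. schain R (restr M Z) C1 & schain R N C2 & card C + 1 <= card C1 + card C2"
  if C: "schain R M C" "C ~= {}" for C
 proof (intro exI conjI)
  have s: "submodule X R M" if "X : C" for X using C that by (simp add: schain_def)
  show "schain R (restr M Z) ((%X. X \<inter> Z) ` C)"
   using C by (auto simp: schain_def M.sub_restr_iff[OF Z] M.sub_Int[OF _ Z])
  show "schain R N ((%X. f ` X) ` C)"
   unfolding schain_def using C lhom_image[OF f(1) s] by (simp add: schain_def) (meson image_mono)
  show "card C + 1 <= card ((%X. X \<inter> Z) ` C) + card ((%X. f ` X) ` C)"
  proof (rule card_chain_split)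
   fix X Y assume a: "X : C" "Y : C" "X <= Y" "X \<inter> Z = Y \<inter> Z" "f ` X = f ` Y"
   have "y : X" if y: "y : Y" for y
   proof -
    obtain x where x: "x : X" "f x = f y" using a(5) y by (metis imageE imageI)
    have c: "x : car M" "y : car M" using M.sub_mem s a x y by blast+
    have "y -[M] x : Y" using M.sub_minus[OF s[OF a(2)] y] x a by blast
    moreover have "y -[M] x : Z" using c x lhom_mem[OF f(1)]
     by (simp add: Z_def lhom_minus[OF f(1)] N.diff_zero_iff)
    ultimately have "y -[M] x : X" using a(4) by blast
    hence "(y -[M] x) +[M] x : X" using subD(4)[OF s[OF a(1)]] x by blast
    thus ?thesis using c by simp
   qed
   with a show "X = Y" by blast
  qed (use C in \<open>auto simp: schain_def\<close>)
 qed
 have dn: "EX C. schain R M C & card C1 + card C2 <= card C + 1"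
  if C1: "schain R (restr M Z) C1" and C2: "schain R N C2" for C1 C2
 proof (intro exI conjI)
  let ?p = "%V. {x : car M. f x : V}"
  have s1: "submodule X R M & X <= Z" if "X : C1" for X
   using C1 that by (simp add: schain_def M.sub_restr_iff[OF Z])
  have s2: "submodule X R N" if "X : C2" for X using C2 that by (simp add: schain_def)
  have z: "Z <= ?p X" if "X : C2" for X using subD(2)[OF s2[OF that]] by (auto simp: Z_def)
  have ff: "f ` ?p X = X" if "X : C2" for X
   using subD(1)[OF s2[OF that]] unfolding f(2)[symmetric] by auto
  have inj: "inj_on ?p C2" by (rule inj_on_inverseI[of _ "%X. f ` X"]) (rule ff)
  have fin: "finite C1" "finite C2" using C1 C2 by (auto simp: schain_def)
  have sub: "submodule X R M" if "X : C1 \<union> ?p ` C2" for X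
   using that s1 lhom_preimage[OF f(1) s2] by blast
  have ord: "X <= Y | Y <= X" if "X : C1 \<union> ?p ` C2" "Y : C1 \<union> ?p ` C2" for X Y
  proof -
   have c1: "X <= Y | Y <= X" if "X : C1" "Y : C1" for X Y using C1 that by (simp add: schain_def)
   have c2: "X <= Y | Y <= X" if "X : C2" "Y : C2" for X Y using C2 that by (simp add: schain_def)
   have c3: "X <= ?p Y" if "X : C1" "Y : C2" for X Y using s1[OF that(1)] z[OF that(2)] by blast
   from that show ?thesis
   proof (elim UnE imageE)
    fix V W assume "X = ?p V" "V : C2" "Y = ?p W" "W : C2"
    thus ?thesis using c2[of V W] by blast
   qed (simp_all add: c1 c3)
  qed
  show "schain R M (C1 \<union> ?p ` C2)" unfolding schain_def
  proof (intro conjI ballI)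
   show "finite (C1 \<union> ?p ` C2)" using fin by simp
  qed (fact sub ord)+
  have "C1 \<inter> ?p ` C2 <= {Z}" using s1 z by blast
  hence "card (C1 \<inter> ?p ` C2) <= 1" using card_mono[of "{Z}"] by fastforce
  moreover have "card (C1 \<union> ?p ` C2) + card (C1 \<inter> ?p ` C2) = card C1 + card (?p ` C2)"
   using fin by (intro card_Un_Int[symmetric]) auto
  ultimately show "card C1 + card C2 <= card (C1 \<union> ?p ` C2) + 1"
   using card_image[OF inj] by linarith
 qed
 show A: ?A
 proof
  assume "flen R M"
  then obtain d where d: "!!C. schain R M C ==> card C <= d" by (auto simp: flen_def)
  have "card C <= d" if "schain R (restr M Z) C" for C
   using dn[OF that N.schain_zero] d by fastforce
  moreover have "card C <= d" if "schain R N C" for C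
   using dn[OF Z.schain_zero that] d by fastforce
  ultimately show "flen R (restr M Z) & flen R N" by (auto simp: flen_def)
 next
  assume a: "flen R (restr M Z) & flen R N"
  show "flen R M"
  proof (rule M.len_leI(1))
   fix C assume "schain R M C" "C ~= {}"
   with up obtain C1 C2 where "schain R (restr M Z) C1" "schain R N C2" "card C + 1 <= card C1 + card C2" by metis
   moreover hence "card C1 <= Suc (len R (restr M Z))" "card C2 <= Suc (len R N)"
    using a Z.len_bound N.len_bound by auto
   ultimately show "card C <= Suc (len R (restr M Z) + len R N)" by linarith
  qed
 qed
 assume fl: "flen R M"
 with A have a: "flen R (restr M Z)" "flen R N" by auto
 obtain C where C: "schain R M C" "card C = Suc (len R M)" "C ~= {}" using M.len_attained[OF fl] .
 obtain D1 D2 where "schain R (restr M Z) D1" "schain R N D2" "card C + 1 <= card D1 + card D2"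
  using up[OF C(1,3)] by metis
 moreover hence "card D1 <= Suc (len R (restr M Z))" "card D2 <= Suc (len R N)"
  using a Z.len_bound N.len_bound by auto
 ultimately have le: "len R M <= len R (restr M Z) + len R N" using C(2) by linarith
 obtain C1 where C1: "schain R (restr M Z) C1" "card C1 = Suc (len R (restr M Z))" using Z.len_attained[OF a(1)] .
 obtain C2 where C2: "schain R N C2" "card C2 = Suc (len R N)" using N.len_attained[OF a(2)] .
 obtain D where "schain R M D" "card C1 + card C2 <= card D + 1" using dn[OF C1(1) C2(1)] by blast
 moreover hence "card D <= Suc (len R M)" using M.len_bound[OF fl] by blast
 ultimately show "len R M = len R (restr M Z) + len R N" using le C1(2) C2(2) by linarith
qed

lemma flen_inj:
 assumes f: "f : lhom R M N" and i: "inj_on f (car M)" and N: "flen R N"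
 shows "flen R M" "len R M <= len R N" "f ` car M = car N ==> len R M = len R N"
  "len R M = len R N ==> f ` car M = car N"
proof -
 have le: "EX C'. schain R N C' & card C' = card C & (ALL X:C'. X <= f ` car M)" if "schain R M C" for C
 proof (intro exI conjI ballI)
  have s: "submodule X R M" if "X : C" for X using `schain R M C` that by (simp add: schain_def)
  show "schain R N ((%X. f ` X) ` C)"
   unfolding schain_def using that lhom_image[OF f s] by (simp add: schain_def) (meson image_mono)
  have "inj_on (%X. f ` X) C"
   using inj_on_image_eq_iff[OF i] subD(1)[OF s] by (intro inj_onI) blast
  thus "card ((%X. f ` X) ` C) = card C" by (rule card_image)
  fix X assume "X : (%X. f ` X) ` C"
  thus "X <= f ` car M" using subD(1)[OF s] by blast
 qed
 have b: "card C <= Suc (len R N)" if "schain R M C" for C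
  using le[OF that] N.len_bound[OF N] by fastforce
 show fM: "flen R M" and "len R M <= len R N" using M.len_leI[of "len R N"] b by auto
 interpret Z: lmod R "restr M {0[M]}" using M.sub_left[OF M.sub_zero] by simp
 have "{x : car M. f x = 0[N]} = {0[M]}"
  using i lhom_zero[OF f] unfolding lhom_inj_iff[OF f] by auto
 thus "len R M = len R N" if "f ` car M = car N"
  using flen_additive(2)[OF f that fM] Z.len_trivial(2) by simp
 assume e: "len R M = len R N"
 show "f ` car M = car N"
 proof (rule ccontr)
  assume ne: "f ` car M ~= car N"
  obtain C where C: "schain R M C" "card C = Suc (len R M)" using M.len_attained[OF fM] .
  obtain C' where C': "schain R N C'" "card C' = card C" "ALL X:C'. X <= f ` car M" using le[OF C(1)] by blast
  have sub: "f ` car M <= car N" using lhom_mem[OF f] by blast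
  hence "car N ~: C'" using C'(3) ne by blast
  hence "card (insert (car N) C') = Suc (card C')" using C'(1) by (simp add: schain_def)
  moreover have "schain R N (insert (car N) C')"
   using C'(1,3) sub N.sub_carrier unfolding schain_def by auto
  ultimately show False using N.len_bound[OF N] C(2) C'(2) e by fastforce
 qed
qed

end

context lmod
begin

lemma flen_sub:
 assumes "flen R M" and N: "submodule N R M"
 shows "flen R (restr M N)" "len R (restr M N) <= len R M" "len R (restr M N) = len R M ==> N = car M"
proof -
 interpret N: lmod R "restr M N" using sub_left[OF N] by simp
 interpret NM: two_mods R "restr M N" M ..
 let ?i = "\<lambda>x\<in>N. x"
 have i: "?i : lhom R (restr M N) M" "inj_on ?i (car (restr M N))" "?i ` car (restr M N) = N"
  using lhom_restrict_source[OF lhom_id[OF left_module_axioms] N] sub_mem[OF N]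
  by (auto simp: inj_on_def cong: restrict_cong)
 show "flen R (restr M N)" "len R (restr M N) <= len R M" "len R (restr M N) = len R M ==> N = car M"
  using NM.flen_inj[OF i(1,2) assms(1)] i(3) by auto
qed

lemma len_submodule_less:
 assumes "submodule N R M" "submodule N' R M" "N \<subset> N'" "flen R (restr M N')"
 shows "len R (restr M N) < len R (restr M N')"
proof -
 interpret N': lmod R "restr M N'" using sub_left[OF assms(2)] by simp
 have "submodule N R (restr M N')" using assms(1-3) by (auto simp: sub_restr_iff)
 from N'.flen_sub[OF assms(4) this] show ?thesis using assms(3) by fastforce
qed

lemma flen_quot:
 assumes N: "submodule N R M"
 shows "flen R M \<longleftrightarrow> flen R (restr M N) & flen R (quot M N)"
  "flen R M ==> len R M = len R (restr M N) + len R (quot M N)"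
proof -
 interpret Q: lmod R "quot M N" using quot_left[OF N] by simp
 interpret MQ: two_mods R M "quot M N" ..
 have "{x : car M. qmap N x = 0[quot M N]} = N"
  using qmap_zero[OF N] subD(1)[OF N] by auto
 thus "flen R M \<longleftrightarrow> flen R (restr M N) & flen R (quot M N)"
  "flen R M ==> len R M = len R (restr M N) + len R (quot M N)"
  using MQ.flen_additive[OF qmap_lhom[OF N] qmap_surj[OF N]] by simp_all
qed

text \<open>Adding an element outside the span raises \<open>\<mu>\<close>, which is bounded by its
  value at the whole module. The measure is abstract since it is \<open>len R\<close> in one
  application and the dimension over \<open>K\<close> of an \<open>A\<close>-module in the
  other.\<close>

lemma fin_gen_if_strict:
 assumes m: "!!N N'. [|submodule N R M; submodule N' R M; N \<subset> N'|] ==> \<mu> N < (\<mu> N' :: nat)"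
 shows "fin_gen R M"
proof -
 have "EX S. finite S & S <= car M & span_in R M S = car M"
  if "finite T" "T <= car M" for T
  using that
 proof (induction "\<mu> (car M) - \<mu> (span_in R M T)" arbitrary: T rule: less_induct)
  case less
  show ?case
  proof (cases "span_in R M T = car M")
   case False
   note sT = span_sub[OF less.prems(2)]
   obtain x where x: "x : car M" "x ~: span_in R M T" using False subD(1)[OF sT] by blast
   let ?U = "span_in R M (insert x T)"
   have sU: "submodule ?U R M" using less.prems(2) x(1) by (intro span_sub) auto
   have "span_in R M T \<subset> ?U" using span_least[OF sU, of T] span_superset[of "insert x T"] x(2) by blast
   hence "\<mu> (span_in R M T) < \<mu> ?U" by (rule m[OF sT sU])
   moreover have "\<mu> ?U <= \<mu> (car M)"
    using m[OF sU sub_carrier] subD(1)[OF sU] by (metis less_imp_le order_refl psubset_eq)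
   ultimately show ?thesis using less.hyps[of "insert x T"] less.prems x(1) by simp
  qed (use less.prems in blast)
 qed
 from this[of "{}"] show ?thesis by (simp add: fin_gen_def)
qed

lemma flen_imp_fin_gen: assumes "flen R M" shows "fin_gen R M"
 using flen_sub(1)[OF assms] by (intro fin_gen_if_strict[where \<mu> = "%N. len R (restr M N)"] len_submodule_less)

end

text \<open>Each new generator enlarges the span by a cyclic quotient, and a cyclic vector space is
  zero or simple because nonzero scalars are invertible.\<close>

lemma flen_fin_gen:
 fixes K :: "('k, 'e) ring_scheme" and V :: "('k, 'v) module"
 assumes K: "field K" and V: "left_module K V" and fg: "fin_gen K V"
 shows "flen K V"
proof -
 interpret K: field K by fact
 interpret V: lmod K V using V by simp
 have cyc: "N = {0[W]} | N = car W"
  if W: "lmod K W" and w: "w : car W" "car W = lmod.cyc K W w" and N: "submodule N K W"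
  for W :: "('k, 'v set) module" and w N
 proof (cases "N = {0[W]}")
  case False
  interpret W: lmod K W by fact
  from False obtain v where v: "v : N" "v ~= 0[W]" using subD(2)[OF N] by blast
  hence "v : W.cyc w" using W.sub_mem[OF N] w by blast
  then obtain c where c: "c : car K" "v = c *[W] w" by (auto simp: W.cyc_def)
  hence "c ~= 0[K]" using v w by auto
  hence "c : Units K" using c by (simp add: K.field_Units)
  hence "inv\<^bsub>K\<^esub> c *[W] v = w" using c w by (simp add: W.smult_assoc1[symmetric])
  hence "w : N" using subD(5)[OF N, of "inv\<^bsub>K\<^esub> c" v] v `c : Units K` by simp
  thus ?thesis using W.cyc_least[OF N] w subD(1)[OF N] by blast
 qed simp
 have step: "flen K (restr V (span_in K V S))" if "finite S" "S <= car V" for S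
  using that
 proof (induction S)
  case empty
  have "span_in K V {} = {0[V]}"
   using V.span_least[OF V.sub_zero, of "{}"] subD(2)[OF V.span_sub[of "{}"]] by auto
  moreover interpret Z: lmod K "restr V {0[V]}" using V.sub_left[OF V.sub_zero] by simp
  have "flen K (restr V {0[V]})" by (rule Z.len_trivial) simp
  ultimately show ?case by simp
 next
  case (insert s S)
  let ?N = "span_in K V S" and ?N' = "span_in K V (insert s S)"
  have N: "submodule ?N K V" "submodule ?N' K V" using insert.prems by (auto intro: V.span_sub)
  have sub: "?N <= ?N'" using V.span_superset[of "insert s S"] by (intro V.span_least[OF N(2)]) auto
  have s: "s : ?N'" "s : car V" using V.span_superset[of "insert s S"] insert.prems by auto
  interpret N': lmod K "restr V ?N'" using V.sub_left[OF N(2)] by simp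
  have NN: "submodule ?N K (restr V ?N')" using N sub by (simp add: V.sub_restr_iff)
  interpret Q: lmod K "quot (restr V ?N') ?N" using N'.quot_left[OF NN] by simp
  interpret MQ: two_mods K "restr V ?N'" "quot (restr V ?N') ?N" ..
  let ?q = "N'.qmap ?N"
  note qh = N'.qmap_lhom[OF NN]
  have sQ: "?q s : car (quot (restr V ?N') ?N)" using lhom_mem[OF qh] s by simp
  have U: "submodule {x : car (restr V ?N'). ?q x : Q.cyc (?q s)} K (restr V ?N')"
   by (rule MQ.lhom_preimage[OF qh Q.cyc_sub[OF sQ]])
  have "?N' <= {x : car (restr V ?N'). ?q x : Q.cyc (?q s)}"
  proof (rule V.span_least)
   show "submodule {x : car (restr V ?N'). ?q x : Q.cyc (?q s)} K V"
    using U by (simp add: V.sub_restr_iff[OF N(2)])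
   have "x : ?N' & ?q x : Q.cyc (?q s)" if "x : S" for x
   proof -
    have x: "x : ?N" using V.span_superset that by blast
    hence "?q x = 0[quot (restr V ?N') ?N]" using N'.qmap_zero[OF NN, of x] sub by auto
    thus ?thesis using x sub subD(2)[OF Q.cyc_sub[OF sQ]] by auto
   qed
   thus "insert s S <= {x : car (restr V ?N'). ?q x : Q.cyc (?q s)}"
    using s Q.cyc_self[OF sQ] by auto
  qed
  hence "car (quot (restr V ?N') ?N) <= Q.cyc (?q s)"
   unfolding N'.qmap_surj[OF NN, symmetric] by auto
  hence car: "car (quot (restr V ?N') ?N) = Q.cyc (?q s)"
   using subD(1)[OF Q.cyc_sub[OF sQ]] by blast
  have "flen K (quot (restr V ?N') ?N)"
   using cyc[OF Q.lmod_axioms sQ car] Q.len_trivial(1) Q.len_simple(1) by metis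
  moreover have "flen K (restr (restr V ?N') ?N)" using insert by simp
  ultimately show ?case using N'.flen_quot(1)[OF NN] by blast
 qed
 from fg obtain S where "finite S" "S <= car V" "span_in K V S = car V" by (auto simp: fin_gen_def)
 with step[of S] show ?thesis by simp
qed

section \<open>Finite-dimensional modules over an algebra\<close>

text \<open>Restriction of scalars along the structure map of the algebra; all dimensions are taken
  in this vector space.\<close>

definition kmod :: "('k, 'a) module => ('a, 'm) module => ('k, 'm) module" where
 "kmod A M = \<lparr>carrier = car M, mult = undefined, one = undefined, zero = 0[M],
   add = add M, smult = (%c x. (c *[A] 1[A]) *[M] x)\<rparr>"

text \<open>For an idempotent \<open>e\<close> and a submodule \<open>N\<close> this is
  \<open>e N\<close>. It is a subspace over \<open>K\<close>, not a submodule over the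
  algebra.\<close>

definition wt :: "('a, 'm) module => 'a => 'm set => 'm set" where
 "wt M e N = {x : N. e *[M] x = x}"

definition kdim :: "('k, 'e) ring_scheme => ('k, 'a) module => ('a, 'm) module => 'm set => nat" where
 "kdim K A M S = len K (restr (kmod A M) S)"

definition fd :: "('k, 'e) ring_scheme => ('k, 'a) module => ('a, 'm) module => bool" where
 "fd K A M \<longleftrightarrow> left_module A M & flen K (kmod A M)"

definition homk :: "('k, 'a) module => ('a, 'm) module => ('a, 'n) module => ('k, 'm => 'n) module" where
 "homk A M N = \<lparr>carrier = lhom A M N, mult = undefined, one = undefined,
   zero = (\<lambda>x\<in>car M. 0[N]), add = (%f g. \<lambda>x\<in>car M. f x +[N] g x),
   smult = (%c f. \<lambda>x\<in>car M. (c *[A] 1[A]) *[N] f x)\<rparr>"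

lemma kmod_simps [simp]:
 "car (kmod A M) = car M" "0[kmod A M] = 0[M]" "add (kmod A M) = add M"
 "smult (kmod A M) c x = (c *[A] 1[A]) *[M] x"
 by (simp_all add: kmod_def)

lemma kmod_restr: "kmod A (restr M N) = restr (kmod A M) N"
 by (simp add: kmod_def)

lemma wt_restr [simp]: "wt (restr M U) e N = wt M e N"
 by (simp add: wt_def)

lemma kdim_restr [simp]: "kdim K A (restr M U) N = kdim K A M N"
 by (simp add: kdim_def kmod_def)

lemma wt_mono: "N <= N' ==> wt M e N <= wt M e N'"
 by (auto simp: wt_def)

locale fdalg = fd_algebra K A
 for K :: "('k, 'e) ring_scheme" (structure) and A :: "('k, 'a) module" (structure)
begin

abbreviation sc where "sc c \<equiv> c *[A] 1[A]"

lemma sc_zero [simp]: "sc 0[K] = 0[A]" by (rule smult_l_null) simp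

lemma sc_mult: "[|c : car K; a : car A|] ==> sc c \<otimes>[A] a = c *[A] a"
 by (simp add: smult_mult_left)

lemma sc_mult_right: "[|c : car K; a : car A|] ==> a \<otimes>[A] sc c = c *[A] a"
 by (simp add: smult_mult_right)

lemma sc_smult:
 fixes M :: "('a, 'm) module"
 assumes "left_module A M" "c : car K" "a : car A" "x : car M"
 shows "sc c *[M] (a *[M] x) = a *[M] (sc c *[M] x)"
proof -
 interpret M: lmod A M using assms by simp
 show ?thesis using assms by (simp add: M.smult_assoc1[symmetric] sc_mult sc_mult_right)
qed

lemma kmod_left:
 assumes "left_module A M" shows "left_module K (kmod A M)"
proof -
 interpret M: lmod A M using assms by simp
 have "abelian_group (kmod A M)"
  by (rule abelian_groupI) (auto simp: M.M.a_ac intro: M.M.l_neg bexI[of _ "-[M] _"])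
 thus ?thesis
  by (intro left_moduleI)
   (simp_all add: K.ring_axioms M.smult_l_distr M.smult_r_distr smult_l_distr smult_assoc1
    M.smult_assoc1[symmetric] sc_mult)
qed

lemma kmod_sub:
 assumes "left_module A M" "submodule N A M" shows "submodule N K (kmod A M)"
proof -
 interpret V: lmod K "kmod A M" using kmod_left[OF assms(1)] by simp
 show ?thesis by (rule V.submoduleI) (use subD[OF assms(2)] in auto)
qed

lemma kmod_lhom:
 assumes "f : lhom A M N" shows "f : lhom K (kmod A M) (kmod A N)"
 by (rule lhomI) (use assms in \<open>auto simp: lhomD\<close>)

lemma wt_sub:
 assumes M: "left_module A M" and N: "submodule N K (kmod A M)" and e: "e : car A"
 shows "submodule (wt M e N) K (kmod A M)"
proof -
 interpret M: lmod A M using M by simp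
 interpret V: lmod K "kmod A M" using kmod_left[OF M] by simp
 note n = subD[OF N] V.sub_mem[OF N]
 show ?thesis
  by (rule V.submoduleI)
   (use n e in \<open>auto simp: wt_def M.smult_r_distr sc_smult[OF M, symmetric]\<close>)
qed

lemma fd_left: "fd K A M ==> left_module A M" by (simp add: fd_def)

lemma fd_lmod: "fd K A M ==> lmod A M" by (simp add: fd_def)

lemma fd_kmod: "fd K A M ==> lmod K (kmod A M)" by (simp add: fd_def kmod_left)

lemma fd_kmod_sub: "[|fd K A M; submodule N A M|] ==> submodule N K (kmod A M)"
 by (simp add: fd_def kmod_sub)

lemma fd_sub:
 assumes "fd K A M" "submodule N A M" shows "fd K A (restr M N)"
proof -
 interpret M: lmod A M by (rule fd_lmod[OF assms(1)])
 interpret V: lmod K "kmod A M" by (rule fd_kmod[OF assms(1)])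
 show ?thesis using assms M.sub_left[OF assms(2)] kmod_sub[OF _ assms(2)] V.flen_sub(1)
  by (simp add: fd_def kmod_restr)
qed

lemma fd_surj:
 assumes "fd K A M" "left_module A N" "f : lhom A M N" "f ` car M = car N"
 shows "fd K A N"
proof -
 interpret V: lmod K "kmod A M" by (rule fd_kmod[OF assms(1)])
 interpret W: lmod K "kmod A N" using kmod_left[OF assms(2)] by simp
 interpret two_mods K "kmod A M" "kmod A N" ..
 show ?thesis using flen_additive(1)[OF kmod_lhom[OF assms(3)]] assms by (simp add: fd_def)
qed

lemma fd_inj:
 assumes "fd K A N" "left_module A M" "f : lhom A M N" "inj_on f (car M)"
 shows "fd K A M"
proof -
 interpret V: lmod K "kmod A N" by (rule fd_kmod[OF assms(1)])
 interpret W: lmod K "kmod A M" using kmod_left[OF assms(2)] by simp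
 interpret two_mods K "kmod A M" "kmod A N" ..
 show ?thesis using flen_inj(1)[OF kmod_lhom[OF assms(3)]] assms by (simp add: fd_def)
qed

lemma fd_quot: assumes "fd K A M" "submodule N A M" shows "fd K A (quot M N)"
proof -
 interpret M: lmod A M by (rule fd_lmod[OF assms(1)])
 show ?thesis by (rule fd_surj[OF assms(1) M.quot_left M.qmap_lhom M.qmap_surj]) (fact assms(2))+
qed

lemma fd_extension:
 assumes "left_module A M" "left_module A N" "f : lhom A M N" "f ` car M = car N"
  "fd K A (restr M {x : car M. f x = 0[N]})" "fd K A N"
 shows "fd K A M"
proof -
 interpret V: lmod K "kmod A M" using kmod_left[OF assms(1)] by simp
 interpret W: lmod K "kmod A N" using kmod_left[OF assms(2)] by simp
 interpret two_mods K "kmod A M" "kmod A N" ..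
 show ?thesis using flen_additive(1)[OF kmod_lhom[OF assms(3)]] assms by (simp add: fd_def kmod_restr)
qed

lemma kdim_mono:
 assumes "fd K A M" "submodule N K (kmod A M)" "submodule N' K (kmod A M)" "N <= N'"
 shows "kdim K A M N <= kdim K A M N'" "kdim K A M N = kdim K A M N' ==> N = N'"
proof -
 interpret V: lmod K "kmod A M" by (rule fd_kmod[OF assms(1)])
 have "flen K (restr (kmod A M) N')" using V.flen_sub(1)[OF _ assms(3)] assms(1) by (simp add: fd_def)
 hence "N ~= N' ==> kdim K A M N < kdim K A M N'"
  using V.len_submodule_less[OF assms(2,3)] assms(4) by (simp add: kdim_def psubset_eq)
 thus "kdim K A M N <= kdim K A M N'" "kdim K A M N = kdim K A M N' ==> N = N'"
  by (cases "N = N'"; simp)+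
qed

lemma kdim_zero: "left_module A M ==> kdim K A M {0[M]} = 0"
proof -
 assume M: "left_module A M"
 interpret V: lmod K "kmod A M" using kmod_left[OF M] by simp
 interpret Z: lmod K "restr (kmod A M) {0[M]}" using V.sub_left[OF V.sub_zero] by simp
 show ?thesis using Z.len_trivial(2) by (simp add: kdim_def)
qed

lemma kdim_eq_0D: assumes "fd K A M" "submodule N K (kmod A M)" "kdim K A M N = 0" shows "N = {0[M]}"
proof -
 interpret V: lmod K "kmod A M" by (rule fd_kmod[OF assms(1)])
 interpret Z: lmod K "restr (kmod A M) N" using V.sub_left[OF assms(2)] by simp
 show ?thesis using Z.len_eq_0D assms V.flen_sub(1)[OF _ assms(2)] by (simp add: kdim_def fd_def)
qed

lemma kdim_line:
 assumes V: "left_module K V" and b: "b : car V" "b ~= 0[V]"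
  and s: "!!x. x : car V ==> EX c:car K. x = c *[V] b"
 shows "flen K V" "len K V = 1"
proof -
 interpret V: lmod K V using V by simp
 have "N = {0[V]} | N = car V" if N: "submodule N K V" for N
 proof (cases "N = {0[V]}")
  case False
  then obtain v where v: "v : N" "v ~= 0[V]" using subD(2)[OF N] by blast
  then obtain c where c: "c : car K" "v = c *[V] b" using V.sub_mem[OF N] s by blast
  hence "c ~= 0[K]" using v b by auto
  hence u: "c : Units K" using c by (simp add: K.field_Units)
  hence "inv\<^bsub>K\<^esub> c *[V] v = b" using c b by (simp add: V.smult_assoc1[symmetric])
  hence "b : N" using subD(5)[OF N, of "inv\<^bsub>K\<^esub> c" v] v u by simp
  hence "car V <= N" using s subD(5)[OF N] by blast
  thus ?thesis using subD(1)[OF N] by blast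
 qed simp
 moreover have "car V ~= {0[V]}" using b by blast
 ultimately show "flen K V" "len K V = 1" using V.len_simple by blast+
qed

lemma line_kdim:
 assumes V: "left_module K V" and "flen K V" "len K V = 1" "b : car V" "b ~= 0[V]" "x : car V"
 shows "EX c:car K. x = c *[V] b"
proof -
 interpret V: lmod K V using V by simp
 have "V.cyc b = {0[V]} | V.cyc b = car V"
  using V.simple_if_len_1[OF assms(2,3) V.cyc_sub[OF assms(4)]] .
 hence "V.cyc b = car V" using V.cyc_self[OF assms(4)] assms(5) by auto
 thus ?thesis using assms(6) by (auto simp: V.cyc_def)
qed

text \<open>The nontrivial inclusion lifts \<open>y = e y\<close> from a preimage \<open>x\<close>
  to \<open>e x\<close>, which has weight \<open>e\<close> because \<open>e\<close> is
  idempotent.\<close>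

lemma wt_image:
 fixes M :: "('a, 'm) module" and N :: "('a, 'n) module"
 assumes "f : lhom A M N" "submodule U A M" "e : car A" "e \<otimes>[A] e = e" "left_module A M"
 shows "f ` wt M e U = wt N e (f ` U)"
proof -
 interpret M: lmod A M using assms by simp
 note u = subD[OF assms(2)] M.sub_mem[OF assms(2)]
 have 1: "f x : wt N e (f ` U)" if "x : wt M e U" for x
  using that lhom_smult[OF assms(1,3), of x] u by (auto simp: wt_def)
 have 2: "y : f ` wt M e U" if "y : wt N e (f ` U)" for y
 proof -
  from that obtain x where x: "x : U" "y = f x" "e *[N] y = y" by (auto simp: wt_def)
  have xc: "x : car M" using u(6) x(1) .
  have "e *[M] x : wt M e U" using u(5)[OF assms(3) x(1)] assms(3,4) xc
   by (simp add: wt_def M.smult_assoc1[symmetric])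
  moreover have "y = f (e *[M] x)" using lhom_smult[OF assms(1,3) xc] x by simp
  ultimately show ?thesis by blast
 qed
 show ?thesis using 1 2 by blast
qed

text \<open>Exactness of passing from \<open>M\<close> to \<open>e M\<close>, as rank plus nullity
  for the restriction of \<open>f\<close> to \<open>e U\<close>.\<close>

lemma wdim_additive:
 assumes M: "fd K A M" and N: "left_module A N" and f: "f : lhom A M N" and U: "submodule U A M"
  and e: "e : car A" "e \<otimes>[A] e = e"
 shows "kdim K A M (wt M e U) = kdim K A M (wt M e {x : U. f x = 0[N]}) + kdim K A N (wt N e (f ` U))"
proof -
 note Ml = fd_left[OF M]
 interpret M: lmod A M by (rule fd_lmod[OF M])
 interpret two_mods A M N using N by (simp add: Ml)
 interpret V: lmod K "kmod A M" by (rule fd_kmod[OF M])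
 interpret W: lmod K "kmod A N" using kmod_left[OF N] by simp
 have sU: "submodule (wt M e U) K (kmod A M)" by (rule wt_sub[OF Ml kmod_sub[OF Ml U] e(1)])
 have sfU: "submodule (wt N e (f ` U)) K (kmod A N)"
  by (rule wt_sub[OF N kmod_sub[OF N lhom_image[OF f U]] e(1)])
 interpret V': lmod K "restr (kmod A M) (wt M e U)" using V.sub_left[OF sU] by simp
 interpret W': lmod K "restr (kmod A N) (wt N e (f ` U))" using W.sub_left[OF sfU] by simp
 interpret VW: two_mods K "restr (kmod A M) (wt M e U)" "restr (kmod A N) (wt N e (f ` U))" ..
 let ?g = "restrict f (wt M e U)"
 have g: "?g : lhom K (restr (kmod A M) (wt M e U)) (restr (kmod A N) (wt N e (f ` U)))"
  by (rule lhom_restrict[OF kmod_lhom[OF f] sU]) (simp add: wt_image[OF f U e Ml])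
 have "flen K (restr (kmod A M) (wt M e U))" using V.flen_sub(1)[OF _ sU] M by (simp add: fd_def)
 from VW.flen_additive(2)[OF g _ this] have
  "kdim K A M (wt M e U) = len K (restr (kmod A M) {x : wt M e U. ?g x = 0[N]}) + kdim K A N (wt N e (f ` U))"
  by (simp add: kdim_def wt_image[OF f U e Ml])
 moreover have "{x : wt M e U. ?g x = 0[N]} = wt M e {x : U. f x = 0[N]}" by (auto simp: wt_def)
 ultimately show ?thesis by (simp add: kdim_def)
qed

lemma wdim_mono:
 assumes "fd K A M" "submodule N A M" "submodule N' A M" "N <= N'" "e : car A"
 shows "kdim K A M (wt M e N) <= kdim K A M (wt M e N')"
  "kdim K A M (wt M e N) = kdim K A M (wt M e N') ==> wt M e N = wt M e N'"
 using kdim_mono[OF assms(1) wt_sub[OF _ kmod_sub[OF _ assms(2)] assms(5)]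
  wt_sub[OF _ kmod_sub[OF _ assms(3)] assms(5)] wt_mono[OF assms(4)]] assms(1)
 by (simp_all add: fd_left)

lemma kdim_inj_image:
 assumes "fd K A M" "left_module A N" "f : lhom A M N" "inj_on f (car M)" "submodule S K (kmod A M)"
 shows "kdim K A N (f ` S) = kdim K A M S"
proof -
 interpret V: lmod K "kmod A M" by (rule fd_kmod[OF assms(1)])
 interpret W: lmod K "kmod A N" using kmod_left[OF assms(2)] by simp
 interpret VW0: two_mods K "kmod A M" "kmod A N" ..
 note fk = kmod_lhom[OF assms(3)]
 have fS: "submodule (f ` S) K (kmod A N)" by (rule VW0.lhom_image[OF fk assms(5)])
 interpret V': lmod K "restr (kmod A M) S" using V.sub_left[OF assms(5)] by simp
 interpret W': lmod K "restr (kmod A N) (f ` S)" using W.sub_left[OF fS] by simp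
 interpret VW: two_mods K "restr (kmod A M) S" "restr (kmod A N) (f ` S)" ..
 have g: "restrict f S : lhom K (restr (kmod A M) S) (restr (kmod A N) (f ` S))"
  by (rule lhom_restrict[OF fk assms(5)]) simp
 have fl: "flen K (restr (kmod A M) S)" using V.flen_sub(1)[OF _ assms(5)] assms(1) by (simp add: fd_def)
 have i: "inj_on (restrict f S) (car (restr (kmod A M) S))"
  using inj_on_subset[OF assms(4)] subD(1)[OF assms(5)] by simp
 have fl2: "flen K (restr (kmod A N) (f ` S))" using VW.flen_additive(1)[OF g] fl by simp
 show ?thesis using VW.flen_inj(3)[OF g i fl2] by (simp add: kdim_def)
qed

text \<open>The products \<open>t s\<close> of generators \<open>t\<close> of \<open>A\<close> over
  \<open>K\<close> and \<open>s\<close> of \<open>M\<close> over \<open>A\<close> span. First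
  \<open>A s\<close> lies in their span \<open>W\<close> for each generator \<open>s\<close>; then
  the elements all of whose multiples lie in \<open>W\<close> form an \<open>A\<close>-submodule
  that contains \<open>S\<close>.\<close>

lemma fg_imp_fd:
 assumes "fg_module A M" shows "fd K A M"
proof -
 from assms have M: "left_module A M" by (simp add: fg_module_def)
 interpret M: lmod A M using M by simp
 interpret V: lmod K "kmod A M" using kmod_left[OF M] by simp
 interpret Av: lmod K A by (simp add: left_module_def left_module_axioms_def K.ring_axioms abelian_group_axioms
   smult_l_distr smult_r_distr smult_assoc1)
 from assms obtain S where S: "finite S" "S <= car M" "span_in A M S = car M"
  by (auto simp: fg_module_def fin_gen_def)
 from finite_dim obtain T where T: "finite T" "T <= car A" "span_in K A T = car A"
  by (auto simp: fin_gen_def)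
 let ?U = "(%(t, s). t *[M] s) ` (T \<times> S)"
 let ?W = "span_in K (kmod A M) ?U"
 have U: "?U <= car (kmod A M)" using S(2) T(2) by auto
 have W: "submodule ?W K (kmod A M)" by (rule V.span_sub[OF U])
 note w = subD[OF W]
 have sW: "b *[M] s : ?W" if s: "s : S" and b: "b : car A" for s b
 proof -
  have sc: "s : car M" using s S(2) by auto
  have "submodule {b : car A. b *[M] s : ?W} K A"
  proof (rule Av.submoduleI)
   fix c b assume "c : car K" "b : {b : car A. b *[M] s : ?W}"
   thus "c *[A] b : {b : car A. b *[M] s : ?W}"
    using w(5)[of c "b *[M] s"] sc by (simp add: M.smult_assoc1[symmetric] sc_mult)
  qed (use w(2,4) sc in \<open>auto simp: M.smult_l_distr\<close>)
  moreover have "T <= {b : car A. b *[M] s : ?W}"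
  proof
   fix t assume "t : T"
   moreover hence "t *[M] s : ?W" using V.span_superset[of ?U] s by (auto simp: image_subset_iff)
   ultimately show "t : {b : car A. b *[M] s : ?W}" using T(2) by auto
  qed
  ultimately have "span_in K A T <= {b : car A. b *[M] s : ?W}" by (rule Av.span_least)
  thus ?thesis using b T(3) by auto
 qed
 let ?W' = "{x : car M. ALL b:car A. b *[M] x : ?W}"
 have "submodule ?W' A M"
  by (rule M.submoduleI) (use w(2,4) in \<open>auto simp: M.smult_r_distr M.smult_assoc1[symmetric]\<close>)
 moreover have "S <= ?W'" using sW S(2) by auto
 ultimately have W': "car M <= ?W'" using M.span_least[of ?W' S] unfolding S(3) by blast
 have "car M <= ?W"
 proof
  fix x assume x: "x : car M"
  hence "1[A] *[M] x : ?W" using W' by blast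
  thus "x : ?W" using x by simp
 qed
 hence "?W = car (kmod A M)" using w(1) by auto
 moreover have "finite ?U" using S(1) T(1) by simp
 ultimately have "fin_gen K (kmod A M)" using U unfolding fin_gen_def by blast
 hence "flen K (kmod A M)"
  by (rule flen_fin_gen[OF K.field_axioms kmod_left[OF M]])
 with M show ?thesis by (simp add: fd_def)
qed

lemma fd_imp_fg:
 assumes M: "fd K A M" shows "fg_module A M"
proof -
 interpret M: lmod A M by (rule fd_lmod[OF M])
 have "kdim K A M N < kdim K A M N'" if "submodule N A M" "submodule N' A M" "N \<subset> N'" for N N'
  using kdim_mono[OF M fd_kmod_sub[OF M that(1)] fd_kmod_sub[OF M that(2)]] that(3) by (metis le_neq_implies_less psubset_eq)
 thus ?thesis using M.fin_gen_if_strict[of "kdim K A M"] M.left by (simp add: fg_module_def)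
qed

text \<open>A submodule of largest dimension among those above \<open>N\<close> with property
  \<open>P\<close>. This is the source of all maximal choices below, as its dual is of all minimal
  ones.\<close>

lemma exists_maximal_submodule:
 assumes M: "fd K A M" and N: "submodule N A M" "P N"
 obtains N' where "submodule N' A M" "N <= N'" "P N'"
  "!!X. [|submodule X A M; P X; N' <= X|] ==> X = N'"
proof -
 interpret M: lmod A M by (rule fd_lmod[OF M])
 note k = fd_kmod_sub[OF M]
 let ?Q = "%X. submodule X A M & N <= X & P X"
 have "ALL X. ?Q X --> kdim K A M X < Suc (kdim K A M (car M))"
  using kdim_mono(1)[OF M k k[OF M.sub_carrier]] subD(1) by (metis le_imp_less_Suc)
 then obtain N' where N': "?Q N'" "ALL X. ?Q X --> kdim K A M X <= kdim K A M N'"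
  using ex_has_greatest_nat[of ?Q N "kdim K A M" "Suc (kdim K A M (car M))"] N by blast
 show ?thesis
 proof (rule that[of N'])
  fix X assume X: "submodule X A M" "P X" "N' <= X"
  hence "kdim K A M X <= kdim K A M N'" using N' by blast
  hence "kdim K A M N' = kdim K A M X" using kdim_mono(1)[OF M k k X(3)] N'(1) X(1) by fastforce
  thus "X = N'" using kdim_mono(2)[OF M k k X(3)] N'(1) X(1) by blast
 qed (use N' in auto)
qed

lemma exists_minimal_submodule:
 assumes M: "fd K A M" and N: "submodule N A M" "P N"
 obtains N' where "submodule N' A M" "P N'" "N' <= N"
  "!!X. [|submodule X A M; P X; X <= N'|] ==> X = N'"
proof -
 interpret M: lmod A M by (rule fd_lmod[OF M])
 note k = fd_kmod_sub[OF M]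
 let ?Q = "%X. submodule X A M & X <= N & P X"
 obtain N' where N': "?Q N'" "ALL X. ?Q X --> kdim K A M N' <= kdim K A M X"
  using ex_has_least_nat[of ?Q N "kdim K A M"] N by blast
 show ?thesis
 proof (rule that[of N'])
  fix X assume X: "submodule X A M" "P X" "X <= N'"
  hence "kdim K A M N' <= kdim K A M X" using N' by blast
  hence "kdim K A M X = kdim K A M N'" using kdim_mono(1)[OF M k k X(3)] N'(1) X(1) by fastforce
  thus "X = N'" using kdim_mono(2)[OF M k k X(3)] N'(1) X(1) by blast
 qed (use N' in auto)
qed

lemma exists_simple_submodule:
 assumes M: "fd K A M" and N: "submodule N A M" "N ~= {0[M]}"
 obtains S where "submodule S A M" "S <= N" "simple_mod A (restr M S)"
proof -
 interpret M: lmod A M by (rule fd_lmod[OF M])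
 obtain S where S: "submodule S A M" "S ~= {0[M]}" "S <= N"
  "!!X. [|submodule X A M; X ~= {0[M]}; X <= S|] ==> X = S"
  using exists_minimal_submodule[OF M N(1), of "%X. X ~= {0[M]}"] N(2) by metis
 have "simple_mod A (restr M S)"
  using S M.sub_left[OF S(1)] by (auto simp: simple_mod_def M.sub_restr_iff[OF S(1)])
 with S that show ?thesis by blast
qed

lemma exists_maximal:
 assumes M: "fd K A M" and N: "submodule N A M" "N ~= car M"
 obtains N' where "maximal_submodule A M N'" "N <= N'"
proof -
 interpret M: lmod A M by (rule fd_lmod[OF M])
 obtain N' where N': "submodule N' A M" "N <= N'" "N' ~= car M"
  "!!X. [|submodule X A M; X ~= car M; N' <= X|] ==> X = N'"
  using exists_maximal_submodule[OF M N(1), of "%X. X ~= car M"] N(2) by metis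
 hence "maximal_submodule A M N'" unfolding maximal_submodule_def by blast
 with N'(2) that show ?thesis by blast
qed

end

lemma maximal_quot_simple:
 assumes "left_module R M" "maximal_submodule R M N" shows "simple_mod R (quot M N)"
proof -
 interpret M: lmod R M using assms by simp
 have N: "submodule N R M" "N ~= car M" using assms(2) by (auto simp: maximal_submodule_def)
 interpret Q: lmod R "quot M N" using M.quot_left[OF N(1)] by simp
 interpret MQ: two_mods R M "quot M N" ..
 obtain x where x: "x : car M" "x ~: N" using N subD(1)[OF N(1)] by blast
 have "car (quot M N) ~= {0[quot M N]}"
  using x M.qmap_zero[OF N(1) x(1)] M.qmap_surj[OF N(1)] by blast
 moreover have "V = {0[quot M N]} | V = car (quot M N)" if V: "submodule V R (quot M N)" for V
 proof -
  let ?U = "{x : car M. M.qmap N x : V}"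
  have VU: "V = M.qmap N ` ?U"
   using subD(1)[OF V] unfolding M.qmap_surj[OF N(1), symmetric] by auto
  have "submodule ?U R M" by (rule MQ.lhom_preimage[OF M.qmap_lhom[OF N(1)] V])
  moreover have "N <= ?U"
  proof
   fix x assume x: "x : N"
   hence "x : car M" by (rule M.sub_mem[OF N(1)])
   with x show "x : ?U" using M.qmap_zero[OF N(1), of x] subD(2)[OF V] by simp
  qed
  ultimately have "?U = N | ?U = car M" using assms(2) by (simp add: maximal_submodule_def)
  thus ?thesis
  proof
   assume u: "?U = N"
   have "V <= {0[quot M N]}"
   proof
    fix v assume "v : V"
    then obtain y where "y : ?U" "v = M.qmap N y" using VU by blast
    thus "v : {0[quot M N]}" using u M.qmap_zero[OF N(1), of y] by auto
   qed
   thus ?thesis using subD(2)[OF V] by blast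
  next
   assume "?U = car M"
   thus ?thesis using VU M.qmap_surj[OF N(1)] by simp
  qed
 qed
 ultimately show ?thesis using Q.left by (auto simp: simple_mod_def)
qed

lemma simple_generated:
 fixes S :: "('r, 'm) module"
 assumes "simple_mod R S" "x : car S" "x ~= 0[S]" "y : car S"
 shows "EX a:car R. y = a *[S] x"
proof -
 interpret S: lmod R S using assms by (simp add: simple_mod_def)
 have "S.cyc x = {0[S]} | S.cyc x = car S"
  using assms(1) S.cyc_sub[OF assms(2)] by (simp add: simple_mod_def)
 hence "S.cyc x = car S" using S.cyc_self[OF assms(2)] assms(3) by auto
 thus ?thesis using assms(4) by (auto simp: S.cyc_def)
qed

lemma simple_fin_gen: assumes "simple_mod R S" shows "fg_module R S"
proof -
 interpret S: lmod R S using assms by (simp add: simple_mod_def)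
 obtain x where x: "x : car S" "x ~= 0[S]" using assms S.M.zero_closed by (auto simp: simple_mod_def)
 have sub: "submodule (span_in R S {x}) R S" using x by (intro S.span_sub) auto
 hence "span_in R S {x} = {0[S]} | span_in R S {x} = car S" using assms by (simp add: simple_mod_def)
 hence "span_in R S {x} = car S" using S.span_superset[of "{x}"] x(2) by auto
 thus ?thesis using x(1) S.left unfolding fg_module_def fin_gen_def by blast
qed

lemma lhom_simple_inj:
 assumes "simple_mod R S" "left_module R N" "f : lhom R S N" "x : car S" "f x ~= 0[N]"
 shows "inj_on f (car S)"
proof -
 interpret two_mods R S N using assms by (simp add: simple_mod_def)
 have "{x : car S. f x = 0[N]} = {0[S]} | {x : car S. f x = 0[N]} = car S"
  using assms(1) lhom_kernel[OF assms(3)] by (simp add: simple_mod_def)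
 thus ?thesis unfolding lhom_inj_iff[OF assms(3)] using assms(4,5) by blast
qed

section \<open>Extension and lifting of homomorphisms\<close>

context fdalg
begin

text \<open>\<open>projective\<close> and \<open>injective\<close> quantify only over modules on the
  type \<open>small_module\<close>. Passing to an isomorphic copy there makes the extension and
  lifting properties usable on every type.\<close>

lemma small_copy:
 assumes "fd K A M"
 obtains N :: "'a small_module" and f where "fg_module A N" "f : lhom A M N"
  "bij_betw f (car M) (car N)"
 using fg_module_small[OF fd_imp_fg[OF assms]] by (auto simp: isomorphic_def)

lemma injective_extend:
 assumes Q: "injective A Q" and M: "fd K A M" and N: "submodule N A M" and g: "g : lhom A (restr M N) Q"
 obtains h where "h : lhom A M Q" "!!x. x : N ==> h x = g x"
proof -
 interpret M: lmod A M by (rule fd_lmod[OF M])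
 have fN: "fd K A (restr M N)" by (rule fd_sub[OF M N])
 interpret N: lmod A "restr M N" by (rule fd_lmod[OF fN])
 obtain M' :: "'a small_module" and \<alpha> where M': "fg_module A M'" "\<alpha> : lhom A M M'" "bij_betw \<alpha> (car M) (car M')"
  using small_copy[OF M] .
 obtain N' :: "'a small_module" and \<beta> where N': "fg_module A N'" "\<beta> : lhom A (restr M N) N'" "bij_betw \<beta> N (car N')"
  using small_copy[OF fN] by auto
 interpret MM: two_mods A M M' using M'(1) by (simp add: M.left fg_module_def)
 interpret NN: two_mods A "restr M N" N' using N'(1) by (simp add: N.left fg_module_def)
 let ?b = "restrict (the_inv_into N \<beta>) (car N')"
 have b: "?b : lhom A N' (restr M N)" using NN.lhom_inverse[OF N'(2)] N'(3) by simp
 have binv: "?b (\<beta> x) = x" if "x : N" for x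
  using that N'(3) by (auto simp: bij_betw_def the_inv_into_f_f)
 have ib: "inj_on ?b (car N')" using bij_betw_the_inv_into[OF N'(3)] unfolding bij_betw_def inj_on_restrict_eq by simp
 have bN: "?b y : N" if "y : car N'" for y using lhom_mem[OF b that] by simp
 have f: "compose (car N') \<alpha> ?b : lhom A N' M'"
  by (rule lhom_comp[OF lhom_restr_target[OF b subD(1)[OF N]] M'(2) NN.N.left])
 have inj: "inj_on (compose (car N') \<alpha> ?b) (car N')"
 proof (rule inj_onI)
  fix x y assume a: "x : car N'" "y : car N'" "compose (car N') \<alpha> ?b x = compose (car N') \<alpha> ?b y"
  hence "\<alpha> (?b x) = \<alpha> (?b y)" by (simp add: compose_def)
  hence "?b x = ?b y" using M'(3) M.sub_mem[OF N bN] a(1,2) by (metis bij_betw_def inj_onD)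
  thus "x = y" using ib a by (metis inj_onD)
 qed
 have g': "compose (car N') g ?b : lhom A N' Q"
  by (rule lhom_comp[OF b g NN.N.left])
 obtain h where h: "h : lhom A M' Q" "ALL x:car N'. h (compose (car N') \<alpha> ?b x) = compose (car N') g ?b x"
  using Q f g' inj M'(1) N'(1) unfolding injective_def by metis
 show ?thesis
 proof (rule that)
  show "compose (car M) h \<alpha> : lhom A M Q" by (rule lhom_comp[OF M'(2) h(1) M.left])
  fix x assume x: "x : N"
  have bx: "\<beta> x : car N'" using lhom_mem[OF N'(2)] x by simp
  have "h (\<alpha> (?b (\<beta> x))) = g (?b (\<beta> x))" using bspec[OF h(2) bx] unfolding compose_eq[OF bx] .
  thus "compose (car M) h \<alpha> x = g x" using x M.sub_mem[OF N x] by (simp only: binv compose_eq)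
 qed
qed

lemma projective_lift:
 assumes P: "projective A P" and M: "fd K A M" and N: "fd K A N"
  and f: "f : lhom A M N" "f ` car M = car N" and g: "g : lhom A P N"
 obtains h where "h : lhom A P M" "!!x. x : car P ==> f (h x) = g x"
proof -
 interpret M: lmod A M by (rule fd_lmod[OF M])
 interpret N: lmod A N by (rule fd_lmod[OF N])
 have Pl: "left_module A P" using P by (simp add: projective_def fg_module_def)
 obtain M' :: "'a small_module" and \<alpha> where M': "fg_module A M'" "\<alpha> : lhom A M M'" "bij_betw \<alpha> (car M) (car M')"
  using small_copy[OF M] .
 obtain N' :: "'a small_module" and \<beta> where N': "fg_module A N'" "\<beta> : lhom A N N'" "bij_betw \<beta> (car N) (car N')"
  using small_copy[OF N] .
 interpret MM: two_mods A M M' using M'(1) by (simp add: M.left fg_module_def)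
 let ?a = "restrict (the_inv_into (car M) \<alpha>) (car M')"
 have a: "?a : lhom A M' M" by (rule MM.lhom_inverse[OF M'(2,3)])
 have as: "?a ` car M' = car M" using bij_betw_the_inv_into[OF M'(3)] unfolding bij_betw_def image_restrict_eq by simp
 let ?f = "compose (car M') \<beta> (compose (car M') f ?a)"
 have f': "?f : lhom A M' N'"
  by (intro lhom_comp[OF _ N'(2) MM.N.left] lhom_comp[OF a f(1) MM.N.left])
 have "?f ` car M' = \<beta> ` f ` ?a ` car M'" by (auto simp: compose_def image_image)
 hence fs: "?f ` car M' = car N'" using as f(2) N'(3) by (simp only: bij_betw_def)
 have g': "compose (car P) \<beta> g : lhom A P N'" by (rule lhom_comp[OF g N'(2) Pl])
 obtain h where h: "h : lhom A P M'" "ALL x:car P. ?f (h x) = compose (car P) \<beta> g x"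
  using P f' g' fs M'(1) N'(1) unfolding projective_def by metis
 show ?thesis
 proof (rule that)
  show "compose (car P) ?a h : lhom A P M" by (rule lhom_comp[OF h(1) a Pl])
  fix x assume x: "x : car P"
  have hx: "h x : car M'" by (rule lhom_mem[OF h(1) x])
  have "?f (h x) = compose (car P) \<beta> g x" using h(2) x by blast
  hence "\<beta> (f (?a (h x))) = \<beta> (g x)" using x hx by (simp only: compose_eq)
  moreover have "f (?a (h x)) : car N" by (rule lhom_mem[OF f(1) lhom_mem[OF a hx]])
  ultimately have "f (?a (h x)) = g x" using N'(3) lhom_mem[OF g x] by (metis bij_betw_def inj_onD)
  thus "f (compose (car P) ?a h x) = g x" using x by (simp only: compose_eq)
 qed
qed

end

section \<open>Fitting's lemma\<close>

lemma funpow_lhom_closed: "[|f : lhom R M M; x : car M|] ==> (f ^^ n) x : car M"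
 by (induction n) (auto simp: lhom_mem)

context fdalg
begin

text \<open>For large \<open>p\<close> the image of the \<open>p\<close>-th power of
  \<open>f\<close> is stable, so \<open>M\<close> is the direct sum of the kernel and the image of
  that power. Indecomposability leaves only one of them.\<close>

lemma fitting:
 assumes M: "fd K A M" and ind: "indecomposable A M" and f: "f : lhom A M M"
 shows "bij_betw f (car M) (car M) | (EX n. ALL x:car M. (f ^^ n) x = 0[M])"
proof -
 interpret M: lmod A M by (rule fd_lmod[OF M])
 interpret MM: two_mods A M M ..
 note k = fd_kmod_sub[OF M]
 define F where "F n = restrict (f ^^ n) (car M)" for n
 have F: "F n : lhom A M M" for n
 proof (induction n)
  case 0
  have "F 0 = (\<lambda>x\<in>car M. x)" by (auto simp: F_def)
  thus ?case using lhom_id[OF M.left] by (simp only:)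
 next
  case (Suc n)
  have "F (Suc n) = compose (car M) f (F n)" by (auto simp: F_def compose_def)
  thus ?case using lhom_comp[OF Suc f M.left] by simp
 qed
 have Fe: "F n x = (f ^^ n) x" if "x : car M" for n x using that by (simp add: F_def)
 have FF: "F (m + n) x = F m (F n x)" if "x : car M" for m n x
  using that funpow_lhom_closed[OF f that] by (simp add: F_def funpow_add)
 let ?I = "%n. F n ` car M"
 have sI: "submodule (?I n) A M" for n by (rule MM.lhom_image[OF F M.sub_carrier])
 have Fcl: "F n x : car M" if "x : car M" for n x by (rule lhom_mem[OF F that])
 have dec: "?I (m + n) <= ?I m" for m n using FF Fcl by auto
 obtain n where n: "!!m. kdim K A M (?I (Suc n)) <= kdim K A M (?I m)"
 proof -
  obtain m where m: "!!m'. kdim K A M (?I m) <= kdim K A M (?I m')"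
   using ex_has_least_nat[of "%_. True" _ "%n. kdim K A M (?I n)"] by auto
  have "kdim K A M (?I (Suc m)) <= kdim K A M (?I m)"
   using kdim_mono(1)[OF M k[OF sI] k[OF sI] dec[of m 1]] by simp
  with m show ?thesis by (meson le_trans that)
 qed
 \<comment> \<open>A positive exponent, so that the kernel of \<open>f\<close> lies in the kernel of
   the \<open>p\<close>-th power.\<close>
 define p where "p = Suc n"
 have st: "?I (p + m) = ?I p" for m
  using kdim_mono[OF M k[OF sI] k[OF sI] dec[of p m]] n[of "p + m"] by (simp add: p_def)
 let ?Z = "{x : car M. F p x = 0[M]}"
 have sZ: "submodule ?Z A M" by (rule MM.lhom_kernel[OF F])
 interpret I: lmod A "restr M (?I p)" using M.sub_left[OF sI] by simp
 have inj: "x = 0[M]" if x: "x : ?I p" "F p x = 0[M]" for x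
 proof -
  have "F p ` ?I p = ?I (p + p)" unfolding image_image by (rule image_cong[OF refl], rule FF[symmetric])
  hence "F p ` ?I p = ?I p" using st[of p] by simp
  hence im: "restrict (F p) (?I p) ` car (restr M (?I p)) = ?I p" by simp
  have r: "restrict (F p) (?I p) : lhom A (restr M (?I p)) (restr M (?I p))"
   by (rule lhom_restrict[OF F sI]) (use \<open>F p ` ?I p = ?I p\<close> in simp)
  interpret V: lmod K "kmod A (restr M (?I p))" by (rule fd_kmod[OF fd_sub[OF M sI]])
  interpret VV: two_mods K "kmod A (restr M (?I p))" "kmod A (restr M (?I p))" ..
  have fl: "flen K (kmod A (restr M (?I p)))" using fd_sub[OF M sI] by (simp add: fd_def)
  let ?Y = "{x : ?I p. restrict (F p) (?I p) x = 0[M]}"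
  have sY: "submodule ?Y K (kmod A (restr M (?I p)))"
   using VV.lhom_kernel[OF kmod_lhom[OF r]] by simp
  interpret Y: lmod K "restr (kmod A (restr M (?I p))) ?Y" using V.sub_left[OF sY] by simp
  have "len K (restr (kmod A (restr M (?I p))) ?Y) = 0"
   using VV.flen_additive(2)[OF kmod_lhom[OF r] _ fl] im by simp
  hence Y0: "?Y = {0[M]}" using Y.len_eq_0D V.flen_sub(1)[OF fl sY] by simp
  have "restrict (F p) (?I p) x = 0[M]" using x by (simp only: restrict_apply' if_True)
  hence "x : ?Y" using x(1) by blast
  thus ?thesis unfolding Y0 by simp
 qed
 have "?Z \<inter> ?I p = {0[M]}" using inj subD(2)[OF sI[of p]] subD(2)[OF sZ] by blast
 moreover have "?Z <+>\<^bsub>M\<^esub> ?I p = car M"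
 proof (rule subset_antisym)
  show "?Z <+>\<^bsub>M\<^esub> ?I p <= car M" by (rule subD(1)[OF M.sub_sum[OF sZ sI]])
  show "car M <= ?Z <+>\<^bsub>M\<^esub> ?I p"
  proof
   fix x assume x: "x : car M"
   hence "F p x : ?I (p + p)" using st[of p] by simp
   then obtain y where y: "y : car M" "F p x = F (p + p) y" by blast
   hence y: "y : car M" "F p x = F p (F p y)" using FF[of y p p] by simp_all
   have c: "F p y : car M" by (rule Fcl[OF y(1)])
   have "F p (x -[M] F p y) = 0[M]"
    using x y c Fcl by (simp add: MM.lhom_minus[OF F] M.diff_zero_iff)
   hence "x -[M] F p y : ?Z" using x c by simp
   hence "(x -[M] F p y) +[M] F p y : ?Z <+>\<^bsub>M\<^esub> ?I p" using y(1) by (intro M.set_addI) auto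
   thus "x : ?Z <+>\<^bsub>M\<^esub> ?I p" using x c by simp
  qed
 qed
 ultimately have "?Z = {0[M]} | ?I p = {0[M]}" using ind sZ sI unfolding indecomposable_def by blast
 thus ?thesis
 proof
  assume z: "?Z = {0[M]}"
  have "inj_on f (car M)"
   unfolding MM.lhom_inj_iff[OF f]
  proof (intro ballI impI)
   fix x assume x: "x : car M" "f x = 0[M]"
   have "F (n + 1) x = F n (F 1 x)" using FF x(1) by blast
   hence "F p x = 0[M]" using x MM.lhom_zero[OF F] by (simp add: Fe p_def)
   thus "x = 0[M]" using z x by blast
  qed
  moreover interpret V: lmod K "kmod A M" by (rule fd_kmod[OF M])
  interpret VV: two_mods K "kmod A M" "kmod A M" ..
  have "f ` car M = car M" using VV.flen_inj(4)[OF kmod_lhom[OF f]] `inj_on f _` M by (simp add: fd_def)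
  ultimately show ?thesis by (simp add: bij_betw_def)
 next
  assume z: "?I p = {0[M]}"
  have "(f ^^ p) x = 0[M]" if x: "x : car M" for x
  proof -
   have "F p x : ?I p" using x by (rule imageI)
   thus ?thesis unfolding z Fe[OF x] by simp
  qed
  thus ?thesis by blast
 qed
qed

end

section \<open>Algebras with idempotents detecting the simple modules\<close>

lemma homk_simps [simp]:
 "car (homk A M N) = lhom A M N" "0[homk A M N] = (\<lambda>x\<in>car M. 0[N])"
 "add (homk A M N) f g = (\<lambda>x\<in>car M. f x +[N] g x)"
 "smult (homk A M N) c f = (\<lambda>x\<in>car M. (c *[A] 1[A]) *[N] f x)"
 by (simp_all add: homk_def)

lemma simple_mod_iso:
 assumes "simple_mod R M" "left_module R N" "f : lhom R M N" "bij_betw f (car M) (car N)"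
 shows "simple_mod R N"
proof -
 interpret two_mods R M N using assms by (simp add: simple_mod_def)
 have i: "inj_on f (car M)" "f ` car M = car N" using assms(4) by (auto simp: bij_betw_def)
 obtain x where x: "x : car M" "x ~= 0[M]" using assms(1) M.M.zero_closed by (auto simp: simple_mod_def)
 hence "f x ~= 0[N]" "f x : car N" using i lhom_inj_iff[OF assms(3)] by auto
 hence "car N ~= {0[N]}" by blast
 moreover have "U = {0[N]} | U = car N" if U: "submodule U R N" for U
 proof -
  let ?V = "{x : car M. f x : U}"
  have fV: "f ` ?V = U" using subD(1)[OF U] unfolding i(2)[symmetric] by auto
  have "?V = {0[M]} | ?V = car M"
   using assms(1) lhom_preimage[OF assms(3) U] by (simp add: simple_mod_def)
  thus ?thesis
  proof
   assume "?V = {0[M]}"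
   hence "U = f ` {0[M]}" using fV by simp
   thus ?thesis using lhom_zero[OF assms(3)] by simp
  next
   assume "?V = car M"
   thus ?thesis using fV i(2) by simp
  qed
 qed
 ultimately show ?thesis using assms(2) by (simp add: simple_mod_def)
qed

context fdalg
begin

lemma homk_left:
 assumes M: "left_module A M" and N: "left_module A N"
 shows "left_module K (homk A M N)"
proof -
 interpret M: lmod A M using M by simp
 interpret N: lmod A N using N by simp
 have scc: "sc c : car A" if "c : car K" for c using that by simp
 have zero: "(\<lambda>x\<in>car M. 0[N]) : lhom A M N" by (rule lhomI) auto
 have add: "(\<lambda>x\<in>car M. f x +[N] g x) : lhom A M N" if "f : lhom A M N" "g : lhom A M N" for f g
  by (rule lhomI) (auto simp: lhomD[OF that(1)] lhomD[OF that(2)] N.M.a_ac N.smult_r_distr)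
 have sm: "(\<lambda>x\<in>car M. sc c *[N] f x) : lhom A M N" if "f : lhom A M N" "c : car K" for f c
  by (rule lhomI) (use scc that(2) in \<open>auto simp: lhomD[OF that(1)] N.smult_r_distr sc_smult[OF N]\<close>)
 have neg: "(\<lambda>x\<in>car M. -[N] f x) : lhom A M N" if "f : lhom A M N" for f
  by (rule lhomI) (auto simp: lhomD[OF that] N.M.minus_add N.smult_r_minus)
 show ?thesis
 proof (rule left_moduleI)
  show "abelian_group (homk A M N)"
  proof (rule abelian_groupI)
   fix f assume f: "f : car (homk A M N)"
   hence "(\<lambda>x\<in>car M. -[N] f x) +[homk A M N] f = 0[homk A M N]"
    by (auto intro!: restrict_ext simp: N.M.l_neg lhom_mem)
   thus "EX g:car (homk A M N). g +[homk A M N] f = 0[homk A M N]"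
    by (rule bexI[where x = "\<lambda>x\<in>car M. -[N] f x"]) (use neg f in simp)
  next
   fix f assume f: "f : car (homk A M N)"
   show "0[homk A M N] +[homk A M N] f = f"
    by (rule extensionalityI[of _ "car M"]) (use f in \<open>auto simp: lhom_ext lhom_mem\<close>)
  qed (auto simp: zero add N.M.a_ac lhom_mem intro!: restrict_ext)
 next
  fix f assume f: "f : car (homk A M N)"
  show "\<one> *[homk A M N] f = f"
   by (rule extensionalityI[of _ "car M"]) (use f in \<open>auto simp: lhom_ext lhom_mem\<close>)
 qed (use scc in \<open>auto intro!: restrict_ext simp: sm add lhom_mem K.ring_axioms smult_l_distr smult_assoc1
    N.smult_l_distr N.smult_r_distr N.smult_assoc1[symmetric] sc_mult\<close>)
qed

lemma homk_restr:
 "homk A M (restr N U) = restr (homk A M N) {f : lhom A M N. f ` car M <= U}" if "U <= car N"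
proof -
 have "lhom A M (restr N U) = {f : lhom A M N. f ` car M <= U}"
  using that by (auto simp: lhom_def PiE_def Pi_def)
 thus ?thesis by (simp add: homk_def)
qed

lemma vanish_submodule:
 assumes M: "left_module A M" and N: "left_module A N" and T: "T <= car M"
 shows "submodule {f : lhom A M N. ALL x:T. f x = 0[N]} K (homk A M N)"
proof -
 interpret H: lmod K "homk A M N" using homk_left[OF M N] by simp
 interpret N: lmod A N using N by simp
 show ?thesis
 proof (rule H.submoduleI)
  show "0[homk A M N] : {f : lhom A M N. ALL x:T. f x = 0[N]}" using H.M.zero_closed subsetD[OF T] by simp
  fix f g assume "f : {f : lhom A M N. ALL x:T. f x = 0[N]}" "g : {f : lhom A M N. ALL x:T. f x = 0[N]}"
  thus "f +[homk A M N] g : {f : lhom A M N. ALL x:T. f x = 0[N]}" using H.M.a_closed[of f g] subsetD[OF T] by simp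
 next
  fix c f assume "c : car K" "f : {f : lhom A M N. ALL x:T. f x = 0[N]}"
  thus "c *[homk A M N] f : {f : lhom A M N. ALL x:T. f x = 0[N]}" using H.smult_closed[of c f] subsetD[OF T] by simp
 qed auto
qed

lemma vanish_eval:
 assumes M: "left_module A M" and N: "left_module A N" and T: "T <= car M" and t: "t : car M"
 defines "F \<equiv> {f : lhom A M N. ALL x:T. f x = 0[N]}"
 shows "(\<lambda>f\<in>F. f t) : lhom K (restr (homk A M N) F) (kmod A N)"
proof -
 note F = subD[OF vanish_submodule[OF M N T], folded F_def]
 show ?thesis by (rule lhomI) (use F(4,5) t in \<open>auto simp: F_def lhom_mem\<close>)
qed

lemma iso_wdim:
 assumes M: "fd K A M" and N: "left_module A N" and f: "f : lhom A M N" "bij_betw f (car M) (car N)"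
  and e: "e : car A" "e \<otimes>[A] e = e"
 shows "kdim K A N (wt N e (car N)) = kdim K A M (wt M e (car M))"
proof -
 note Ml = fd_left[OF M]
 interpret M: lmod A M by (rule fd_lmod[OF M])
 have i: "inj_on f (car M)" "f ` car M = car N" using f(2) by (auto simp: bij_betw_def)
 have s: "submodule (wt M e (car M)) K (kmod A M)"
  by (rule wt_sub[OF Ml kmod_sub[OF Ml M.sub_carrier] e(1)])
 show ?thesis using kdim_inj_image[OF M N f(1) i(1) s] wt_image[OF f(1) M.sub_carrier e Ml] i(2) by simp
qed

lemma simple_fd: "simple_mod A S ==> fd K A S"
 by (rule fg_imp_fd[OF simple_fin_gen])

text \<open>The terms are submodules of the fixed module \<open>M\<close>, so that induction on
  \<open>U\<close> can append \<open>U\<close> to a series of a maximal submodule of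
  \<open>U\<close>.\<close>

definition ccs :: "('a, 'm) module => 'm set => 'm set list => bool" where
 "ccs M U Ns \<longleftrightarrow> Ns ~= [] & hd Ns = {0[M]} & last Ns = U & (ALL N:set Ns. submodule N A M) &
   (ALL i. Suc i < length Ns --> Ns ! i <= Ns ! Suc i & simple_mod A (filt_factor M Ns i))"

lemma ccs_exists:
 assumes M: "fd K A M" and U: "submodule U A M"
 shows "EX Ns. ccs M U Ns"
 using U
proof (induction "kdim K A M U" arbitrary: U rule: less_induct)
 case less
 interpret M: lmod A M by (rule fd_lmod[OF M])
 show ?case
 proof (cases "U = {0[M]}")
  case True
  hence "ccs M U [{0[M]}]" by (simp add: ccs_def M.sub_zero)
  thus ?thesis by blast
 next
  case False
  have fU: "fd K A (restr M U)" by (rule fd_sub[OF M less.prems])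
  have "submodule {0[M]} A (restr M U)"
   using M.sub_zero subD(2)[OF less.prems] by (simp add: M.sub_restr_iff[OF less.prems])
  then obtain N where N: "maximal_submodule A (restr M U) N"
   using exists_maximal[OF fU, of "{0[M]}"] False by auto
  hence N': "submodule N A M" "N <= U" "N ~= U"
   by (auto simp: maximal_submodule_def M.sub_restr_iff[OF less.prems])
  have "kdim K A M N < kdim K A M U"
   using kdim_mono[OF M fd_kmod_sub[OF M N'(1)] fd_kmod_sub[OF M less.prems] N'(2)] N'(3) by linarith
  then obtain Ns where Ns: "ccs M N Ns" using less.hyps N'(1) by blast
  have s: "simple_mod A (quot (restr M U) N)" by (rule maximal_quot_simple[OF fd_left[OF fU] N])
  have ln: "Ns ~= []" "last Ns = N" "hd Ns = {0[M]}" using Ns by (auto simp: ccs_def)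
  have "(Ns @ [U]) ! i <= (Ns @ [U]) ! Suc i & simple_mod A (filt_factor M (Ns @ [U]) i)"
   if i: "Suc i < length (Ns @ [U])" for i
  proof (cases "Suc i < length Ns")
   case True
   thus ?thesis using Ns by (simp add: ccs_def filt_factor_def nth_append)
  next
   case False
   hence i': "Suc i = length Ns" using i by simp
   hence "Ns ! i = N" using ln by (metis diff_Suc_1 last_conv_nth)
   thus ?thesis using i' N'(2) s by (simp add: filt_factor_def nth_append)
  qed
  moreover have "ALL X:set (Ns @ [U]). submodule X A M" using Ns less.prems by (auto simp: ccs_def)
  ultimately have "ccs M U (Ns @ [U])" using ln by (simp add: ccs_def)
  thus ?thesis by blast
 qed
qed

lemma ccs_carrier: "ccs M (car M) Ns \<longleftrightarrow> comp_series A M Ns"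
 unfolding ccs_def comp_series_def filtration_def by blast

lemma wdim_quot:
 assumes M: "fd K A M" and N: "submodule N A M" "submodule N' A M" "N <= N'"
  and e: "e : car A" "e \<otimes>[A] e = e"
 shows "kdim K A M (wt M e N') = kdim K A M (wt M e N) +
  kdim K A (quot (restr M N') N) (wt (quot (restr M N') N) e (car (quot (restr M N') N)))"
proof -
 interpret M: lmod A M by (rule fd_lmod[OF M])
 have f': "fd K A (restr M N')" by (rule fd_sub[OF M N(2)])
 interpret N': lmod A "restr M N'" by (rule fd_lmod[OF f'])
 have s: "submodule N A (restr M N')" using N by (simp add: M.sub_restr_iff)
 have z: "{x : car (restr M N'). N'.qmap N x = 0[quot (restr M N') N]} = N"
 proof -
  have "N'.qmap N x = 0[quot (restr M N') N] \<longleftrightarrow> x : N" if "x : N'" for x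
   using N'.qmap_zero[OF s] that by simp
  thus ?thesis using N(3) by auto
 qed
 show ?thesis
  using wdim_additive[OF f' N'.quot_left[OF s] N'.qmap_lhom[OF s] N'.sub_carrier e]
  unfolding z N'.qmap_surj[OF s] by simp
qed

end

text \<open>The weight \<open>e i M\<close> of a module has dimension \<open>[M : S i]\<close>, so all multiplicities are computed as dimensions.\<close>

locale walg = fdalg K A
 for K :: "('k, 'e) ring_scheme" (structure) and A :: "('k, 'a) module" (structure) +
 fixes I :: "'i set" and e :: "'i => 'a" and S :: "'i => ('a, 's) module"
 assumes e_closed [simp, intro]: "i : I ==> e i : car A"
  and e_idem [simp]: "i : I ==> e i \<otimes>[A] e i = e i"
  and S_simple: "i : I ==> simple_mod A (S i)"
  and S_wdim: "[|i : I; j : I|] ==> kdim K A (S j) (wt (S j) (e i) (car (S j))) = (if i = j then 1 else 0)"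
  and S_complete: "simple_mod A (N :: 'a small_module) ==> EX i:I. isomorphic A N (S i)"
begin

abbreviation wd where "wd i M N \<equiv> kdim K A M (wt M (e i) N)"

text \<open>Completeness of the list \<open>S\<close> is assumed for modules on one type and is
  transported to all types by \<open>small_copy\<close>.\<close>

lemma simple_iso:
 assumes "simple_mod A N" shows "EX i:I. isomorphic A N (S i)"
proof -
 obtain N' :: "'a small_module" and f where N': "fg_module A N'" "f : lhom A N N'" "bij_betw f (car N) (car N')"
  using small_copy[OF simple_fd[OF assms]] .
 have "simple_mod A N'" by (rule simple_mod_iso[OF assms _ N'(2,3)]) (use N'(1) in \<open>simp add: fg_module_def\<close>)
 then obtain i where i: "i : I" "isomorphic A N' (S i)" using S_complete by blast
 have "isomorphic A N N'" using N' by (auto simp: isomorphic_def)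
 from isomorphic_trans[OF this i(2)] i(1) show ?thesis using assms by (auto simp: simple_mod_def)
qed

lemma iso_simple_wd:
 assumes "simple_mod A N" "isomorphic A N (S j)" "i : I" "j : I"
 shows "wd i N (car N) = (if i = j then 1 else 0)"
proof -
 obtain f where f: "f : lhom A N (S j)" "bij_betw f (car N) (car (S j))"
  using assms(2) by (auto simp: isomorphic_def)
 have "left_module A (S j)" using S_simple[OF assms(4)] by (simp add: simple_mod_def)
 from iso_wdim[OF simple_fd[OF assms(1)] this f e_closed[OF assms(3)] e_idem[OF assms(3)]]
 show ?thesis using S_wdim[OF assms(3,4)] by simp
qed

lemma wt_eq_zero_iff:
 assumes "fd K A M" "submodule N A M" "i : I"
 shows "wd i M N = 0 \<longleftrightarrow> wt M (e i) N = {0[M]}"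
 using kdim_eq_0D[OF assms(1) wt_sub[OF fd_left[OF assms(1)] fd_kmod_sub[OF assms(1,2)]]]
  kdim_zero[OF fd_left[OF assms(1)]] assms(3) by auto

lemma wt_zero_mem: assumes "left_module A M" "submodule N A M" "i : I" shows "0[M] : wt M (e i) N"
proof -
 interpret M: lmod A M using assms by simp
 show ?thesis using assms subD(2)[OF assms(2)] by (simp add: wt_def)
qed

lemma wt_e: assumes M: "left_module A M" and N: "submodule N A M" and z: "z : I" and x: "x : N"
 shows "e z *[M] x : wt M (e z) N"
proof -
 interpret M: lmod A M using M by simp
 show ?thesis using M.smult_assoc1[of "e z" "e z" x] z M.sub_mem[OF N x] subD(5)[OF N _ x] by (simp add: wt_def)
qed

lemma all_wt_zero:
 assumes M: "fd K A M" and N: "submodule N A M" and z: "!!i. i : I ==> wt M (e i) N <= {0[M]}"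
 shows "N = {0[M]}"
proof (rule ccontr)
 assume "N ~= {0[M]}"
 then obtain X where X: "submodule X A M" "X <= N" "simple_mod A (restr M X)"
  using exists_simple_submodule[OF M N] by blast
 then obtain i where i: "i : I" "isomorphic A (restr M X) (S i)" using simple_iso by blast
 have "wd i M X = 1" using iso_simple_wd[OF X(3) i(2) i(1) i(1)] by simp
 moreover have "wt M (e i) X <= {0[M]}" using z[OF i(1)] wt_mono[OF X(2), of M "e i"] by blast
 hence "wt M (e i) X = {0[M]}" using wt_zero_mem[OF fd_left[OF M] X(1) i(1)] by blast
 hence "wd i M X = 0" using wt_eq_zero_iff[OF M X(1) i(1)] by simp
 ultimately show False by simp
qed

text \<open>Apply \<open>all_wt_zero\<close> to the quotient of \<open>N'\<close> by
  \<open>N\<close>. Equality of submodules is proved in this way from now on: by weights here, by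
  multiplicities in \<open>wd_determines\<close>.\<close>

lemma wt_determines:
 assumes M: "fd K A M" and N: "submodule N A M" "submodule N' A M" "N <= N'"
  and z: "!!i. i : I ==> wt M (e i) N' <= N"
 shows "N = N'"
proof -
 interpret M: lmod A M by (rule fd_lmod[OF M])
 have f': "fd K A (restr M N')" by (rule fd_sub[OF M N(2)])
 interpret N': lmod A "restr M N'" by (rule fd_lmod[OF f'])
 have s: "submodule N A (restr M N')" using N by (simp add: M.sub_restr_iff)
 let ?Q = "quot (restr M N') N"
 have fQ: "fd K A ?Q" by (rule fd_quot[OF f' s])
 interpret Q: lmod A ?Q by (rule fd_lmod[OF fQ])
 have "car ?Q = {0[?Q]}"
 proof (rule all_wt_zero[OF fQ Q.sub_carrier])
  fix i assume i: "i : I"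
  have "wt ?Q (e i) (car ?Q) = N'.qmap N ` wt (restr M N') (e i) N'"
   using wt_image[OF N'.qmap_lhom[OF s] N'.sub_carrier _ _ N'.left, of "e i"] i
    N'.qmap_surj[OF s] by simp
  moreover have "N'.qmap N x = 0[?Q]" if "x : wt M (e i) N'" for x
   using z[OF i] that N(3) N'.qmap_zero[OF s, of x] by auto
  ultimately show "wt ?Q (e i) (car ?Q) <= {0[?Q]}" by auto
 qed
 hence "x : N" if "x : N'" for x
  using N'.qmap_zero[OF s, of x] N'.qmap_surj[OF s] that by auto
 thus ?thesis using N(3) by blast
qed

lemma wd_determines:
 assumes M: "fd K A M" and N: "submodule N A M" "submodule N' A M" "N <= N'"
  and z: "!!i. i : I ==> wd i M N' <= wd i M N"
 shows "N = N'"
proof (rule wt_determines[OF M N])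
 fix i assume i: "i : I"
 have "wt M (e i) N = wt M (e i) N'"
  using wdim_mono[OF M N e_closed[OF i]] z[OF i] by linarith
 thus "wt M (e i) N' <= N" by (auto simp: wt_def)
qed

text \<open>Each factor contributes \<open>1\<close> to the weight of exactly one index, and weights
  are additive along the series. So the count does not depend on the series, which is the part of
  the Jordan-Hoelder theorem that makes \<open>multiplicity_of\<close> well defined.\<close>

lemma comp_series_count:
 assumes M: "fd K A M" and Ns: "comp_series A M Ns" and j: "j : I"
 shows "card {i. Suc i < length Ns & isomorphic A (filt_factor M Ns i) (S j)} = wd j M (car M)"
proof -
 interpret M: lmod A M by (rule fd_lmod[OF M])
 have fil: "Ns ~= []" "hd Ns = {0[M]}" "last Ns = car M" "!!N. N : set Ns ==> submodule N A M"
  "!!i. Suc i < length Ns ==> Ns ! i <= Ns ! Suc i"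
  "!!i. Suc i < length Ns ==> simple_mod A (filt_factor M Ns i)"
  using Ns by (auto simp: comp_series_def filtration_def)
 have "wd j M (Ns ! k) = card {i. i < k & isomorphic A (filt_factor M Ns i) (S j)}" if "k < length Ns" for k
  using that
 proof (induction k)
  case 0
  have "Ns ! 0 = {0[M]}" using fil(1,2) by (simp add: hd_conv_nth)
  moreover have "wt M (e j) {0[M]} = {0[M]}" using j by (auto simp: wt_def)
  ultimately show ?case by (simp add: kdim_zero[OF M.left])
 next
  case (Suc k)
  have s: "simple_mod A (filt_factor M Ns k)" by (rule fil(6)[OF Suc.prems])
  then obtain y where y: "y : I" "isomorphic A (filt_factor M Ns k) (S y)" using simple_iso by blast
  have iso: "isomorphic A (filt_factor M Ns k) (S j) \<longleftrightarrow> y = j"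
   using iso_simple_wd[OF s y(2) y(1) y(1)] iso_simple_wd[OF s _ y(1) j] y(2) by (auto split: if_splits)
  have "wd j M (Ns ! Suc k) = wd j M (Ns ! k) + wd j (filt_factor M Ns k) (car (filt_factor M Ns k))"
   unfolding filt_factor_def using Suc.prems fil(4,5) j by (intro wdim_quot[OF M]) auto
  also have "... = card {i. i < k & isomorphic A (filt_factor M Ns i) (S j)} + (if y = j then 1 else 0)"
   using Suc iso_simple_wd[OF s y(2) j y(1)] by auto
  also have "... = card {i. i < Suc k & isomorphic A (filt_factor M Ns i) (S j)}"
  proof (cases "y = j")
   case True
   hence "{i. i < Suc k & isomorphic A (filt_factor M Ns i) (S j)} =
    insert k {i. i < k & isomorphic A (filt_factor M Ns i) (S j)}" using iso less_Suc_eq by auto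
   thus ?thesis using True by simp
  next
   case False
   hence "{i. i < Suc k & isomorphic A (filt_factor M Ns i) (S j)} =
    {i. i < k & isomorphic A (filt_factor M Ns i) (S j)}" using iso less_Suc_eq by auto
   thus ?thesis using False by simp
  qed
  finally show ?case .
 qed
 from this[of "length Ns - 1"] fil(1,3) show ?thesis
  by (simp add: last_conv_nth less_diff_conv)
qed

lemma multiplicity_eq_wd:
 assumes M: "fd K A M" and j: "j : I"
 shows "multiplicity_of A M (S j) = wd j M (car M)"
proof -
 interpret M: lmod A M by (rule fd_lmod[OF M])
 obtain Ns where "comp_series A M Ns" using ccs_exists[OF M M.sub_carrier] ccs_carrier by blast
 thus ?thesis unfolding multiplicity_of_def using comp_series_count[OF M _ j]
  by (intro the_equality) auto
qed

text \<open>Turns the conditions on composition factors in \<open>standard\<close> and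
  \<open>costandard\<close> into the vanishing of weights.\<close>

lemma comp_factors_among_iff:
 assumes M: "fd K A M" and J: "J <= I"
 shows "comp_factors_among A S J M \<longleftrightarrow> (ALL i:I - J. wt M (e i) (car M) = {0[M]})"
proof -
 interpret M: lmod A M by (rule fd_lmod[OF M])
 note z = wt_eq_zero_iff[OF M M.sub_carrier]
 show ?thesis
 proof
  assume "comp_factors_among A S J M"
  then obtain Ns where Ns: "comp_series A M Ns"
   "!!i. Suc i < length Ns ==> EX j:J. isomorphic A (filt_factor M Ns i) (S j)"
   by (auto simp: comp_factors_among_def)
  show "ALL i:I - J. wt M (e i) (car M) = {0[M]}"
  proof
   fix i assume i: "i : I - J"
   have "~ isomorphic A (filt_factor M Ns k) (S i)" if k: "Suc k < length Ns" for k
   proof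
    assume iso: "isomorphic A (filt_factor M Ns k) (S i)"
    have s: "simple_mod A (filt_factor M Ns k)" using Ns(1) k by (simp add: comp_series_def)
    obtain j where j: "j : J" "isomorphic A (filt_factor M Ns k) (S j)" using Ns(2)[OF k] by blast
    have "i = j" using iso_simple_wd[OF s iso, of i] iso_simple_wd[OF s j(2), of i] i j(1) J
     by (auto split: if_splits)
    thus False using i j by blast
   qed
   hence "{k. Suc k < length Ns & isomorphic A (filt_factor M Ns k) (S i)} = {}" by blast
   hence "wd i M (car M) = 0" using comp_series_count[OF M Ns(1), of i] i by (metis DiffD1 card.empty)
   thus "wt M (e i) (car M) = {0[M]}" using z i by blast
  qed
 next
  assume a: "ALL i:I - J. wt M (e i) (car M) = {0[M]}"
  obtain Ns where Ns: "comp_series A M Ns" using ccs_exists[OF M M.sub_carrier] ccs_carrier by blast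
  have "EX j:J. isomorphic A (filt_factor M Ns k) (S j)" if k: "Suc k < length Ns" for k
  proof -
   have s: "simple_mod A (filt_factor M Ns k)" using Ns k by (simp add: comp_series_def)
   then obtain j where j: "j : I" "isomorphic A (filt_factor M Ns k) (S j)" using simple_iso by blast
   have "finite {i. Suc i < length Ns & isomorphic A (filt_factor M Ns i) (S j)}"
    by (rule finite_subset[of _ "{..<length Ns}"]) auto
   hence "wd j M (car M) ~= 0" using comp_series_count[OF M Ns j(1)] k j(2) by (metis (mono_tags, lifting) card_0_eq empty_iff mem_Collect_eq)
   hence "j : J" using a z[OF j(1)] j(1) by auto
   thus ?thesis using j(2) by blast
  qed
  thus "comp_factors_among A S J M" using Ns unfolding comp_factors_among_def by blast
 qed
qed

lemma span_weights:
 assumes M: "fd K A M" and N: "submodule N A M"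
 shows "span_in A M (\<Union>i\<in>I. wt M (e i) N) = N"
proof -
 interpret M: lmod A M by (rule fd_lmod[OF M])
 have sub: "(\<Union>i\<in>I. wt M (e i) N) <= N" by (auto simp: wt_def)
 hence c: "(\<Union>i\<in>I. wt M (e i) N) <= car M" using subD(1)[OF N] by blast
 show ?thesis
 proof (rule wt_determines[OF M M.span_sub[OF c] N M.span_least[OF N sub]])
  fix i assume "i : I"
  hence "wt M (e i) N <= (\<Union>i\<in>I. wt M (e i) N)" by (rule UN_upper)
  thus "wt M (e i) N <= span_in A M (\<Union>i\<in>I. wt M (e i) N)" using M.span_superset by (rule subset_trans)
 qed
qed

section \<open>Homomorphisms into an injective hull\<close>

text \<open>The image \<open>Z\<close> of the simple module is simple and essential, hence contained
  in every nonzero submodule. In this form the socle of a hull is used later.\<close>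

lemma hull_facts:
 assumes Q: "injective_hull A Q (S k)" and k: "k : I"
 obtains Z where "fd K A Q" "injective A Q" "submodule Z A Q" "simple_mod A (restr Q Z)"
  "wd k Q Z = 1" "!!U. [|submodule U A Q; U ~= {0[Q]}|] ==> Z <= U"
  "!!i. [|i : I; i ~= k|] ==> wd i Q Z = 0" "isomorphic A (S k) (restr Q Z)"
proof -
 from Q obtain f where f: "injective A Q" "f : lhom A (S k) Q" "inj_on f (car (S k))"
  "!!U. [|submodule U A Q; U \<inter> f ` car (S k) = {0[Q]}|] ==> U = {0[Q]}"
  by (auto simp: injective_hull_def)
 have fQ: "fd K A Q" using f(1) by (simp add: injective_def fg_imp_fd)
 interpret Q: lmod A Q by (rule fd_lmod[OF fQ])
 have fS: "fd K A (S k)" by (rule simple_fd[OF S_simple[OF k]])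
 interpret S: lmod A "S k" by (rule fd_lmod[OF fS])
 interpret SQ: two_mods A "S k" Q ..
 let ?Z = "f ` car (S k)"
 have Z: "submodule ?Z A Q" by (rule SQ.lhom_image[OF f(2) S.sub_carrier])
 have fZ: "f : lhom A (S k) (restr Q ?Z)" by (rule lhom_image_target[OF f(2)]) simp
 have bZ: "bij_betw f (car (S k)) (car (restr Q ?Z))" using f(3) by (simp add: bij_betw_def)
 have lZ: "left_module A (restr Q ?Z)" by (rule Q.sub_left[OF Z])
 have sZ: "simple_mod A (restr Q ?Z)" by (rule simple_mod_iso[OF S_simple[OF k] lZ fZ bZ])
 have w: "wd i Q ?Z = (if i = k then 1 else 0)" if "i : I" for i
  using iso_wdim[OF fS lZ fZ bZ, of "e i"] that k S_wdim by simp
 have ess: "?Z <= U" if U: "submodule U A Q" "U ~= {0[Q]}" for U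
 proof -
  have "U \<inter> ?Z ~= {0[Q]}" using f(4) U by blast
  moreover have "submodule (U \<inter> ?Z) A (restr Q ?Z)"
   using Q.sub_Int[OF U(1) Z] by (simp add: Q.sub_restr_iff[OF Z])
  hence "U \<inter> ?Z = {0[Q]} | U \<inter> ?Z = ?Z" using sZ unfolding simple_mod_def by simp
  ultimately have "U \<inter> ?Z = ?Z" by simp
  thus ?thesis by blast
 qed
 show ?thesis
  by (rule that[OF fQ f(1) Z sZ _ ess]) (use w k fZ bZ in \<open>auto simp: isomorphic_def\<close>)
qed

text \<open>Maps that vanish on \<open>N\<close> are maps from \<open>M/N\<close> to the hull, and
  by exactness of \<open>Hom(-, Q)\<close> their space has dimension \<open>[M/N : S k]\<close>. The
  induction starts at \<open>N = M\<close> and passes from a minimal larger submodule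
  \<open>N'\<close> to \<open>N\<close>.\<close>

lemma hom_vanish_dim:
 assumes Q: "injective_hull A Q (S k)" and k: "k : I" and M: "fd K A M" and N: "submodule N A M"
 defines "F \<equiv> %N. {f : lhom A M Q. ALL x:N. f x = 0[Q]}"
 shows "flen K (restr (homk A M Q) (F N)) & len K (restr (homk A M Q) (F N)) + wd k M N = wd k M (car M)"
proof -
 obtain Z where Z: "fd K A Q" "injective A Q" "submodule Z A Q" "simple_mod A (restr Q Z)" "wd k Q Z = 1"
  "!!U. [|submodule U A Q; U ~= {0[Q]}|] ==> Z <= U" "!!i. [|i : I; i ~= k|] ==> wd i Q Z = 0"
  using hull_facts[OF Q k] by metis
 interpret M: lmod A M by (rule fd_lmod[OF M])
 interpret Q: lmod A Q by (rule fd_lmod[OF Z(1)])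
 interpret MQ: two_mods A M Q ..
 interpret H: lmod K "homk A M Q"
  using homk_left[OF M.left Q.left] by simp
 have F: "submodule (F N) K (homk A M Q)" if N: "submodule N A M" for N
  unfolding F_def by (rule vanish_submodule[OF M.left Q.left subD(1)[OF N]])
 show ?thesis using N
 proof (induction "kdim K A M (car M) - kdim K A M N" arbitrary: N rule: less_induct)
  case less
  note N = `submodule N A M`
  have NM: "N <= car M" by (rule subD(1)[OF N])
  show ?case
  proof (cases "N = car M")
   case True
   have "F N = {0[homk A M Q]}"
    using subD(2)[OF F[OF N]] True
    by (auto simp: F_def lhom_ext intro!: extensionalityI[of _ "car M"])
   interpret Y: lmod K "restr (homk A M Q) (F N)" using H.sub_left[OF F[OF N]] by simp
   have "car (restr (homk A M Q) (F N)) = {0[restr (homk A M Q) (F N)]}"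
    using `F N = {0[homk A M Q]}` by simp
   from Y.len_trivial[OF this] show ?thesis using True by simp
  next
   case False
   obtain N' where N': "submodule N' A M" "N <= N'" "N' ~= N"
    "!!X. [|submodule X A M; N <= X; X ~= N; X <= N'|] ==> X = N'"
    using exists_minimal_submodule[OF M M.sub_carrier, of "%X. N <= X & X ~= N"] NM False by metis
   have lt: "kdim K A M N < kdim K A M N'"
    using kdim_mono[OF M fd_kmod_sub[OF M N] fd_kmod_sub[OF M N'(1)] N'(2)] N'(3)[symmetric] by linarith
   moreover have "kdim K A M N' <= kdim K A M (car M)"
    using kdim_mono(1)[OF M fd_kmod_sub[OF M N'(1)] fd_kmod_sub[OF M M.sub_carrier]]
     subD(1)[OF N'(1)] by blast
   ultimately have IH: "flen K (restr (homk A M Q) (F N'))"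
    "len K (restr (homk A M Q) (F N')) + wd k M N' = wd k M (car M)"
    using less.hyps[OF _ N'(1)] by auto
   have gen: "N' <= N <+>\<^bsub>M\<^esub> M.cyc n" if n: "n : N'" "n ~: N" for n
   proof -
    have nc: "n : car M" by (rule M.sub_mem[OF N'(1) n(1)])
    note c = M.cyc_sub[OF nc]
    have "N <+>\<^bsub>M\<^esub> M.cyc n ~= N"
     using M.sum_upper2[OF N c] M.cyc_self[OF nc] n(2) by blast
    thus ?thesis
     using N'(4)[OF M.sub_sum[OF N c] M.sum_upper1[OF N c]]
      M.sum_least[OF N'(1,2) M.cyc_least[OF N'(1) n(1)]] by blast
   qed
   have van: "f : F N'" if f: "f : F N" "n : N'" "n ~: N" "f n = 0[Q]" for f n
   proof -
    have fl: "f : lhom A M Q" using f(1) by (simp add: F_def)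
    have ker: "submodule {x : car M. f x = 0[Q]} A M" by (rule MQ.lhom_kernel[OF fl])
    have nc: "n : car M" by (rule M.sub_mem[OF N'(1) f(2)])
    have "N <= {x : car M. f x = 0[Q]}" using f(1) NM by (auto simp: F_def)
    moreover have "M.cyc n <= {x : car M. f x = 0[Q]}" by (rule M.cyc_least[OF ker]) (use f nc in simp)
    ultimately have "N' <= {x : car M. f x = 0[Q]}" using gen[OF f(2,3)] M.sum_least[OF ker] by blast
    thus ?thesis using fl by (auto simp: F_def)
   qed
   have FF: "F N' <= F N" using N'(2) by (auto simp: F_def)
   have fN': "fd K A (restr M N')" by (rule fd_sub[OF M N'(1)])
   interpret N': lmod A "restr M N'" by (rule fd_lmod[OF fN'])
   have sN: "submodule N A (restr M N')" using N N'(2) by (simp add: M.sub_restr_iff[OF N'(1)])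
   let ?G = "quot (restr M N') N"
   have "maximal_submodule A (restr M N') N"
    unfolding maximal_submodule_def M.sub_restr_iff[OF N'(1)] using N N' by auto
   from maximal_quot_simple[OF N'.left this] have sG: "simple_mod A ?G" .
   then obtain y where y: "y : I" "isomorphic A ?G (S y)" using simple_iso by blast
   interpret G: lmod A ?G using N'.quot_left[OF sN] by simp
   interpret N'G: two_mods A "restr M N'" ?G ..
    have wdN': "wd i M N' = wd i M N + (if i = y then 1 else 0)" if "i : I" for i
    using wdim_quot[OF M N N'(1,2) e_closed[OF that] e_idem[OF that]] iso_simple_wd[OF sG y(2) that y(1)] by simp
   \<comment> \<open>As \<open>N'/N\<close> is simple, a map \<open>f\<close> that vanishes on
     \<open>N\<close> sends \<open>N'\<close> into the simple socle \<open>Z\<close>. If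
     \<open>f\<close> is not zero on \<open>N'\<close>, the weight \<open>k\<close> of
     \<open>N'/N\<close> cannot vanish.\<close>
   have im: "f ` N' <= Z & (f ~: F N' --> y = k)" if f: "f : F N" for f
   proof (cases "f : F N'")
    case True
    thus ?thesis using subD(2)[OF Z(3)] by (auto simp: F_def)
   next
    case False
    have fl: "f : lhom A M Q" using f by (simp add: F_def)
    obtain x where "x : N'" "f x ~= 0[Q]" using False fl by (auto simp: F_def)
    hence ZF: "Z <= f ` N'" by (intro Z(6)[OF MQ.lhom_image[OF fl N'(1)]]) blast
    have "wt Q (e k) Z ~= {0[Q]}" using wt_eq_zero_iff[OF Z(1,3) k] Z(5) by simp
    then obtain z where z: "z : Z" "e k *[Q] z = z" "z ~= 0[Q]"
     using wt_zero_mem[OF Q.left Z(3) k] by (auto simp: wt_def)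
    obtain u where u: "u : N'" "z = f u" using ZF z(1) by blast
    have uc: "u : car M" by (rule M.sub_mem[OF N'(1) u(1)])
    let ?X = "N' \<inter> {x : car M. f x : Z}"
    have X: "submodule ?X A M" by (rule M.sub_Int[OF N'(1) MQ.lhom_preimage[OF fl Z(3)]])
    have NX: "N <= ?X" using N'(2) NM f subD(2)[OF Z(3)] by (auto simp: F_def)
    have "u ~: N" using u z(3) f by (auto simp: F_def)
    moreover have "u : ?X" using u uc z(1) by simp
    ultimately have "?X ~= N" by blast
    hence "?X = N'" using N'(4)[OF X NX] by blast
    hence "f ` N' <= Z" by blast
    moreover have "y = k"
    proof (rule ccontr)
     assume "y ~= k"
     hence "wt M (e k) N = wt M (e k) N'" using wdN'[OF k] by (intro wdim_mono(2)[OF M N N'(1,2) e_closed[OF k]]) simp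
     hence "e k *[M] u : wt M (e k) N" using wt_e[OF M.left N'(1) k u(1)] by simp
     hence "f (e k *[M] u) = 0[Q]" using f by (simp add: F_def wt_def)
     thus False using lhom_smult[OF fl e_closed[OF k] uc] u(2) z by simp
    qed
    ultimately show ?thesis by (intro conjI impI)
   qed
   show ?thesis
   proof (cases "y = k")
    case False
    hence "F N = F N'" using im FF by blast
    thus ?thesis using IH wdN'[OF k] False by simp
   next
    case True
    hence wN': "wd k M N' = wd k M N + 1" using wdN'[OF k] by simp
    have "~ wt M (e k) N' <= N"
    proof
     assume "wt M (e k) N' <= N"
     hence "wt M (e k) N' = wt M (e k) N" using N'(2) by (auto simp: wt_def)
     thus False using wN' by simp
    qed
    \<comment> \<open>The vector \<open>n\<close> generates \<open>N'\<close> modulo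
      \<open>N\<close>, so evaluation at \<open>n\<close> has kernel \<open>F N'\<close>. Its values
      lie in the line \<open>e k Z\<close>, and injectivity of \<open>Q\<close> provides a nonzero
      value.\<close>
    then obtain n where n: "n : N'" "n ~: N" "e k *[M] n = n" by (auto simp: wt_def)
    have nc: "n : car M" by (rule M.sub_mem[OF N'(1) n(1)])
    have wZ: "submodule (wt Q (e k) Z) K (kmod A Q)"
     by (rule wt_sub[OF Q.left fd_kmod_sub[OF Z(1,3)] e_closed[OF k]])
    interpret kQ: lmod K "kmod A Q" by (rule fd_kmod[OF Z(1)])
    interpret W: lmod K "restr (kmod A Q) (wt Q (e k) Z)" using kQ.sub_left[OF wZ] by simp
    interpret FN: lmod K "restr (homk A M Q) (F N)" using H.sub_left[OF F[OF N]] by simp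
    interpret FW: two_mods K "restr (homk A M Q) (F N)" "restr (kmod A Q) (wt Q (e k) Z)" ..
    let ?X = "restr (homk A M Q) (F N)" and ?Y = "restr (kmod A Q) (wt Q (e k) Z)"
    let ?ev = "\<lambda>f\<in>F N. f n"
    have "?ev f : wt Q (e k) Z" if f: "f : F N" for f
     using im[OF f] n lhom_smult[of f A M Q "e k" n] nc k f by (auto simp: wt_def F_def)
    hence ev: "?ev : lhom K (?X) (?Y)"
     unfolding F_def by (intro lhom_image_target[OF vanish_eval[OF M.left Q.left NM nc]]) auto
    have fW: "flen K (?Y)" "len K (?Y) = 1"
     using kQ.flen_sub(1)[OF _ wZ] Z(1,5) by (simp_all add: fd_def kdim_def)
    have ker: "{f : F N. ?ev f = 0[?Y]} = F N'"
     using van[OF _ n(1,2)] FF n(1) by (auto simp: F_def)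
    have "EX f:F N. f n ~= 0[Q]"
    proof -
     obtain i0 where i0: "i0 : lhom A ?G (S y)" "bij_betw i0 (car ?G) (car (S y))"
      using y(2) by (auto simp: isomorphic_def)
     obtain s0 where s0: "s0 : lhom A (S k) Q" "inj_on s0 (car (S k))"
      using Q by (auto simp: injective_hull_def)
     interpret Sk: lmod A "S k" using S_simple[OF k] by (simp add: simple_mod_def)
     interpret GS: two_mods A ?G "S k" ..
     interpret SQ: two_mods A "S k" Q ..
     let ?h = "compose N' s0 (compose N' i0 (N'.qmap N))"
     have i0': "i0 : lhom A ?G (S k)" "inj_on i0 (car ?G)" using i0 True by (auto simp: bij_betw_def)
     have h: "?h : lhom A (restr M N') Q"
      using lhom_comp[OF lhom_comp[OF N'.qmap_lhom[OF sN] i0'(1) N'.left] s0(1) N'.left] by simp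
     obtain f where f: "f : lhom A M Q" "!!x. x : N' ==> f x = ?h x"
      using injective_extend[OF Z(2) M N'(1) h] by blast
     have q: "N'.qmap N x : car ?G" if "x : N'" for x using N'.qmap_surj[OF sN] that by auto
     have hx: "?h x = 0[Q] \<longleftrightarrow> x : N" if x: "x : N'" for x
     proof -
      have "?h x = 0[Q] \<longleftrightarrow> i0 (N'.qmap N x) = 0[S k]"
       using x s0(2) lhom_mem[OF i0'(1) q[OF x]] SQ.lhom_zero[OF s0(1)]
       unfolding SQ.lhom_inj_iff[OF s0(1)] by (auto simp: compose_def)
      also have "... \<longleftrightarrow> N'.qmap N x = 0[?G]"
       using i0'(2) q[OF x] GS.lhom_zero[OF i0'(1)] unfolding GS.lhom_inj_iff[OF i0'(1)] by auto
      finally show ?thesis using N'.qmap_zero[OF sN] x by simp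
     qed
     have "f : F N" using f hx N'(2) by (auto simp: F_def)
     moreover have "f n ~= 0[Q]" using f hx n by simp
     ultimately show ?thesis by blast
    qed
    then obtain f where f: "f : F N" "f n ~= 0[Q]" by blast
    have "submodule (?ev ` F N) K (?Y)"
     using FW.lhom_image[OF ev FN.sub_carrier] by simp
    hence "?ev ` F N = {0[Q]} | ?ev ` F N = wt Q (e k) Z"
     using W.simple_if_len_1[OF fW] by simp
    moreover have "?ev f : ?ev ` F N" using f(1) by (rule imageI)
    hence "?ev ` F N ~= {0[Q]}" using f by auto
    ultimately have surj: "?ev ` car (?X) = car (?Y)" by simp
    have "flen K (?X)"
     using FW.flen_additive(1)[OF ev surj] fW(1) IH(1) ker by simp
    moreover from FW.flen_additive(2)[OF ev surj this]
    have "len K (?X) = len K (restr (homk A M Q) (F N')) + 1" using ker fW(2) by simp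
    ultimately show ?thesis using IH(2) wN' by simp
   qed
  qed
 qed
qed

end

section \<open>Endomorphism algebras\<close>

lemma restr_carrier: "restr M (car M) = M"
 by (cases M) simp

lemma flen_transfer:
 assumes V: "left_module K V" and W: "left_module K W"
  and f: "f : lhom K V W" "bij_betw f (car V) (car W)"
 shows "flen K V \<longleftrightarrow> flen K W" "flen K W ==> len K V = len K W"
proof -
 interpret two_mods K V W using V W by simp
 have i: "inj_on f (car V)" "f ` car V = car W" using f(2) by (auto simp: bij_betw_def)
 show "flen K V \<longleftrightarrow> flen K W" using flen_inj(1)[OF f(1) i(1)] flen_additive(1)[OF f(1) i(2)] by blast
 show "flen K W ==> len K V = len K W" using flen_inj(3)[OF f(1) i(1) _ i(2)] .
qed

lemma flen_transferI:
 assumes V: "left_module K V" and W: "left_module K W" "flen K W" and b: "bij_betw F (car V) (car W)"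
  and F: "!!x y. [|x : car V; y : car V|] ==> F (x +[V] y) = F x +[W] F y"
   "!!c x. [|c : car K; x : car V|] ==> F (c *[V] x) = c *[W] F x"
 shows "len K V = len K W"
proof -
 interpret V: lmod K V using V by simp
 have "restrict F (car V) : lhom K V W"
  by (rule lhomI) (use F bij_betwE[OF b] in auto)
 moreover have "bij_betw (restrict F (car V)) (car V) (car W)"
  using b by (subst bij_betw_cong[of _ _ F]) simp_all
 ultimately show ?thesis using flen_transfer(2)[OF V W(1) _ _ W(2)] by blast
qed

context fdalg
begin

lemma endo_inj_iff_surj:
 assumes M: "fd K A M" and f: "f : lhom A M M"
 shows "inj_on f (car M) \<longleftrightarrow> f ` car M = car M"
proof -
 interpret V: lmod K "kmod A M" by (rule fd_kmod[OF M])
 interpret VV: two_mods K "kmod A M" "kmod A M" ..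
 note fk = kmod_lhom[OF f]
 have fl: "flen K (kmod A M)" using M by (simp add: fd_def)
 show ?thesis
 proof
  assume "inj_on f (car M)"
  thus "f ` car M = car M" using VV.flen_inj(4)[OF fk _ fl] by simp
 next
  assume a: "f ` car M = car M"
  let ?Z = "{x : car (kmod A M). f x = 0[kmod A M]}"
  have Z: "submodule ?Z K (kmod A M)" by (rule VV.lhom_kernel[OF fk])
  interpret Z: lmod K "restr (kmod A M) ?Z" using V.sub_left[OF Z] by simp
  have "len K (restr (kmod A M) ?Z) = 0" using VV.flen_additive(2)[OF fk _ fl] a by simp
  hence "?Z = {0[M]}" using Z.len_eq_0D V.flen_sub(1)[OF fl Z] by simp
  thus "inj_on f (car M)" using VV.lhom_inj_iff[OF fk] by auto
 qed
qed

text \<open>For a module generated by \<open>t\<close> a homomorphism is determined by its value at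
  \<open>t\<close>, and \<open>W\<close> is the space of possible values. Used for projective
  modules and for the \<open>P_k/Rad^l P_k\<close>.\<close>

lemma homk_eval_len:
 assumes M: "left_module A M" and N: "fd K A N" and t: "t : car M" and W: "submodule W K (kmod A N)"
  and inj: "!!f g. [|f : lhom A M N; g : lhom A M N; f t = g t|] ==> f = g" and im: "(%f. f t) ` lhom A M N = W"
 shows "len K (homk A M N) = kdim K A N W"
proof -
 interpret N: lmod K "kmod A N" by (rule fd_kmod[OF N])
 have fW: "flen K (restr (kmod A N) W)" using N.flen_sub(1)[OF _ W] N by (simp add: fd_def)
 show ?thesis
  unfolding kdim_def
 proof (rule flen_transferI[OF homk_left[OF M fd_left[OF N]] N.sub_left[OF W] fW, where F = "%f. f t"])
  have "inj_on (%f. f t) (lhom A M N)" by (rule inj_onI) (rule inj)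
  thus "bij_betw (%f. f t) (car (homk A M N)) (car (restr (kmod A N) W))" using im by (simp add: bij_betw_def)
 qed (use t in simp_all)
qed

text \<open>A homomorphism that vanishes on all generators is zero. Dropping the condition at one
  generator enlarges the space by a subspace of \<open>N\<close>, through evaluation at that
  generator.\<close>

lemma homk_flen:
 assumes M: "fd K A M" and N: "fd K A N"
 shows "flen K (homk A M N)"
proof -
 interpret M: lmod A M by (rule fd_lmod[OF M])
 interpret N: lmod A N by (rule fd_lmod[OF N])
 interpret MN: two_mods A M N ..
 interpret H: lmod K "homk A M N"
  using homk_left[OF M.left N.left] by simp
 interpret kN: lmod K "kmod A N" by (rule fd_kmod[OF N])
 define F where "F T = {f : lhom A M N. ALL x:T. f x = 0[N]}" for T
 have F: "submodule (F T) K (homk A M N)" if T: "T <= car M" for T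
  unfolding F_def by (rule vanish_submodule[OF M.left N.left T])
 obtain G where G: "finite G" "G <= car M" "span_in A M G = car M"
  using fd_imp_fg[OF M] by (auto simp: fg_module_def fin_gen_def)
 have "F G <= {0[homk A M N]}"
 proof
  fix f assume f: "f : F G"
  hence fl: "f : lhom A M N" by (simp add: F_def)
  have "G <= {x : car M. f x = 0[N]}" using f G(2) by (auto simp: F_def)
  from M.span_least[OF MN.lhom_kernel[OF fl] this]
  have "car M <= {x : car M. f x = 0[N]}" by (simp only: G(3))
  hence "f = 0[homk A M N]" by (intro extensionalityI[of _ "car M"]) (use fl lhom_ext in auto)
  thus "f : {0[homk A M N]}" by simp
 qed
 hence FG0: "F G = {0[homk A M N]}" using subD(2)[OF F[OF G(2)]] by blast
 have FG: "flen K (restr (homk A M N) (F G))"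
 proof -
  interpret Z: lmod K "restr (homk A M N) (F G)" using H.sub_left[OF F[OF G(2)]] by simp
  show ?thesis by (rule Z.len_trivial(1)) (simp add: FG0)
 qed
 have step: "flen K (restr (homk A M N) (F T))"
  if T: "insert t T <= car M" and fl: "flen K (restr (homk A M N) (F (insert t T)))" for t T
 proof -
  have T': "T <= car M" "t : car M" using T by auto
  interpret FT: lmod K "restr (homk A M N) (F T)" using H.sub_left[OF F[OF T'(1)]] by simp
  interpret FN: two_mods K "restr (homk A M N) (F T)" "kmod A N" ..
  let ?ev = "\<lambda>f\<in>F T. f t"
  have ev: "?ev : lhom K (restr (homk A M N) (F T)) (kmod A N)"
   unfolding F_def by (rule vanish_eval[OF M.left N.left T'])
  let ?B = "?ev ` F T"
  have B: "submodule ?B K (kmod A N)" using FN.lhom_image[OF ev FT.sub_carrier] by simp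
  have evB: "?ev : lhom K (restr (homk A M N) (F T)) (restr (kmod A N) ?B)" by (rule lhom_image_target[OF ev]) simp
  interpret B: lmod K "restr (kmod A N) ?B" using kN.sub_left[OF B] by simp
  interpret FB: two_mods K "restr (homk A M N) (F T)" "restr (kmod A N) ?B" ..
  have ker: "{f : F T. ?ev f = 0[N]} = F (insert t T)" by (auto simp: F_def)
  have "flen K (restr (kmod A N) ?B)" using kN.flen_sub(1)[OF _ B] N by (simp add: fd_def)
  thus ?thesis using FB.flen_additive(1)[OF evB] fl ker by simp
 qed
 have "flen K (restr (homk A M N) (F T0))" if "finite T" "flen K (restr (homk A M N) (F (T \<union> T0)))" "T \<union> T0 <= car M" for T T0
  using that
 proof (induction T arbitrary: T0)
  case (insert t T)
  have "flen K (restr (homk A M N) (F (T \<union> T0)))" using step[of t "T \<union> T0"] insert.prems by simp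
  thus ?case using insert by simp
 qed simp
 from this[of G "{}"] FG G have "flen K (restr (homk A M N) (F {}))" by simp
 moreover have "F {} = car (homk A M N)" by (simp add: F_def)
 ultimately show ?thesis by (simp only: restr_carrier)
qed

end

section \<open>Endomorphism algebras of sums of indecomposable modules\<close>

text \<open>\<open>V_split\<close> says that the endomorphism ring of \<open>V x\<close>, which is
  local by Fitting's lemma, has residue field \<open>K\<close>. The locale is instantiated three
  times: with the summands of the ADR generator, of the generator of \<open>S_A\<close> and of the
  tilting module.\<close>

locale summands = fdalg K A
 for K :: "('k, 'e) ring_scheme" (structure) and A :: "('k, 'a) module" (structure) +
 fixes I :: "'x set" and V :: "'x => ('a, 'v) module"
 assumes finite_index: "finite I"
  and V_fd: "x : I ==> fd K A (V x)"
  and V_indec: "x : I ==> indecomposable A (V x)"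
  and V_noniso: "[|x : I; y : I; isomorphic A (V x) (V y)|] ==> x = y"
  and V_split: "[|x : I; f : lhom A (V x) (V x)|] ==> EX c:car K.
   ~ bij_betw (\<lambda>v\<in>car (V x). f v -[V x] (c *[A] 1[A]) *[V x] v) (car (V x)) (car (V x))"
begin

abbreviation G where "G \<equiv> dsum I V"
abbreviation E where "E \<equiv> op_alg (end_alg A G)"
abbreviation HG where "HG \<equiv> hom_mod A G"

lemma V_lmod: "x : I ==> lmod A (V x)" by (rule fd_lmod[OF V_fd])
lemma V_left: "x : I ==> left_module A (V x)" by (rule fd_left[OF V_fd])

lemma G_simps:
 "0[G] = (\<lambda>i\<in>I. 0[V i])" "u +[G] w = (\<lambda>i\<in>I. u i +[V i] w i)" "a *[G] u = (\<lambda>i\<in>I. a *[V i] u i)"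
 by (simp_all add: dsum_def)

lemma G_iff: "u : car G \<longleftrightarrow> u : extensional I & (ALL x:I. u x : car (V x))"
 by (auto simp: dsum_def PiE_def Pi_def)

lemma G_eqI: "[|u : car G; w : car G; !!x. x : I ==> u x = w x|] ==> u = w"
 by (rule extensionalityI[of _ I]) (auto simp: G_iff)

lemma V_closed:
 assumes "x : I"
 shows "0[V x] : car (V x)"
  "!!v w. [|v : car (V x); w : car (V x)|] ==> v +[V x] w : car (V x)"
  "!!a v. [|a : car A; v : car (V x)|] ==> a *[V x] v : car (V x)"
proof -
 interpret lmod A "V x" by (rule V_lmod[OF assms])
 show "0[V x] : car (V x)"
  "!!v w. [|v : car (V x); w : car (V x)|] ==> v +[V x] w : car (V x)"
  "!!a v. [|a : car A; v : car (V x)|] ==> a *[V x] v : car (V x)" by auto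
qed

lemma G_left: "left_module A G"
proof -
 note V = left_module.smult_l_distr[OF V_left] left_module.smult_r_distr[OF V_left]
  left_module.smult_assoc1[OF V_left] left_module.smult_one[OF V_left]
 have ab: "abelian_group (V x)" if "x : I" for x using V_left[OF that] by (simp add: left_module_def)
 show ?thesis
 proof (rule left_moduleI)
  show "abelian_group G"
  proof (rule abelian_groupI)
   fix u v w assume "u : car G" "v : car G" "w : car G"
   thus "u +[G] v +[G] w = u +[G] (v +[G] w)"
    using abelian_monoid.a_assoc[OF abelian_group.axioms(1)[OF ab]]
    by (auto simp: G_iff G_simps intro!: restrict_ext)
  next
   fix u v assume "u : car G" "v : car G"
   thus "u +[G] v = v +[G] u"
    using abelian_monoid.a_comm[OF abelian_group.axioms(1)[OF ab]]
    by (auto simp: G_iff G_simps intro!: restrict_ext)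
  next
   fix u assume u: "u : car G"
   let ?w = "\<lambda>i\<in>I. -[V i] u i"
   have "?w : car G" using u abelian_group.a_inv_closed[OF ab] by (simp add: G_iff)
   moreover have "?w +[G] u = 0[G]"
    using u abelian_group.l_neg[OF ab] by (auto simp: G_iff G_simps intro!: restrict_ext)
   ultimately show "EX w:car G. w +[G] u = 0[G]" by blast
   show "0[G] +[G] u = u"
    using u abelian_monoid.l_zero[OF abelian_group.axioms(1)[OF ab]]
    by (intro extensionalityI[of _ I]) (auto simp: G_iff G_simps)
  qed (auto simp: G_iff G_simps V_closed)
 next
  fix u assume u: "u : car G"
  thus "1[A] *[G] u = u"
   by (intro extensionalityI[of _ I]) (auto simp: G_iff G_simps V)
 qed (auto simp: G_iff G_simps V_closed V A.ring_axioms intro!: restrict_ext)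
qed

definition inc :: "'x => 'v => 'x => 'v" where
 "inc x = (\<lambda>v\<in>car (V x). \<lambda>i\<in>I. if i = x then v else 0[V i])"

definition prj :: "'x => ('x => 'v) => 'v" where
 "prj x = (\<lambda>u\<in>car G. u x)"

lemma inc_apply [simp]: "[|v : car (V x); i : I|] ==> inc x v i = (if i = x then v else 0[V i])"
 by (simp add: inc_def)

lemma inc_lhom: assumes x: "x : I" shows "inc x : lhom A (V x) G"
proof (rule lhomI)
 fix v w assume "v : car (V x)" "w : car (V x)"
 thus "inc x (v +[V x] w) = inc x v +[G] inc x w"
  using V_closed[OF x] abelian_monoid.l_zero[of "V _"] V_left x
  by (auto simp: inc_def G_simps left_module_def abelian_group_def V_closed intro!: restrict_ext)
next
 fix a v assume "a : car A" "v : car (V x)"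
 thus "inc x (a *[V x] v) = a *[G] inc x v"
  using V_closed[OF x] lmod.smult_r_null[OF V_lmod] by (auto simp: inc_def G_simps intro!: restrict_ext)
qed (auto simp: inc_def G_iff V_closed x)

lemma prj_lhom: "x : I ==> prj x : lhom A G (V x)"
 using left_module.smult_closed[OF G_left] abelian_monoid.a_closed[of G] G_left
 by (intro lhomI) (auto simp: prj_def G_iff G_simps left_module_def abelian_group_def V_closed)

lemma inc_closed: "[|x : I; v : car (V x)|] ==> inc x v : car G"
 by (rule lhom_mem[OF inc_lhom])

lemma prj_apply [simp]: "u : car G ==> prj x u = u x" by (simp add: prj_def)

lemma G_fd: "fd K A G"
proof -
 interpret G: lmod A G using G_left by simp
 define GT where "GT T = {u : car G. ALL i:I - T. u i = 0[V i]}" for T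
 have z: "0[V i] +[V i] 0[V i] = 0[V i]" if "i : I" for i
  using abelian_monoid.l_zero[of "V i"] V_left[OF that] V_closed(1)[OF that] by (simp add: left_module_def abelian_group_def)
 have GT: "submodule (GT T) A G" for T
 proof (rule G.submoduleI)
  show "0[G] : GT T" using G.M.zero_closed by (auto simp: GT_def G_simps)
  fix u w assume "u : GT T" "w : GT T"
  thus "u +[G] w : GT T" using G.M.a_closed[of u w] z by (auto simp: GT_def G_simps)
 next
  fix a u assume "a : car A" "u : GT T"
  thus "a *[G] u : GT T" using G.smult_closed[of a u] lmod.smult_r_null[OF V_lmod] by (auto simp: GT_def G_simps)
 qed (auto simp: GT_def)
 have "fd K A (restr G (GT T))" if "finite T" "T <= I" for T
  using that
 proof (induction T)
  case empty
  have "u = 0[G]" if "u : GT {}" for u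
   using that by (intro G_eqI) (auto simp: GT_def G_simps G.M.zero_closed[unfolded G_simps])
  hence "GT {} = {0[G]}" using subD(2)[OF GT[of "{}"]] by blast
  hence c: "car (kmod A (restr G (GT {}))) = {0[kmod A (restr G (GT {}))]}" by simp
  interpret Z: lmod A "restr G (GT {})" using G.sub_left[OF GT] by simp
  interpret Zk: lmod K "kmod A (restr G (GT {}))" using kmod_left[OF Z.left] by simp
  show ?case using Zk.len_trivial(1)[OF c] Z.left by (simp add: fd_def)
 next
  case (insert x T)
  hence x: "x : I" by simp
  let ?f = "restrict (prj x) (GT (insert x T))"
  have l: "left_module A (restr G (GT (insert x T)))" by (rule G.sub_left[OF GT])
  have f: "?f : lhom A (restr G (GT (insert x T))) (V x)" by (rule lhom_restrict_source[OF prj_lhom[OF x] GT])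
  have s: "?f ` car (restr G (GT (insert x T))) = car (V x)"
  proof
   show "?f ` car (restr G (GT (insert x T))) <= car (V x)" using lhom_mem[OF f] by blast
   show "car (V x) <= ?f ` car (restr G (GT (insert x T)))"
   proof
    fix v assume v: "v : car (V x)"
    hence "inc x v : GT (insert x T)" using inc_closed[OF x v] by (auto simp: GT_def)
    moreover hence "v = ?f (inc x v)" using v x inc_closed[OF x v] by simp
    ultimately show "v : ?f ` car (restr G (GT (insert x T)))" by auto
   qed
  qed
  have k: "{u : car (restr G (GT (insert x T))). ?f u = 0[V x]} = GT T"
   using x insert.hyps by (auto simp: GT_def)
  have "fd K A (restr (restr G (GT (insert x T))) (GT T))" using insert by simp
  thus ?case using fd_extension[OF l V_left[OF x] f s _ V_fd[OF x]] k by simp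
 qed
 from this[OF finite_index] have "fd K A (restr G (GT I))" by simp
 moreover have "GT I = car G" by (simp add: GT_def)
 ultimately show ?thesis by simp
qed

lemma E_simps [simp]:
 "car E = lhom A G G" "r \<otimes>[E] s = compose (car G) s r" "1[E] = (\<lambda>u\<in>car G. u)"
 "0[E] = (\<lambda>u\<in>car G. 0[G])" "r +[E] s = (\<lambda>u\<in>car G. r u +[G] s u)"
 "c *[E] r = (\<lambda>u\<in>car G. sc c *[G] r u)"
 by (simp_all add: op_alg_def end_alg_def)

lemma HG_simps [simp]:
 "car (HG U) = lhom A G U" "0[HG U] = (\<lambda>u\<in>car G. 0[U])"
 "f +[HG U] g = (\<lambda>u\<in>car G. f u +[U] g u)" "r *[HG U] f = compose (car G) f r"
 by (simp_all add: hom_mod_def)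

lemma abelian_group_cong:
 assumes "abelian_group M" "car N = car M" "0[N] = 0[M]" "add N = add M"
 shows "abelian_group N"
proof -
 interpret M: abelian_group M by fact
 show ?thesis
  by (rule abelian_groupI) (use M.l_neg M.a_inv_closed in \<open>auto simp: assms M.a_ac\<close>)
qed

lemma E_fdalg: "fdalg K E"
proof -
 interpret G: lmod A G using G_left by simp
 interpret H: lmod K "homk A G G" using homk_left[OF G_left G_left] by simp
 have ab: "abelian_group E"
  by (rule abelian_group_cong[OF H.M.abelian_group_axioms]) (auto simp: fun_eq_iff)
 have id: "(\<lambda>u\<in>car G. u) : lhom A G G" by (rule lhom_id[OF G_left])
 have cmp: "compose (car G) s r : lhom A G G" if "r : lhom A G G" "s : lhom A G G" for r s
  by (rule lhom_comp[OF that G_left])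
 have mon: "monoid E"
  by (rule monoidI)
   (auto simp: id cmp cmp[unfolded compose_def] compose_def lhom_mem lhom_ext intro!: restrict_ext extensionalityI[of _ "car G"])
 have ring: "ring E"
  by (rule ringI[OF ab mon])
   (auto simp: compose_def lhom_mem lhom_add intro!: restrict_ext)
 have modE: "module K E"
 proof (rule moduleI)
  have e: "c *[E] r = c *[homk A G G] r" "r +[E] s = r +[homk A G G] s" for c r s by simp_all
  show "cring K" by (rule K.is_cring)
  show "abelian_group E" by (rule ab)
 qed (use H.smult_closed H.smult_l_distr H.smult_r_distr H.smult_assoc1 H.smult_one in simp_all)
 have "fin_gen K E"
 proof -
  have fg: "fin_gen K (homk A G G)" by (rule H.flen_imp_fin_gen[OF homk_flen[OF G_fd G_fd]])
  have lE: "left_module K E" using modE by (simp add: module_def left_module_def module_axioms_def left_module_axioms_def cring_def)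
  have i: "(\<lambda>f\<in>lhom A G G. f) : lhom K (homk A G G) E"
   by (rule lhomI) (use H.M.a_closed H.smult_closed in auto)
  show ?thesis by (rule fin_gen_image[OF H.left lE i _ fg]) simp
 qed
 moreover have "(c *[E] r) \<otimes>[E] s = c *[E] (r \<otimes>[E] s)" "r \<otimes>[E] (c *[E] s) = c *[E] (r \<otimes>[E] s)"
  if "c : car K" "r : car E" "s : car E" for c r s
  using that by (auto simp: compose_def lhom_mem lhom_smult intro!: restrict_ext)
 ultimately show ?thesis
  using modE ring K.field_axioms by (simp add: fdalg_def fd_algebra_def fd_algebra_axioms_def)
qed

lemma HG_left: assumes U: "left_module A U" shows "left_module E (HG U)"
proof -
 interpret G: lmod A G using G_left by simp
 interpret U: lmod A U using U by simp
 interpret H: lmod K "homk A G U" using homk_left[OF G_left U] by simp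
 interpret E: fdalg K E by (rule E_fdalg)
 have cmp: "compose (car G) f r : lhom A G U" if "r : lhom A G G" "f : lhom A G U" for r f
  by (rule lhom_comp[OF that G_left])
 show ?thesis
 proof (rule left_moduleI)
  show "ring E" by (rule E.A.ring_axioms)
  show "abelian_group (HG U)"
   by (rule abelian_group_cong[OF H.M.abelian_group_axioms]) (auto simp: fun_eq_iff)
  fix f assume "f : car (HG U)"
  thus "1[E] *[HG U] f = f"
   by (intro extensionalityI[of _ "car G"]) (auto simp: compose_def lhom_ext)
 qed (auto simp: cmp cmp[unfolded compose_def] compose_def lhom_mem lhom_add intro!: restrict_ext)
qed

text \<open>\<open>Hom(G, U)\<close> is a vector space over \<open>K\<close> in two ways, through
  the algebra \<open>E\<close> and directly. The identity identifies them, so both have the same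
  dimension.\<close>

lemma HG_kmod_lhom:
 assumes U: "left_module A U"
 shows "(\<lambda>f\<in>lhom A G U. f) : lhom K (kmod E (HG U)) (homk A G U)"
  "bij_betw (\<lambda>f\<in>lhom A G U. f) (car (kmod E (HG U))) (car (homk A G U))"
  "left_module K (kmod E (HG U))" "left_module K (homk A G U)"
proof -
 interpret G: lmod A G using G_left by simp
 interpret U: lmod A U using U by simp
 interpret E: fdalg K E by (rule E_fdalg)
 show l: "left_module K (kmod E (HG U))" by (rule E.kmod_left[OF HG_left[OF U]])
 show "left_module K (homk A G U)" by (rule homk_left[OF G_left U])
 show "(\<lambda>f\<in>lhom A G U. f) : lhom K (kmod E (HG U)) (homk A G U)"
 proof (rule lhomI)
  fix c f assume a: "c : car K" "f : car (kmod E (HG U))"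
  hence "c *[kmod E (HG U)] f : lhom A G U" using left_module.smult_closed[OF l] by fastforce
  moreover have "c *[kmod E (HG U)] f = c *[homk A G U] f"
   using a by (auto simp: compose_def lhom_smult intro!: restrict_ext)
  ultimately show "(\<lambda>f\<in>lhom A G U. f) (c *[kmod E (HG U)] f) = c *[homk A G U] (\<lambda>f\<in>lhom A G U. f) f"
   using a by simp
 next
  fix f g assume a: "f : car (kmod E (HG U))" "g : car (kmod E (HG U))"
  hence "f +[kmod E (HG U)] g : lhom A G U"
   using abelian_monoid.a_closed[of "kmod E (HG U)" f g] l by (simp add: left_module_def abelian_group_def)
  thus "(\<lambda>f\<in>lhom A G U. f) (f +[kmod E (HG U)] g) = (\<lambda>f\<in>lhom A G U. f) f +[homk A G U] (\<lambda>f\<in>lhom A G U. f) g"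
   using a by simp
 qed auto
 show "bij_betw (\<lambda>f\<in>lhom A G U. f) (car (kmod E (HG U))) (car (homk A G U))"
  by (auto simp: bij_betw_def inj_on_def)
qed

lemma HG_fd: assumes U: "fd K A U" shows "fd K E (HG U)"
proof -
 note l = fd_left[OF U]
 show ?thesis
  using flen_transfer(1)[OF HG_kmod_lhom(3)[OF l] HG_kmod_lhom(4)[OF l] HG_kmod_lhom(1)[OF l] HG_kmod_lhom(2)[OF l]] homk_flen[OF G_fd U] HG_left[OF l]
  by (simp add: fd_def)
qed

end

context summands
begin

definition eps :: "'x => ('x => 'v) => 'x => 'v" where
 "eps x = (\<lambda>u\<in>car G. inc x (u x))"

text \<open>The map \<open>f\<close> from \<open>V w\<close> to \<open>V x\<close> as an element of
  the algebra. The algebra is the opposite of the endomorphism ring, so products compose from left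
  to right, see \<open>hat_mult\<close>.\<close>

definition hat :: "'x => 'x => ('v => 'v) => ('x => 'v) => 'x => 'v" where
 "hat w x f = (\<lambda>u\<in>car G. inc x (f (u w)))"

lemma G_mem: "[|u : car G; x : I|] ==> u x : car (V x)" by (simp add: G_iff)

lemma hat_lhom: assumes "w : I" "x : I" "f : lhom A (V w) (V x)" shows "hat w x f : lhom A G G"
proof -
 have "hat w x f = compose (car G) (inc x) (compose (car G) f (prj w))"
  by (auto simp: hat_def compose_def prj_def)
 thus ?thesis
  using lhom_comp[OF lhom_comp[OF prj_lhom[OF assms(1)] assms(3) G_left] inc_lhom[OF assms(2)] G_left] by simp
qed

lemma eps_hat: "x : I ==> eps x = hat x x (\<lambda>v\<in>car (V x). v)"
 by (auto simp: eps_def hat_def G_mem intro!: restrict_ext)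

lemma eps_lhom: "x : I ==> eps x : lhom A G G"
 by (simp add: eps_hat hat_lhom lhom_id V_left)

lemma eps_idem: "x : I ==> eps x \<otimes>[E] eps x = eps x"
 by (auto simp: eps_def compose_def G_mem inc_closed intro!: restrict_ext)

lemma hat_mult:
 assumes "w : I" "x : I" "f : lhom A (V w) (V x)"
 shows "hat w x f \<otimes>[E] hat x y g = hat w y (compose (car (V w)) g f)"
 using assms by (auto simp: hat_def compose_def G_mem inc_closed lhom_mem intro!: restrict_ext)

lemma sandwich:
 assumes "w : I" "x : I" and r: "r : lhom A G G"
 defines "f \<equiv> \<lambda>v\<in>car (V w). r (inc w v) x"
 shows "f : lhom A (V w) (V x)" "eps w \<otimes>[E] (r \<otimes>[E] eps x) = hat w x f"
proof -
 have "f = compose (car (V w)) (prj x) (compose (car (V w)) r (inc w))"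
  using assms(1) inc_closed lhom_mem[OF r] by (auto simp: f_def compose_def intro!: restrict_ext)
 thus "f : lhom A (V w) (V x)"
  using lhom_comp[OF lhom_comp[OF inc_lhom[OF assms(1)] r V_left[OF assms(1)]] prj_lhom[OF assms(2)] V_left[OF assms(1)]]
  by simp
 show "eps w \<otimes>[E] (r \<otimes>[E] eps x) = hat w x f"
  using assms(1) r by (auto simp: f_def eps_def hat_def compose_def G_mem inc_closed lhom_mem intro!: restrict_ext)
qed

text \<open>The \<open>eps x\<close> sum to the identity. The partial sums \<open>eT T\<close> keep
  the multiples of \<open>m\<close> inside \<open>N\<close> while one index after the other is
  added.\<close>

lemma eps_decomp:
 fixes M :: "(('x => 'v) => ('x => 'v), 'm) module"
 assumes M: "left_module E M" and N: "submodule N E M" and m: "m : car M"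
  and z: "!!x. x : I ==> eps x *[M] m : N"
 shows "m : N"
proof -
 interpret M: lmod E M using M by simp
 define eT where "eT T = (\<lambda>u\<in>car G. \<lambda>i\<in>I. if i : T then u i else 0[V i])" for T
 have lz: "0[V i] +[V i] v = v" "v +[V i] 0[V i] = v" if "i : I" "v : car (V i)" for i v
  using V_left[OF that(1)] that(2) abelian_monoid.l_zero[of "V i"] abelian_monoid.r_zero[of "V i"]
  by (auto simp: left_module_def abelian_group_def)
 have add: "eT (insert x T) = eT T +[E] eps x" if "x : I" "x ~: T" for x T
  using that lz by (auto simp: eT_def eps_def G_simps G_mem V_closed intro!: restrict_ext)
 have "eT T : car E & eT T *[M] m : N" if "finite T" "T <= I" for T
  using that
 proof (induction T)
  case empty
  have e: "eT {} = 0[E]" by (auto simp: eT_def G_simps)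
  show ?case unfolding e using m subD(2)[OF N] M.R.zero_closed M.smult_l_null[OF m] by metis
 next
  case (insert x T)
  hence x: "x : I" "eps x : car E" by (auto simp: eps_lhom)
  have IH: "eT T : car E" "eT T *[M] m : N" using insert by auto
  have "eT (insert x T) *[M] m = eT T *[M] m +[M] eps x *[M] m"
   unfolding add[OF x(1) insert.hyps(2)] by (rule M.smult_l_distr[OF IH(1) x(2) m])
  thus ?case
   using subD(4)[OF N IH(2) z[OF x(1)]] M.R.a_closed[OF IH(1) x(2)] unfolding add[OF x(1) insert.hyps(2)] by metis
 qed
 from this[OF finite_index] have "eT I *[M] m : N" by simp
 moreover have "eT I = 1[E]"
  by (auto simp: eT_def fun_eq_iff G_iff extensional_def)
 ultimately show ?thesis using M.smult_one[OF m] by metis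
qed

lemma V_nonzero: "x : I ==> car (V x) ~= {0[V x]}"
 using V_indec by (auto simp: indecomposable_def)

abbreviation aut where "aut x f \<equiv> bij_betw f (car (V x)) (car (V x))"

lemma aut_compose: assumes "aut x u" "aut x w" "!!v. v : car (V x) ==> f v = u (w v)" shows "aut x f"
 using bij_betw_trans[OF assms(2,1)] assms(3) by (simp add: bij_betw_cong[of "car (V x)" f "u \<circ> w"])

lemma aut_if_surj: "[|x : I; f : lhom A (V x) (V x); f ` car (V x) = car (V x)|] ==> aut x f"
 using endo_inj_iff_surj[OF V_fd] by (auto simp: bij_betw_def)

lemma aut_if_inj: "[|x : I; f : lhom A (V x) (V x); inj_on f (car (V x))|] ==> aut x f"
 using endo_inj_iff_surj[OF V_fd] by (auto simp: bij_betw_def)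

text \<open>Compose with the inverse of the sum, so that the two maps add up to the identity. One of
  them is then nilpotent by Fitting's lemma, and the other is injective, because a vector fixed by a
  nilpotent map is zero.\<close>

lemma local_add:
 assumes x: "x : I" and f: "f : lhom A (V x) (V x)" and g: "g : lhom A (V x) (V x)" and n: "~ aut x f" "~ aut x g"
 shows "~ aut x (\<lambda>v\<in>car (V x). f v +[V x] g v)"
proof
 let ?C = "car (V x)" let ?u = "\<lambda>v\<in>?C. f v +[V x] g v"
 assume b: "aut x ?u"
 interpret V: lmod A "V x" by (rule V_lmod[OF x])
 interpret VV: two_mods A "V x" "V x" ..
 interpret H: lmod K "homk A (V x) (V x)" using homk_left[OF V.left V.left] by simp
 have u: "?u : lhom A (V x) (V x)" using H.M.a_closed[of f g] f g by simp
 let ?i = "restrict (the_inv_into ?C ?u) ?C"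
 have i: "?i : lhom A (V x) (V x)" by (rule VV.lhom_inverse[OF u b])
 have iu: "?i (?u v) = v" if "v : ?C" for v
  using that b lhom_mem[OF u that] the_inv_into_f_f[of ?u ?C v] unfolding bij_betw_def by simp
 have ui: "?u (?i v) = v" if "v : ?C" for v
  using that b f_the_inv_into_f[of ?u ?C v] unfolding bij_betw_def by simp
 let ?w = "compose ?C ?i f" let ?v = "compose ?C ?i g"
 have w: "?w : lhom A (V x) (V x)" by (rule lhom_comp[OF f i V.left])
 have v: "?v : lhom A (V x) (V x)" by (rule lhom_comp[OF g i V.left])
 have "~ aut x ?w"
 proof
  assume "aut x ?w"
  hence "aut x f"
  proof (rule aut_compose[OF b])
   fix v assume v: "v : ?C"
   show "f v = ?u (?w v)" using ui[OF lhom_mem[OF f v]] v by (simp only: compose_eq)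
  qed
  thus False using n by simp
 qed
 then obtain m where m: "ALL y:?C. (?w ^^ m) y = 0[V x]" using fitting[OF V_fd[OF x] V_indec[OF x] w] by blast
 have sum: "?w y +[V x] ?v y = y" if y: "y : ?C" for y
 proof -
  have "?w y +[V x] ?v y = ?i (f y +[V x] g y)"
   using lhom_add[OF i lhom_mem[OF f y] lhom_mem[OF g y]] y by (simp only: compose_eq)
  thus ?thesis using iu[OF y] y by simp
 qed
 have "inj_on ?v ?C"
  unfolding VV.lhom_inj_iff[OF v]
 proof (intro ballI impI)
  fix y assume y: "y : ?C" "?v y = 0[V x]"
  hence "?w y = y" using sum[OF y(1)] lhom_mem[OF w y(1)] by simp
  hence "(?w ^^ m) y = y" by (induction m) simp_all
  thus "y = 0[V x]" using m y(1) by simp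
 qed
 hence "aut x ?v" by (rule aut_if_inj[OF x v])
 hence "aut x g"
 proof (rule aut_compose[OF b])
  fix v assume v: "v : ?C"
  show "g v = ?u (?v v)" using ui[OF lhom_mem[OF g v]] v by (simp only: compose_eq)
 qed
 thus False using n by simp
qed

text \<open>If \<open>b a\<close> were an automorphism, the image of \<open>a\<close> would be a
  direct summand of the indecomposable \<open>V z\<close> with the kernel of \<open>b\<close> as
  complement. So the kernel is zero and \<open>b\<close> is an isomorphism between two different
  summands.\<close>

lemma factor_nonaut:
 assumes x: "x : I" and z: "z : I" "z ~= x" and a: "a : lhom A (V x) (V z)" and b: "b : lhom A (V z) (V x)"
 shows "~ aut x (compose (car (V x)) b a)"
proof
 assume bij: "aut x (compose (car (V x)) b a)"
 interpret X: lmod A "V x" by (rule V_lmod[OF x])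
 interpret Z: lmod A "V z" by (rule V_lmod[OF z(1)])
 interpret XZ: two_mods A "V x" "V z" ..
 interpret ZX: two_mods A "V z" "V x" ..
 let ?I = "a ` car (V x)" let ?Z = "{y : car (V z). b y = 0[V x]}"
 have ba: "compose (car (V x)) b a : lhom A (V x) (V x)" by (rule lhom_comp[OF a b X.left])
 have surj: "EX v:car (V x). y = b (a v)" if "y : car (V x)" for y
 proof -
  have "y : compose (car (V x)) b a ` car (V x)" using bij that by (simp add: bij_betw_def)
  thus ?thesis by (auto simp: compose_def)
 qed
 interpret XX: two_mods A "V x" "V x" ..
 have inj: "v = 0[V x]" if "v : car (V x)" "b (a v) = 0[V x]" for v
  using bij that unfolding bij_betw_def XX.lhom_inj_iff[OF ba] by (simp add: compose_eq)
 have I: "submodule ?I A (V z)" by (rule XZ.lhom_image[OF a X.sub_carrier])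
 have Z: "submodule ?Z A (V z)" by (rule ZX.lhom_kernel[OF b])
 have "?I \<inter> ?Z = {0[V z]}"
  using inj XZ.lhom_zero[OF a] subD(2)[OF I] subD(2)[OF Z] by auto
 moreover have "?I <+>\<^bsub>V z\<^esub> ?Z = car (V z)"
 proof
  show "?I <+>\<^bsub>V z\<^esub> ?Z <= car (V z)" by (rule subD(1)[OF Z.sub_sum[OF I Z]])
  show "car (V z) <= ?I <+>\<^bsub>V z\<^esub> ?Z"
  proof
   fix y assume y: "y : car (V z)"
   obtain v where v: "v : car (V x)" "b y = b (a v)" using surj[OF lhom_mem[OF b y]] by blast
   have av: "a v : car (V z)" by (rule lhom_mem[OF a v(1)])
   have "b (y -[V z] a v) = 0[V x]" using y av v lhom_mem[OF b]
    by (simp add: ZX.lhom_minus[OF b] X.diff_zero_iff)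
   hence "y -[V z] a v : ?Z" using y av by simp
   hence "a v +[V z] (y -[V z] a v) : ?I <+>\<^bsub>V z\<^esub> ?Z" using v(1) by (intro Z.set_addI) auto
   thus "y : ?I <+>\<^bsub>V z\<^esub> ?Z" using y av by (simp add: Z.M.a_comm[OF av])
  qed
 qed
 ultimately have "?I = {0[V z]} | ?Z = {0[V z]}"
  using V_indec[OF z(1)] I Z unfolding indecomposable_def by blast
 thus False
 proof
  assume i: "?I = {0[V z]}"
  have "v = 0[V x]" if "v : car (V x)" for v
  proof -
   have "a v : ?I" using that by blast
   hence "a v = 0[V z]" unfolding i by simp
   thus ?thesis using inj[OF that] ZX.lhom_zero[OF b] by simp
  qed
  thus False using V_nonzero[OF x] X.M.zero_closed by blast
 next
  assume z0: "?Z = {0[V z]}"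
  have "inj_on b (car (V z))" unfolding ZX.lhom_inj_iff[OF b] using z0 by blast
  moreover have "b ` car (V z) = car (V x)"
   using surj lhom_mem[OF a] lhom_mem[OF b] by blast
  ultimately have "isomorphic A (V z) (V x)" using b by (auto simp: isomorphic_def bij_betw_def)
  thus False using V_noniso[OF z(1) x] z(2) by blast
 qed
qed

text \<open>\<open>NN x\<close> turns out to be the radical of \<open>Hom(G, V x)\<close>.\<close>

definition NN :: "'x => (('x => 'v) => 'v) set" where
 "NN x = {f : lhom A G (V x). ALL h:lhom A (V x) G. ~ aut x (compose (car (V x)) f h)}"

lemma NN_submodule: assumes x: "x : I" shows "submodule (NN x) E (HG (V x))"
proof -
 interpret X: lmod A "V x" by (rule V_lmod[OF x])
 interpret E: fdalg K E by (rule E_fdalg)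
 interpret P: lmod E "HG (V x)" using HG_left[OF V_left[OF x]] by simp
 show ?thesis
 proof (rule P.submoduleI)
  show "0[HG (V x)] : NN x"
  proof -
   have "~ aut x (compose (car (V x)) 0[HG (V x)] h)" if h: "h : lhom A (V x) G" for h
   proof
    assume "aut x (compose (car (V x)) 0[HG (V x)] h)"
    hence "car (V x) = compose (car (V x)) 0[HG (V x)] h ` car (V x)" by (simp add: bij_betw_def)
    also have "... <= {0[V x]}" using lhom_mem[OF h] by (auto simp: compose_def)
    finally show False using V_nonzero[OF x] X.M.zero_closed by blast
   qed
   thus ?thesis using P.M.zero_closed by (simp add: NN_def)
  qed
  fix f g assume fg: "f : NN x" "g : NN x"
  hence l: "f : lhom A G (V x)" "g : lhom A G (V x)" by (auto simp: NN_def)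
  have "~ aut x (compose (car (V x)) (f +[HG (V x)] g) h)" if h: "h : lhom A (V x) G" for h
  proof -
   have eq: "compose (car (V x)) (f +[HG (V x)] g) h =
    (\<lambda>v\<in>car (V x). compose (car (V x)) f h v +[V x] compose (car (V x)) g h v)"
    by (auto simp: compose_def lhom_mem[OF h] intro!: restrict_ext)
   show ?thesis unfolding eq
    by (rule local_add[OF x lhom_comp[OF h l(1) X.left] lhom_comp[OF h l(2) X.left]])
     (use fg h in \<open>auto simp: NN_def\<close>)
  qed
  thus "f +[HG (V x)] g : NN x" using P.M.a_closed[of f g] l by (simp add: NN_def)
 next
  fix r f assume r: "r : car E" and f: "f : NN x"
  hence l: "f : lhom A G (V x)" "r : lhom A G G" by (auto simp: NN_def)
  have "~ aut x (compose (car (V x)) (r *[HG (V x)] f) h)" if h: "h : lhom A (V x) G" for h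
  proof -
   have "compose (car (V x)) (r *[HG (V x)] f) h = compose (car (V x)) f (compose (car (V x)) r h)"
    by (auto simp: compose_def lhom_mem[OF h] intro!: restrict_ext)
   moreover have "compose (car (V x)) r h : lhom A (V x) G" by (rule lhom_comp[OF h l(2) X.left])
   ultimately show ?thesis using f by (simp add: NN_def)
  qed
  thus "r *[HG (V x)] f : NN x" using P.smult_closed[OF r, of f] l by (simp add: NN_def)
 qed (auto simp: NN_def)
qed

lemma prj_not_NN: assumes x: "x : I" shows "prj x ~: NN x"
proof
 assume "prj x : NN x"
 hence "~ aut x (compose (car (V x)) (prj x) (inc x))" using inc_lhom[OF x] by (simp add: NN_def)
 moreover have "compose (car (V x)) (prj x) (inc x) = (\<lambda>v\<in>car (V x). v)"
  using inc_closed[OF x] x by (auto simp: compose_def intro!: restrict_ext)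
 moreover have "aut x (\<lambda>v\<in>car (V x). v)" by (auto simp: bij_betw_def inj_on_def)
 ultimately show False by simp
qed

text \<open>If \<open>f h\<close> is an automorphism \<open>u\<close>, then
  \<open>g = f (h u^-1 g)\<close>, and this is a multiple of \<open>f\<close> since the algebra acts
  by composition on the right.\<close>

lemma NN_generate:
 assumes x: "x : I" and f: "f : lhom A G (V x)" "f ~: NN x" and g: "g : lhom A G (V x)"
 shows "EX s:car E. g = s *[HG (V x)] f"
proof -
 interpret X: lmod A "V x" by (rule V_lmod[OF x])
 interpret XX: two_mods A "V x" "V x" ..
 obtain h where h: "h : lhom A (V x) G" "aut x (compose (car (V x)) f h)" using f by (auto simp: NN_def)
 let ?u = "compose (car (V x)) f h" let ?C = "car (V x)"
 have u: "?u : lhom A (V x) (V x)" by (rule lhom_comp[OF h(1) f(1) X.left])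
 let ?i = "restrict (the_inv_into ?C ?u) ?C"
 have i: "?i : lhom A (V x) (V x)" by (rule XX.lhom_inverse[OF u h(2)])
 have ui: "f (h (?i v)) = v" if v: "v : ?C" for v
 proof -
  have "?u (?i v) = v" using v h(2) f_the_inv_into_f[of ?u ?C v] unfolding bij_betw_def by simp
  thus ?thesis using lhom_mem[OF i v] by (simp only: compose_eq)
 qed
 let ?s = "compose (car G) (compose ?C h ?i) g"
 have s: "?s : car E"
  using lhom_comp[OF g lhom_comp[OF i h(1) X.left] G_left] by simp
 moreover have "g = ?s *[HG (V x)] f"
 proof (rule extensionalityI[of _ "car G"])
  fix a assume a: "a : car G"
  have "f (h (?i (g a))) = g a" by (rule ui[OF lhom_mem[OF g a]])
  thus "g a = (?s *[HG (V x)] f) a" using a lhom_mem[OF g a] by (simp only: HG_simps compose_eq)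
 qed (use lhom_ext[OF g] in auto)
 ultimately show ?thesis by blast
qed

lemma NN_max:
 assumes x: "x : I" and U: "submodule U E (HG (V x))" "U ~= car (HG (V x))"
 shows "U <= NN x"
proof
 fix f assume f: "f : U"
 show "f : NN x"
 proof (rule ccontr)
  assume n: "f ~: NN x"
  have fl: "f : lhom A G (V x)" using subD(1)[OF U(1)] f by auto
  have "car (HG (V x)) <= U"
  proof
   fix g assume "g : car (HG (V x))"
   then obtain s where "s : car E" "g = s *[HG (V x)] f" using NN_generate[OF x fl n] by (metis HG_simps(1))
   thus "g : U" using subD(5)[OF U(1) _ f] by metis
  qed
  thus False using U subD(1)[OF U(1)] by blast
 qed
qed

lemma NN_maximal: assumes x: "x : I" shows "maximal_submodule E (HG (V x)) (NN x)"
proof -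
 have "NN x ~= car (HG (V x))" using prj_not_NN[OF x] prj_lhom[OF x] by auto
 thus ?thesis unfolding maximal_submodule_def using NN_submodule[OF x] NN_max[OF x] by blast
qed

lemma rad_NN: assumes x: "x : I" shows "rad E (HG (V x)) = NN x"
proof -
 have "N = NN x" if "maximal_submodule E (HG (V x)) N" for N
  using that NN_max[OF x, of N] NN_maximal[OF x] unfolding maximal_submodule_def by blast
 hence "{N. maximal_submodule E (HG (V x)) N} = {NN x}" using NN_maximal[OF x] by blast
 thus ?thesis unfolding rad_def using subD(1)[OF NN_submodule[OF x]] by auto
qed

definition SE :: "'x => (('x => 'v) => ('x => 'v), (('x => 'v) => 'v) set) module" where
 "SE x = top_mod E (HG (V x))"

lemma SE_quot: "x : I ==> SE x = quot (HG (V x)) (NN x)"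
 by (simp add: SE_def top_mod_def rad_NN)

lemma SE_simple: "x : I ==> simple_mod E (SE x)"
 unfolding SE_quot by (rule maximal_quot_simple[OF HG_left[OF V_left] NN_maximal])

lemma HG_wt:
 assumes z: "z : I" and f: "f : wt (HG U) (eps z) (car (HG U))"
 obtains h where "h : lhom A (V z) U" "f = compose (car G) h (prj z)"
proof -
 have fl: "f : lhom A G U" "compose (car G) f (eps z) = f" using f by (simp_all add: wt_def)
 have h: "compose (car (V z)) f (inc z) : lhom A (V z) U" by (rule lhom_comp[OF inc_lhom[OF z] fl(1) V_left[OF z]])
 have "f = compose (car G) (compose (car (V z)) f (inc z)) (prj z)"
 proof (rule extensionalityI[of _ "car G"])
  fix u assume u: "u : car G"
  have "f u = compose (car G) f (eps z) u" using fl(2) by simp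
  thus "f u = compose (car G) (compose (car (V z)) f (inc z)) (prj z) u"
   using u G_mem[OF u z] by (simp add: compose_eq eps_def)
 qed (use lhom_ext[OF fl(1)] in simp_all)
 with h show ?thesis by (rule that)
qed

text \<open>Maps through another summand lie in \<open>NN x\<close> by \<open>factor_nonaut\<close>.
  An endomorphism of \<open>V x\<close> is a scalar modulo \<open>NN x\<close> by
  \<open>V_split\<close>, so the class of the projection spans the weight space.\<close>

lemma SE_wdim:
 assumes z: "z : I" and x: "x : I"
 shows "kdim K E (SE x) (wt (SE x) (eps z) (car (SE x))) = (if z = x then 1 else 0)"
proof -
 interpret X: lmod A "V x" by (rule V_lmod[OF x])
 interpret E: fdalg K E by (rule E_fdalg)
 interpret P: lmod E "HG (V x)" using HG_left[OF V_left[OF x]] by simp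
 note N = NN_submodule[OF x]
 interpret S: lmod E "SE x" using P.quot_left[OF N] by (simp add: SE_quot[OF x])
 interpret PS: two_mods E "HG (V x)" "SE x" ..
 let ?q = "P.qmap (NN x)"
 have q: "?q : lhom E (HG (V x)) (SE x)" "?q ` car (HG (V x)) = car (SE x)"
  using P.qmap_lhom[OF N] P.qmap_surj[OF N] by (simp_all add: SE_quot[OF x])
 have q0: "?q f = 0[SE x] \<longleftrightarrow> f : NN x" if "f : lhom A G (V x)" for f
  using P.qmap_zero[OF N, of f] that by (simp add: SE_quot[OF x])
 have e: "eps z : car E" "eps z \<otimes>[E] eps z = eps z" using eps_lhom[OF z] eps_idem[OF z] by auto
 have w: "wt (SE x) (eps z) (car (SE x)) = ?q ` wt (HG (V x)) (eps z) (car (HG (V x)))"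
  using E.wt_image[OF q(1) P.sub_carrier e P.left] q(2) by simp
 show ?thesis
 proof (cases "z = x")
  case False
  have "f : NN x" if f: "f : wt (HG (V x)) (eps z) (car (HG (V x)))" for f
  proof -
   obtain h where h: "h : lhom A (V z) (V x)" "f = compose (car G) h (prj z)" by (rule HG_wt[OF z f])
   have "~ aut x (compose (car (V x)) f g)" if g: "g : lhom A (V x) G" for g
   proof -
    have "compose (car (V x)) f g = compose (car (V x)) h (compose (car (V x)) (prj z) g)"
     unfolding h(2) using lhom_mem[OF g] by (auto simp: compose_def intro!: restrict_ext)
    thus ?thesis using factor_nonaut[OF x z False lhom_comp[OF g prj_lhom[OF z] X.left] h(1)] by simp
   qed
   thus ?thesis using f by (simp add: NN_def wt_def)
  qed
  hence "?q f = 0[SE x]" if "f : wt (HG (V x)) (eps z) (car (HG (V x)))" for f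
   using that q0[of f] by (simp add: wt_def)
  hence "wt (SE x) (eps z) (car (SE x)) <= {0[SE x]}" unfolding w by blast
  moreover have "0[SE x] : wt (SE x) (eps z) (car (SE x))" using e(1) by (simp add: wt_def S.smult_r_null)
  ultimately have "wt (SE x) (eps z) (car (SE x)) = {0[SE x]}" by blast
  thus ?thesis using False E.kdim_zero[OF S.left] by simp
 next
  case True
  let ?W = "wt (SE x) (eps z) (car (SE x))"
  have pl: "prj x : lhom A G (V x)" by (rule prj_lhom[OF x])
  have pw: "prj x : wt (HG (V x)) (eps z) (car (HG (V x)))"
   unfolding True using pl x by (auto simp: wt_def compose_def eps_def prj_def G_mem inc_closed intro!: restrict_ext)
  interpret kS: lmod K "kmod E (SE x)" using E.kmod_left[OF S.left] by simp
  have sW: "submodule ?W K (kmod E (SE x))"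
   using E.wt_sub[OF S.left kS.sub_carrier[simplified] e(1)] by simp
  have "len K (restr (kmod E (SE x)) ?W) = 1"
  proof (rule E.kdim_line(2)[OF kS.sub_left[OF sW], of "?q (prj x)"])
   show "?q (prj x) : car (restr (kmod E (SE x)) ?W)" using pw w by simp
   show "?q (prj x) ~= 0[restr (kmod E (SE x)) ?W]" using q0[OF pl] prj_not_NN[OF x] by simp
   fix s assume "s : car (restr (kmod E (SE x)) ?W)"
   then obtain f where f: "f : wt (HG (V x)) (eps x) (car (HG (V x)))" "s = ?q f" using w True by auto
   obtain u where u: "u : lhom A (V x) (V x)" "f = compose (car G) u (prj x)" by (rule HG_wt[OF x f(1)])
   obtain c where c: "c : car K" "~ aut x (\<lambda>v\<in>car (V x). u v -[V x] sc c *[V x] v)"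
    using V_split[OF x u(1)] by blast
   let ?d = "\<lambda>v\<in>car (V x). u v -[V x] sc c *[V x] v" let ?c = "c *[E] 1[E]"
   have scA: "sc c : car A" using c(1) by simp
   have d: "?d : lhom A (V x) (V x)"
    using c(1) by (intro lhomI)
     (auto simp: lhomD[OF u(1)] X.smult_r_distr X.smult_r_diff a_minus_def X.M.minus_add X.M.a_ac
      sc_smult[OF X.left] X.smult_r_minus)
   let ?g = "compose (car G) ?d (prj x)"
   have g: "?g : lhom A G (V x)" by (rule lhom_comp[OF pl d G_left])
   have cE: "?c : car E" using E.smult_closed[OF c(1) E.A.one_closed] .
   have cpl: "?c *[HG (V x)] prj x : car (HG (V x))" by (rule P.smult_closed[OF cE]) (simp add: pl)
   have "f = ?g +[HG (V x)] ?c *[HG (V x)] prj x"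
   proof (rule extensionalityI[of _ "car G"])
    fix a assume a: "a : car G"
    hence sa: "sc c *[G] a : car G" by (rule left_module.smult_closed[OF G_left scA])
    have ax: "a x : car (V x)" by (rule G_mem[OF a x])
    have "(?c *[HG (V x)] prj x) a = sc c *[V x] a x" using a sa x by (simp add: compose_eq) (simp add: G_simps)
    thus "f a = (?g +[HG (V x)] ?c *[HG (V x)] prj x) a"
     using a ax X.diff_add_cancel[OF lhom_mem[OF u(1) ax] X.smult_closed[OF scA ax]] by (simp add: u(2) compose_eq)
   qed (simp_all add: u(2))
   moreover have "?g : NN x"
   proof -
    have "~ aut x (compose (car (V x)) ?g h)" if h: "h : lhom A (V x) G" for h
    proof
     assume "aut x (compose (car (V x)) ?g h)"
     hence "car (V x) = compose (car (V x)) ?g h ` car (V x)" by (simp only: bij_betw_def)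
     also have "... <= ?d ` car (V x)" using lhom_mem[OF h] G_mem[OF _ x] by (auto simp: compose_eq)
     finally have "?d ` car (V x) = car (V x)" using lhom_mem[OF d] by blast
     thus False using aut_if_surj[OF x d] c(2) by simp
    qed
    thus ?thesis using g by (simp add: NN_def)
   qed
   hence "?q ?g = 0[SE x]" using q0[OF g] by simp
   ultimately have "?q f = ?q (?c *[HG (V x)] prj x)"
    using lhom_add[OF q(1) _ cpl, of ?g] g lhom_mem[OF q(1) cpl] by simp
   also have "... = ?c *[SE x] ?q (prj x)" by (rule lhom_smult[OF q(1) cE]) (simp add: pl)
   finally show "EX c:car K. s = c *[restr (kmod E (SE x)) ?W] ?q (prj x)" using c(1) f(2) by auto
  qed
  thus ?thesis using True by (simp add: kdim_def)
 qed
qed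

text \<open>Some \<open>eps x\<close> does not kill a vector \<open>m\<close> of the simple module,
  and sending \<open>f\<close> to \<open>(inc x f) m\<close> maps \<open>Hom(G, V x)\<close> onto
  it. The kernel is the largest proper submodule \<open>NN x\<close>.\<close>

lemma SE_complete:
 assumes N: "simple_mod E N" shows "EX x:I. isomorphic E N (SE x)"
proof -
 interpret E: fdalg K E by (rule E_fdalg)
 interpret N: lmod E N using N by (simp add: simple_mod_def)
 obtain m where m: "m : car N" "m ~= 0[N]" using N N.M.zero_closed by (auto simp: simple_mod_def)
 obtain x where x: "x : I" "eps x *[N] m ~= 0[N]"
  using eps_decomp[OF N.left N.sub_zero m(1)] m(2) by auto
 interpret X: lmod A "V x" by (rule V_lmod[OF x(1)])
 interpret P: lmod E "HG (V x)" using HG_left[OF V_left[OF x(1)]] by simp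
 interpret PN: two_mods E "HG (V x)" N ..
 let ?t = "%f. compose (car G) (inc x) f"
 have t: "?t f : car E" if "f : lhom A G (V x)" for f
  using lhom_comp[OF that inc_lhom[OF x(1)] G_left] by simp
 let ?\<phi> = "\<lambda>f\<in>lhom A G (V x). ?t f *[N] m"
 have \<phi>: "?\<phi> : lhom E (HG (V x)) N"
 proof (rule lhomI)
  fix f assume "f : car (HG (V x))" thus "?\<phi> f : car N" using N.smult_closed[OF t m(1)] by simp
 next
  fix f g assume fg: "f : car (HG (V x))" "g : car (HG (V x))"
  have s: "f +[HG (V x)] g : lhom A G (V x)" using P.M.a_closed[OF fg] by simp
  have "?t (f +[HG (V x)] g) = ?t f +[E] ?t g"
   using fg lhom_add[OF inc_lhom[OF x(1)]] by (auto simp: compose_def lhom_mem intro!: restrict_ext)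
  hence "?t (f +[HG (V x)] g) *[N] m = ?t f *[N] m +[N] ?t g *[N] m"
   using N.smult_l_distr[OF t t m(1)] fg by (metis HG_simps(1))
  thus "?\<phi> (f +[HG (V x)] g) = ?\<phi> f +[N] ?\<phi> g"
   using s fg by (simp only: restrict_apply' HG_simps(1))
 next
  fix r f assume r: "r : car E" and f: "f : car (HG (V x))"
  have s: "r *[HG (V x)] f : lhom A G (V x)" using P.smult_closed[OF r f] by simp
  have "?t (r *[HG (V x)] f) = r \<otimes>[E] ?t f"
   using r by (auto simp: compose_def lhom_mem intro!: restrict_ext)
  hence "?t (r *[HG (V x)] f) *[N] m = r *[N] (?t f *[N] m)"
   using N.smult_assoc1[OF r t m(1), of f] f by (metis HG_simps(1))
  thus "?\<phi> (r *[HG (V x)] f) = r *[N] ?\<phi> f"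
   using s f by (simp only: restrict_apply' HG_simps(1))
 qed simp
 have "?t (prj x) = eps x" by (auto simp: eps_def compose_def prj_def intro!: restrict_ext)
 hence p: "?\<phi> (prj x) ~= 0[N]" "prj x : car (HG (V x))" using x(2) prj_lhom[OF x(1)] by simp_all
 let ?Z = "{f : car (HG (V x)). ?\<phi> f = 0[N]}"
 have Z: "submodule ?Z E (HG (V x))" by (rule PN.lhom_kernel[OF \<phi>])
 have im: "submodule (?\<phi> ` U) E N" if "submodule U E (HG (V x))" for U by (rule PN.lhom_image[OF \<phi> that])
 have surj: "?\<phi> ` car (HG (V x)) = car N"
 proof -
  have "?\<phi> ` car (HG (V x)) = {0[N]} | ?\<phi> ` car (HG (V x)) = car N"
   using N im[OF P.sub_carrier] unfolding simple_mod_def by blast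
  moreover have "?\<phi> (prj x) : ?\<phi> ` car (HG (V x))" by (rule imageI[OF p(2)])
  ultimately show ?thesis using p(1) by (metis singletonD)
 qed
 have ZN: "?Z <= NN x" by (rule NN_max[OF x(1) Z]) (use p in blast)
 \<comment> \<open>Otherwise \<open>prj x\<close> would differ from an element of
   \<open>NN x\<close> by an element of the kernel, which itself lies in
   \<open>NN x\<close>.\<close>
 have "?\<phi> ` NN x ~= car N"
 proof
  assume a: "?\<phi> ` NN x = car N"
  have "?\<phi> (prj x) : ?\<phi> ` NN x" unfolding a by (rule lhom_mem[OF \<phi> p(2)])
  then obtain f where f: "f : NN x" "?\<phi> (prj x) = ?\<phi> f" by (rule imageE)
  have fc: "f : car (HG (V x))" using P.sub_mem[OF NN_submodule[OF x(1)] f(1)] .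
  have "?\<phi> (prj x -[HG (V x)] f) = 0[N]"
   using PN.lhom_minus[OF \<phi> p(2) fc] f(2) N.diff_zero_iff[OF lhom_mem[OF \<phi> p(2)] lhom_mem[OF \<phi> fc]] by simp
  hence "prj x -[HG (V x)] f : NN x" using ZN P.M.minus_closed[OF p(2) fc] by blast
  hence "(prj x -[HG (V x)] f) +[HG (V x)] f : NN x" using subD(4)[OF NN_submodule[OF x(1)] _ f(1)] by blast
  thus False using P.diff_add_cancel[OF p(2) fc] prj_not_NN[OF x(1)] by simp
 qed
 hence "?\<phi> ` NN x = {0[N]}" using N im[OF NN_submodule[OF x(1)]] unfolding simple_mod_def by blast
 hence "NN x <= ?Z" using P.sub_mem[OF NN_submodule[OF x(1)]] by blast
 hence "NN x = ?Z" using ZN by blast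
 from P.isomorphic_quotI[OF \<phi> surj N.left this]
 have "isomorphic E (SE x) N" by (simp add: SE_quot[OF x(1)])
 hence "isomorphic E N (SE x)"
  using isomorphic_sym SE_simple[OF x(1)] N.left by (auto simp: simple_mod_def)
 thus ?thesis using x(1) by blast
qed

lemma E_walg: "walg K E I eps SE"
 by (intro walg.intro walg_axioms.intro E_fdalg)
  (use eps_lhom eps_idem SE_simple SE_wdim SE_complete in \<open>simp_all only: E_simps(1)\<close>)

text \<open>\<open>eps x Hom(G, U)\<close> consists of the maps that factor through the projection
  to \<open>V x\<close>.\<close>

lemma wt_hom_dim:
 assumes x: "x : I" and U: "fd K A U"
 shows "kdim K E (HG U) (wt (HG U) (eps x) (car (HG U))) = len K (homk A (V x) U)"
proof -
 note Ul = fd_left[OF U]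
 interpret X: lmod A "V x" by (rule V_lmod[OF x])
 interpret U: lmod A U by (rule fd_lmod[OF U])
 interpret E: fdalg K E by (rule E_fdalg)
 interpret P: lmod E "HG U" using HG_left[OF Ul] by simp
 interpret kP: lmod K "kmod E (HG U)" using E.kmod_left[OF P.left] by simp
 let ?W = "wt (HG U) (eps x) (car (HG U))"
 have sW: "submodule ?W K (kmod E (HG U))"
  using E.wt_sub[OF P.left kP.sub_carrier[simplified]] eps_lhom[OF x] by simp
 have lW: "left_module K (restr (kmod E (HG U)) ?W)" by (rule kP.sub_left[OF sW])
 have lH: "left_module K (homk A (V x) U)" by (rule homk_left[OF X.left Ul])
 have fW: "flen K (restr (kmod E (HG U)) ?W)" using kP.flen_sub(1)[OF _ sW] HG_fd[OF U] by (simp add: fd_def)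
 let ?F = "%h. compose (car G) h (prj x)"
 have Fw: "?F h : ?W" if "h : lhom A (V x) U" for h
  using lhom_comp[OF prj_lhom[OF x] that G_left] x by (auto simp: wt_def compose_def eps_def inc_closed G_mem intro!: restrict_ext)
 have "len K (homk A (V x) U) = len K (restr (kmod E (HG U)) ?W)"
 proof (rule flen_transferI[OF lH lW fW, where F = ?F])
  have "inj_on ?F (lhom A (V x) U)"
  proof (rule inj_onI, rule lhom_eqI)
   fix h h' v assume e: "?F h = ?F h'" and v: "v : car (V x)"
   from e have "?F h (inc x v) = ?F h' (inc x v)" by simp
   thus "h v = h' v" using inc_closed[OF x v] x v by (simp add: compose_eq)
  qed
  moreover have "?W <= ?F ` lhom A (V x) U" using HG_wt[OF x] by blast
  ultimately show "bij_betw ?F (car (homk A (V x) U)) (car (restr (kmod E (HG U)) ?W))" using Fw by (auto simp: bij_betw_def)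
  fix c h assume a: "c : car K" "h : car (homk A (V x) U)"
  have "sc c *[G] u : car G" "(sc c *[G] u) x = sc c *[V x] u x" if "u : car G" for u
   using that a(1) x left_module.smult_closed[OF G_left, of "sc c" u] by simp_all (simp add: G_simps)
  thus "?F (c *[homk A (V x) U] h) = c *[restr (kmod E (HG U)) ?W] ?F h"
   using a x by (auto simp: compose_def G_mem lhom_smult intro!: restrict_ext)
 qed (use x in \<open>auto simp: compose_def G_mem intro!: restrict_ext\<close>)
 thus ?thesis by (simp add: kdim_def)
qed

text \<open>This turns both sides of (B2) into dimensions of Hom spaces.\<close>

lemma multiplicity_hom:
 assumes "x : I" "fd K A U"
 shows "multiplicity_of E (HG U) (top_mod E (HG (V x))) = len K (homk A (V x) U)"
 using walg.multiplicity_eq_wd[OF E_walg HG_fd[OF assms(2)] assms(1)] wt_hom_dim[OF assms]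
 by (simp add: SE_def)

end

section \<open>Projective modules generated by an idempotent\<close>

definition reg :: "('k, 'a) module => ('a, 'a) module" where
 "reg A = \<lparr>carrier = car A, mult = mult A, one = 1[A], zero = 0[A], add = add A, smult = mult A\<rparr>"

lemma reg_simps [simp]: "car (reg A) = car A" "0[reg A] = 0[A]" "add (reg A) = add A" "smult (reg A) = mult A"
 by (simp_all add: reg_def)

context fdalg
begin

lemmas A_ab = ring.is_abelian_group[OF A.ring_axioms]
lemmas A_add = abelian_group.l_neg[OF A_ab] abelian_group.a_inv_closed[OF A_ab]
 abelian_monoid.a_assoc[OF abelian_group.axioms(1)[OF A_ab]] abelian_monoid.a_comm[OF abelian_group.axioms(1)[OF A_ab]]
 abelian_monoid.a_closed[OF abelian_group.axioms(1)[OF A_ab]]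

lemma reg_left: "left_module A (reg A)"
proof (rule left_moduleI)
 show "abelian_group (reg A)"
  by (rule abelian_groupI) (use A_add in auto)
qed (simp_all add: A.ring_axioms A.l_distr A.r_distr A.m_assoc)

lemma reg_fd: "fd K A (reg A)"
proof (rule fg_imp_fd)
 interpret M: lmod A "reg A" using reg_left by simp
 have s: "submodule (span_in A (reg A) {1[A]}) A (reg A)" by (rule M.span_sub) simp
 have "x : span_in A (reg A) {1[A]}" if "x : car A" for x
  using subD(5)[OF s that, of "1[A]"] M.span_superset[of "{1[A]}"] that by simp
 hence "span_in A (reg A) {1[A]} = car (reg A)" using subD(1)[OF s] by auto
 thus "fg_module A (reg A)" using M.left unfolding fg_module_def fin_gen_def
  by (intro conjI exI[of _ "{1[A]}"]) auto
qed

lemma act_lhom: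
 fixes M :: "('a, 'm) module"
 assumes M: "left_module A M" and m: "m : car M"
 shows "(\<lambda>a\<in>car A. a *[M] m) : lhom A (reg A) M"
proof -
 interpret M: lmod A M using M by simp
 show ?thesis by (rule lhomI) (use m in \<open>auto simp: M.smult_l_distr M.smult_assoc1\<close>)
qed

text \<open>\<open>P\<close> is a copy of \<open>A e\<close> in which \<open>p\<close> corresponds to \<open>e\<close>.\<close>

definition pgen :: "'a => ('a, 'p) module => 'p => bool" where
 "pgen e P p \<longleftrightarrow> left_module A P & e : car A & e \<otimes>[A] e = e & p : car P & e *[P] p = p &
   (ALL y:car P. EX a:car A. y = a *[P] p) & (ALL a:car A. a *[P] p = 0[P] --> a \<otimes>[A] e = 0[A])"

text \<open>The map from \<open>a p\<close> to \<open>a m\<close> is well defined: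
  \<open>a p = 0\<close> forces \<open>a e = 0\<close>, hence
  \<open>a m = a e m = 0\<close>.\<close>

lemma pgen_hom:
 fixes M :: "('a, 'm) module"
 assumes p: "pgen e P p" and M: "left_module A M" and m: "m : car M" "e *[M] m = m"
 obtains f where "f : lhom A P M" "f p = m"
proof -
 have P: "left_module A P" "e : car A" "p : car P" "e *[P] p = p"
  "!!y. y : car P ==> EX a:car A. y = a *[P] p"
  "!!a. [|a : car A; a *[P] p = 0[P]|] ==> a \<otimes>[A] e = 0[A]"
  using p by (auto simp: pgen_def)
 interpret M: lmod A M using M by simp
 interpret P: lmod A P using P(1) by simp
 interpret A': lmod A "reg A" using reg_left by simp
 interpret AP: two_mods A "reg A" P ..
 let ?\<rho> = "\<lambda>a\<in>car A. a *[P] p"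
 have r: "?\<rho> : lhom A (reg A) P" by (rule act_lhom[OF P(1,3)])
 have s: "?\<rho> ` car (reg A) = car P"
 proof
  show "car P <= ?\<rho> ` car (reg A)" using P(5) by force
 qed (use lhom_mem[OF r] in blast)
 obtain h where h: "h : lhom A P M" "!!a. a : car (reg A) ==> h (?\<rho> a) = (\<lambda>a\<in>car A. a *[M] m) a"
 proof (rule AP.lhom_factor[OF r s M act_lhom[OF M m(1)]])
  fix a assume a: "a : car (reg A)" "?\<rho> a = 0[P]"
  hence "a \<otimes>[A] e = 0[A]" using P(6) by simp
  moreover have "a *[M] m = (a \<otimes>[A] e) *[M] m" using a m P(2) by (simp add: M.smult_assoc1)
  ultimately show "(\<lambda>a\<in>car A. a *[M] m) a = 0[M]" using a m by simp
 qed (use that in blast)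
 have "h (1[A] *[P] p) = 1[A] *[M] m" using h(2)[of "1[A]"] by simp
 hence "h p = m" using P(3) m(1) by simp
 with h(1) that show ?thesis by blast
qed

lemma pgen_hom_eqI:
 assumes "pgen e P p" "f : lhom A P M" "g : lhom A P M" "f p = g p" shows "f = g"
proof (rule lhom_eqI[OF assms(2,3)])
 fix y assume "y : car P"
 then obtain a where "a : car A" "y = a *[P] p" "p : car P" using assms(1) by (auto simp: pgen_def)
 thus "f y = g y" using lhom_smult[OF assms(2)] lhom_smult[OF assms(3)] assms(4) by simp
qed

lemma pgen_dim:
 fixes M :: "('a, 'm) module"
 assumes p: "pgen e P p" and M: "fd K A M"
 shows "len K (homk A P M) = kdim K A M (wt M e (car M))"
proof -
 note Ml = fd_left[OF M]
 have P: "left_module A P" "e : car A" "p : car P" "e *[P] p = p" using p by (auto simp: pgen_def)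
 interpret M: lmod A M by (rule fd_lmod[OF M])
 let ?W = "wt M e (car M)"
 have "f p : ?W" if "f : lhom A P M" for f
  using lhom_mem[OF that P(3)] lhom_smult[OF that P(2,3)] P(4) by (simp add: wt_def)
 moreover have "?W <= (%f. f p) ` lhom A P M" using pgen_hom[OF p Ml] by (auto simp: wt_def image_iff)
 ultimately show ?thesis
  by (intro homk_eval_len[OF P(1) M P(3) wt_sub[OF Ml fd_kmod_sub[OF M M.sub_carrier] P(2)] pgen_hom_eqI[OF p]]) auto
qed

end

section \<open>The Jacobson radical, radical series and socle series\<close>

lemma simple_ann_maximal:
 fixes N :: "('a, 'm) module"
 assumes "fdalg K A" "simple_mod A N" "v : car N" "v ~= 0[N]"
 shows "maximal_submodule A (reg A) {a : car A. a *[N] v = 0[N]}" (is "maximal_submodule _ _ ?I")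
proof -
 interpret fdalg K A by fact
 interpret N: lmod A N using assms by (simp add: simple_mod_def)
 interpret A': lmod A "reg A" using reg_left by simp
 interpret AN: two_mods A "reg A" N ..
 have g: "(\<lambda>a\<in>car A. a *[N] v) : lhom A (reg A) N" by (rule act_lhom[OF N.left assms(3)])
 have "{x : car (reg A). (\<lambda>a\<in>car A. a *[N] v) x = 0[N]} = ?I" by auto
 hence I: "submodule ?I A (reg A)" using AN.lhom_kernel[OF g] by simp
 have "X = ?I | X = car (reg A)" if X: "submodule X A (reg A)" "?I <= X" for X
 proof (cases "X = ?I")
  case False
  then obtain a where a: "a : X" "a ~: ?I" using X by blast
  have ac: "a : car A" using A'.sub_mem[OF X(1) a(1)] by simp
  hence nz: "a *[N] v ~= 0[N]" using a(2) by simp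
  have "b : X" if b: "b : car A" for b
  proof -
   obtain c where c: "c : car A" "b *[N] v = c *[N] (a *[N] v)"
    using simple_generated[OF assms(2) _ nz] b ac assms(3) by (metis N.smult_closed)
   hence "(b -[A] c \<otimes>[A] a) *[N] v = 0[N]"
    using b ac assms(3) by (simp add: N.smult_l_diff N.smult_assoc1 N.diff_zero_iff)
   hence "b -[A] c \<otimes>[A] a : X" using X(2) b ac c(1) by auto
   moreover have "c \<otimes>[A] a : X" using subD(5)[OF X(1) c(1) a(1)] by simp
   ultimately have "(b -[A] c \<otimes>[A] a) +[A] c \<otimes>[A] a : X" using subD(4)[OF X(1)] by simp
   moreover have "(b -[A] c \<otimes>[A] a) +[A] c \<otimes>[A] a = b"
    using b ac c(1) by (simp add: a_minus_def A_add(1,2,3))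
   ultimately show ?thesis by simp
  qed
  thus ?thesis using subD(1)[OF X(1)] by auto
 qed simp
 moreover have "1[A] ~: ?I" using assms(3,4) by simp
 hence "?I ~= car (reg A)" by auto
 ultimately show ?thesis using I unfolding maximal_submodule_def by blast
qed

context walg
begin

text \<open>The Jacobson radical, as the common annihilator of the simple modules.\<close>

definition J :: "'a set" where
 "J = {a : car A. ALL i:I. ALL v:car (S i). a *[S i] v = 0[S i]}"

lemma J_carrier: "a : J ==> a : car A" by (simp add: J_def)

lemma J_kills:
 assumes N: "simple_mod A N" and a: "a : J" and v: "v : car N"
 shows "a *[N] v = 0[N]"
proof -
 obtain i f where i: "i : I" "f : lhom A N (S i)" "bij_betw f (car N) (car (S i))"
  using simple_iso[OF N] by (auto simp: isomorphic_def)
 interpret N: lmod A N using N by (simp add: simple_mod_def)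
 interpret Si: lmod A "S i" using S_simple[OF i(1)] by (simp add: simple_mod_def)
 interpret two_mods A N "S i" ..
 have "f (a *[N] v) = 0[S i]"
  using lhom_smult[OF i(2) J_carrier[OF a] v] a i(1) lhom_mem[OF i(2) v] by (simp add: J_def)
 thus ?thesis using i(3) lhom_inj_iff[OF i(2)] J_carrier[OF a] v unfolding bij_betw_def by blast
qed

lemma J_maximal:
 assumes M: "left_module A M" and N: "maximal_submodule A M N" and a: "a : J" and x: "x : car M"
 shows "a *[M] x : N"
proof -
 interpret M: lmod A M using M by simp
 have s: "submodule N A M" using N by (simp add: maximal_submodule_def)
 have q: "M.qmap N (a *[M] x) = a *[quot M N] M.qmap N x" by (rule lhom_smult[OF M.qmap_lhom[OF s] J_carrier[OF a] x])
 also have "... = 0[quot M N]"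
  by (rule J_kills[OF maximal_quot_simple[OF M N] a lhom_mem[OF M.qmap_lhom[OF s] x]])
 finally show ?thesis using M.qmap_zero[OF s] J_carrier[OF a] x by simp
qed

text \<open>Among the finite intersections of maximal left ideals take a minimal one. It cannot be
  made smaller by the annihilator of a nonzero vector of some \<open>S i\<close>, because that is a
  maximal left ideal; so it annihilates all these vectors.\<close>

lemma J_finite:
 obtains F where "finite F" "ALL N:F. maximal_submodule A (reg A) N" "car A \<inter> \<Inter>F <= J"
proof -
 interpret A': lmod A "reg A" using reg_left by simp
 define good where "good X \<longleftrightarrow> (EX F. finite F & (ALL N:F. maximal_submodule A (reg A) N) & X = car A \<inter> \<Inter>F)" for X
 have "good (car (reg A))" unfolding good_def by (intro exI[of _ "{}"]) simp
 then obtain X where X: "submodule X A (reg A)" "good X"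
  "!!Y. [|submodule Y A (reg A); good Y; Y <= X|] ==> Y = X"
  using exists_minimal_submodule[OF reg_fd A'.sub_carrier, of good] by metis
 from X(2)[unfolded good_def] obtain F where F: "finite F" "ALL N:F. maximal_submodule A (reg A) N" "X = car A \<inter> \<Inter>F" by blast
 have "a *[S i] v = 0[S i]" if a: "a : X" and i: "i : I" and v: "v : car (S i)" for a i v
 proof (cases "v = 0[S i]")
  case True
  interpret Si: lmod A "S i" using S_simple[OF i] by (simp add: simple_mod_def)
  show ?thesis using True a F(3) by simp
 next
  case False
  let ?N = "{a : car A. a *[S i] v = 0[S i]}"
  have m: "maximal_submodule A (reg A) ?N" by (rule simple_ann_maximal[OF fdalg_axioms S_simple[OF i] v False])
  hence s: "submodule ?N A (reg A)" by (simp add: maximal_submodule_def)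
  have "good (X \<inter> ?N)" unfolding good_def using F m by (intro exI[of _ "insert ?N F"]) auto
  hence "X \<inter> ?N = X" by (intro X(3) A'.sub_Int[OF X(1) s]) auto
  thus ?thesis using a by blast
 qed
 hence "X <= J" using F(3) by (auto simp: J_def)
 thus ?thesis using F by (intro that[of F]) auto
qed

lemma soc_submodule: assumes M: "left_module A M" shows "submodule (soc A M) A M"
proof -
 interpret M: lmod A M using M by simp
 show ?thesis unfolding soc_def by (rule M.span_sub) (auto dest: subD(1))
qed

lemma simple_in_soc: assumes "submodule N A M" "simple_mod A (restr M N)" shows "N <= soc A M"
 unfolding soc_def span_in_def using assms by blast

text \<open>Semisimplicity of \<open>A\<close> modulo a finite intersection of maximal left ideals,
  made explicit. Let \<open>X\<close> be the intersection of \<open>F\<close>. If \<open>X\<close>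
  is not inside \<open>N\<close>, write \<open>1 = a + b\<close> with \<open>a\<close> in
  \<open>X\<close> and \<open>b\<close> in \<open>N\<close>. Then \<open>b x\<close> is killed by
  \<open>X\<close> and falls under the induction hypothesis, while \<open>a x\<close> is killed by
  \<open>N\<close> and so is zero or generates a simple submodule.\<close>

lemma finite_inter_soc:
 assumes M: "left_module A M" and F: "finite F" "!!N. N : F ==> maximal_submodule A (reg A) N"
  and x: "x : car M" and z: "!!a. a : car A \<inter> \<Inter>F ==> a *[M] x = 0[M]"
 shows "x : soc A M"
 using F x z
proof (induction F arbitrary: x)
 case empty
 interpret M: lmod A M using M by simp
 have "1[A] *[M] x = 0[M]" using empty by blast
 thus ?case using subD(2)[OF soc_submodule[OF M]] M.smult_one[OF `x : car M`] by simp
next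
 case (insert N F)
 interpret M: lmod A M using M by simp
 interpret A': lmod A "reg A" using reg_left by simp
 interpret AM: two_mods A "reg A" M ..
 have mN: "maximal_submodule A (reg A) N" using insert.prems by simp
 hence sN: "submodule N A (reg A)" by (simp add: maximal_submodule_def)
 let ?X = "car A \<inter> \<Inter>F"
 have "submodule (\<Inter>(insert (car (reg A)) F)) A (reg A)"
  using insert.prems(1) A'.sub_carrier by (intro A'.submodule_Inter) (auto simp: maximal_submodule_def)
 hence sX: "submodule ?X A (reg A)" by simp
 note xc = `x : car M`
 have kill: "a *[M] x = 0[M]" if "a : ?X" "a : N" for a using insert.prems(3)[of a] that by blast
 show ?case
 proof (cases "?X <= N")
  case True
  have "!!N. N : F ==> maximal_submodule A (reg A) N" using insert.prems(1) by blast
  thus ?thesis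
  proof (rule insert.IH[OF _ xc])
   fix a assume a: "a : ?X"
   thus "a *[M] x = 0[M]" using kill subsetD[OF True] by simp
  qed
 next
  case False
  have "?X <+>\<^bsub>reg A\<^esub> N = car (reg A)"
  proof -
   have "submodule (?X <+>\<^bsub>reg A\<^esub> N) A (reg A)" by (rule A'.sub_sum[OF sX sN])
   moreover have "N <= ?X <+>\<^bsub>reg A\<^esub> N" by (rule A'.sum_upper2[OF sX sN])
   moreover have "?X <+>\<^bsub>reg A\<^esub> N ~= N" using A'.sum_upper1[OF sX sN] False by blast
   ultimately show ?thesis using mN unfolding maximal_submodule_def by blast
  qed
  hence "1[A] : ?X <+>\<^bsub>reg A\<^esub> N" by simp
  then obtain a b where ab: "a : ?X" "b : N" "1[A] = a +[A] b" by (auto simp: A'.mem_set_add)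
  have c: "a : car A" "b : car A" using ab(1) A'.sub_mem[OF sN ab(2)] by auto
  have split: "d = d \<otimes>[A] a +[A] d \<otimes>[A] b" if "d : car A" for d
   using A.r_one[OF that] unfolding ab(3) A.r_distr[OF c that] by (rule sym)
  have "b *[M] x : soc A M"
  proof (rule insert.IH)
   show "!!N. N : F ==> maximal_submodule A (reg A) N" using insert.prems(1) by blast
   show "b *[M] x : car M" using c xc by simp
   fix d assume d: "d : ?X"
   have dc: "d : car A" using d by blast
   have "d \<otimes>[A] a : ?X" using subD(5)[OF sX dc ab(1)] by simp
   moreover have "d \<otimes>[A] a +[A] d \<otimes>[A] b : ?X" using split[OF dc] d by simp
   ultimately have "d \<otimes>[A] b : ?X" using A'.submodule_add_iff[OF sX, of "d \<otimes>[A] a" "d \<otimes>[A] b"] dc c by simp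
   moreover have "d \<otimes>[A] b : N" using subD(5)[OF sN dc ab(2)] by simp
   ultimately have "(d \<otimes>[A] b) *[M] x = 0[M]" by (rule kill)
   thus "d *[M] (b *[M] x) = 0[M]" using M.smult_assoc1[OF dc c(2) xc] by simp
  qed
  moreover have "a *[M] x : soc A M"
  proof -
   let ?y = "a *[M] x"
   have yc: "?y : car M" using c xc by simp
   let ?g = "\<lambda>d\<in>car A. d *[M] ?y"
   have g: "?g : lhom A (reg A) M" by (rule act_lhom[OF M yc])
   let ?Z = "{d : car (reg A). ?g d = 0[M]}"
   have Z: "submodule ?Z A (reg A)" by (rule AM.lhom_kernel[OF g])
   have "N <= ?Z"
   proof
    fix d assume d: "d : N"
    have dc: "d : car A" using A'.sub_mem[OF sN d] by simp
    have X: "d \<otimes>[A] a : ?X" using subD(5)[OF sX dc ab(1)] by simp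
    have "d \<otimes>[A] b : N" using subD(5)[OF sN dc ab(2)] by simp
    moreover have "d \<otimes>[A] b +[A] d \<otimes>[A] a : N" using split[OF dc] d dc c by (simp add: A_add(4))
    ultimately have "d \<otimes>[A] a : N" using A'.submodule_add_iff[OF sN, of "d \<otimes>[A] b" "d \<otimes>[A] a"] dc c by simp
    hence "(d \<otimes>[A] a) *[M] x = 0[M]" by (rule kill[OF X])
    thus "d : ?Z" using M.smult_assoc1[OF dc c(1) xc] dc by simp
   qed
   hence "?Z = N | ?Z = car (reg A)" using mN Z unfolding maximal_submodule_def by blast
   thus ?thesis
   proof
    assume "?Z = car (reg A)"
    hence "1[A] : ?Z" by simp
    hence "?y = 0[M]" using yc by simp
    thus ?thesis using subD(2)[OF soc_submodule[OF M]] by simp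
   next
    assume ZN: "?Z = N"
    let ?Y = "?g ` car (reg A)"
    have Y: "submodule ?Y A M" by (rule AM.lhom_image[OF g A'.sub_carrier])
    have lY: "left_module A (restr M ?Y)" by (rule M.sub_left[OF Y])
    have gY: "?g : lhom A (reg A) (restr M ?Y)" by (rule lhom_image_target[OF g order_refl])
    have "isomorphic A (quot (reg A) N) (restr M ?Y)"
     by (rule A'.isomorphic_quotI[OF gY _ lY]) (use ZN in simp_all)
    then obtain h where "h : lhom A (quot (reg A) N) (restr M ?Y)"
     "bij_betw h (car (quot (reg A) N)) (car (restr M ?Y))" by (auto simp: isomorphic_def)
    hence "simple_mod A (restr M ?Y)"
     by (rule simple_mod_iso[OF maximal_quot_simple[OF A'.left mN] lY])
    hence "?Y <= soc A M" by (rule simple_in_soc[OF Y])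
    moreover have "?y : ?Y" using yc by (intro image_eqI[of _ _ "1[A]"]) simp_all
    ultimately show ?thesis by blast
   qed
  qed
  ultimately have "a *[M] x +[M] b *[M] x : soc A M" using subD(4)[OF soc_submodule[OF M]] by blast
  moreover have "(a +[A] b) *[M] x = x" unfolding ab(3)[symmetric] by (rule M.smult_one[OF xc])
  ultimately show ?thesis unfolding M.smult_l_distr[OF c xc] by simp
 qed
qed

text \<open>By \<open>J_finite\<close> an element killed by \<open>J\<close> is killed by a finite
  intersection of maximal left ideals. With \<open>rad_le_iff\<close> this turns the radical and the
  socle series into statements about multiplication by \<open>J\<close>.\<close>

lemma soc_iff:
 assumes M: "left_module A M"
 shows "x : soc A M \<longleftrightarrow> x : car M & (ALL a:J. a *[M] x = 0[M])"
proof
 interpret M: lmod A M using M by simp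
 let ?Z = "{x : car M. ALL a:J. a *[M] x = 0[M]}"
 have right: "a \<otimes>[A] b : J" if "a : J" "b : car A" for a b
 proof -
  have "(a \<otimes>[A] b) *[S i] v = 0[S i]" if i: "i : I" "v : car (S i)" for i v
  proof -
   interpret Si: lmod A "S i" using S_simple[OF i(1)] by (simp add: simple_mod_def)
   show ?thesis using `a : J` `b : car A` i by (simp add: Si.smult_assoc1 J_def)
  qed
  thus ?thesis using that by (simp add: J_def)
 qed
 have Z: "submodule ?Z A M"
 proof (rule M.submoduleI)
  fix b x assume b: "b : car A" and x: "x : ?Z"
  have "a *[M] (b *[M] x) = 0[M]" if "a : J" for a
   using M.smult_assoc1[OF J_carrier[OF that] b, of x] right[OF that b] x by simp
  thus "b *[M] x : ?Z" using b x by simp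
 qed (auto simp: M.smult_r_distr J_carrier)
 have "N <= ?Z" if "submodule N A M" "simple_mod A (restr M N)" for N
  using J_kills[OF that(2)] M.sub_mem[OF that(1)] by auto
 hence "soc A M <= ?Z" unfolding soc_def by (intro M.span_least[OF Z]) blast
 thus "x : soc A M ==> x : car M & (ALL a:J. a *[M] x = 0[M])" by blast
 assume x: "x : car M & (ALL a:J. a *[M] x = 0[M])"
 obtain F where F: "finite F" "ALL N:F. maximal_submodule A (reg A) N" "car A \<inter> \<Inter>F <= J"
  using J_finite .
 show "x : soc A M" by (rule finite_inter_soc[OF M F(1)]) (use x F(2,3) in blast)+
qed

lemma rad_submodule: assumes M: "left_module A M" shows "submodule (rad A M) A M"
proof -
 interpret M: lmod A M using M by simp
 have "submodule (\<Inter>(insert (car M) {N. maximal_submodule A M N})) A M"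
  using M.sub_carrier by (intro M.submodule_Inter) (auto simp: maximal_submodule_def)
 thus ?thesis by (simp add: rad_def)
qed

text \<open>The equation \<open>Rad M = J M\<close>, tested against submodules. If some
  \<open>x\<close> in the radical were outside \<open>U\<close>, let \<open>N\<close> be maximal
  among the submodules above \<open>U\<close> that avoid \<open>x\<close>. Then \<open>M/N\<close>
  is killed by \<open>J\<close>, hence semisimple, and every submodule properly above
  \<open>N\<close> contains \<open>x\<close>. So no proper submodule lies between: \<open>N\<close>
  is maximal and must contain \<open>x\<close>.\<close>

lemma rad_le_iff:
 assumes M: "fd K A M" and U: "submodule U A M"
 shows "rad A M <= U \<longleftrightarrow> (ALL a:J. ALL x:car M. a *[M] x : U)"
proof
 interpret M: lmod A M by (rule fd_lmod[OF M])
 assume r: "rad A M <= U"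
 show "ALL a:J. ALL x:car M. a *[M] x : U"
 proof (intro ballI)
  fix a x assume "a : J" "x : car M"
  hence "a *[M] x : rad A M"
   using J_maximal[OF M.left] J_carrier by (auto simp: rad_def)
  with r show "a *[M] x : U" by blast
 qed
next
 interpret M: lmod A M by (rule fd_lmod[OF M])
 assume J: "ALL a:J. ALL x:car M. a *[M] x : U"
 show "rad A M <= U"
 proof
  fix x assume x: "x : rad A M"
  show "x : U"
  proof (rule ccontr)
   assume "x ~: U"
   then obtain N where N: "submodule N A M" "U <= N" "x ~: N"
    "!!X. [|submodule X A M; x ~: X; N <= X|] ==> X = N"
    using exists_maximal_submodule[OF M U, of "%N. x ~: N"] by metis
   have xc: "x : car M" using x by (simp add: rad_def)
   have lQ: "left_module A (quot M N)" by (rule M.quot_left[OF N(1)])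
   interpret Q: lmod A "quot M N" using lQ by simp
   interpret MQ: two_mods A M "quot M N" ..
   note q = M.qmap_lhom[OF N(1)]
   have soc: "soc A (quot M N) = car (quot M N)"
   proof
    show "soc A (quot M N) <= car (quot M N)" by (rule subD(1)[OF soc_submodule[OF lQ]])
    show "car (quot M N) <= soc A (quot M N)"
    proof
     fix Y assume Y: "Y : car (quot M N)"
     then obtain y where y: "y : car M" "Y = M.qmap N y" using M.qmap_surj[OF N(1)] by blast
     have "a *[quot M N] Y = 0[quot M N]" if a: "a : J" for a
      unfolding y(2) lhom_smult[OF q J_carrier[OF a] y(1), symmetric]
      using M.qmap_zero[OF N(1)] J a y(1) N(2) J_carrier[OF a] by auto
     thus "Y : soc A (quot M N)" using Y by (simp add: soc_iff[OF lQ])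
    qed
   qed
   have "maximal_submodule A M N"
    unfolding maximal_submodule_def
   proof (intro conjI allI impI)
    show "N ~= car M" using N(3) xc by blast
    fix N' assume N': "submodule N' A M & N <= N'"
    show "N' = N | N' = car M"
    proof (rule ccontr)
     assume ne: "~ (N' = N | N' = car M)"
     hence xN': "x : N'" using N(4) N' by blast
     let ?N' = "M.qmap N ` N'"
     have sN': "submodule ?N' A (quot M N)" by (rule MQ.lhom_image[OF q]) (use N' in simp)
     have inN': "y : N'" if y: "y : car M" "M.qmap N y : ?N'" for y
     proof -
      obtain z where z: "z : N'" "M.qmap N y = M.qmap N z" using y(2) by blast
      have zc: "z : car M" using M.sub_mem N' z(1) by blast
      hence "y -[M] z : N'" using M.qmap_eq_iff[OF N(1) y(1) zc] z(2) N' by blast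
      hence "(y -[M] z) +[M] z : N'" using subD(4) N' z(1) by metis
      thus ?thesis using y(1) zc by simp
     qed
     have "EX X. submodule X A (quot M N) & simple_mod A (restr (quot M N) X) & ~ X <= ?N'"
     proof (rule ccontr)
      assume "~ ?thesis"
      hence "\<Union>{X. submodule X A (quot M N) & simple_mod A (restr (quot M N) X)} <= ?N'" by blast
      hence "soc A (quot M N) <= ?N'" unfolding soc_def by (rule Q.span_least[OF sN'])
      hence "car M <= N'" using soc inN' M.qmap_surj[OF N(1)] by blast
      thus False using ne N' subD(1) by blast
     qed
     then obtain X where X: "submodule X A (quot M N)" "simple_mod A (restr (quot M N) X)" "~ X <= ?N'" by blast
     have "submodule (X \<inter> ?N') A (restr (quot M N) X)"
      using Q.sub_Int[OF X(1) sN'] by (simp add: Q.sub_restr_iff[OF X(1)])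
     hence "X \<inter> ?N' = {0[quot M N]} | X \<inter> ?N' = X" using X(2) by (simp add: simple_mod_def)
     hence X0: "X \<inter> ?N' = {0[quot M N]}" using X(3) by blast
     let ?U = "{y : car M. M.qmap N y : X}"
     have sU: "submodule ?U A M" by (rule MQ.lhom_preimage[OF q X(1)])
     have NU: "N <= ?U"
     proof
      fix y assume y: "y : N"
      hence "y : car M" by (rule M.sub_mem[OF N(1)])
      thus "y : ?U" using M.qmap_zero[OF N(1), of y] y subD(2)[OF X(1)] by simp
     qed
     have "?U ~= N"
     proof
      assume UN: "?U = N"
      obtain Y where Y: "Y : X" "Y ~: ?N'" using X(3) by blast
      then obtain y where y: "y : car M" "Y = M.qmap N y"
       using subD(1)[OF X(1)] M.qmap_surj[OF N(1)] by blast
      hence "y : N" using UN Y by blast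
      thus False using Y y N' by blast
     qed
     hence "x : ?U" using N(4)[OF sU _ NU] by blast
     hence "M.qmap N x : X \<inter> ?N'" using xN' by blast
     hence "x : N" using X0 M.qmap_zero[OF N(1) xc] by blast
     thus False using N(3) by simp
    qed
   qed (fact N(1))
   thus False using x N(3) by (auto simp: rad_def)
  qed
 qed
qed

lemma rad_proper: assumes M: "fd K A M" and nz: "car M ~= {0[M]}" shows "rad A M ~= car M"
proof -
 interpret M: lmod A M by (rule fd_lmod[OF M])
 obtain N where "maximal_submodule A M N" using exists_maximal[OF M M.sub_zero] nz by metis
 thus ?thesis by (auto simp: rad_def maximal_submodule_def dest: subD(1))
qed

lemma rad_sub: assumes M: "left_module A M" shows "submodule (rad_pow A M j) A M"
proof (induction j)
 interpret M: lmod A M using M by simp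
 case 0 show ?case by (simp add: M.sub_carrier)
 case (Suc j)
 have "submodule (rad A (restr M (rad_pow A M j))) A (restr M (rad_pow A M j))"
  by (rule rad_submodule[OF M.sub_left[OF Suc]])
 thus ?case by (simp add: M.sub_restr_iff[OF Suc])
qed

lemma rad_pow_Suc_le_iff:
 assumes M: "fd K A M" and U: "submodule U A M"
 shows "rad_pow A M (Suc j) <= U \<longleftrightarrow> (ALL a:J. ALL x:rad_pow A M j. a *[M] x : U)"
proof -
 interpret M: lmod A M by (rule fd_lmod[OF M])
 let ?N = "rad_pow A M j"
 have N: "submodule ?N A M" by (rule rad_sub[OF M.left])
 have fN: "fd K A (restr M ?N)" by (rule fd_sub[OF M N])
 have UN: "submodule (U \<inter> ?N) A (restr M ?N)" using M.sub_Int[OF U N] by (simp add: M.sub_restr_iff[OF N])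
 have "rad A (restr M ?N) <= ?N" using subD(1)[OF rad_submodule[OF fd_left[OF fN]]] by simp
 hence "rad_pow A M (Suc j) <= U \<longleftrightarrow> rad A (restr M ?N) <= U \<inter> ?N" by auto
 also have "... \<longleftrightarrow> (ALL a:J. ALL x:?N. a *[M] x : U \<inter> ?N)" using rad_le_iff[OF fN UN] by simp
 also have "... \<longleftrightarrow> (ALL a:J. ALL x:?N. a *[M] x : U)" using subD(5)[OF N] J_carrier by blast
 finally show ?thesis .
qed

lemma rad_pow_Suc_mem:
 assumes M: "fd K A M" and "a : J" "x : rad_pow A M j" shows "a *[M] x : rad_pow A M (Suc j)"
 using rad_pow_Suc_le_iff[OF M rad_sub[OF fd_left[OF M]], of j "Suc j"] assms by blast

lemma rad_pow_antimono: assumes M: "fd K A M" and "i <= j" shows "rad_pow A M j <= rad_pow A M i"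
proof (rule lift_Suc_antimono_le[OF _ assms(2)])
 fix j
 note N = rad_sub[OF fd_left[OF M], of j]
 show "rad_pow A M (Suc j) <= rad_pow A M j"
  using rad_pow_Suc_le_iff[OF M N] subD(5)[OF N] J_carrier by blast
qed

lemma rad_pow_strict:
 assumes M: "fd K A M" and "rad_pow A M j ~= {0[M]}" shows "rad_pow A M (Suc j) ~= rad_pow A M j"
 using rad_proper[OF fd_sub[OF M rad_sub[OF fd_left[OF M]]], of j] assms(2) by simp

text \<open>Guarantees that the \<open>LEAST\<close> in \<open>loewy_length\<close> ranges over a
  nonempty set: the dimension drops strictly as long as the radical power is not zero.\<close>

lemma loewy_zero: assumes M: "fd K A M" shows "rad_pow A M (loewy_length A M) = {0[M]}"
proof -
 let ?d = "%j. kdim K A M (rad_pow A M j)"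
 have "EX j. rad_pow A M j = {0[M]}"
 proof (rule ccontr)
  assume n: "~ ?thesis"
  have s: "submodule (rad_pow A M j) K (kmod A M)" for j
   by (rule fd_kmod_sub[OF M rad_sub[OF fd_left[OF M]]])
  have "?d (Suc j) < ?d j" for j
   using kdim_mono[OF M s s rad_pow_antimono[OF M], of j "Suc j"] rad_pow_strict[OF M, of j] n by fastforce
  hence "?d j + j <= ?d 0" for j
  proof (induction j)
   case (Suc j)
   hence "?d (Suc j) < ?d j" "?d j + j <= ?d 0" by blast+
   thus ?case by linarith
  qed simp
  from this[of "Suc (?d 0)"] show False by simp
 qed
 thus ?thesis unfolding loewy_length_def by (rule LeastI_ex)
qed

lemma loewy_le: "rad_pow A M j = {0[M]} ==> loewy_length A M <= j"
 unfolding loewy_length_def by (rule Least_le)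

lemma rad_pow_zero_iff: assumes M: "fd K A M" shows "rad_pow A M j = {0[M]} \<longleftrightarrow> loewy_length A M <= j"
 using loewy_le loewy_zero[OF M] rad_pow_antimono[OF M, of "loewy_length A M" j]
  subD(2)[OF rad_sub[OF fd_left[OF M]], of j] by auto

lemma soc_pow_step:
 assumes M: "left_module A M" and N: "submodule N A M"
 shows "\<Union>(soc A (quot M N)) = {x : car M. ALL a:J. a *[M] x : N}"
proof -
 interpret M: lmod A M using M by simp
 have lQ: "left_module A (quot M N)" by (rule M.quot_left[OF N])
 note q = M.qmap_lhom[OF N]
 have qs: "M.qmap N x : soc A (quot M N) \<longleftrightarrow> (ALL a:J. a *[M] x : N)" if x: "x : car M" for x
 proof -
  have "a *[quot M N] M.qmap N x = 0[quot M N] \<longleftrightarrow> a *[M] x : N" if a: "a : J" for a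
   unfolding lhom_smult[OF q J_carrier[OF a] x, symmetric]
   using M.qmap_zero[OF N] J_carrier[OF a] x by simp
  thus ?thesis using lhom_mem[OF q x] by (simp add: soc_iff[OF lQ])
 qed
 show ?thesis
 proof (rule subset_antisym; rule subsetI)
  fix x assume "x : \<Union>(soc A (quot M N))"
  then obtain Y where Y: "Y : soc A (quot M N)" "x : Y" by blast
  then obtain y where y: "y : car M" "Y = M.qmap N y"
   using subD(1)[OF soc_submodule[OF lQ]] M.qmap_surj[OF N] by blast
  hence x: "x : car M" "M.qmap N x = Y" using M.qmap_of_mem[OF N y(1), of x] Y(2) by simp_all
  thus "x : {x : car M. ALL a:J. a *[M] x : N}" using qs[OF x(1)] Y(1) by simp
 next
  fix x assume "x : {x : car M. ALL a:J. a *[M] x : N}"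
  thus "x : \<Union>(soc A (quot M N))" using qs[of x] M.qmap_mem[OF N, of x] by blast
 qed
qed

lemma soc_sub: assumes M: "left_module A M" shows "submodule (soc_pow A M j) A M"
proof (induction j)
 interpret M: lmod A M using M by simp
 case 0 show ?case by (simp add: M.sub_zero)
 case (Suc j)
 interpret Q: lmod A "quot M (soc_pow A M j)" using M.quot_left[OF Suc] by simp
 interpret MQ: two_mods A M "quot M (soc_pow A M j)" ..
 have "\<Union>(soc A (quot M (soc_pow A M j))) = {x : car M. M.qmap (soc_pow A M j) x : soc A (quot M (soc_pow A M j))}"
  (is "?L = ?R")
 proof
  show "?R <= ?L" using M.qmap_mem[OF Suc] by blast
  show "?L <= ?R"
  proof
   fix x assume "x : ?L"
   then obtain Y where Y: "Y : soc A (quot M (soc_pow A M j))" "x : Y" by blast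
   then obtain y where y: "y : car M" "Y = M.qmap (soc_pow A M j) y"
    using subD(1)[OF soc_submodule[OF Q.left]] M.qmap_surj[OF Suc] by blast
   thus "x : ?R" using M.qmap_of_mem[OF Suc y(1), of x] Y by simp
  qed
 qed
 thus ?case using MQ.lhom_preimage[OF M.qmap_lhom[OF Suc] soc_submodule[OF Q.left]] by simp
qed

lemma soc_pow_Suc:
 assumes M: "left_module A M"
 shows "soc_pow A M (Suc j) = {x : car M. ALL a:J. a *[M] x : soc_pow A M j}"
 using soc_pow_step[OF M soc_sub[OF M]] by simp

text \<open>One step down the radical series of the source corresponds to one step up the socle
  series of the target, since both steps are conditions on multiplication by \<open>J\<close>. The
  comparisons between the two series below rest on this adjunction.\<close>

lemma rad_soc:
 assumes M: "fd K A M" and N: "left_module A N" and f: "f : lhom A M N"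
 shows "f ` rad_pow A M j <= soc_pow A N t \<longleftrightarrow> f ` car M <= soc_pow A N (t + j)"
proof (induction j arbitrary: t)
 case (Suc j)
 interpret M: lmod A M by (rule fd_lmod[OF M])
 interpret N: lmod A N using N by simp
 interpret MN: two_mods A M N ..
 note rM = rad_sub[OF M.left]
 have rc: "x : car M" if "x : rad_pow A M j" for x j by (rule M.sub_mem[OF rM that])
 let ?U = "{x : car M. f x : soc_pow A N t}"
 have U: "submodule ?U A M" by (rule MN.lhom_preimage[OF f soc_sub[OF N]])
 have "f ` rad_pow A M (Suc j) <= soc_pow A N t \<longleftrightarrow> rad_pow A M (Suc j) <= ?U"
  using subD(1)[OF rM[of "Suc j"]] by blast
 also have "... \<longleftrightarrow> (ALL a:J. ALL x:rad_pow A M j. a *[M] x : ?U)" by (rule rad_pow_Suc_le_iff[OF M U])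
 also have "... \<longleftrightarrow> (ALL a:J. ALL x:rad_pow A M j. a *[N] f x : soc_pow A N t)"
  using rc J_carrier by (auto simp: lhom_smult[OF f])
 also have "... \<longleftrightarrow> f ` rad_pow A M j <= soc_pow A N (Suc t)"
  unfolding soc_pow_Suc[OF N] using rc lhom_mem[OF f] by blast
 also have "... \<longleftrightarrow> f ` car M <= soc_pow A N (Suc t + j)" by (rule Suc.IH)
 finally show ?case by simp
qed simp

lemma soc_pow_full_iff:
 assumes M: "fd K A M" shows "soc_pow A M j = car M \<longleftrightarrow> loewy_length A M <= j"
proof -
 interpret M: lmod A M by (rule fd_lmod[OF M])
 note rM = rad_sub[OF M.left, of j]
 have "(\<lambda>x\<in>car M. x) ` rad_pow A M j = rad_pow A M j" "(\<lambda>x\<in>car M. x) ` car M = car M"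
  using subD(1)[OF rM] by (auto simp: image_iff subset_eq)
 hence "rad_pow A M j <= {0[M]} \<longleftrightarrow> car M <= soc_pow A M j"
  using rad_soc[OF M M.left lhom_id[OF M.left], of j 0] by simp
 thus ?thesis unfolding rad_pow_zero_iff[OF M, symmetric]
  using subD(1)[OF soc_sub[OF M.left, of j]] subD(2)[OF rM] by blast
qed

lemma soc_pow_mono: assumes M: "left_module A M" and "i <= j" shows "soc_pow A M i <= soc_pow A M j"
proof (rule lift_Suc_mono_le[OF _ assms(2)])
 fix j
 note N = soc_sub[OF M, of j]
 show "soc_pow A M j <= soc_pow A M (Suc j)"
  unfolding soc_pow_Suc[OF M] using subD(1,5)[OF N] J_carrier by blast
qed

text \<open>Once two consecutive terms agree the series is constant, but at the Loewy length it has
  reached the whole module.\<close>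

lemma soc_pow_strict:
 assumes M: "fd K A M" and j: "j < loewy_length A M" shows "soc_pow A M j ~= soc_pow A M (Suc j)"
proof
 note l = fd_left[OF M]
 assume e: "soc_pow A M j = soc_pow A M (Suc j)"
 have "soc_pow A M (j + k) = soc_pow A M j" for k
 proof (induction k)
  case (Suc k)
  have "soc_pow A M (Suc (j + k)) = soc_pow A M (Suc j)" unfolding soc_pow_Suc[OF l] Suc ..
  also have "... = soc_pow A M j" by (rule e[symmetric])
  finally show ?case unfolding add_Suc_right .
 qed simp
 from this[of "loewy_length A M - j"] have "soc_pow A M j = soc_pow A M (loewy_length A M)" using j by simp
 also have "... = car M" unfolding soc_pow_full_iff[OF M] by (rule order_refl)
 finally show False unfolding soc_pow_full_iff[OF M] using j by simp
qed

end

section \<open>The algebra \<open>A\<close> with its projective covers and injective hulls\<close>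

locale base = fdalg K A
 for K :: "('k, 'e) ring_scheme" (structure) and A :: "('k, 'a) module" (structure) +
 fixes n :: nat and L :: "nat => ('a, 'l) module" and P :: "nat => ('a, 'p) module" and Q :: "nat => ('a, 'q) module"
 assumes simples: "simple_modules A {1..n} L"
  and covers: "i : {1..n} ==> projective_cover A (P i) (L i)"
  and hulls: "i : {1..n} ==> injective_hull A (Q i) (L i)"
  and ends: "i : {1..n} ==> has_dim K (end_alg A (L i)) 1"
begin

lemma L_simple: "i : {1..n} ==> simple_mod A (L i)"
 using simples unfolding simple_modules_def by blast

lemma L_noniso: "[|i : {1..n}; j : {1..n}; isomorphic A (L i) (L j)|] ==> i = j"
 using simples unfolding simple_modules_def by blast

lemma end_alg_left_module: assumes M: "left_module A M" shows "left_module K (end_alg A M)"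
proof -
 interpret H: lmod K "homk A M M" using homk_left[OF M M] by simp
 have c: "car (end_alg A M) = car (homk A M M)" "0[end_alg A M] = 0[homk A M M]"
  "add (end_alg A M) = add (homk A M M)" "smult (end_alg A M) = smult (homk A M M)"
  by (simp_all add: end_alg_def homk_def)
 have "abelian_group (end_alg A M)"
  by (rule abelian_groupI) (use H.M.l_neg H.M.a_inv_closed in \<open>auto simp: c H.M.a_ac simp del: homk_simps\<close>)
 thus ?thesis
  by (intro left_moduleI)
   (auto simp: c K.ring_axioms H.smult_l_distr H.smult_r_distr H.smult_assoc1 simp del: homk_simps)
qed

text \<open>Both \<open>h\<close> and the identity are multiples of the single basis vector, and the
  coefficient of the identity is invertible.\<close>

lemma end_scalar:
 assumes i: "i : {1..n}" and h: "h : lhom A (L i) (L i)"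
 obtains c where "c : car K" "ALL x:car (L i). h x = sc c *[L i] x"
proof -
 interpret Li: lmod A "L i" using L_simple[OF i] by (simp add: simple_mod_def)
 interpret E: lmod K "end_alg A (L i)" using end_alg_left_module[OF Li.left] by simp
 have s: "car (end_alg A (L i)) = lhom A (L i) (L i)"
  "smult (end_alg A (L i)) c f = (\<lambda>x\<in>car (L i). sc c *[L i] f x)" for c f
  by (simp_all add: end_alg_def)
 from ends[OF i] obtain B where B: "B <= car (end_alg A (L i))" "card B = 1"
  "span_in K (end_alg A (L i)) B = car (end_alg A (L i))" by (auto simp: has_dim_def)
 from B(2) obtain b where b: "B = {b}" by (auto simp: card_1_singleton_iff)
 have bc: "b : car (end_alg A (L i))" using B b by simp
 have all: "EX c:car K. f = c *[end_alg A (L i)] b" if "f : lhom A (L i) (L i)" for f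
 proof -
  have "{b} <= E.cyc b" using E.cyc_self[OF bc] by simp
  hence "span_in K (end_alg A (L i)) B <= E.cyc b" unfolding b by (rule E.span_least[OF E.cyc_sub[OF bc]])
  thus ?thesis using that s(1) B(3) by (auto simp: E.cyc_def)
 qed
 obtain d where d: "d : car K" "(\<lambda>x\<in>car (L i). x) = d *[end_alg A (L i)] b"
  using all[OF lhom_id[OF Li.left]] by blast
 obtain c where c: "c : car K" "h = c *[end_alg A (L i)] b" using all[OF h] by blast
 have bl: "b : lhom A (L i) (L i)" using bc s(1) by simp
 have db: "sc d *[L i] b x = x" if "x : car (L i)" for x
 proof -
  have "(d *[end_alg A (L i)] b) x = x" unfolding d(2)[symmetric] using that by simp
  thus ?thesis using that by (simp add: s(2))
 qed
 have "d ~= 0[K]"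
 proof
  assume d0: "d = 0[K]"
  have "sc d = 0[A]" unfolding d0 by (rule smult_l_null) simp
  hence "x = 0[L i]" if "x : car (L i)" for x using db[OF that] lhom_mem[OF bl that] by simp
  hence "car (L i) = {0[L i]}" using Li.M.zero_closed by blast
  thus False using L_simple[OF i] by (simp add: simple_mod_def)
 qed
 hence u: "d : Units K" using d(1) by (simp add: K.field_Units)
 have "h x = sc (c \<otimes>[K] inv\<^bsub>K\<^esub> d) *[L i] x" if x: "x : car (L i)" for x
 proof -
  have bx: "b x : car (L i)" by (rule lhom_mem[OF bl x])
  have id: "inv\<^bsub>K\<^esub> d : car K" using u by simp
  have eq: "sc (c \<otimes>[K] inv\<^bsub>K\<^esub> d) \<otimes>[A] sc d = sc c"
   using c(1) d(1) id u by (simp add: sc_mult smult_assoc1[symmetric] K.m_assoc)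
  have "sc (c \<otimes>[K] inv\<^bsub>K\<^esub> d) *[L i] x = sc (c \<otimes>[K] inv\<^bsub>K\<^esub> d) *[L i] (sc d *[L i] b x)" using db[OF x] by simp
  also have "... = (sc (c \<otimes>[K] inv\<^bsub>K\<^esub> d) \<otimes>[A] sc d) *[L i] b x"
   using c(1) d(1) id bx by (intro Li.smult_assoc1[symmetric]) simp_all
  also have "... = sc c *[L i] b x" unfolding eq ..
  also have "... = h x" unfolding c(2) using x by (simp add: s(2))
  finally show ?thesis by simp
 qed
 thus ?thesis using that[of "c \<otimes>[K] inv\<^bsub>K\<^esub> d"] c(1) u by simp
qed

lemma P_fd: assumes "i : {1..n}" shows "fd K A (P i)"
 by (rule fg_imp_fd) (use covers[OF assms] in \<open>simp add: projective_cover_def projective_def\<close>)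

lemma cover_map:
 assumes i: "i : {1..n}"
 obtains f where "f : lhom A (P i) (L i)" "f ` car (P i) = car (L i)"
  "!!U. [|submodule U A (P i); U ~= car (P i)|] ==> U <= {x : car (P i). f x = 0[L i]}"
proof -
 from covers[OF i] obtain f where f: "f : lhom A (P i) (L i)" "f ` car (P i) = car (L i)"
  "!!U. [|submodule U A (P i); U <+>\<^bsub>P i\<^esub> a_kernel (P i) (L i) f = car (P i)|] ==> U = car (P i)"
  by (auto simp: projective_cover_def)
 interpret Pi: lmod A "P i" by (rule fd_lmod[OF P_fd[OF i]])
 interpret Li: lmod A "L i" using L_simple[OF i] by (simp add: simple_mod_def)
 interpret PL: two_mods A "P i" "L i" ..
 let ?Z = "{x : car (P i). f x = 0[L i]}"
 have k: "a_kernel (P i) (L i) f = ?Z" by (simp add: a_kernel_def')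
 have Z: "submodule ?Z A (P i)" by (rule PL.lhom_kernel[OF f(1)])
 have "U <= ?Z" if U: "submodule U A (P i)" "U ~= car (P i)" for U
 proof (rule ccontr)
  assume n: "~ U <= ?Z"
  obtain u where u: "u : U" "f u ~= 0[L i]" using n Pi.sub_mem[OF U(1)] by blast
  have fU: "f ` U = car (L i)" by (rule PL.lhom_simple_surj[OF L_simple[OF i] f(1) U(1) u])
  have "car (P i) <= U <+>\<^bsub>P i\<^esub> ?Z"
  proof
   fix x assume x: "x : car (P i)"
   hence "f x : f ` U" unfolding fU by (rule lhom_mem[OF f(1)])
   then obtain u where u: "u : U" "f x = f u" by blast
   have uc: "u : car (P i)" by (rule Pi.sub_mem[OF U(1) u(1)])
   have "f (x -[P i] u) = 0[L i]"
    using x uc u(2) lhom_mem[OF f(1)] by (simp add: PL.lhom_minus[OF f(1)] Li.diff_zero_iff)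
   hence "u +[P i] (x -[P i] u) : U <+>\<^bsub>P i\<^esub> ?Z" using u(1) x uc by (intro Pi.set_addI) auto
   thus "x : U <+>\<^bsub>P i\<^esub> ?Z" using x uc by (simp add: Pi.M.a_comm[OF uc])
  qed
  hence "U <+>\<^bsub>P i\<^esub> ?Z = car (P i)" using subD(1)[OF Pi.sub_sum[OF U(1) Z]] by blast
  thus False using f(3)[OF U(1)] U(2) k by simp
 qed
 with f that show ?thesis by blast
qed

text \<open>The epimorphism from \<open>A\<close> sending \<open>a\<close> to \<open>a p\<close>
  splits as \<open>P i\<close> is projective, and the idempotent is the image of \<open>p\<close>
  under the splitting. A nonzero vector of \<open>e (L j)\<close> gives a map from
  \<open>P i\<close> onto \<open>L j\<close>, which makes \<open>L j\<close> isomorphic to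
  \<open>L i\<close>. That \<open>e (L i)\<close> is a line comes from
  \<open>end_scalar\<close>.\<close>

lemma pgen_ex:
 assumes i: "i : {1..n}"
 shows "EX e p. pgen e (P i) p &
  (ALL j:{1..n}. kdim K A (L j) (wt (L j) e (car (L j))) = (if i = j then 1 else 0))"
proof -
 obtain f where f: "f : lhom A (P i) (L i)" "f ` car (P i) = car (L i)"
  "!!U. [|submodule U A (P i); U ~= car (P i)|] ==> U <= {x : car (P i). f x = 0[L i]}"
  using cover_map[OF i] by blast
 interpret Pi: lmod A "P i" by (rule fd_lmod[OF P_fd[OF i]])
 interpret Li: lmod A "L i" using L_simple[OF i] by (simp add: simple_mod_def)
 interpret A': lmod A "reg A" using reg_left by simp
 interpret PL: two_mods A "P i" "L i" ..
 interpret PA: two_mods A "P i" "reg A" ..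
 have "EX x:car (L i). x ~= 0[L i]" using L_simple[OF i] Li.M.zero_closed unfolding simple_mod_def by blast
 then obtain y where y: "y : car (L i)" "y ~= 0[L i]" ..
 from y(1) have "y : f ` car (P i)" unfolding f(2) .
 then obtain p where p: "p : car (P i)" "f p ~= 0[L i]" using y(2) by blast
 have cyc: "Pi.cyc p = car (P i)"
 proof (rule ccontr)
  assume "Pi.cyc p ~= car (P i)"
  from f(3)[OF Pi.cyc_sub[OF p(1)] this] Pi.cyc_self[OF p(1)] p(2) show False by blast
 qed
 let ?\<rho> = "\<lambda>a\<in>car A. a *[P i] p"
 have r: "?\<rho> : lhom A (reg A) (P i)" by (rule act_lhom[OF Pi.left p(1)])
 have rs: "?\<rho> ` car (reg A) = car (P i)" unfolding cyc[symmetric] by (auto simp: Pi.cyc_def)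
 have pr: "projective A (P i)" using covers[OF i] by (simp add: projective_cover_def)
 obtain \<sigma> where \<sigma>: "\<sigma> : lhom A (P i) (reg A)" "!!y. y : car (P i) ==> ?\<rho> (\<sigma> y) = (\<lambda>y\<in>car (P i). y) y"
  using projective_lift[OF pr reg_fd P_fd[OF i] r rs lhom_id[OF Pi.left]] by blast
 let ?e = "\<sigma> p"
 have e: "?e : car A" using lhom_mem[OF \<sigma>(1) p(1)] by simp
 have ep: "?e *[P i] p = p" using \<sigma>(2)[OF p(1)] e p(1) by simp
 have act: "a \<otimes>[A] ?e = \<sigma> (a *[P i] p)" if "a : car A" for a using lhom_smult[OF \<sigma>(1) that p(1)] by simp
 have gen: "ALL y:car (P i). EX a:car A. y = a *[P i] p"
 proof
  fix y assume "y : car (P i)"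
  hence "y : Pi.cyc p" unfolding cyc .
  thus "EX a:car A. y = a *[P i] p" by (auto simp: Pi.cyc_def)
 qed
 have pg: "pgen ?e (P i) p"
  unfolding pgen_def using Pi.left e ep p(1) act gen PA.lhom_zero[OF \<sigma>(1)] by simp
 have fe: "f p : car (L i)" "?e *[L i] f p = f p"
  using lhom_mem[OF f(1) p(1)] lhom_smult[OF f(1) e p(1)] ep by simp_all
 have main: "EX h. h : lhom A (L j) (L i) & bij_betw h (car (L j)) (car (L i)) & h x = f p"
  if j: "j : {1..n}" and x: "x : wt (L j) ?e (car (L j))" "x ~= 0[L j]" for j x
 proof -
  interpret Lj: lmod A "L j" using L_simple[OF j] by (simp add: simple_mod_def)
  interpret PLj: two_mods A "P i" "L j" ..
  interpret LL: two_mods A "L j" "L i" ..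
  have xc: "x : car (L j)" "?e *[L j] x = x" using x(1) by (auto simp: wt_def)
  obtain g where g: "g : lhom A (P i) (L j)" "g p = x" using pgen_hom[OF pg Lj.left xc] .
  have gs: "g ` car (P i) = car (L j)"
   by (rule PLj.lhom_simple_surj[OF L_simple[OF j] g(1) Pi.sub_carrier p(1)]) (use g(2) x(2) in simp)
  have k: "{y : car (P i). g y = 0[L j]} <= {y : car (P i). f y = 0[L i]}"
   by (rule f(3)[OF PLj.lhom_kernel[OF g(1)]]) (use g(2) p(1) x(2) in blast)
  obtain h where h: "h : lhom A (L j) (L i)" "!!y. y : car (P i) ==> h (g y) = f y"
  proof (rule PLj.lhom_factor[OF g(1) gs Li.left f(1)])
   fix y assume "y : car (P i)" "g y = 0[L j]"
   thus "f y = 0[L i]" using subsetD[OF k, of y] by simp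
  qed (rule that)
  have hx: "h x = f p" using h(2)[OF p(1)] g(2) by simp
  have "inj_on h (car (L j))" by (rule lhom_simple_inj[OF L_simple[OF j] Li.left h(1) xc(1)]) (use hx p(2) in simp)
  moreover have "h ` car (L j) = car (L i)"
   by (rule LL.lhom_simple_surj[OF L_simple[OF i] h(1) Lj.sub_carrier xc(1)]) (use hx p(2) in simp)
  ultimately show ?thesis using h(1) hx by (auto simp: bij_betw_def)
 qed
 have "kdim K A (L j) (wt (L j) ?e (car (L j))) = (if i = j then 1 else 0)" if j: "j : {1..n}" for j
 proof (cases "i = j")
  case False
  interpret Lj: lmod A "L j" using L_simple[OF j] by (simp add: simple_mod_def)
  have "wt (L j) ?e (car (L j)) <= {0[L j]}"
  proof
   fix x assume x: "x : wt (L j) ?e (car (L j))"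
   have "isomorphic A (L j) (L i)" if "x ~= 0[L j]" using main[OF j x that] by (auto simp: isomorphic_def)
   thus "x : {0[L j]}" using L_noniso[OF j i] False by blast
  qed
  hence "wt (L j) ?e (car (L j)) = {0[L j]}" using e by (auto simp: wt_def)
  thus ?thesis using False kdim_zero[OF Lj.left] by simp
 next
  case True
  let ?W = "wt (L i) ?e (car (L i))"
  interpret kL: lmod K "kmod A (L i)" using kmod_left[OF Li.left] by simp
  have sW: "submodule ?W K (kmod A (L i))"
   by (rule wt_sub[OF Li.left kmod_sub[OF Li.left Li.sub_carrier] e])
  have "len K (restr (kmod A (L i)) ?W) = 1"
  proof (rule kdim_line(2)[OF kL.sub_left[OF sW], of "f p"])
   show "f p : car (restr (kmod A (L i)) ?W)" using fe by (simp add: wt_def)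
   show "f p ~= 0[restr (kmod A (L i)) ?W]" using p(2) by simp
   fix x assume "x : car (restr (kmod A (L i)) ?W)"
   hence x: "x : ?W" "x : car (L i)" by (auto simp: wt_def)
   show "EX c:car K. x = c *[restr (kmod A (L i)) ?W] f p"
   proof (cases "x = 0[L i]")
    case True
    thus ?thesis using fe(1) by (intro bexI[of _ "0[K]"]) simp_all
   next
    case False
    obtain h where h: "h : lhom A (L i) (L i)" "bij_betw h (car (L i)) (car (L i))" "h x = f p"
     using main[OF i x(1) False] by blast
    interpret LL: two_mods A "L i" "L i" ..
    obtain c where c: "c : car K" "ALL y:car (L i). restrict (the_inv_into (car (L i)) h) (car (L i)) y = sc c *[L i] y"
     using end_scalar[OF i LL.lhom_inverse[OF h(1,2)]] .
    have "the_inv_into (car (L i)) h (f p) = x"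
     unfolding h(3)[symmetric] using h(2) x(2) by (intro the_inv_into_f_f) (simp_all add: bij_betw_def)
    thus ?thesis using bspec[OF c(2) fe(1)] fe(1) by (intro bexI[OF _ c(1)]) simp
   qed
  qed
  thus ?thesis using True by (simp add: kdim_def)
 qed
 with pg show ?thesis by blast
qed

definition ei :: "nat => 'a" where
 "ei i = (SOME e. EX p. pgen e (P i) p &
  (ALL j:{1..n}. kdim K A (L j) (wt (L j) e (car (L j))) = (if i = j then 1 else 0)))"

definition pg :: "nat => 'p" where
 "pg i = (SOME p. pgen (ei i) (P i) p)"

lemma ei_facts:
 assumes i: "i : {1..n}"
 shows "pgen (ei i) (P i) (pg i)"
  "!!j. j : {1..n} ==> kdim K A (L j) (wt (L j) (ei i) (car (L j))) = (if i = j then 1 else 0)"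
proof -
 have *: "EX p. pgen (ei i) (P i) p &
  (ALL j:{1..n}. kdim K A (L j) (wt (L j) (ei i) (car (L j))) = (if i = j then 1 else 0))"
  unfolding ei_def by (rule someI_ex) (rule pgen_ex[OF i])
 thus "pgen (ei i) (P i) (pg i)" unfolding pg_def by (metis (no_types, lifting) someI_ex)
 show "!!j. j : {1..n} ==> kdim K A (L j) (wt (L j) (ei i) (car (L j))) = (if i = j then 1 else 0)"
  using * by blast
qed

end

sublocale base \<subseteq> W: walg K A "{1..n}" ei L
proof (intro walg.intro walg_axioms.intro)
 show "fdalg K A" by (rule fdalg_axioms)
 show "ei i : car A" "ei i \<otimes>[A] ei i = ei i" if "i : {1..n}" for i
  using ei_facts(1)[OF that] by (simp_all add: pgen_def)
 show "simple_mod A (L i)" if "i : {1..n}" for i by (rule L_simple[OF that])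
 show "kdim K A (L j) (wt (L j) (ei i) (car (L j))) = (if i = j then 1 else 0)"
  if "i : {1..n}" "j : {1..n}" for i j by (rule ei_facts(2)[OF that])
 show "EX i:{1..n}. isomorphic A N (L i)" if "simple_mod A N" for N :: "'a small_module"
  using simples that unfolding simple_modules_def by blast
qed

context base
begin

abbreviation lp where "lp i \<equiv> loewy_length A (P i)"
abbreviation lq where "lq i \<equiv> loewy_length A (Q i)"

lemma P_lmod: "i : {1..n} ==> lmod A (P i)" by (rule fd_lmod[OF P_fd])
lemma P_left: "i : {1..n} ==> left_module A (P i)" by (rule fd_left[OF P_fd])

lemma Q_fd: assumes "i : {1..n}" shows "fd K A (Q i)"
 by (rule fg_imp_fd) (use hulls[OF assms] in \<open>simp add: injective_hull_def injective_def\<close>)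

lemma Q_lmod: "i : {1..n} ==> lmod A (Q i)" by (rule fd_lmod[OF Q_fd])
lemma Q_left: "i : {1..n} ==> left_module A (Q i)" by (rule fd_left[OF Q_fd])

lemma P_rad:
 assumes i: "i : {1..n}"
 shows "!!U. [|submodule U A (P i); U ~= car (P i)|] ==> U <= rad A (P i)"
  "rad A (P i) ~= car (P i)"
  "!!j. j : {1..n} ==> W.wd j (P i) (car (P i)) = W.wd j (P i) (rad A (P i)) + (if i = j then 1 else 0)"
  "EX f:lhom A (P i) (L i). f (pg i) ~= 0[L i] & rad A (P i) = {x : car (P i). f x = 0[L i]}"
proof -
 obtain f where f: "f : lhom A (P i) (L i)" "f ` car (P i) = car (L i)"
  "!!U. [|submodule U A (P i); U ~= car (P i)|] ==> U <= {x : car (P i). f x = 0[L i]}"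
  using cover_map[OF i] by blast
 interpret Pi: lmod A "P i" by (rule P_lmod[OF i])
 interpret Li: lmod A "L i" using L_simple[OF i] by (simp add: simple_mod_def)
 interpret PL: two_mods A "P i" "L i" ..
 let ?Z = "{x : car (P i). f x = 0[L i]}"
 have Z: "submodule ?Z A (P i)" by (rule PL.lhom_kernel[OF f(1)])
 have "EX x:car (L i). x ~= 0[L i]" using L_simple[OF i] Li.M.zero_closed unfolding simple_mod_def by blast
 then obtain y where y: "y : car (L i)" "y ~= 0[L i]" ..
 from y(1) have "y : f ` car (P i)" unfolding f(2) .
 hence ZP: "?Z ~= car (P i)" using y(2) by blast
 have mZ: "maximal_submodule A (P i) ?Z" unfolding maximal_submodule_def
 proof (intro conjI allI impI)
  fix N assume N: "submodule N A (P i) & ?Z <= N"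
  show "N = ?Z | N = car (P i)" using f(3)[of N] N by (cases "N = car (P i)") auto
 qed (fact Z ZP)+
 have "N = ?Z" if "maximal_submodule A (P i) N" for N
  
 proof -
  have N: "submodule N A (P i)" "N ~= car (P i)" using that by (auto simp: maximal_submodule_def)
  have "?Z = N | ?Z = car (P i)" using that Z f(3)[OF N] by (simp add: maximal_submodule_def)
  thus ?thesis using ZP by (elim disjE) simp_all
 qed
 hence "{N. maximal_submodule A (P i) N} = {?Z}" using mZ by blast
 hence rZ: "rad A (P i) = ?Z" unfolding rad_def by auto
 show "!!U. [|submodule U A (P i); U ~= car (P i)|] ==> U <= rad A (P i)" using f(3) rZ by simp
 show "rad A (P i) ~= car (P i)" using ZP rZ by simp
 show "W.wd j (P i) (car (P i)) = W.wd j (P i) (rad A (P i)) + (if i = j then 1 else 0)" if j: "j : {1..n}" for j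
  using wdim_additive[OF P_fd[OF i] Li.left f(1) Pi.sub_carrier W.e_closed[OF j] W.e_idem[OF j]]
   rZ f(2) ei_facts(2)[OF j i] by auto
 have p: "pgen (ei i) (P i) (pg i)" by (rule ei_facts(1)[OF i])
 have "f (pg i) ~= 0[L i]"
 proof
  assume "f (pg i) = 0[L i]"
  hence pZ: "pg i : ?Z" using p by (simp add: pgen_def)
  have "car (P i) <= ?Z"
  proof
   fix y assume "y : car (P i)"
   then obtain a where a: "a : car A" "y = a *[P i] pg i" using p unfolding pgen_def by blast
   show "y : ?Z" unfolding a(2) by (rule subD(5)[OF Z a(1) pZ])
  qed
  thus False using ZP by blast
 qed
 thus "EX f:lhom A (P i) (L i). f (pg i) ~= 0[L i] & rad A (P i) = {x : car (P i). f x = 0[L i]}"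
  using f(1) rZ by blast
qed

lemma P_hom_dim: "[|i : {1..n}; fd K A M|] ==> len K (homk A (P i) M) = W.wd i M (car M)"
 by (rule pgen_dim[OF ei_facts(1)])

text \<open>By \<open>rad_soc\<close> a map to \<open>Q k\<close> lands in \<open>Soc_t\<close>
  exactly if it kills \<open>Rad^t M\<close>; these maps are counted by
  \<open>hom_vanish_dim\<close>.\<close>

lemma hom_soc_dim:
 assumes k: "k : {1..n}" and M: "fd K A M"
 shows "len K (homk A M (restr (Q k) (soc_pow A (Q k) t))) + W.wd k M (rad_pow A M t) = W.wd k M (car M)"
proof -
 interpret M: lmod A M by (rule fd_lmod[OF M])
 interpret Qk: lmod A "Q k" by (rule Q_lmod[OF k])
 interpret MQ: two_mods A M "Q k" ..
 note r = W.rad_sub[OF M.left, of t]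
 have "f ` car M <= soc_pow A (Q k) t \<longleftrightarrow> (ALL x:rad_pow A M t. f x = 0[Q k])" if "f : lhom A M (Q k)" for f
  using W.rad_soc[OF M Qk.left that, of t 0] by auto
 hence "{f : lhom A M (Q k). f ` car M <= soc_pow A (Q k) t} = {f : lhom A M (Q k). ALL x:rad_pow A M t. f x = 0[Q k]}"
  by blast
 thus ?thesis
  using W.hom_vanish_dim[OF hulls[OF k] k M r] homk_restr[OF subD(1)[OF W.soc_sub[OF Qk.left]], of M t]
  by simp
qed

lemma hom_Q_dim:
 assumes k: "k : {1..n}" and M: "fd K A M"
 shows "len K (homk A M (Q k)) = W.wd k M (car M)"
proof -
 interpret M: lmod A M by (rule fd_lmod[OF M])
 interpret Qk: lmod A "Q k" by (rule Q_lmod[OF k])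
 interpret MQ: two_mods A M "Q k" ..
 have "{f : lhom A M (Q k). ALL x:{0[M]}. f x = 0[Q k]} = car (homk A M (Q k))"
  using MQ.lhom_zero by auto
 moreover have "wt M (ei k) {0[M]} = {0[M]}" using W.e_closed[OF k] by (auto simp: wt_def)
 hence "W.wd k M {0[M]} = 0" using kdim_zero[OF M.left] by simp
 ultimately show ?thesis using W.hom_vanish_dim[OF hulls[OF k] k M M.sub_zero] by (simp only: restr_carrier add_0_right)
qed

text \<open>Both sides are the dimension of \<open>Hom(P_k, Q_i)\<close>.\<close>

lemma wd_Q_eq: assumes "i : {1..n}" "k : {1..n}"
 shows "W.wd k (Q i) (car (Q i)) = W.wd i (P k) (car (P k))"
 using P_hom_dim[OF assms(2) Q_fd[OF assms(1)]] hom_Q_dim[OF assms(1) P_fd[OF assms(2)]] by simp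

text \<open>Two counts of \<open>Hom(P_k, Soc_t Q_i)\<close>: one by projectivity of
  \<open>P_k\<close>, one by \<open>hom_soc_dim\<close>.\<close>

lemma wd_soc_Q: assumes i: "i : {1..n}" and k: "k : {1..n}"
 shows "W.wd k (Q i) (soc_pow A (Q i) t) + W.wd i (P k) (rad_pow A (P k) t) = W.wd i (P k) (car (P k))"
proof -
 note s = W.soc_sub[OF Q_left[OF i], of t]
 show ?thesis
  using P_hom_dim[OF k fd_sub[OF Q_fd[OF i] s]] hom_soc_dim[OF i P_fd[OF k], of t] by simp
qed

lemma wd_soc_Q_1: assumes i: "i : {1..n}" and k: "k : {1..n}"
 shows "W.wd k (Q i) (soc_pow A (Q i) 1) = (if i = k then 1 else 0)"
proof -
 interpret Pk: lmod A "P k" by (rule P_lmod[OF k])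
 have "rad_pow A (P k) 1 = rad A (P k)" by (simp add: restr_carrier)
 thus ?thesis using wd_soc_Q[OF i k, of 1] P_rad(3)[OF k i] by auto
qed

lemma lp_pos: assumes i: "i : {1..n}" shows "1 <= lp i"
proof -
 interpret Pi: lmod A "P i" by (rule P_lmod[OF i])
 have "lp i ~= 0"
 proof
  assume "lp i = 0"
  hence "car (P i) = {0[P i]}" using W.loewy_zero[OF P_fd[OF i]] by simp
  moreover have "0[P i] : rad A (P i)" by (rule subD(2)[OF W.rad_submodule[OF P_left[OF i]]])
  ultimately have "car (P i) <= rad A (P i)" by simp
  thus False using P_rad(2)[OF i] subD(1)[OF W.rad_submodule[OF P_left[OF i]]] by simp
 qed
 thus ?thesis by simp
qed

lemma Q_socle:
 assumes i: "i : {1..n}"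
 obtains Z where "submodule Z A (Q i)" "simple_mod A (restr (Q i) Z)" "W.wd i (Q i) Z = 1"
  "!!U. [|submodule U A (Q i); U ~= {0[Q i]}|] ==> Z <= U" "!!j. [|j : {1..n}; j ~= i|] ==> W.wd j (Q i) Z = 0"
 using W.hull_facts[OF hulls[OF i] i] by metis

section \<open>The summands of the generator of \<open>S_A\<close>\<close>

text \<open>\<open>Soc_j Q_i\<close> has a simple socle \<open>Z\<close>, so it is indecomposable.
  An endomorphism preserves \<open>Z\<close> and acts on the line \<open>e_i Z\<close> by a scalar
  \<open>c\<close>; after subtracting \<open>c\<close> there is a kernel. The socle determines
  \<open>i\<close>, and the strictly increasing socle series determines \<open>j\<close>.\<close>

lemma C_summands: "summands K A (s_index A n Q) (s_summand A Q)"
proof (intro summands.intro summands_axioms.intro fdalg_axioms)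
 have "s_index A n Q <= {1..n} \<times> {..Max (lq ` {1..n})}" by (auto simp: s_index_def intro!: Max_ge[THEN order_trans[rotated]])
 thus "finite (s_index A n Q)" by (rule finite_subset) simp
next
 fix x assume "x : s_index A n Q"
 then obtain i j where x: "x = (i, j)" "i : {1..n}" "1 <= j" "j <= lq i" by (auto simp: s_index_def)
 note i = x(2)
 interpret Qi: lmod A "Q i" by (rule Q_lmod[OF i])
 let ?C = "soc_pow A (Q i) j"
 let ?R = "restr (Q i) ?C"
 have C: "s_summand A Q x = ?R" by (simp add: s_summand_def x(1))
 note sC = W.soc_sub[OF Q_left[OF i], of j]
 show "fd K A (s_summand A Q x)" unfolding C by (rule fd_sub[OF Q_fd[OF i] sC])
 obtain Z where Z: "submodule Z A (Q i)" "simple_mod A (restr (Q i) Z)" "W.wd i (Q i) Z = 1"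
  "!!U. [|submodule U A (Q i); U ~= {0[Q i]}|] ==> Z <= U" using Q_socle[OF i] by metis
 have C0: "?C ~= {0[Q i]}"
 proof
  assume c: "?C = {0[Q i]}"
  have "soc_pow A (Q i) 1 <= ?C" by (rule W.soc_pow_mono[OF Q_left[OF i] x(3)])
  hence "soc_pow A (Q i) (Suc 0) = {0[Q i]}"
   using c subD(2)[OF W.soc_sub[OF Q_left[OF i], of "Suc 0"]] by auto
  thus False using W.soc_pow_strict[OF Q_fd[OF i], of 0] x(3,4) by simp
 qed
 have Z0: "Z ~= {0[Q i]}" using Z(2) by (simp add: simple_mod_def)
 show "indecomposable A (s_summand A Q x)"
  unfolding C indecomposable_def
 proof (intro conjI allI impI)
  show "car (?R) ~= {0[?R]}" using C0 by simp
  fix N N' assume a: "submodule N A (?R) & submodule N' A (?R) &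
   N \<inter> N' = {0[?R]} & N <+>\<^bsub>?R\<^esub> N' = car (?R)"
  hence s: "submodule N A (Q i)" "submodule N' A (Q i)" by (auto simp: Qi.sub_restr_iff[OF sC])
  show "N = {0[?R]} | N' = {0[?R]}"
  proof (rule ccontr)
   assume "~ ?thesis"
   hence "Z <= N \<inter> N'" using Z(4)[OF s(1)] Z(4)[OF s(2)] by simp
   hence "Z <= {0[Q i]}" using a by simp
   thus False using Z0 subD(2)[OF Z(1)] by blast
  qed
 qed
 fix f assume "f : lhom A (s_summand A Q x) (s_summand A Q x)"
 hence f: "f : lhom A (?R) (?R)" unfolding C .
 interpret Ci: lmod A "?R" using Qi.sub_left[OF sC] by simp
 interpret CC: two_mods A "?R" "?R" ..
 have ZC: "Z <= ?C" by (rule Z(4)[OF sC C0])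
 have sZC: "submodule Z A (?R)" using Z(1) ZC by (simp add: Qi.sub_restr_iff[OF sC])
 \<comment> \<open>To see that \<open>f\<close> maps \<open>Z\<close> into \<open>Z\<close> it is
   enough that this preimage is not zero, since \<open>Z\<close> lies in every nonzero
   submodule.\<close>
 let ?V = "{z : ?C. f z : Z}"
 have sV: "submodule ?V A (Q i)" using CC.lhom_preimage[OF f sZC] by (simp add: Qi.sub_restr_iff[OF sC])
 obtain z0 where z0: "z0 : Z" "z0 ~= 0[Q i]" using Z0 subD(2)[OF Z(1)] by blast
 have "?V ~= {0[Q i]}"
 proof (cases "f z0 = 0[Q i]")
  case True thus ?thesis using z0 ZC subD(2)[OF Z(1)] by auto
 next
  case False
  have "submodule (f ` Z) A (Q i)" using CC.lhom_image[OF f sZC] by (simp add: Qi.sub_restr_iff[OF sC])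
  hence "Z <= f ` Z" using Z(4) False z0(1) by blast
  then obtain z' where z': "z' : Z" "z0 = f z'" using z0(1) by blast
  have "z' ~= 0[Q i]" by (rule notI) (use z0(2) z'(2) CC.lhom_zero[OF f] in simp)
  moreover have "z' : ?V" using z' z0(1) ZC by blast
  ultimately show ?thesis by blast
 qed
 hence fZ: "f ` Z <= Z" using Z(4)[OF sV] by blast
 interpret kQ: lmod K "kmod A (Q i)" by (rule fd_kmod[OF Q_fd[OF i]])
 have sW: "submodule (wt (Q i) (ei i) Z) K (kmod A (Q i))"
  by (rule wt_sub[OF Q_left[OF i] fd_kmod_sub[OF Q_fd[OF i] Z(1)] W.e_closed[OF i]])
 have fW: "flen K (restr (kmod A (Q i)) (wt (Q i) (ei i) Z))"
  using kQ.flen_sub(1)[OF _ sW] Q_fd[OF i] by (simp add: fd_def)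
 have "wt (Q i) (ei i) Z ~= {0[Q i]}" using Z(3) kdim_zero[OF Q_left[OF i]] by auto
 then obtain z where z: "z : Z" "z ~= 0[Q i]" "ei i *[Q i] z = z"
  using subD(2)[OF sW] by (auto simp: wt_def)
 have zC: "z : ?C" using z ZC by blast
 have "f z : wt (Q i) (ei i) Z" using fZ z(1,3) lhom_smult[OF f W.e_closed[OF i], of z] zC by (auto simp: wt_def)
 then obtain c where c: "c : car K" "f z = sc c *[Q i] z"
  using line_kdim[OF kQ.sub_left[OF sW] fW, of z "f z"] Z(3) z by (auto simp: kdim_def wt_def)
 have "~ inj_on (\<lambda>v\<in>?C. f v -[?R] sc c *[Q i] v) ?C"
 proof
  let ?g = "\<lambda>v\<in>?C. f v -[?R] sc c *[Q i] v"
  assume inj: "inj_on ?g ?C"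
  have fz: "f z : car (?R)" using lhom_mem[OF f] zC by simp
  have "?g z = 0[?R]" using Ci.diff_zero_iff[OF fz fz] zC c(2) by simp
  moreover have z0: "0[Q i] : ?C" by (rule subD(2)[OF sC])
  have "?g 0[Q i] = 0[?R]"
   using z0 CC.lhom_zero[OF f] c(1) Qi.smult_r_null[of "sc c"] Ci.diff_zero[of "0[Q i]"] by simp
  ultimately have "?g z = ?g 0[Q i]" by (simp only:)
  thus False using inj_onD[OF inj _ zC z0] z(2) by blast
 qed
 thus "EX c:car K. ~ bij_betw (\<lambda>v\<in>car (s_summand A Q x). f v -[s_summand A Q x]
   sc c *[s_summand A Q x] v) (car (s_summand A Q x)) (car (s_summand A Q x))"
  unfolding C using c(1) by (auto simp: bij_betw_def)
next
 fix x y assume "x : s_index A n Q" "y : s_index A n Q" and iso: "isomorphic A (s_summand A Q x) (s_summand A Q y)"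
 then obtain i j k l where x: "x = (i, j)" "i : {1..n}" "1 <= j" "j <= lq i"
  and y: "y = (k, l)" "k : {1..n}" "1 <= l" "l <= lq k" by (auto simp: s_index_def)
 note i = x(2) and k = y(2)
 interpret Qi: lmod A "Q i" by (rule Q_lmod[OF i])
 interpret Qk: lmod A "Q k" by (rule Q_lmod[OF k])
 let ?C = "soc_pow A (Q i) j" and ?D = "soc_pow A (Q k) l"
 note sC = W.soc_sub[OF Q_left[OF i], of j]
 note sD = W.soc_sub[OF Q_left[OF k], of l]
 have fC: "fd K A (restr (Q i) ?C)" by (rule fd_sub[OF Q_fd[OF i] sC])
 have lD: "left_module A (restr (Q k) ?D)" by (rule Qk.sub_left[OF sD])
 obtain f where f: "f : lhom A (restr (Q i) ?C) (restr (Q k) ?D)" "bij_betw f ?C ?D"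
  using iso unfolding isomorphic_def s_summand_def x(1) y(1) by auto
 have w: "W.wd m (Q i) ?C = W.wd m (Q k) ?D" if "m : {1..n}" for m
  using iso_wdim[OF fC lD f(1) _ W.e_closed[OF that] W.e_idem[OF that]] f(2) by simp
 show "x = y"
 proof -
  interpret Ci: lmod A "restr (Q i) ?C" by (rule fd_lmod[OF fC])
  interpret Dk: lmod A "restr (Q k) ?D" using lD by simp
  interpret CD: two_mods A "restr (Q i) ?C" "restr (Q k) ?D" ..
  let ?S = "soc_pow A (Q i) 1"
  have sS: "submodule ?S A (Q i)" by (rule W.soc_sub[OF Q_left[OF i]])
  have SC: "?S <= ?C" by (rule W.soc_pow_mono[OF Q_left[OF i] x(3)])
  have sS': "submodule ?S A (restr (Q i) ?C)" using sS SC by (simp add: Qi.sub_restr_iff[OF sC])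
  have fS: "submodule (f ` ?S) A (Q k)" using CD.lhom_image[OF f(1) sS'] by (simp add: Qk.sub_restr_iff[OF sD])
  obtain Z where Z: "submodule Z A (Q k)" "W.wd k (Q k) Z = 1"
   "!!U. [|submodule U A (Q k); U ~= {0[Q k]}|] ==> Z <= U" using Q_socle[OF k] by metis
  have inj: "inj_on f (car (restr (Q i) ?C))" using f(2) by (simp add: bij_betw_def)
  have wf: "W.wd k (Q k) (f ` ?S) = W.wd k (Q i) ?S"
  proof -
   have "kdim K A (restr (Q k) ?D) (f ` wt (restr (Q i) ?C) (ei k) ?S) = kdim K A (restr (Q i) ?C) (wt (restr (Q i) ?C) (ei k) ?S)"
    by (rule kdim_inj_image[OF fC lD f(1) inj wt_sub[OF Ci.left fd_kmod_sub[OF fC sS'] W.e_closed[OF k]]])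
   thus ?thesis
    unfolding wt_image[OF f(1) sS' W.e_closed[OF k] W.e_idem[OF k] Ci.left] by simp
  qed
  have "f ` ?S ~= {0[Q k]}"
  proof
   assume a: "f ` ?S = {0[Q k]}"
   have "s = 0[Q i]" if s: "s : ?S" for s
   proof -
    have "f s = 0[Q k]" using a s by blast
    thus ?thesis using inj SC s unfolding CD.lhom_inj_iff[OF f(1)] by auto
   qed
   hence "?S = {0[Q i]}" using subD(2)[OF sS] by blast
   thus False using W.soc_pow_strict[OF Q_fd[OF i], of 0] x(3,4) by simp
  qed
  hence "Z <= f ` ?S" by (rule Z(3)[OF fS])
  from wdim_mono(1)[OF Q_fd[OF k] Z(1) fS this W.e_closed[OF k]]
  have "1 <= W.wd k (Q i) ?S" using Z(2) wf by simp
  hence ik: "i = k" using wd_soc_Q_1[OF i k] by (simp split: if_splits)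
  have neq: False if "j' < l'" "l' <= lq i" "!!m. m : {1..n} ==> W.wd m (Q i) (soc_pow A (Q i) j') = W.wd m (Q i) (soc_pow A (Q i) l')" for j' l'
  proof -
   have "soc_pow A (Q i) j' = soc_pow A (Q i) l'"
    by (rule W.wd_determines[OF Q_fd[OF i] W.soc_sub[OF Q_left[OF i]] W.soc_sub[OF Q_left[OF i]]
       W.soc_pow_mono[OF Q_left[OF i]]]) (use that in simp_all)
   moreover have "soc_pow A (Q i) j' <= soc_pow A (Q i) (Suc j')" "soc_pow A (Q i) (Suc j') <= soc_pow A (Q i) l'"
    using that(1) by (intro W.soc_pow_mono[OF Q_left[OF i]]; simp)+
   ultimately have "soc_pow A (Q i) j' = soc_pow A (Q i) (Suc j')" by blast
   thus False using W.soc_pow_strict[OF Q_fd[OF i], of j'] that by simp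
  qed
  have "j = l"
  proof (rule linorder_cases[of j l])
   assume "j < l" thus ?thesis using neq[of j l] w y(4) ik by simp
  next
   assume "l < j" thus ?thesis using neq[of l j] w x(4) ik by simp
  qed simp
  thus ?thesis using x(1) y(1) ik by simp
 qed
qed

end

section \<open>The modules \<open>P_k/Rad^l P_k\<close> and the homomorphisms between them\<close>

context base
begin

abbreviation I where "I \<equiv> adr_index A n P"
abbreviation VV where "VV \<equiv> adr_summand A P"

definition vq :: "nat \<times> nat => 'p => 'p set" where
 "vq x = lmod.qmap (P (fst x)) (rad_pow A (P (fst x)) (snd x))"

definition vg :: "nat \<times> nat => 'p set" where "vg x = vq x (pg (fst x))"

lemma index_iff: "(k, l) : I \<longleftrightarrow> k : {1..n} & 1 <= l & l <= lp k"
 by (auto simp: adr_index_def)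

lemma VV_eq: "VV (k, l) = quot (P k) (rad_pow A (P k) l)"
 by (simp add: adr_summand_def)

lemma pg_facts:
 assumes "k : {1..n}"
 shows "pg k : car (P k)" "ei k *[P k] pg k = pg k"
  "!!y. y : car (P k) ==> EX a:car A. y = a *[P k] pg k"
 using ei_facts(1)[OF assms] by (auto simp: pgen_def)

lemma VV_facts:
 assumes x: "(k, l) : I"
 shows VV_fd: "fd K A (VV (k, l))" and vq_lhom: "vq (k, l) : lhom A (P k) (VV (k, l))"
  and vq_surj: "vq (k, l) ` car (P k) = car (VV (k, l))"
  and vq_zero: "!!y. y : car (P k) ==> vq (k, l) y = 0[VV (k, l)] \<longleftrightarrow> y : rad_pow A (P k) l"
  and vg_closed: "vg (k, l) : car (VV (k, l))" and vg_wt: "ei k *[VV (k, l)] vg (k, l) = vg (k, l)"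
  and vg_gen: "!!y. y : car (VV (k, l)) ==> EX a:car A. y = a *[VV (k, l)] vg (k, l)"
proof -
 have k: "k : {1..n}" using x by (simp add: index_iff)
 interpret Pk: lmod A "P k" by (rule P_lmod[OF k])
 note r = W.rad_sub[OF P_left[OF k], of l]
 show "fd K A (VV (k, l))" unfolding VV_eq by (rule fd_quot[OF P_fd[OF k] r])
 show q: "vq (k, l) : lhom A (P k) (VV (k, l))" unfolding VV_eq vq_def fst_conv snd_conv by (rule Pk.qmap_lhom[OF r])
 show s: "vq (k, l) ` car (P k) = car (VV (k, l))" unfolding VV_eq vq_def fst_conv snd_conv by (rule Pk.qmap_surj[OF r])
 show "vq (k, l) y = 0[VV (k, l)] \<longleftrightarrow> y : rad_pow A (P k) l" if "y : car (P k)" for y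
  unfolding VV_eq vq_def fst_conv snd_conv by (rule Pk.qmap_zero[OF r that])
 note p = pg_facts[OF k]
 show "vg (k, l) : car (VV (k, l))" unfolding vg_def fst_conv by (rule lhom_mem[OF q p(1)])
 show "ei k *[VV (k, l)] vg (k, l) = vg (k, l)"
  unfolding vg_def fst_conv using lhom_smult[OF q W.e_closed[OF k] p(1)] p(2) by simp
 fix y assume "y : car (VV (k, l))"
 then obtain z where z: "z : car (P k)" "y = vq (k, l) z" using s by blast
 obtain a where a: "a : car A" "z = a *[P k] pg k" using p(3)[OF z(1)] by blast
 show "EX a:car A. y = a *[VV (k, l)] vg (k, l)"
  unfolding vg_def fst_conv z(2) a(2) using a(1) lhom_smult[OF q a(1) p(1)] by blast
qed

lemma VV_left: "(k, l) : I ==> left_module A (VV (k, l))" by (rule fd_left[OF VV_fd])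
lemma VV_lmod: "(k, l) : I ==> lmod A (VV (k, l))" by (rule fd_lmod[OF VV_fd])

lemma Vhom_eqI:
 assumes x: "(k, l) : I" and f: "f : lhom A (VV (k, l)) M" and g: "g : lhom A (VV (k, l)) M" and e: "f (vg (k, l)) = g (vg (k, l))"
 shows "f = g"
proof (rule lhom_eqI[OF f g])
 fix y assume "y : car (VV (k, l))"
 then obtain a where "a : car A" "y = a *[VV (k, l)] vg (k, l)" using vg_gen[OF x] by blast
 thus "f y = g y" using lhom_smult[OF f _ vg_closed[OF x]] lhom_smult[OF g _ vg_closed[OF x]] e by simp
qed

text \<open>Together with \<open>Vhom_ex\<close>: evaluation at the generator identifies
  \<open>Hom(P_k/Rad^l P_k, M)\<close> with \<open>e_k Soc_l M\<close>. By \<open>rad_soc\<close> a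
  map from \<open>P_k\<close> kills \<open>Rad^l P_k\<close> exactly if its image lies in
  \<open>Soc_l M\<close>.\<close>

lemma Vhom_val:
 assumes x: "(k, l) : I" and M: "left_module A M" and f: "f : lhom A (VV (k, l)) M"
 shows "f (vg (k, l)) : wt M (ei k) (soc_pow A M l)"
proof -
 have k: "k : {1..n}" using x by (simp add: index_iff)
 interpret V: lmod A "VV (k, l)" by (rule VV_lmod[OF x])
 interpret Pk: lmod A "P k" by (rule P_lmod[OF k])
 interpret M: lmod A M using M by simp
 interpret VM: two_mods A "VV (k, l)" M ..
 let ?g = "compose (car (P k)) f (vq (k, l))"
 have g: "?g : lhom A (P k) M" by (rule lhom_comp[OF vq_lhom[OF x] f Pk.left])
 have "?g y = 0[M]" if y: "y : rad_pow A (P k) l" for y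
 proof -
  have yc: "y : car (P k)" by (rule Pk.sub_mem[OF W.rad_sub[OF P_left[OF k]] y])
  hence "vq (k, l) y = 0[VV (k, l)]" using vq_zero[OF x yc] y by simp
  thus ?thesis using yc VM.lhom_zero[OF f] by (simp add: compose_eq)
 qed
 hence "?g ` rad_pow A (P k) l <= soc_pow A M 0" by auto
 hence s: "?g ` car (P k) <= soc_pow A M l" using W.rad_soc[OF P_fd[OF k] M g, of l 0] by simp
 have "?g (pg k) : ?g ` car (P k)" by (rule imageI[OF pg_facts(1)[OF k]])
 moreover have "?g (pg k) = f (vg (k, l))" unfolding vg_def fst_conv by (rule compose_eq[OF pg_facts(1)[OF k]])
 ultimately have "f (vg (k, l)) : soc_pow A M l" using s by auto
 moreover have "ei k *[M] f (vg (k, l)) = f (vg (k, l))"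
  using lhom_smult[OF f W.e_closed[OF k] vg_closed[OF x]] vg_wt[OF x] by simp
 ultimately show ?thesis by (simp add: wt_def)
qed

lemma Vhom_ex:
 assumes x: "(k, l) : I" and M: "left_module A M" and m: "m : wt M (ei k) (soc_pow A M l)"
 obtains f where "f : lhom A (VV (k, l)) M" "f (vg (k, l)) = m"
proof -
 have k: "k : {1..n}" using x by (simp add: index_iff)
 interpret Pk: lmod A "P k" by (rule P_lmod[OF k])
 interpret V: lmod A "VV (k, l)" by (rule VV_lmod[OF x])
 interpret M: lmod A M using M by simp
 interpret PV: two_mods A "P k" "VV (k, l)" ..
 note s = W.soc_sub[OF M, of l]
 have mc: "m : car M" "ei k *[M] m = m" "m : soc_pow A M l" using m M.sub_mem[OF s] by (auto simp: wt_def)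
 obtain g where g: "g : lhom A (P k) M" "g (pg k) = m" using pgen_hom[OF ei_facts(1)[OF k] M mc(1,2)] .
 have "g ` car (P k) <= soc_pow A M l"
 proof
  fix z assume "z : g ` car (P k)"
  then obtain y where y: "y : car (P k)" "z = g y" by blast
  obtain a where a: "a : car A" "y = a *[P k] pg k" using pg_facts(3)[OF k y(1)] by blast
  have "z = a *[M] m" using y(2) a(2) lhom_smult[OF g(1) a(1) pg_facts(1)[OF k]] g(2) by simp
  thus "z : soc_pow A M l" using subD(5)[OF s a(1) mc(3)] by simp
 qed
 hence r: "g ` rad_pow A (P k) l <= {0[M]}" using W.rad_soc[OF P_fd[OF k] M g(1), of l 0] by simp
 obtain h where h: "h : lhom A (VV (k, l)) M" "!!y. y : car (P k) ==> h (vq (k, l) y) = g y"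
 proof (rule PV.lhom_factor[OF vq_lhom[OF x] vq_surj[OF x] M g(1)])
  fix y assume "y : car (P k)" "vq (k, l) y = 0[VV (k, l)]"
  hence "y : rad_pow A (P k) l" using vq_zero[OF x] by simp
  thus "g y = 0[M]" using r by blast
 qed (rule that)
 have "h (vg (k, l)) = m" unfolding vg_def fst_conv using h(2)[OF pg_facts(1)[OF k]] g(2) by simp
 with h(1) that show ?thesis by blast
qed

text \<open>By \<open>rad_soc\<close> the condition says that \<open>Rad^t P_k\<close> lies in
  \<open>Rad^l P_k\<close>, and the radical series decreases strictly until it vanishes at
  \<open>l_k\<close>, where \<open>l <= l_k\<close>.\<close>

lemma VV_soc_full_iff:
 assumes x: "(k, l) : I"
 shows "vg (k, l) : soc_pow A (VV (k, l)) t \<longleftrightarrow> l <= t"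
proof -
 have k: "k : {1..n}" and l: "l <= lp k" using x by (auto simp: index_iff)
 interpret V: lmod A "VV (k, l)" by (rule VV_lmod[OF x])
 interpret Pk: lmod A "P k" by (rule P_lmod[OF k])
 note s = W.soc_sub[OF VV_left[OF x], of t]
 have pv: "vq (k, l) (pg k) = vg (k, l)" by (simp add: vg_def)
 have "vg (k, l) : soc_pow A (VV (k, l)) t \<longleftrightarrow> vq (k, l) ` car (P k) <= soc_pow A (VV (k, l)) t"
 proof
  assume v: "vg (k, l) : soc_pow A (VV (k, l)) t"
  show "vq (k, l) ` car (P k) <= soc_pow A (VV (k, l)) t"
   unfolding vq_surj[OF x] using vg_gen[OF x] subD(5)[OF s _ v] by blast
 next
  assume "vq (k, l) ` car (P k) <= soc_pow A (VV (k, l)) t"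
  thus "vg (k, l) : soc_pow A (VV (k, l)) t" using pv pg_facts(1)[OF k] by blast
 qed
 also have "... \<longleftrightarrow> vq (k, l) ` rad_pow A (P k) t <= {0[VV (k, l)]}"
  using W.rad_soc[OF P_fd[OF k] VV_left[OF x] vq_lhom[OF x], of t 0] by simp
 also have "... \<longleftrightarrow> rad_pow A (P k) t <= rad_pow A (P k) l"
  using vq_zero[OF x] Pk.sub_mem[OF W.rad_sub[OF P_left[OF k], of t]] by blast
 also have "... \<longleftrightarrow> l <= t"
 proof
  assume a: "rad_pow A (P k) t <= rad_pow A (P k) l"
  show "l <= t"
  proof (rule ccontr)
   assume "~ l <= t"
   hence t: "Suc t <= l" "t < lp k" using l by simp_all
   have "rad_pow A (P k) l <= rad_pow A (P k) (Suc t)" by (rule W.rad_pow_antimono[OF P_fd[OF k] t(1)])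
   moreover have "rad_pow A (P k) (Suc t) <= rad_pow A (P k) t" by (rule W.rad_pow_antimono[OF P_fd[OF k]]) simp
   ultimately have "rad_pow A (P k) (Suc t) = rad_pow A (P k) t" using a by blast
   moreover have "rad_pow A (P k) t ~= {0[P k]}" using W.rad_pow_zero_iff[OF P_fd[OF k], of t] t(2) by simp
   ultimately show False using W.rad_pow_strict[OF P_fd[OF k]] by blast
  qed
 qed (rule W.rad_pow_antimono[OF P_fd[OF k]])
 finally show ?thesis .
qed

text \<open>The radical of \<open>P_k/Rad^l P_k\<close>, described through the radical of
  \<open>P_k\<close>.\<close>

definition VR :: "nat \<times> nat => 'p set set" where "VR x = vq x ` rad A (P (fst x))"

lemma VR_facts:
 assumes x: "(k, l) : I"
 shows VR_submodule: "submodule (VR (k, l)) A (VV (k, l))"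
  and VR_max: "!!U. [|submodule U A (VV (k, l)); U ~= car (VV (k, l))|] ==> U <= VR (k, l)"
  and vg_not_VR: "vg (k, l) ~: VR (k, l)"
  and VR_soc: "VR (k, l) <= soc_pow A (VV (k, l)) (l - 1)"
  and VR_map: "EX \<tau>:lhom A (VV (k, l)) (L k). \<tau> (vg (k, l)) ~= 0[L k] & VR (k, l) = {y : car (VV (k, l)). \<tau> y = 0[L k]}"
proof -
 have k: "k : {1..n}" and l: "1 <= l" "l <= lp k" using x by (auto simp: index_iff)
 interpret V: lmod A "VV (k, l)" by (rule VV_lmod[OF x])
 interpret Pk: lmod A "P k" by (rule P_lmod[OF k])
 interpret Lk: lmod A "L k" using L_simple[OF k] by (simp add: simple_mod_def)
 interpret PV: two_mods A "P k" "VV (k, l)" ..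
 interpret VL: two_mods A "VV (k, l)" "L k" ..
 note sr = W.rad_submodule[OF P_left[OF k]]
 obtain f where f: "f : lhom A (P k) (L k)" "f (pg k) ~= 0[L k]" "rad A (P k) = {x : car (P k). f x = 0[L k]}"
  using P_rad(4)[OF k] by blast
 have r1: "rad_pow A (P k) 1 = rad A (P k)" by (simp add: restr_carrier)
 have rl: "rad_pow A (P k) l <= rad A (P k)" using W.rad_pow_antimono[OF P_fd[OF k] l(1)] r1 by simp
 obtain \<tau> where t: "\<tau> : lhom A (VV (k, l)) (L k)" "!!y. y : car (P k) ==> \<tau> (vq (k, l) y) = f y"
 proof (rule PV.lhom_factor[OF vq_lhom[OF x] vq_surj[OF x] Lk.left f(1)])
  fix y assume "y : car (P k)" "vq (k, l) y = 0[VV (k, l)]"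
  hence "y : rad A (P k)" using vq_zero[OF x] rl by blast
  thus "f y = 0[L k]" using f(3) by simp
 qed (rule that)
 have tv: "\<tau> (vg (k, l)) ~= 0[L k]" unfolding vg_def fst_conv using t(2)[OF pg_facts(1)[OF k]] f(2) by simp
 have VRe: "VR (k, l) = {y : car (VV (k, l)). \<tau> y = 0[L k]}"
 proof
  show "VR (k, l) <= {y : car (VV (k, l)). \<tau> y = 0[L k]}"
   unfolding VR_def fst_conv using t(2) f(3) lhom_mem[OF vq_lhom[OF x]] by auto
  show "{y : car (VV (k, l)). \<tau> y = 0[L k]} <= VR (k, l)"
  proof
   fix y assume y: "y : {y : car (VV (k, l)). \<tau> y = 0[L k]}"
   then obtain z where z: "z : car (P k)" "y = vq (k, l) z" using vq_surj[OF x] by blast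
   hence "z : rad A (P k)" using y t(2)[OF z(1)] f(3) by simp
   thus "y : VR (k, l)" unfolding VR_def fst_conv using z(2) by blast
  qed
 qed
 show sV: "submodule (VR (k, l)) A (VV (k, l))" unfolding VRe by (rule VL.lhom_kernel[OF t(1)])
 show "vg (k, l) ~: VR (k, l)" unfolding VRe using tv by simp
 show "EX \<tau>:lhom A (VV (k, l)) (L k). \<tau> (vg (k, l)) ~= 0[L k] & VR (k, l) = {y : car (VV (k, l)). \<tau> y = 0[L k]}"
  using t(1) tv VRe by blast
 show "U <= VR (k, l)" if U: "submodule U A (VV (k, l))" "U ~= car (VV (k, l))" for U
 proof
  fix u assume u: "u : U"
  let ?Y = "{y : car (P k). vq (k, l) y : U}"
  have Y: "submodule ?Y A (P k)" by (rule PV.lhom_preimage[OF vq_lhom[OF x] U(1)])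
  have "?Y ~= car (P k)"
  proof
   assume "?Y = car (P k)"
   hence "car (VV (k, l)) <= U" unfolding vq_surj[OF x, symmetric] by blast
   thus False using U subD(1)[OF U(1)] by blast
  qed
  hence Yr: "?Y <= rad A (P k)" by (rule P_rad(1)[OF k Y])
  obtain z where z: "z : car (P k)" "u = vq (k, l) z" using u V.sub_mem[OF U(1)] vq_surj[OF x] by blast
  hence "z : rad A (P k)" using u Yr by blast
  thus "u : VR (k, l)" unfolding VR_def fst_conv using z(2) by blast
 qed
 show "VR (k, l) <= soc_pow A (VV (k, l)) (l - 1)"
 proof -
  have "vq (k, l) ` car (P k) <= soc_pow A (VV (k, l)) l"
  proof -
   have "vg (k, l) : soc_pow A (VV (k, l)) l" using VV_soc_full_iff[OF x] by simp
   thus ?thesis unfolding vq_surj[OF x]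
    using vg_gen[OF x] subD(5)[OF W.soc_sub[OF VV_left[OF x], of l]] by blast
  qed
  hence "vq (k, l) ` car (P k) <= soc_pow A (VV (k, l)) ((l - 1) + 1)" using l(1) by simp
  hence "vq (k, l) ` rad_pow A (P k) 1 <= soc_pow A (VV (k, l)) (l - 1)"
   using W.rad_soc[OF P_fd[OF k] VV_left[OF x] vq_lhom[OF x], of 1 "l - 1"] by simp
  thus ?thesis unfolding VR_def fst_conv r1 .
 qed
qed

lemma wt_L_line:
 assumes k: "k : {1..n}" and b: "b : wt (L k) (ei k) (car (L k))" "b ~= 0[L k]" and y: "y : wt (L k) (ei k) (car (L k))"
 obtains c where "c : car K" "y = sc c *[L k] b"
proof -
 have fL: "fd K A (L k)" by (rule simple_fd[OF L_simple[OF k]])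
 interpret Lk: lmod A "L k" by (rule fd_lmod[OF fL])
 interpret kL: lmod K "kmod A (L k)" by (rule fd_kmod[OF fL])
 let ?W = "wt (L k) (ei k) (car (L k))"
 have sW: "submodule ?W K (kmod A (L k))"
  by (rule wt_sub[OF Lk.left fd_kmod_sub[OF fL Lk.sub_carrier] W.e_closed[OF k]])
 have fW: "flen K (restr (kmod A (L k)) ?W)" using kL.flen_sub(1)[OF _ sW] fL by (simp add: fd_def)
 have "len K (restr (kmod A (L k)) ?W) = 1" using ei_facts(2)[OF k k] by (simp add: kdim_def)
 from line_kdim[OF kL.sub_left[OF sW] fW this, of b y] b y that show ?thesis by auto
qed

text \<open>A map that does not land in the radical is onto, so tops and Loewy lengths can be
  compared. Since the top \<open>L_k\<close> has a one-dimensional weight \<open>e_k\<close>, the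
  image of the generator is a multiple of the generator up to the radical.\<close>

lemma hom_nonrad:
 assumes w: "(s, t) : I" and x: "(k, l) : I" and f: "f : lhom A (VV (s, t)) (VV (k, l))" and nr: "f (vg (s, t)) ~: VR (k, l)"
 shows "s = k" "l <= t" "EX c:car K. f (vg (s, t)) -[VV (k, l)] sc c *[VV (k, l)] vg (k, l) : VR (k, l)"
proof -
 have k: "k : {1..n}" and s: "s : {1..n}" using x w by (auto simp: index_iff)
 interpret V: lmod A "VV (k, l)" by (rule VV_lmod[OF x])
 interpret Wm: lmod A "VV (s, t)" by (rule VV_lmod[OF w])
 interpret Lk: lmod A "L k" using L_simple[OF k] by (simp add: simple_mod_def)
 interpret VL: two_mods A "VV (k, l)" "L k" ..
 obtain \<tau> where t: "\<tau> : lhom A (VV (k, l)) (L k)" "\<tau> (vg (k, l)) ~= 0[L k]" "VR (k, l) = {y : car (VV (k, l)). \<tau> y = 0[L k]}"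
  using VR_map[OF x] by blast
 let ?y = "f (vg (s, t))"
 have y: "?y : wt (VV (k, l)) (ei s) (soc_pow A (VV (k, l)) t)" by (rule Vhom_val[OF w VV_left[OF x] f])
 have yc: "?y : car (VV (k, l))" by (rule lhom_mem[OF f vg_closed[OF w]])
 have ty: "\<tau> ?y ~= 0[L k]" using nr yc t(3) by simp
 have tyw: "\<tau> ?y : wt (L k) (ei s) (car (L k))"
  using lhom_mem[OF t(1) yc] lhom_smult[OF t(1) W.e_closed[OF s] yc] y by (simp add: wt_def)
 show sk: "s = k"
 proof (rule ccontr)
  assume "s ~= k"
  hence "W.wd s (L k) (car (L k)) = 0" using ei_facts(2)[OF s k] by simp
  hence "wt (L k) (ei s) (car (L k)) = {0[L k]}"
   using W.wt_eq_zero_iff[OF simple_fd[OF L_simple[OF k]] Lk.sub_carrier s] by simp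
  thus False using tyw ty by blast
 qed
 have "vg (k, l) : V.cyc ?y"
 proof (rule ccontr)
  assume "vg (k, l) ~: V.cyc ?y"
  hence "V.cyc ?y ~= car (VV (k, l))" using vg_closed[OF x] by blast
  hence "V.cyc ?y <= VR (k, l)" by (rule VR_max[OF x V.cyc_sub[OF yc]])
  thus False using nr V.cyc_self[OF yc] by blast
 qed
 moreover have "V.cyc ?y <= soc_pow A (VV (k, l)) t"
  using y by (intro V.cyc_least[OF W.soc_sub[OF VV_left[OF x]]]) (simp add: wt_def)
 ultimately show "l <= t" using VV_soc_full_iff[OF x] by blast
 have vw: "\<tau> (vg (k, l)) : wt (L k) (ei k) (car (L k))"
  using lhom_mem[OF t(1) vg_closed[OF x]] lhom_smult[OF t(1) W.e_closed[OF k] vg_closed[OF x]] vg_wt[OF x]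
  by (simp add: wt_def)
 obtain c where c: "c : car K" "\<tau> ?y = sc c *[L k] \<tau> (vg (k, l))"
  using wt_L_line[OF k vw t(2)] tyw sk by blast
 have scv: "sc c *[VV (k, l)] vg (k, l) : car (VV (k, l))" using c(1) vg_closed[OF x] by simp
 have "\<tau> (sc c *[VV (k, l)] vg (k, l)) = sc c *[L k] \<tau> (vg (k, l))" using c(1) by (intro lhom_smult[OF t(1) _ vg_closed[OF x]]) simp
 hence "\<tau> (?y -[VV (k, l)] sc c *[VV (k, l)] vg (k, l)) = 0[L k]"
  using VL.lhom_minus[OF t(1) yc scv] c(2) Lk.diff_zero_iff lhom_mem[OF t(1) yc] by simp
 thus "EX c:car K. ?y -[VV (k, l)] sc c *[VV (k, l)] vg (k, l) : VR (k, l)"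
  using c(1) t(3) V.M.minus_closed[OF yc scv] by blast
qed

text \<open>The summands are local modules because \<open>VR\<close> is the largest proper
  submodule. The scalar for \<open>V_split\<close> and the equality of the indices of isomorphic
  summands both come from \<open>hom_nonrad\<close>.\<close>

lemma V_summands: "summands K A I VV"
proof (intro summands.intro summands_axioms.intro fdalg_axioms)
 have "I <= {1..n} \<times> {..Max (lp ` {1..n})}" by (auto simp: adr_index_def intro!: Max_ge[THEN order_trans[rotated]])
 thus "finite I" by (rule finite_subset) simp
next
 fix x assume "x : I"
 then obtain k l where xk: "x = (k, l)" and x: "(k, l) : I" by (cases x) auto
 let ?V = "VV (k, l)"
 show "fd K A (VV x)" unfolding xk by (rule VV_fd[OF x])
 interpret V: lmod A "?V" by (rule VV_lmod[OF x])
 show "indecomposable A (VV x)"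
  unfolding xk indecomposable_def
 proof (intro conjI allI impI)
  show "car (?V) ~= {0[?V]}"
   using vg_closed[OF x] vg_not_VR[OF x] subD(2)[OF VR_submodule[OF x]] by auto
  fix N N' assume a: "submodule N A (?V) & submodule N' A (?V) &
   N \<inter> N' = {0[?V]} & N <+>\<^bsub>?V\<^esub> N' = car (?V)"
  hence N: "submodule N A (?V)" "submodule N' A (?V)" by simp_all
  have "N = car (?V) | N' = car (?V)"
  proof (rule ccontr)
   assume "~ ?thesis"
   hence "N <= VR (k, l)" "N' <= VR (k, l)" using VR_max[OF x] N by simp_all
   hence "N <+>\<^bsub>?V\<^esub> N' <= VR (k, l)" by (rule V.sum_least[OF VR_submodule[OF x]])
   thus False using a vg_closed[OF x] vg_not_VR[OF x] by blast
  qed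
  thus "N = {0[?V]} | N' = {0[?V]}"
   using a subD(1)[OF N(1)] subD(1)[OF N(2)] by (metis inf.absorb1 inf.absorb2)
 qed
 fix f assume "f : lhom A (VV x) (VV x)"
 hence f: "f : lhom A (?V) (?V)" unfolding xk .
 have fv: "f (vg (k, l)) : car (?V)" by (rule lhom_mem[OF f vg_closed[OF x]])
 obtain c where c: "c : car K" "f (vg (k, l)) -[?V] sc c *[?V] vg (k, l) : VR (k, l)"
 proof (cases "f (vg (k, l)) : VR (k, l)")
  case True
  have "f (vg (k, l)) -[?V] sc 0[K] *[?V] vg (k, l) : VR (k, l)"
   using True fv vg_closed[OF x] by simp
  thus ?thesis using that[of "0[K]"] by simp
 next
  case False
  thus ?thesis using hom_nonrad(3)[OF x x f] that by blast
 qed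
 let ?g = "\<lambda>v\<in>car (?V). f v -[?V] sc c *[?V] v"
 have scA: "sc c : car A" using c(1) by simp
 have g: "?g v : VR (k, l)" if v: "v : car (?V)" for v
 proof -
  obtain a where a: "a : car A" "v = a *[?V] vg (k, l)" using vg_gen[OF x v] by blast
  have "?g v = f v -[?V] sc c *[?V] v" using v by simp
  also have "... = a *[?V] f (vg (k, l)) -[?V] a *[?V] (sc c *[?V] vg (k, l))"
   unfolding a(2) using lhom_smult[OF f a(1) vg_closed[OF x]] sc_smult[OF VV_left[OF x] c(1) a(1) vg_closed[OF x]] by simp
  also have "... = a *[?V] (f (vg (k, l)) -[?V] sc c *[?V] vg (k, l))"
   by (rule V.smult_r_diff[OF a(1) fv, symmetric]) (rule V.smult_closed[OF scA vg_closed[OF x]])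
  finally show ?thesis using subD(5)[OF VR_submodule[OF x] a(1) c(2)] by simp
 qed
 have "~ bij_betw ?g (car (?V)) (car (?V))"
 proof
  assume "bij_betw ?g (car (?V)) (car (?V))"
  hence "vg (k, l) : ?g ` car (?V)" using vg_closed[OF x] by (simp only: bij_betw_def)
  then obtain v where "v : car (?V)" "vg (k, l) = ?g v" by (rule imageE)
  hence "vg (k, l) : VR (k, l)" using g[of v] by (simp only:)
  thus False using vg_not_VR[OF x] by simp
 qed
 thus "EX c:car K. ~ bij_betw (\<lambda>v\<in>car (VV x). f v -[VV x] sc c *[VV x] v) (car (VV x)) (car (VV x))"
  unfolding xk using c(1) by blast
next
 fix x y assume xy: "x : I" "y : I" "isomorphic A (VV x) (VV y)"
 obtain k l s t where e: "x = (k, l)" "y = (s, t)" by (cases x, cases y) auto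
 have x: "(k, l) : I" and y: "(s, t) : I" and iso: "isomorphic A (VV (k, l)) (VV (s, t))" using xy e by auto
 have half: "a = b & d <= c" if w: "(a, c) : I" "(b, d) : I" and i: "isomorphic A (VV (a, c)) (VV (b, d))" for a b c d
 proof -
  obtain f where f: "f : lhom A (VV (a, c)) (VV (b, d))" "bij_betw f (car (VV (a, c))) (car (VV (b, d)))"
   using i by (auto simp: isomorphic_def)
  have "f (vg (a, c)) ~: VR (b, d)"
  proof
   assume r: "f (vg (a, c)) : VR (b, d)"
   have "vg (b, d) : f ` car (VV (a, c))" using f(2) vg_closed[OF w(2)] by (simp add: bij_betw_def)
   then obtain u where u: "u : car (VV (a, c))" "vg (b, d) = f u" by blast
   obtain r' where r': "r' : car A" "u = r' *[VV (a, c)] vg (a, c)" using vg_gen[OF w(1) u(1)] by blast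
   have "vg (b, d) : VR (b, d)" unfolding u(2) r'(2) lhom_smult[OF f(1) r'(1) vg_closed[OF w(1)]]
    by (rule subD(5)[OF VR_submodule[OF w(2)] r'(1) r])
   thus False using vg_not_VR[OF w(2)] by simp
  qed
  from hom_nonrad(1,2)[OF w f(1) this] show ?thesis by simp
 qed
 have "isomorphic A (VV (s, t)) (VV (k, l))" by (rule isomorphic_sym[OF VV_left[OF x] VV_left[OF y] iso])
 thus "x = y" using half[OF x y iso] half[OF y x] e by simp
qed

text \<open>The canonical projection from \<open>P_k/Rad^l' P_k\<close> to
  \<open>P_k/Rad^l P_k\<close>, for \<open>l <= l'\<close>, fixed by its value at the
  generator.\<close>

definition prmap :: "nat => nat => nat => 'p set => 'p set" where
 "prmap k l l' = (SOME f. f : lhom A (VV (k, l')) (VV (k, l)) & f (vg (k, l')) = vg (k, l))"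

lemma prmap_facts:
 assumes "(k, l) : I" "(k, l') : I" "l <= l'"
 shows prmap_lhom: "prmap k l l' : lhom A (VV (k, l')) (VV (k, l))" and prmap_vg: "prmap k l l' (vg (k, l')) = vg (k, l)"
  and prmap_surj: "prmap k l l' ` car (VV (k, l')) = car (VV (k, l))"
proof -
 have m: "vg (k, l) : wt (VV (k, l)) (ei k) (soc_pow A (VV (k, l)) l')"
  unfolding wt_def mem_Collect_eq VV_soc_full_iff[OF assms(1)] by (rule conjI[OF assms(3) vg_wt[OF assms(1)]])
 obtain f where "f : lhom A (VV (k, l')) (VV (k, l))" "f (vg (k, l')) = vg (k, l)"
  by (rule Vhom_ex[OF assms(2) VV_left[OF assms(1)] m])
 hence "EX f. f : lhom A (VV (k, l')) (VV (k, l)) & f (vg (k, l')) = vg (k, l)" by blast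
 hence *: "prmap k l l' : lhom A (VV (k, l')) (VV (k, l)) & prmap k l l' (vg (k, l')) = vg (k, l)"
  unfolding prmap_def by (rule someI_ex)
 thus p: "prmap k l l' : lhom A (VV (k, l')) (VV (k, l))" "prmap k l l' (vg (k, l')) = vg (k, l)" by simp_all
 show "prmap k l l' ` car (VV (k, l')) = car (VV (k, l))"
 proof
  show "car (VV (k, l)) <= prmap k l l' ` car (VV (k, l'))"
  proof
   interpret V': lmod A "VV (k, l')" by (rule VV_lmod[OF assms(2)])
   fix z assume "z : car (VV (k, l))"
   then obtain a where a: "a : car A" "z = a *[VV (k, l)] vg (k, l)" using vg_gen[OF assms(1)] by blast
   have "z = prmap k l l' (a *[VV (k, l')] vg (k, l'))"
    using lhom_smult[OF p(1) a(1) vg_closed[OF assms(2)]] p(2) a(2) by simp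
   thus "z : prmap k l l' ` car (VV (k, l'))" using V'.smult_closed[OF a(1) vg_closed[OF assms(2)]] by blast
  qed
 qed (use lhom_mem[OF p(1)] in blast)
qed

text \<open>A map whose value at the generator lies in the smaller socle term kills the
  corresponding radical power. This is what lets maps into the radical pass through a summand of
  lower level.\<close>

lemma Vhom_factor:
 assumes w: "(s, t) : I" "(s, t') : I" "t' <= t" and M: "left_module A M"
  and f: "f : lhom A (VV (s, t)) M" "f (vg (s, t)) : soc_pow A M t'"
 obtains f' where "f' : lhom A (VV (s, t')) M" "f = compose (car (VV (s, t))) f' (prmap s t' t)"
proof -
 have m: "f (vg (s, t)) : wt M (ei s) (soc_pow A M t')" using Vhom_val[OF w(1) M f(1)] f(2) by (simp add: wt_def)
 obtain f' where f': "f' : lhom A (VV (s, t')) M" "f' (vg (s, t')) = f (vg (s, t))"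
  by (rule Vhom_ex[OF w(2) M m])
 have "f = compose (car (VV (s, t))) f' (prmap s t' t)"
  by (rule Vhom_eqI[OF w(1) f(1) lhom_comp[OF prmap_lhom[OF w(2,1,3)] f'(1) VV_left[OF w(1)]]])
   (simp add: compose_eq[OF vg_closed[OF w(1)]] prmap_vg[OF w(2,1,3)] f'(2))
 with f'(1) that show ?thesis by blast
qed

lemma Vhom_dim:
 assumes x: "(k, l) : I" and M: "fd K A M"
 shows "len K (homk A (VV (k, l)) M) = W.wd k M (soc_pow A M l)"
proof -
 note Ml = fd_left[OF M]
 have k: "k : {1..n}" using x by (simp add: index_iff)
 have sW: "submodule (wt M (ei k) (soc_pow A M l)) K (kmod A M)"
  by (rule wt_sub[OF Ml fd_kmod_sub[OF M W.soc_sub[OF Ml]] W.e_closed[OF k]])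
 have "wt M (ei k) (soc_pow A M l) <= (%f. f (vg (k, l))) ` lhom A (VV (k, l)) M"
 proof
  fix m assume "m : wt M (ei k) (soc_pow A M l)"
  from Vhom_ex[OF x Ml this] show "m : (%f. f (vg (k, l))) ` lhom A (VV (k, l)) M" by blast
 qed
 thus ?thesis
  by (intro homk_eval_len[OF VV_left[OF x] M vg_closed[OF x] sW Vhom_eqI[OF x]]) (use Vhom_val[OF x Ml] in auto)
qed

end

section \<open>Hom spaces under isomorphisms of the target, and binary products\<close>

context fdalg
begin

lemma homk_target_iso:
 fixes M :: "('a, 'm) module" and N :: "('a, 'o) module" and N' :: "('a, 'q2) module"
 assumes M: "fd K A M" and N: "fd K A N" and N': "fd K A N'" and f: "f : lhom A N N'" "bij_betw f (car N) (car N')"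
 shows "len K (homk A M N) = len K (homk A M N')"
proof -
 interpret M: lmod A M by (rule fd_lmod[OF M])
 interpret N: lmod A N by (rule fd_lmod[OF N])
 interpret N': lmod A N' by (rule fd_lmod[OF N'])
 interpret NN: two_mods A N N' ..
 let ?f' = "restrict (the_inv_into (car N) f) (car N')"
 have f': "?f' : lhom A N' N" by (rule NN.lhom_inverse[OF f])
 have inv: "f (?f' y) = y" if "y : car N'" for y
  using that f(2) f_the_inv_into_f[of f "car N" y] unfolding bij_betw_def by simp
 show ?thesis
 proof (rule flen_transferI[OF homk_left homk_left homk_flen[OF M N'], where F = "compose (car M) f"])
  have "inj_on (compose (car M) f) (lhom A M N)"
  proof (rule inj_onI, rule lhom_eqI)
   fix g h x assume g: "g : lhom A M N" "h : lhom A M N" "compose (car M) f g = compose (car M) f h" and x: "x : car M"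
   from g(3) have "f (g x) = f (h x)" using x by (metis compose_eq)
   thus "g x = h x" using f(2) lhom_mem[OF g(1) x] lhom_mem[OF g(2) x] by (simp add: bij_betw_def inj_on_def)
  qed
  moreover have "g : compose (car M) f ` lhom A M N" if g: "g : lhom A M N'" for g
  proof (rule image_eqI)
   show c: "compose (car M) ?f' g : lhom A M N" by (rule lhom_comp[OF g f' M.left])
   show "g = compose (car M) f (compose (car M) ?f' g)"
    by (rule lhom_eqI[OF g lhom_comp[OF c f(1) M.left]]) (use inv lhom_mem[OF g] in \<open>simp add: compose_eq del: restrict_apply\<close>)
  qed
  ultimately show "bij_betw (compose (car M) f) (car (homk A M N)) (car (homk A M N'))"
   using lhom_comp[OF _ f(1) M.left] by (auto simp: bij_betw_def)
 qed (use M.left N.left N'.left in \<open>auto simp: compose_def lhom_mem lhom_add[OF f(1)] lhom_smult[OF f(1)] intro!: restrict_ext\<close>)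
qed

text \<open>Unlike in \<open>dsum\<close>, the two factors may live on different types. The product
  serves to glue maps in \<open>extend_by_zero\<close> and to hold graphs in
  \<open>pull_back\<close>.\<close>

definition mprod :: "('a, 'm) module => ('a, 'n) module => ('a, 'm \<times> 'n) module" where
 "mprod M N = \<lparr>carrier = car M \<times> car N, mult = undefined, one = undefined, zero = (0[M], 0[N]),
   add = (%x y. (fst x +[M] fst y, snd x +[N] snd y)), smult = (%a x. (a *[M] fst x, a *[N] snd x))\<rparr>"

lemma mprod_simps [simp]:
 "car (mprod M N) = car M \<times> car N" "0[mprod M N] = (0[M], 0[N])"
 "x +[mprod M N] y = (fst x +[M] fst y, snd x +[N] snd y)" "a *[mprod M N] x = (a *[M] fst x, a *[N] snd x)"
 by (simp_all add: mprod_def)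

lemma mprod_fd:
 assumes M: "fd K A M" and N: "fd K A N"
 shows "fd K A (mprod M N)" "restrict fst (car M \<times> car N) : lhom A (mprod M N) M"
  "restrict snd (car M \<times> car N) : lhom A (mprod M N) N"
proof -
 interpret M: lmod A M by (rule fd_lmod[OF M])
 interpret N: lmod A N by (rule fd_lmod[OF N])
 have ab: "abelian_group (mprod M N)"
 proof (rule abelian_groupI)
  fix x assume "x : car (mprod M N)"
  thus "EX y:car (mprod M N). y +[mprod M N] x = 0[mprod M N]"
   by (intro bexI[of _ "(-[M] fst x, -[N] snd x)"]) (auto simp: M.M.l_neg N.M.l_neg)
 qed (auto simp: M.M.a_ac N.M.a_ac)
 have l: "left_module A (mprod M N)"
  by (rule left_moduleI[OF A.ring_axioms ab])
   (auto simp: M.smult_l_distr M.smult_r_distr M.smult_assoc1 N.smult_l_distr N.smult_r_distr N.smult_assoc1)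
 interpret D: lmod A "mprod M N" using l by simp
 interpret DM: two_mods A "mprod M N" M ..
 interpret DN: two_mods A "mprod M N" N ..
 show f: "restrict fst (car M \<times> car N) : lhom A (mprod M N) M" by (rule lhomI) auto
 show s: "restrict snd (car M \<times> car N) : lhom A (mprod M N) N" by (rule lhomI) auto
 let ?f = "restrict fst (car M \<times> car N)" let ?Z = "{x : car (mprod M N). ?f x = 0[M]}"
 have sZ: "submodule ?Z A (mprod M N)" by (rule DM.lhom_kernel[OF f])
 have fZ: "fd K A (restr (mprod M N) ?Z)"
 proof (rule fd_inj[OF N D.sub_left[OF sZ] lhom_restrict_source[OF s sZ]])
  show "inj_on (restrict (restrict snd (car M \<times> car N)) ?Z) (car (restr (mprod M N) ?Z))"
   by (rule inj_onI) auto
 qed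
 have "x : ?f ` car (mprod M N)" if "x : car M" for x
  by (rule image_eqI[of _ _ "(x, 0[N])"]) (use that in simp_all)
 hence "?f ` car (mprod M N) = car M" using lhom_mem[OF f] by blast
 thus "fd K A (mprod M N)" by (rule fd_extension[OF l M.left f _ fZ M])
qed

end

section \<open>Weights and structure maps over an abstract ADR algebra\<close>

text \<open>What the proof needs to know about the ADR algebra: \<open>pp k l l'\<close> is the projection \<open>P\<^sub>k / Rad\<^sup>l\<^sup>' P\<^sub>k \<rightarrow> P\<^sub>k / Rad\<^sup>l P\<^sub>k\<close>.\<close>

locale adr = walg K A I e S
 for K :: "('k, 'e) ring_scheme" (structure) and A :: "('k, 'a) module" (structure)
  and I :: "(nat \<times> nat) set" and e and S :: "nat \<times> nat => ('a, 's) module" +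
 fixes lp :: "nat => nat" and pp :: "nat => nat => nat => 'a"
 assumes index: "(k, l) : I ==> 1 <= l & l <= lp k"
  and index_down: "[|(k, l) : I; 1 <= l'; l' <= lp k|] ==> (k, l') : I"
  and pp_closed [simp]: "[|(k, l) : I; (k, l') : I; l <= l'|] ==> pp k l l' : car A"
  and pp_left: "[|(k, l) : I; (k, l') : I; l <= l'|] ==> e (k, l') \<otimes>[A] pp k l l' = pp k l l'"
  and pp_comp: "[|(k, l) : I; (k, l') : I; (k, l'') : I; l <= l'; l' <= l''|] ==> pp k l' l'' \<otimes>[A] pp k l l' = pp k l l''"
  and pp_id: "(k, l) : I ==> pp k l l = e (k, l)"
  and decomp: "[|(s, t) : I; (k, l) : I; a : car A|] ==> EX c:car K. EX b:car A.
   e (s, t) \<otimes>[A] (a \<otimes>[A] e (k, l)) = (if s = k & l <= t then sc c \<otimes>[A] pp k l t else 0[A]) +[A] b &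
   (b = 0[A] | (EX t' a'. t' < l & t' <= t & (s, t') : I & a' : car A &
    b = pp s t' t \<otimes>[A] (e (s, t') \<otimes>[A] (a' \<otimes>[A] e (k, l)))))"
  and lift: "[|(i, lp i) : I; (k, l) : I; (k, Suc l) : I; a : car A|] ==>
   EX b:car A. e (i, lp i) \<otimes>[A] (a \<otimes>[A] e (k, l)) = b \<otimes>[A] pp k l (Suc l)"
begin

lemma pp_wt:
 fixes M :: "('a, 'm) module"
 assumes M: "left_module A M" and N: "submodule N A M" and w: "(k, l) : I" "(k, l') : I" "l <= l'" and m: "m : N"
 shows "pp k l l' *[M] m : wt M (e (k, l')) N"
proof -
 interpret M: lmod A M using M by simp
 have "m : car M" by (rule M.sub_mem[OF N m])
 hence "e (k, l') *[M] (pp k l l' *[M] m) = pp k l l' *[M] m"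
  using pp_left[OF w] M.smult_assoc1[of "e (k, l')" "pp k l l'" m] w by simp
 thus ?thesis using subD(5)[OF N pp_closed[OF w] m] by (simp add: wt_def)
qed

text \<open>The assumption \<open>decomp\<close>, evaluated at a vector \<open>m\<close> of weight
  \<open>(k, l)\<close>: up to terms that pass through a level below \<open>l\<close>, a weight
  vector in \<open>A m\<close> is a multiple of an image of \<open>m\<close> under a structure
  map.\<close>

lemma wt_decomp:
 fixes M :: "('a, 'm) module"
 assumes M: "left_module A M" and m: "m : wt M (e (k, l)) (car M)" and w: "(k, l) : I" "(s, t) : I" and a: "a : car A"
 obtains c y where "c : car K" "y : car M"
  "e (s, t) *[M] (a *[M] m) = (if s = k & l <= t then sc c *[M] (pp k l t *[M] m) else 0[M]) +[M] y"
  "y = 0[M] | (EX t' b. t' < l & t' <= t & (s, t') : I & b : car A & y = pp s t' t *[M] (e (s, t') *[M] (b *[M] m)))"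
proof -
 interpret M: lmod A M using M by simp
 have mc: "m : car M" "e (k, l) *[M] m = m" using m by (auto simp: wt_def)
 have ex: "e w *[M] (r *[M] m) = (e w \<otimes>[A] (r \<otimes>[A] e (k, l))) *[M] m" if "w : I" "r : car A" for w r
  using that w mc by (simp add: M.smult_assoc1)
 obtain c b where c: "c : car K" "b : car A"
  "e (s, t) \<otimes>[A] (a \<otimes>[A] e (k, l)) = (if s = k & l <= t then sc c \<otimes>[A] pp k l t else 0[A]) +[A] b"
  "b = 0[A] | (EX t' a'. t' < l & t' <= t & (s, t') : I & a' : car A &
    b = pp s t' t \<otimes>[A] (e (s, t') \<otimes>[A] (a' \<otimes>[A] e (k, l))))" using decomp[OF w(2,1) a] by blast
 show ?thesis
 proof (rule that[OF c(1) M.smult_closed[OF c(2) mc(1)]])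
  show "e (s, t) *[M] (a *[M] m) = (if s = k & l <= t then sc c *[M] (pp k l t *[M] m) else 0[M]) +[M] b *[M] m"
  proof (cases "s = k & l <= t")
   case True
   hence "pp k l t : car A" using w by simp
   thus ?thesis using True c(1,2) mc unfolding ex[OF w(2) a] c(3) by (simp add: M.smult_l_distr M.smult_assoc1)
  next
   case False
   have z: "0[A] : car A" by simp
   show ?thesis unfolding ex[OF w(2) a] c(3) if_not_P[OF False] M.smult_l_distr[OF z c(2) mc(1)] M.smult_l_null[OF mc(1)] ..
  qed
  from c(4) show "b *[M] m = 0[M] | (EX t' r. t' < l & t' <= t & (s, t') : I & r : car A & b *[M] m = pp s t' t *[M] (e (s, t') *[M] (r *[M] m)))"
  proof
   assume "b = 0[A]" thus ?thesis using mc(1) by simp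
  next
   assume "EX t' a'. t' < l & t' <= t & (s, t') : I & a' : car A & b = pp s t' t \<otimes>[A] (e (s, t') \<otimes>[A] (a' \<otimes>[A] e (k, l)))"
   then obtain t' r where r: "t' < l" "t' <= t" "(s, t') : I" "r : car A" "b = pp s t' t \<otimes>[A] (e (s, t') \<otimes>[A] (r \<otimes>[A] e (k, l)))" by blast
   have "b *[M] m = pp s t' t *[M] (e (s, t') *[M] (r *[M] m))"
    unfolding ex[OF r(3,4)] r(5) using r(2-4) w mc(1) by (simp add: M.smult_assoc1)
   thus ?thesis using r by blast
  qed
 qed
qed

text \<open>If \<open>N\<close> contains the part of \<open>Am\<close> of level below that of \<open>m\<close>, then \<open>(N + Am)/N\<close> looks like a standard module.\<close>

lemma rel_wt:
 fixes M :: "('a, 'm) module"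
 assumes M: "left_module A M" and N: "submodule N A M" and m: "m : wt M (e (k, l)) (car M)" and w: "(k, l) : I" "(s, t) : I"
  and a: "a : car A" and below: "!!s t b. [|(s, t) : I; t < l; b : car A|] ==> e (s, t) *[M] (b *[M] m) : N"
 obtains (low) "e (s, t) *[M] (a *[M] m) : N"
 | (top) c y where "s = k" "l <= t" "c : car K" "y : N" "e (s, t) *[M] (a *[M] m) = sc c *[M] (pp k l t *[M] m) +[M] y"
proof -
 interpret M: lmod A M using M by simp
 obtain c y where c: "c : car K" "y : car M"
  "e (s, t) *[M] (a *[M] m) = (if s = k & l <= t then sc c *[M] (pp k l t *[M] m) else 0[M]) +[M] y"
  "y = 0[M] | (EX t' b. t' < l & t' <= t & (s, t') : I & b : car A & y = pp s t' t *[M] (e (s, t') *[M] (b *[M] m)))"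
  by (rule wt_decomp[OF M m w a])
 have y: "y : N" using c(4)
 proof
  assume "EX t' b. t' < l & t' <= t & (s, t') : I & b : car A & y = pp s t' t *[M] (e (s, t') *[M] (b *[M] m))"
  then obtain t' b where b: "t' < l" "t' <= t" "(s, t') : I" "b : car A" "y = pp s t' t *[M] (e (s, t') *[M] (b *[M] m))" by blast
  show ?thesis unfolding b(5) by (rule subD(5)[OF N pp_closed[OF b(3) w(2) b(2)] below[OF b(3,1,4)]])
 qed (use subD(2)[OF N] in simp)
 show ?thesis
 proof (cases "s = k & l <= t")
  case True thus ?thesis using top[of c y] c y by simp
 next
  case False thus ?thesis using low[unfolded c(3)] y c(2) by (auto intro: low)
 qed
qed

text \<open>The structure maps \<open>pp k l (Suc l)\<close> act injectively on \<open>D / N\<close>.\<close>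

definition rel_inj :: "('a, 'm) module => 'm set => 'm set => bool" where
 "rel_inj M N D \<longleftrightarrow> (ALL k l m. (k, l) : I --> (k, Suc l) : I --> m : wt M (e (k, l)) D --> pp k l (Suc l) *[M] m : N --> m : N)"

lemma rel_injI: "(!!k l m. [|(k, l) : I; (k, Suc l) : I; m : wt M (e (k, l)) D; pp k l (Suc l) *[M] m : N|] ==> m : N) ==> rel_inj M N D"
 by (simp add: rel_inj_def)

lemma rel_injD: "[|rel_inj M N D; (k, l) : I; (k, Suc l) : I; m : wt M (e (k, l)) D; pp k l (Suc l) *[M] m : N|] ==> m : N"
 by (simp add: rel_inj_def)

lemma rel_inj_trans: "[|submodule D A M; left_module A M; rel_inj M N N'; rel_inj M N' D; N <= N'|] ==> rel_inj M N D"
 unfolding rel_inj_def wt_def by blast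

lemma rel_inj_pp:
 fixes M :: "('a, 'm) module"
 assumes M: "left_module A M" and D: "submodule D A M" and r: "rel_inj M N D" and w: "(k, l) : I" "(k, l') : I" "l <= l'"
  and m: "m : wt M (e (k, l)) D" and n: "pp k l l' *[M] m : N"
 shows "m : N"
 using w(3,2) n
proof (induction l' rule: dec_induct)
 case base
 thus ?case using m pp_id[OF w(1)] by (simp add: wt_def)
next
 case (step t)
 interpret M: lmod A M using M by simp
 have t: "(k, t) : I" using index_down[OF w(1), of t] index[OF w(1)] index[OF step.prems(1)] step.hyps by simp
 have mD: "m : D" using m by (simp add: wt_def)
 have "pp k t (Suc t) *[M] (pp k l t *[M] m) = pp k l (Suc t) *[M] m"
  using pp_comp[OF w(1) t step.prems(1)] M.smult_assoc1[of "pp k t (Suc t)" "pp k l t" m] step t w(1) M.sub_mem[OF D mD] by simp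
 hence "pp k l t *[M] m : N"
  using rel_injD[OF r t step.prems(1) pp_wt[OF M D w(1) t step.hyps(1) mD]] step.prems(2) by simp
 thus ?case by (rule step.IH[OF t])
qed

end

context fdalg
begin

lemma sc_cancel:
 fixes M :: "('a, 'm) module"
 assumes M: "left_module A M" and N: "submodule N A M" and c: "c : car K" "c ~= 0[K]" and x: "x : car M" "sc c *[M] x : N"
 shows "x : N"
proof -
 interpret M: lmod A M using M by simp
 have ci: "inv\<^bsub>K\<^esub> c : car K" "inv\<^bsub>K\<^esub> c \<otimes>[K] c = 1[K]" using c K.field_Units K.Units_l_inv K.Units_inv_closed by auto
 have one: "sc (inv\<^bsub>K\<^esub> c) \<otimes>[A] sc c = 1[A]"
  using sc_mult[OF ci(1), of "sc c"] c(1) ci smult_assoc1[OF ci(1) c(1) A.one_closed] by simp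
 have "sc (inv\<^bsub>K\<^esub> c) *[M] (sc c *[M] x) : N" using ci(1) by (intro subD(5)[OF N _ x(2)]) simp
 thus ?thesis using M.smult_assoc1[of "sc (inv\<^bsub>K\<^esub> c)" "sc c" x] ci(1) c(1) x(1) one by simp
qed

text \<open>On the product of \<open>N\<close> and \<open>C\<close> the map sending
  \<open>(x, y)\<close> to \<open>g x\<close> factors through addition, because \<open>g\<close>
  vanishes on the intersection.\<close>

lemma extend_by_zero:
 fixes M :: "('a, 'm) module" and Y :: "('a, 'y) module"
 assumes M: "fd K A M" and N: "submodule N A M" and C: "submodule C A M" and Y: "left_module A Y"
  and g: "g : lhom A (restr M N) Y" and z: "!!x. [|x : N; x : C|] ==> g x = 0[Y]"
 obtains h where "h : lhom A (restr M (N <+>\<^bsub>M\<^esub> C)) Y" "!!x. x : N ==> h x = g x"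
proof -
 interpret M: lmod A M by (rule fd_lmod[OF M])
 interpret Y: lmod A Y using Y by simp
 let ?D = "mprod (restr M N) (restr M C)" let ?S = "N <+>\<^bsub>M\<^esub> C"
 have mem: "x : car M" if "x : N | x : C" for x using that M.sub_mem N C by blast
 have D: "fd K A ?D" by (rule mprod_fd(1)[OF fd_sub[OF M N] fd_sub[OF M C]])
 have S: "left_module A (restr M ?S)" by (rule M.sub_left[OF M.sub_sum[OF N C]])
 interpret DS: two_mods A ?D "restr M ?S" using fd_lmod[OF D] S by simp
 let ?f = "\<lambda>x\<in>car ?D. fst x +[M] snd x"
 have f: "?f : lhom A ?D (restr M ?S)"
 proof (rule lhomI)
  fix x y assume "x : car ?D" "y : car ?D"
  thus "?f (x +[?D] y) = ?f x +[restr M ?S] ?f y"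
   using mem DS.M.M.a_closed[of x y] by (auto simp: M.M.a_ac)
 next
  fix r x assume "r : car A" "x : car ?D"
  thus "?f (r *[?D] x) = r *[restr M ?S] ?f x"
   using mem DS.M.smult_closed[of r x] by (auto simp: M.smult_r_distr)
 qed (auto intro: M.set_addI)
 have sf: "?f ` car ?D = car (restr M ?S)"
  by (auto simp: M.mem_set_add intro: M.set_addI) (auto simp: image_iff)
 have g': "compose (car ?D) g (restrict fst (N \<times> C)) : lhom A ?D Y"
  using lhom_comp[OF mprod_fd(2)[OF fd_sub[OF M N] fd_sub[OF M C]] g DS.M.left] by simp
 obtain h where h: "h : lhom A (restr M ?S) Y" "!!x. x : car ?D ==> h (?f x) = compose (car ?D) g (restrict fst (N \<times> C)) x"
 proof (rule DS.lhom_factor[OF f sf Y g'])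
  fix x assume x: "x : car ?D" "?f x = 0[restr M ?S]"
  hence c: "fst x : N" "snd x : C" "fst x +[M] snd x = 0[M]" by auto
  hence "fst x = -[M] snd x" using mem by (metis M.M.minus_equality)
  hence "fst x : C" using c(2) subD(3)[OF C] by simp
  thus "compose (car ?D) g (restrict fst (N \<times> C)) x = 0[Y]"
   using x c(1,2) z by (simp add: compose_eq)
 qed (rule that)
 have "h x = g x" if x: "x : N" for x
  using h(2)[of "(x, 0[M])"] x subD(2)[OF C] mem by (simp add: compose_eq)
 with h(1) show ?thesis by (rule that)
qed

end

section \<open>Extending homomorphisms into costandard modules\<close>

context adr
begin

text \<open>The largest submodule of \<open>M\<close> that has no composition factor
  \<open>S z\<close> with \<open>z\<close> in \<open>Z\<close>.\<close>

definition killed :: "('a, 'm) module => (nat \<times> nat) set => 'm set" where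
 "killed M Z = {h : car M. ALL z:Z. ALL a:car A. e z *[M] (a *[M] h) = 0[M]}"

lemma killedD: "[|h : killed M Z; z : Z; a : car A|] ==> e z *[M] (a *[M] h) = 0[M]"
 unfolding killed_def by blast

lemma killed_submodule:
 assumes M: "left_module A M" and Z: "Z <= I"
 shows "submodule (killed M Z) A M"
proof -
 interpret M: lmod A M using M by simp
 have e: "e z : car A" if "z : Z" for z using that Z by auto
 show ?thesis
 proof (rule M.submoduleI)
  fix a h assume a: "a : car A" and h: "h : killed M Z"
  have hc: "h : car M" using h by (simp add: killed_def)
  have "e z *[M] (b *[M] (a *[M] h)) = 0[M]" if "z : Z" "b : car A" for z b
   using killedD[OF h that(1), of "b \<otimes>[A] a"] M.smult_assoc1[OF that(2) a hc] a that(2) by simp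
  thus "a *[M] h : killed M Z" using a hc by (simp add: killed_def)
 qed (auto simp: killed_def M.smult_r_distr e)
qed

lemma killed_wt:
 assumes M: "left_module A M" and h: "h : killed M Z" "z : Z" "e z *[M] h = h" shows "h = 0[M]"
proof -
 interpret M: lmod A M using M by simp
 have "h : car M" using h by (simp add: killed_def)
 thus ?thesis using killedD[OF h(1,2), of "1[A]"] h(3) by simp
qed

lemma subset_killed:
 assumes M: "left_module A M" and Z: "Z <= I" and N: "submodule N A M" and z: "!!z. z : Z ==> wt M (e z) N <= {0[M]}"
 shows "N <= killed M Z"
proof -
 interpret M: lmod A M using M by simp
 show ?thesis unfolding killed_def using wt_e[OF M N] z subD(5)[OF N] M.sub_mem[OF N] Z by blast
qed

text \<open>The costandard module at \<open>y\<close> inside the hull \<open>H\<close>: the excluded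
  indices are those not below \<open>y\<close> for \<open>adr_le\<close>. Agreement with
  \<open>costandard\<close> is \<open>costandard_nab\<close>.\<close>

definition nab :: "('a, 'h) module => nat \<times> nat => ('a, 'h) module" where
 "nab H y = restr H (killed H {z : I. z ~= y & snd z <= snd y})"

lemma nab_left: "left_module A H ==> left_module A (nab H y)"
 unfolding nab_def by (rule lmod.sub_left[OF _ killed_submodule]) (auto simp: lmod_def)

lemma nab_simps [simp]: "0[nab H y] = 0[H]" "add (nab H y) = add H" "smult (nab H y) = smult H"
 by (simp_all add: nab_def)

lemma hom_nab_zero:
 assumes H: "left_module A H" and M: "left_module A M" and N: "submodule N A M" and g: "g : lhom A (restr M N) (nab H y)"
  and z: "z : I" "z ~= y" "snd z <= snd y" and u: "u : wt M (e z) N"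
 shows "g u = 0[H]"
proof -
 have u': "u : car (restr M N)" "e z *[M] u = u" using u by (auto simp: wt_def)
 have gu: "g u : killed H {z : I. z ~= y & snd z <= snd y}" using lhom_mem[OF g u'(1)] by (simp add: nab_def)
 have ez: "e z *[H] g u = g u" using lhom_smult[OF g e_closed[OF z(1)] u'(1)] by (simp add: u'(2))
 have "z : {z : I. z ~= y & snd z <= snd y}" using z by simp
 thus ?thesis by (rule killed_wt[OF H gu _ ez])
qed

text \<open>Enlarge \<open>N\<close> by a vector \<open>m\<close> of the lowest level
  \<open>l\<close> at which \<open>D\<close> is not yet inside \<open>N\<close>. By
  \<open>rel_wt\<close> the new part is spanned modulo \<open>N\<close> by images of
  \<open>m\<close> under structure maps, which also preserves \<open>rel_inj\<close>. If
  \<open>l\<close> is at most the level of \<open>y\<close>, then \<open>g\<close> vanishes on the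
  intersection of \<open>N\<close> with \<open>A m\<close> and extends by zero. If \<open>l\<close>
  is larger, \<open>g\<close> extends to the injective \<open>H\<close>, and the extension stays in
  the costandard module.\<close>

lemma extend_step:
 fixes M :: "('a, 'm) module" and H :: "('a, 'h) module"
 assumes M: "fd K A M" and N: "submodule N A M" and D: "submodule D A M" and sub: "N <= D" "N ~= D" and r: "rel_inj M N D"
  and H: "injective A H" and g: "g : lhom A (restr M N) (nab H y)"
 obtains N' h where "submodule N' A M" "N <= N'" "N ~= N'" "N' <= D" "rel_inj M N' D"
  "h : lhom A (restr M N') (nab H y)" "!!x. x : N ==> h x = g x"
proof -
 interpret M: lmod A M by (rule fd_lmod[OF M])
 have fH: "fd K A H" by (rule fg_imp_fd[OF H[unfolded injective_def, THEN conjunct1]])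
 interpret H: lmod A H by (rule fd_lmod[OF fH])
 note Ml = M.left and Hl = H.left
 define bad where "bad t \<longleftrightarrow> (EX s. (s, t) : I & ~ wt M (e (s, t)) D <= N)" for t
 obtain i where "i : I" "~ wt M (e i) D <= N" using wt_determines[OF M N D sub(1)] sub(2) by blast
 hence "bad (snd i)" unfolding bad_def by (intro exI[of _ "fst i"]) simp
 then obtain l where l: "bad l" "!!t. t < l ==> ~ bad t" by (metis LeastI not_less_Least)
 obtain k where k: "(k, l) : I" "~ wt M (e (k, l)) D <= N" using l(1) unfolding bad_def by blast
 then obtain m where m: "m : wt M (e (k, l)) D" "m ~: N" by blast
 have low: "u : N" if "(s, t) : I" "t < l" "u : wt M (e (s, t)) D" for s t u using l(2)[OF that(2)] that(1,3) unfolding bad_def by blast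
 have mD: "m : D" "m : car M" "m : wt M (e (k, l)) (car M)" using m(1) M.sub_mem[OF D] by (auto simp: wt_def)
 have below: "e (s, t) *[M] (b *[M] m) : wt M (e (s, t)) N" if "(s, t) : I" "t < l" "b : car A" for s t b
  using low[OF that(1,2) wt_e[OF Ml D that(1) subD(5)[OF D that(3) mD(1)]]]
   wt_e[OF Ml D that(1) subD(5)[OF D that(3) mD(1)]] by (simp add: wt_def)
 hence belowN: "e (s, t) *[M] (b *[M] m) : N" if "(s, t) : I" "t < l" "b : car A" for s t b using that by (simp add: wt_def)
 have C: "submodule (M.cyc m) A M" by (rule M.cyc_sub[OF mD(2)])
 let ?N' = "N <+>\<^bsub>M\<^esub> M.cyc m"
 have N': "submodule ?N' A M" by (rule M.sub_sum[OF N C])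
 have up: "N <= ?N'" "M.cyc m <= ?N'" by (rule M.sum_upper1[OF N C], rule M.sum_upper2[OF N C])
 have "m : ?N'" using up(2) M.cyc_self[OF mD(2)] by blast
 hence ne: "N ~= ?N'" using m(2) by blast
 have N'D: "?N' <= D" by (rule M.sum_least[OF D sub(1) M.cyc_least[OF D mD(1)]])
 have rel: "rel_inj M ?N' D"
 proof (rule rel_injI)
  fix s u x assume w: "(s, u) : I" "(s, Suc u) : I" and x: "x : wt M (e (s, u)) D" and px: "pp s u (Suc u) *[M] x : ?N'"
  have xD: "x : D" "x : car M" using x M.sub_mem[OF D] by (auto simp: wt_def)
  define q where "q = pp s u (Suc u) *[M] x"
  have pc: "pp s u (Suc u) : car A" using w by simp
  have q: "e (s, Suc u) *[M] q = q" "q : car M" using pp_wt[OF Ml D w _ xD(1)] pc xD(2) by (simp_all add: q_def wt_def)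
  obtain n' a where na: "n' : N" "a : car A" "q = n' +[M] a *[M] m"
   using px unfolding q_def[symmetric] M.mem_set_add M.cyc_def by blast
  have nc: "n' : car M" by (rule M.sub_mem[OF N na(1)])
  have qe: "q = e (s, Suc u) *[M] n' +[M] e (s, Suc u) *[M] (a *[M] m)"
   using q(1) M.smult_r_distr[OF e_closed[OF w(2)] nc M.smult_closed[OF na(2) mD(2)]] na(3) by simp
  have en: "e (s, Suc u) *[M] n' : N" by (rule subD(5)[OF N e_closed[OF w(2)] na(1)])
  show "x : ?N'"
  proof (rule rel_wt[OF Ml N mD(3) k(1) w(2) na(2)])
   fix s t b assume "(s, t) : I" "t < l" "b : car A"
   thus "e (s, t) *[M] (b *[M] m) : N" by (rule belowN)
  next
   assume "e (s, Suc u) *[M] (a *[M] m) : N"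
   hence "q : N" unfolding qe using subD(4)[OF N en] by simp
   hence "x : N" using rel_injD[OF r w x] by (simp add: q_def)
   thus ?thesis using up(1) by blast
  next
   fix c v assume c: "s = k" "l <= Suc u" "c : car K" "v : N" "e (s, Suc u) *[M] (a *[M] m) = sc c *[M] (pp k l (Suc u) *[M] m) +[M] v"
   show ?thesis
   proof (cases "u < l")
    case True thus ?thesis using low[OF w(1) _ x] up(1) by blast
   next
    case False
    hence lu: "l <= u" by simp
    have w': "(k, u) : I" "(k, Suc u) : I" using w c(1) by simp_all
    have pc': "pp k u (Suc u) : car A" "pp k l u : car A" "sc c : car A" using w' k(1) lu c(3) by simp_all
    \<comment> \<open>The multiple of the image of \<open>m\<close> at the level of \<open>x\<close>
      that has, modulo \<open>N\<close>, the same image as \<open>x\<close> under the structure map.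
      So \<open>rel_inj\<close> applies to the difference of \<open>x\<close> and
      \<open>b\<close>.\<close>
    define b where "b = sc c *[M] (pp k l u *[M] m)"
    have ppm: "pp k l u *[M] m : wt M (e (k, u)) (M.cyc m)" by (rule pp_wt[OF Ml C k(1) w'(1) lu M.cyc_self[OF mD(2)]])
    have pm: "pp k l u *[M] m : car M" "e (k, u) *[M] (pp k l u *[M] m) = pp k l u *[M] m" "pp k l u *[M] m : M.cyc m"
     using ppm pc' mD(2) by (simp_all add: wt_def)
    have b: "b : M.cyc m" "b : car M" using subD(5)[OF C pc'(3) pm(3)] M.sub_mem[OF C] by (simp_all add: b_def)
    have bD: "b : D" using b(1) up(2) N'D by blast
    have eb: "e (k, u) *[M] b = b" unfolding b_def using sc_smult[OF Ml c(3) e_closed[OF w'(1)] pm(1)] pm(2) by simp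
    have pb: "pp k u (Suc u) *[M] b = sc c *[M] (pp k l (Suc u) *[M] m)"
     unfolding b_def sc_smult[OF Ml c(3) pc'(1) pm(1), symmetric]
     using M.smult_assoc1[OF pc'(1,2) mD(2)] pp_comp[OF k(1) w' lu] by simp
    have pbc: "sc c *[M] (pp k l (Suc u) *[M] m) : car M" using pb pc' b(2) by (metis M.smult_closed)
    have "x -[M] b : wt M (e (k, u)) D"
     using M.sub_minus[OF D xD(1) bD] M.smult_r_diff[OF e_closed[OF w'(1)] xD(2) b(2)] eb x c(1) by (simp add: wt_def)
    moreover have "pp k u (Suc u) *[M] (x -[M] b) : N"
    proof -
     have vc: "v : car M" "e (s, Suc u) *[M] n' : car M" using M.sub_mem[OF N] c(4) en by simp_all
     have "pp k u (Suc u) *[M] (x -[M] b) = q -[M] sc c *[M] (pp k l (Suc u) *[M] m)"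
      unfolding M.smult_r_diff[OF pc'(1) xD(2) b(2)] pb q_def c(1) ..
     also have "q = (e (s, Suc u) *[M] n' +[M] v) +[M] sc c *[M] (pp k l (Suc u) *[M] m)"
      using qe c(5) vc pbc by (simp add: M.M.a_ac)
     finally have "pp k u (Suc u) *[M] (x -[M] b) = e (s, Suc u) *[M] n' +[M] v"
      using M.add_diff_cancel[OF M.M.a_closed[OF vc(2,1)] pbc] by simp
     thus ?thesis using subD(4)[OF N en c(4)] by simp
    qed
    ultimately have "x -[M] b : N" by (rule rel_injD[OF r w'])
    hence "(x -[M] b) +[M] b : ?N'" using b(1) by (rule M.set_addI)
    thus ?thesis using xD(2) b(2) by simp
   qed
  qed
 qed
 show ?thesis
 proof (cases "l <= snd y")
  case True
  interpret NY: two_mods A "restr M N" "nab H y"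
   using M.sub_left[OF N] nab_left[OF Hl] by simp
  define N0 where "N0 = {x : N. g x = 0[H]}"
  have "submodule N0 A (restr M N)" using NY.lhom_kernel[OF g] by (simp add: N0_def)
  hence N0: "submodule N0 A M" "N0 <= N" using M.sub_restr_iff[OF N] by auto
  let ?I = "N \<inter> M.cyc m"
  have I: "submodule ?I A M" by (rule M.sub_Int[OF N C])
  \<comment> \<open>\<open>g\<close> vanishes on the intersection: a nonzero coefficient
    \<open>c\<close> would put an image of \<open>m\<close> into \<open>N\<close>, and then
    \<open>rel_inj_pp\<close> would put \<open>m\<close> itself there.\<close>
  have "N0 \<inter> ?I = ?I"
  proof (rule wt_determines[OF M M.sub_Int[OF N0(1) I] I])
   fix w assume w: "w : I"
   obtain s t where st: "w = (s, t)" by (cases w)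
   show "wt M (e w) ?I <= N0 \<inter> ?I"
   proof
    fix x assume x: "x : wt M (e w) ?I"
    then obtain a where a: "a : car A" "x = a *[M] m" by (auto simp: wt_def M.cyc_def)
    have xI: "x : ?I" "e (s, t) *[M] (a *[M] m) = x" using x a st by (auto simp: wt_def)
    have "x : N0"
    proof (rule rel_wt[OF Ml N0(1) mD(3) k(1) w[unfolded st] a(1)])
     fix s' t' b assume b: "(s', t') : I" "t' < l" "b : car A"
     have "g (e (s', t') *[M] (b *[M] m)) = 0[H]"
      by (rule hom_nab_zero[OF Hl Ml N g b(1) _ _ below[OF b]]) (use b(2) True in auto)
     thus "e (s', t') *[M] (b *[M] m) : N0" using belowN[OF b] by (simp add: N0_def)
    next
     assume "e (s, t) *[M] (a *[M] m) : N0" thus ?thesis using xI(2) by simp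
    next
     fix c v assume c: "s = k" "l <= t" "c : car K" "v : N0" "e (s, t) *[M] (a *[M] m) = sc c *[M] (pp k l t *[M] m) +[M] v"
     have wkt: "(k, t) : I" using w st c(1) by simp
     have pc: "pp k l t : car A" using k(1) wkt c(2) by simp
     define z where "z = sc c *[M] (pp k l t *[M] m)"
     have pm: "pp k l t *[M] m : car M" using pc mD(2) by simp
     have zc: "z : car M" "v : car M" "v : N" using c(3,4) pm N0(2) M.sub_mem[OF N] by (auto simp: z_def)
     have xz: "x = z +[M] v" using c(5) xI(2) by (simp add: z_def)
     have "x -[M] v : N" using xI(1) zc(3) by (intro M.sub_minus[OF N]) auto
     hence zN: "z : N" unfolding xz M.add_diff_cancel[OF zc(1,2)] .
     have "c = 0[K]"
     proof (rule ccontr)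
      assume "c ~= 0[K]"
      hence "pp k l t *[M] m : N" using zN by (intro sc_cancel[OF Ml N c(3) _ pm]) (simp_all add: z_def)
      hence "m : N" by (rule rel_inj_pp[OF Ml D r k(1) wkt c(2) m(1)])
      thus False using m(2) by simp
     qed
     hence "z = 0[M]" using pm by (simp add: z_def)
     thus ?thesis using xz zc(2) c(4) by simp
    qed
    thus "x : N0 \<inter> ?I" using xI(1) by simp
   qed
  qed blast
  hence zero: "g x = 0[nab H y]" if "x : N" "x : M.cyc m" for x using that by (auto simp: N0_def)
  obtain h where "h : lhom A (restr M ?N') (nab H y)" "!!x. x : N ==> h x = g x"
   using extend_by_zero[OF M N C nab_left[OF Hl] g zero] by blast
  thus ?thesis by (rule that[OF N' up(1) ne N'D rel])
 next
  case False
  let ?Z = "{z : I. z ~= y & snd z <= snd y}"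
  have Z: "?Z <= I" by auto
  have g': "g : lhom A (restr (restr M ?N') N) H"
   using lhom_restr_target[OF g[unfolded nab_def] subD(1)[OF killed_submodule[OF Hl Z]]] by simp
  have NN': "submodule N A (restr M ?N')" using M.sub_restr_iff[OF N'] N up(1) by simp
  obtain h where h: "h : lhom A (restr M ?N') H" "!!x. x : N ==> h x = g x"
   using injective_extend[OF H fd_sub[OF M N'] NN' g'] by blast
  \<comment> \<open>Vectors of \<open>D\<close> at levels up to that of \<open>y\<close> are below
    \<open>l\<close>, so they already lie in \<open>N\<close>, where \<open>h\<close> agrees with
    \<open>g\<close>.\<close>
  have "h ` ?N' <= killed H ?Z"
  proof (rule subset_killed[OF Hl Z])
   interpret N'H: two_mods A "restr M ?N'" H
    using M.sub_left[OF N'] Hl by simp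
   show "submodule (h ` ?N') A H" using N'H.lhom_image[OF h(1) N'H.M.sub_carrier] by simp
   fix z assume z: "z : ?Z"
   hence zL: "z : I" "z ~= y" "snd z <= snd y" by auto
   show "wt H (e z) (h ` ?N') <= {0[H]}"
   proof
    fix x assume "x : wt H (e z) (h ` ?N')"
    then obtain u where u: "u : ?N'" "x = h u" "e z *[H] x = x" by (auto simp: wt_def)
    have "e z *[M] u : wt M (e z) D" using wt_e[OF Ml D zL(1)] u(1) N'D by blast
    hence eN: "e z *[M] u : wt M (e z) N" using low[of "fst z" "snd z" "e z *[M] u"] zL False by (simp add: wt_def)
    have "x = h (e z *[M] u)" using lhom_smult[OF h(1) e_closed[OF zL(1)], of u] u by simp
    also have "... = g (e z *[M] u)" using eN h(2) by (simp add: wt_def)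
    also have "... = 0[H]" by (rule hom_nab_zero[OF Hl Ml N g zL eN])
    finally show "x : {0[H]}" by simp
   qed
  qed
  hence "h : lhom A (restr M ?N') (nab H y)" unfolding nab_def by (intro lhom_image_target[OF h(1)]) simp
  thus ?thesis using h(2) by (rule that[OF N' up(1) ne N'D rel])
 qed
qed

text \<open>Iterate \<open>extend_step\<close> until it stops at \<open>D\<close>. This is the
  surjectivity of restriction that the vanishing of \<open>Ext^1\<close> from \<open>D/N\<close> to
  the costandard module would give.\<close>

lemma extend_nab:
 fixes M :: "('a, 'm) module" and H :: "('a, 'h) module"
 assumes M: "fd K A M" and N: "submodule N A M" and D: "submodule D A M" and sub: "N <= D" and r: "rel_inj M N D"
  and H: "injective A H" and g: "g : lhom A (restr M N) (nab H y)"
 obtains h where "h : lhom A (restr M D) (nab H y)" "!!x. x : N ==> h x = g x"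
proof -
 define ok where "ok N' \<longleftrightarrow> N <= N' & N' <= D & rel_inj M N' D & (EX h:lhom A (restr M N') (nab H y). ALL x:N. h x = g x)" for N'
 have "ok N" unfolding ok_def using sub r g by blast
 then obtain N' where N': "submodule N' A M" "N <= N'" "ok N'" "!!X. [|submodule X A M; ok X; N' <= X|] ==> X = N'"
  using exists_maximal_submodule[OF M N, of ok] by blast
 obtain h where h: "N' <= D" "rel_inj M N' D" "h : lhom A (restr M N') (nab H y)" "!!x. x : N ==> h x = g x"
  using N'(3) unfolding ok_def by blast
 have "N' = D"
 proof (rule ccontr)
  assume "N' ~= D"
  then obtain X h' where X: "submodule X A M" "N' <= X" "N' ~= X" "X <= D" "rel_inj M X D"
   "h' : lhom A (restr M X) (nab H y)" "!!x. x : N' ==> h' x = h x"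
   using extend_step[OF M N'(1) D h(1) _ h(2) H h(3)] by blast
  have "ALL x:N. h' x = g x" using X(7) h(4) N'(2) by auto
  hence "ok X" unfolding ok_def using X N'(2) by blast
  thus False using N'(4)[OF X(1) _ X(2)] X(3) by blast
 qed
 thus ?thesis using that h(3,4) by blast
qed

text \<open>The costandardly filtered \<open>N r / N 0\<close> is a direct summand of
  \<open>D / N 0\<close>, as an injective submodule would be. The map from \<open>N (Suc r)\<close>
  onto its top factor extends to \<open>D\<close> by \<open>extend_nab\<close>; the kernel of the
  extension meets \<open>N (Suc r)\<close> in \<open>N r\<close> and takes the role of
  \<open>D\<close> in the induction.\<close>

lemma relative_complement:
 fixes M :: "('a, 'm) module" and H :: "nat \<times> nat => ('a, 'h) module"
 assumes M: "fd K A M" and H: "!!y. y : I ==> injective A (H y)"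
  and N: "!!a. a <= r ==> submodule (N a) A M"
  and D: "submodule D A M" "N r <= D" "rel_inj M (N r) D"
  and q: "!!a. a < r ==> N a <= N (Suc a) & (EX y:I. EX q:lhom A (restr M (N (Suc a))) (nab (H y) y).
   q ` N (Suc a) = car (nab (H y) y) & N a = {x : N (Suc a). q x = 0[H y]})"
 shows "EX W. submodule W A M & W <= D & W \<inter> N r = N 0 & D <= W <+>\<^bsub>M\<^esub> N r"
 using N D q
proof (induction r arbitrary: D)
 case 0
 interpret M: lmod A M by (rule fd_lmod[OF M])
 have "D <= D <+>\<^bsub>M\<^esub> N 0" by (rule M.sum_upper1[OF "0.prems"(2) "0.prems"(1)]) simp
 thus ?case using "0.prems"(2,3) by blast
next
 case (Suc r)
 interpret M: lmod A M by (rule fd_lmod[OF M])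
 note D = Suc.prems(2-4)
 have sN: "submodule (N r) A M" "submodule (N (Suc r)) A M" using Suc.prems(1) by simp_all
 obtain y q where q: "y : I" "q : lhom A (restr M (N (Suc r))) (nab (H y) y)" "q ` N (Suc r) = car (nab (H y) y)"
  "N r = {x : N (Suc r). q x = 0[H y]}" using Suc.prems(5)[of r] by blast
 have Hl: "left_module A (H y)" using H[OF q(1)] by (simp add: injective_def fg_module_def)
 obtain h where h: "h : lhom A (restr M D) (nab (H y) y)" "!!x. x : N (Suc r) ==> h x = q x"
  using extend_nab[OF M sN(2) D(1-3) H[OF q(1)] q(2)] by blast
 interpret DH: two_mods A "restr M D" "nab (H y) y"
  using M.sub_left[OF D(1)] nab_left[OF Hl] by simp
 define W1 where "W1 = {x : D. h x = 0[H y]}"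
 have "submodule W1 A (restr M D)" using DH.lhom_kernel[OF h(1)] by (simp add: W1_def)
 hence W1: "submodule W1 A M" "W1 <= D" using M.sub_restr_iff[OF D(1)] by auto
 have int: "W1 \<inter> N (Suc r) = N r" using q(4) h(2) D(2) by (auto simp: W1_def)
 have "EX W. submodule W A M & W <= W1 & W \<inter> N r = N 0 & W1 <= W <+>\<^bsub>M\<^esub> N r"
 proof (rule Suc.IH[OF _ W1(1)])
  show "submodule (N a) A M" if "a <= r" for a using Suc.prems(1) that by simp
  show "N r <= W1" using int by blast
  show "rel_inj M (N r) W1"
  proof (rule rel_injI)
   fix k l m assume a: "(k, l) : I" "(k, Suc l) : I" "m : wt M (e (k, l)) W1" "pp k l (Suc l) *[M] m : N r"
   hence "m : wt M (e (k, l)) D" "pp k l (Suc l) *[M] m : N (Suc r)" using W1(2) int by (auto simp: wt_def)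
   hence "m : N (Suc r)" by (rule rel_injD[OF D(3) a(1,2)])
   thus "m : N r" using a(3) int by (auto simp: wt_def)
  qed
  show "N a <= N (Suc a) & (EX y:I. EX q:lhom A (restr M (N (Suc a))) (nab (H y) y).
   q ` N (Suc a) = car (nab (H y) y) & N a = {x : N (Suc a). q x = 0[H y]})" if "a < r" for a
   using Suc.prems(5)[of a] that by simp
 qed
 then obtain W where W: "submodule W A M" "W <= W1" "W \<inter> N r = N 0" "W1 <= W <+>\<^bsub>M\<^esub> N r" by blast
 have s: "submodule (W <+>\<^bsub>M\<^esub> N (Suc r)) A M" by (rule M.sub_sum[OF W(1) sN(2)])
 have up: "N (Suc r) <= W <+>\<^bsub>M\<^esub> N (Suc r)" by (rule M.sum_upper2[OF W(1) sN(2)])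
 have "N r <= N (Suc r)" using q(4) by blast
 hence "W <+>\<^bsub>M\<^esub> N r <= W <+>\<^bsub>M\<^esub> N (Suc r)"
  by (intro M.sum_least[OF s M.sum_upper1[OF W(1) sN(2)]] order_trans[OF _ up])
 hence up: "W1 <= W <+>\<^bsub>M\<^esub> N (Suc r)" "N (Suc r) <= W <+>\<^bsub>M\<^esub> N (Suc r)" using W(4) up by simp_all
 have "D <= W <+>\<^bsub>M\<^esub> N (Suc r)"
 proof
  fix x assume x: "x : D"
  have "h x : q ` N (Suc r)" using lhom_mem[OF h(1), of x] x q(3) by simp
  then obtain v where v: "v : N (Suc r)" "h x = h v" using h(2) by auto
  have vD: "v : D" "v : car M" "x : car M" using v(1) D(2) x M.sub_mem[OF D(1)] by auto
  have "h (x -[M] v) = 0[H y]"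
   using DH.lhom_minus[OF h(1), of x v] x vD(1) v(2) M.restr_minus[OF D(1) x vD(1)]
    DH.N.diff_zero_iff[of "h x" "h v"] lhom_mem[OF h(1), of x] by simp
  hence "x -[M] v : W1" using M.sub_minus[OF D(1) x vD(1)] by (simp add: W1_def)
  hence "(x -[M] v) +[M] v : W <+>\<^bsub>M\<^esub> N (Suc r)" using up v(1) subD(4)[OF s] by blast
  thus "x : W <+>\<^bsub>M\<^esub> N (Suc r)" using vD by simp
 qed
 moreover have "W \<inter> N (Suc r) = N 0" using W(2,3) int by blast
 ultimately show ?case using W(1,2) W1(2) by blast
qed

end

section \<open>Filtered modules and generators of standard modules\<close>

context adr
begin

text \<open>A filtration whose factors are given by epimorphisms onto the \<open>D j\<close> with
  the previous term as kernel, instead of isomorphisms of quotients. In this form a filtration can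
  be pulled back along a homomorphism, as in \<open>pull_back\<close>.\<close>

definition filt_chain :: "('j => ('a, 'd) module) => 'j set => ('a, 'm) module => nat => (nat => 'm set) => bool" where
 "filt_chain D X M r N \<longleftrightarrow> N 0 = {0[M]} & N r = car M & (ALL a<=r. submodule (N a) A M) &
  (ALL a<r. N a <= N (Suc a) & (EX j:X. EX q:lhom A (restr M (N (Suc a))) (D j).
   q ` N (Suc a) = car (D j) & N a = {x : N (Suc a). q x = 0[D j]}))"

lemma filt_chainD:
 assumes "filt_chain D X M r N"
 shows "N 0 = {0[M]}" "N r = car M" "!!a. a <= r ==> submodule (N a) A M" "!!a. a < r ==> N a <= N (Suc a) & (EX j:X. EX q:lhom A (restr M (N (Suc a))) (D j).
   q ` N (Suc a) = car (D j) & N a = {x : N (Suc a). q x = 0[D j]})"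
 using assms unfolding filt_chain_def by simp_all

lemma filtered_chain:
 fixes M :: "('a, 'm) module" and D :: "'j => ('a, 'd) module"
 assumes M: "left_module A M" and D: "!!j. j : X ==> left_module A (D j)" and f: "filtered_by A D X M"
 shows "EX r N. filt_chain D X M r N"
proof -
 interpret M: lmod A M using M by simp
 obtain Ns where Ns: "filtration A M Ns" "!!i. Suc i < length Ns ==> EX j:X. isomorphic A (filt_factor M Ns i) (D j)"
  using f unfolding filtered_by_def by blast
 have n: "Ns ~= []" "hd Ns = {0[M]}" "last Ns = car M" "!!U. U : set Ns ==> submodule U A M" "!!i. Suc i < length Ns ==> Ns ! i <= Ns ! Suc i"
  using Ns(1) unfolding filtration_def by blast+
 have s: "submodule (Ns ! a) A M" if "a < length Ns" for a using n(4) that by simp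
 have first: "Ns ! 0 = {0[M]}" "Ns ! (length Ns - 1) = car M" using n(1-3) by (simp_all add: hd_conv_nth last_conv_nth)
 have sub: "submodule (Ns ! a) A M" if "a <= length Ns - 1" for a
 proof -
  have "a < length Ns" using that n(1) by (cases Ns) auto
  thus ?thesis by (rule s)
 qed
 have le: "Ns ! a <= Ns ! Suc a" if "a < length Ns - 1" for a using n(5) that by simp
 have "EX j:X. EX q:lhom A (restr M (Ns ! Suc a)) (D j).
   q ` (Ns ! Suc a) = car (D j) & Ns ! a = {x : Ns ! Suc a. q x = 0[D j]}" if "a < length Ns - 1" for a
 proof -
  have a: "Suc a < length Ns" using that by simp
  obtain j where j: "j : X" "isomorphic A (filt_factor M Ns a) (D j)" using Ns(2)[OF a] by blast
  have sS: "submodule (Ns ! Suc a) A M" and sa: "submodule (Ns ! a) A M" using s a by simp_all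
  interpret U: lmod A "restr M (Ns ! Suc a)" using M.sub_left[OF sS] by simp
  have nn: "submodule (Ns ! a) A (restr M (Ns ! Suc a))" using M.sub_restr_iff[OF sS] sa n(5)[OF a] by simp
  obtain q where q: "q : lhom A (restr M (Ns ! Suc a)) (D j)" "q ` car (restr M (Ns ! Suc a)) = car (D j)"
   "Ns ! a = {x : car (restr M (Ns ! Suc a)). q x = 0[D j]}"
   using U.isomorphic_quotE[OF nn D[OF j(1)] j(2)[unfolded filt_factor_def]] .
  show ?thesis using q(2,3) by (intro bexI[OF _ j(1)] bexI[OF _ q(1)] conjI) simp_all
 qed
 hence "filt_chain D X M (length Ns - 1) ((!) Ns)"
  unfolding filt_chain_def by (intro conjI allI impI first sub le)
 thus ?thesis by blast
qed

lemma rel_inj_preimage: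
 fixes M :: "('a, 'm) module" and N :: "('a, 'n) module"
 assumes M: "left_module A M" and N: "left_module A N" and U: "submodule U A M" and q: "q : lhom A (restr M U) N"
  and r: "rel_inj N {0[N]} (car N)"
 shows "rel_inj M {x : U. q x = 0[N]} U"
proof (rule rel_injI)
 interpret M: lmod A M using M by simp
 fix k l m assume w: "(k, l) : I" "(k, Suc l) : I" and m: "m : wt M (e (k, l)) U" and p: "pp k l (Suc l) *[M] m : {x : U. q x = 0[N]}"
 have mU: "m : car (restr M U)" "e (k, l) *[M] m = m" using m by (simp_all add: wt_def)
 have pc: "pp k l (Suc l) : car A" using w by simp
 have "q m : wt N (e (k, l)) (car N)" using lhom_mem[OF q mU(1)] lhom_smult[OF q e_closed[OF w(1)] mU(1)] mU(2) by (simp add: wt_def)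
 moreover have "pp k l (Suc l) *[N] q m : {0[N]}" using lhom_smult[OF q pc mU(1)] p by simp
 ultimately have "q m : {0[N]}" by (rule rel_injD[OF r w])
 thus "m : {x : U. q x = 0[N]}" using mU(1) by simp
qed

text \<open>Injectivity of the structure maps passes to extensions by
  \<open>rel_inj_preimage\<close> and \<open>rel_inj_trans\<close>. Applied to modules filtered by
  standard modules.\<close>

lemma filtered_rel_inj:
 fixes M :: "('a, 'm) module" and D :: "'j => ('a, 'd) module"
 assumes M: "left_module A M" and D: "!!j. j : X ==> left_module A (D j) & rel_inj (D j) {0[D j]} (car (D j))" and f: "filtered_by A D X M"
 shows "rel_inj M {0[M]} (car M)"
proof -
 have Dl: "left_module A (D j)" if "j : X" for j using D[OF that] by simp
 obtain r N where "filt_chain D X M r N" using filtered_chain[OF M Dl f] by blast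
 note N = filt_chainD[OF this]
 have "rel_inj M {0[M]} (N a)" if "a <= r" for a
  using that
 proof (induction a)
  case 0 thus ?case unfolding N(1) by (intro rel_injI) (simp add: wt_def)
 next
  case (Suc a)
  hence a: "a < r" by simp
  obtain j q where q: "j : X" "q : lhom A (restr M (N (Suc a))) (D j)" "N a = {x : N (Suc a). q x = 0[D j]}" using N(4)[OF a] by blast
  have "rel_inj M (N a) (N (Suc a))"
   unfolding q(3) by (rule rel_inj_preimage[OF M _ N(3)[OF Suc.prems] q(2)]) (use D[OF q(1)] in simp_all)
  moreover have "{0[M]} <= N a" using subD(2)[OF N(3), of a] a by simp
  ultimately show ?case using rel_inj_trans[OF N(3)[OF Suc.prems] M Suc.IH] a by simp
 qed
 from this[of r] show ?thesis using N(2) by simp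
qed

lemma filtered_wt_zero:
 fixes M :: "('a, 'm) module" and D :: "'j => ('a, 'd) module"
 assumes M: "left_module A M" and D: "!!j. j : X ==> left_module A (D j) & wt (D j) (e z) (car (D j)) <= {0[D j]}"
  and z: "z : I" and f: "filtered_by A D X M"
 shows "wt M (e z) (car M) <= {0[M]}"
proof -
 have Dl: "left_module A (D j)" if "j : X" for j using D[OF that] by simp
 obtain r N where "filt_chain D X M r N" using filtered_chain[OF M Dl f] by blast
 note N = filt_chainD[OF this]
 have "wt M (e z) (N a) <= {0[M]}" if "a <= r" for a
  using that
 proof (induction a)
  case 0 thus ?case by (auto simp: wt_def N(1))
 next
  case (Suc a)
  hence a: "a < r" by simp
  obtain j q where q: "j : X" "q : lhom A (restr M (N (Suc a))) (D j)" "N a = {x : N (Suc a). q x = 0[D j]}" using N(4)[OF a] by blast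
  show ?case
  proof
   fix m assume m: "m : wt M (e z) (N (Suc a))"
   hence mU: "m : car (restr M (N (Suc a)))" "e z *[M] m = m" by (simp_all add: wt_def)
   have "q m : wt (D j) (e z) (car (D j))"
    using lhom_mem[OF q(2) mU(1)] lhom_smult[OF q(2) e_closed[OF z] mU(1)] mU(2) by (simp add: wt_def)
   hence "m : N a" unfolding q(3) using D[OF q(1)] mU(1) by auto
   hence "m : wt M (e z) (N a)" using mU(2) by (simp add: wt_def)
   thus "m : {0[M]}" using Suc.IH a by auto
  qed
 qed
 from this[of r] show ?thesis using N(2) by simp
qed

text \<open>\<open>m\<close> generates a copy of the standard module \<open>\<Delta>(k, l)\<close>.\<close>

definition stdgen :: "('a, 'm) module => nat => nat => 'm => bool" where
 "stdgen M k l m \<longleftrightarrow> m : wt M (e (k, l)) (car M) & pp k l (lp k) *[M] m ~= 0[M] &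
   (ALL s t b. (s, t) : I --> t < l --> b : car A --> e (s, t) *[M] (b *[M] m) = 0[M])"

text \<open>The properties of standard modules on which the argument rests: generation by a single
  vector as in \<open>stdgen\<close>. They are established in \<open>standard_ok\<close>.\<close>

definition std_like :: "('a, 'd) module => nat \<times> nat => bool" where
 "std_like D x \<longleftrightarrow> fd K A D & (EX d. stdgen D (fst x) (snd x) d & car D <= lmod.cyc A D d)"

lemma index_top: "(k, l) : I ==> (k, lp k) : I"
 using index_down[of k l "lp k"] index[of k l] by simp

lemma stdgen_mem: "stdgen M k l m ==> m : car M" by (simp add: stdgen_def wt_def)

lemma stdgen_hom:
 fixes M :: "('a, 'm) module" and N :: "('a, 'n) module"
 assumes M: "left_module A M" and N: "left_module A N" and f: "f : lhom A M N" and w: "(k, l) : I"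
  and s: "stdgen M k l m" and nz: "f (pp k l (lp k) *[M] m) ~= 0[N]"
 shows "stdgen N k l (f m)"
proof -
 interpret two_mods A M N using M N by simp
 have m: "m : car M" "e (k, l) *[M] m = m" using s by (simp_all add: stdgen_def wt_def)
 have pc: "pp k l (lp k) : car A" using index_top[OF w] w index[OF w] by simp
 have "e (s, t) *[N] (b *[N] f m) = 0[N]" if b: "(s, t) : I" "t < l" "b : car A" for s t b
 proof -
  have "e (s, t) *[N] (b *[N] f m) = f (e (s, t) *[M] (b *[M] m))"
   using lhom_smult[OF f b(3) m(1)] lhom_smult[OF f e_closed[OF b(1)] M.smult_closed[OF b(3) m(1)]] by simp
  also have "e (s, t) *[M] (b *[M] m) = 0[M]" using s b by (simp add: stdgen_def)
  finally show ?thesis using lhom_zero[OF f] by simp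
 qed
 moreover have "pp k l (lp k) *[N] f m ~= 0[N]" using nz lhom_smult[OF f pc m(1)] by simp
 ultimately show ?thesis unfolding stdgen_def
  using lhom_mem[OF f m(1)] lhom_smult[OF f e_closed[OF w] m(1)] m(2) by (simp add: wt_def)
qed

text \<open>The case of \<open>rel_wt\<close> in which \<open>N\<close> is zero: in a copy of a
  standard module each weight is at most a line, spanned by an image of the generator.\<close>

lemma stdgen_wt:
 fixes M :: "('a, 'm) module"
 assumes M: "left_module A M" and w: "(k, l) : I" "(s, t) : I" and g: "stdgen M k l m" and y: "y : wt M (e (s, t)) (lmod.cyc A M m)" "y ~= 0[M]"
 obtains c where "s = k" "l <= t" "c : car K" "y = sc c *[M] (pp k l t *[M] m)"
proof -
 interpret M: lmod A M using M by simp
 obtain a where a: "a : car A" "y = a *[M] m" using y(1) by (auto simp: wt_def M.cyc_def)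
 have ey: "e (s, t) *[M] (a *[M] m) = y" using y(1) a by (simp add: wt_def)
 have m: "m : wt M (e (k, l)) (car M)" using g by (simp add: stdgen_def)
 show ?thesis
 proof (rule rel_wt[OF M M.sub_zero m w a(1)])
  fix s t b assume "(s, t) : I" "t < l" "b : car A"
  thus "e (s, t) *[M] (b *[M] m) : {0[M]}" using g by (simp add: stdgen_def)
 next
  assume "e (s, t) *[M] (a *[M] m) : {0[M]}" thus ?thesis using ey y(2) by simp
 next
  fix c v assume c: "s = k" "l <= t" "c : car K" "v : {0[M]}" "e (s, t) *[M] (a *[M] m) = sc c *[M] (pp k l t *[M] m) +[M] v"
  have "pp k l t : car A" using w c(1,2) by simp
  hence "sc c *[M] (pp k l t *[M] m) : car M" using m c(3) by (simp add: wt_def)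
  thus ?thesis using that[OF c(1-3)] ey c(4,5) by simp
 qed
qed

lemma stdgen_pp_nonzero:
 fixes M :: "('a, 'm) module"
 assumes M: "left_module A M" and w: "(k, l) : I" "(k, t) : I" "l <= t" and g: "stdgen M k l m"
 shows "pp k l t *[M] m ~= 0[M]"
proof
 interpret M: lmod A M using M by simp
 assume z: "pp k l t *[M] m = 0[M]"
 note wp = index_top[OF w(1)]
 have tl: "t <= lp k" using index[OF w(2)] by simp
 have c: "pp k l t : car A" "pp k t (lp k) : car A" using w wp tl by simp_all
 have "pp k l (lp k) *[M] m = pp k t (lp k) *[M] (pp k l t *[M] m)"
  using M.smult_assoc1[OF c(2,1) stdgen_mem[OF g]] pp_comp[OF w(1,2) wp w(3) tl] by simp
 thus False using g z c by (simp add: stdgen_def)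
qed

text \<open>The standard modules are uniserial with pairwise different composition factors; \<open>f\<close> is injective on one as soon as it is nonzero on its socle.\<close>

lemma stdgen_inj:
 fixes M :: "('a, 'm) module" and N :: "('a, 'n) module"
 assumes M: "fd K A M" and N: "left_module A N" and f: "f : lhom A M N" and w: "(k, l) : I"
  and s: "stdgen M k l m" and nz: "f (pp k l (lp k) *[M] m) ~= 0[N]" and u: "u : lmod.cyc A M m" "f u = 0[N]"
 shows "u = 0[M]"
proof -
 note Ml = fd_left[OF M]
 interpret two_mods A M N using Ml N by simp
 have mc: "m : car M" by (rule stdgen_mem[OF s])
 let ?U = "M.cyc m \<inter> {x : car M. f x = 0[N]}"
 have U: "submodule ?U A M" by (rule M.sub_Int[OF M.cyc_sub[OF mc] lhom_kernel[OF f]])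
 have "?U = {0[M]}"
 proof (rule all_wt_zero[OF M U], rule subsetI, rule ccontr)
  fix z y assume z: "z : I" and y: "y : wt M (e z) ?U" "y ~: {0[M]}"
  obtain s' t where st: "z = (s', t)" by (cases z)
  have yU: "y : ?U" and ycyc: "y : wt M (e (s', t)) (M.cyc m)" using y(1) st by (auto simp: wt_def)
  obtain c where c: "s' = k" "l <= t" "c : car K" "y = sc c *[M] (pp k l t *[M] m)"
   using stdgen_wt[OF Ml w z[unfolded st] s ycyc] y(2) by blast
  have wt': "(k, t) : I" using z st c(1) by simp
  have tl: "t <= lp k" using index[OF wt'] by simp
  have pc: "pp k l t : car A" "pp k t (lp k) : car A" using w wt' c(2) index_top[OF w] tl by simp_all
  have pm: "pp k l t *[M] m : car M" using pc mc by simp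
  have "c ~= 0[K]"
  proof
   assume "c = 0[K]"
   thus False using c(4) y(2) pm by simp
  qed
  hence "pp k l t *[M] m : ?U" using yU c(4) by (intro sc_cancel[OF Ml U c(3) _ pm]) simp_all
  hence "pp k t (lp k) *[M] (pp k l t *[M] m) : ?U" by (rule subD(5)[OF U pc(2)])
  hence "f (pp k l (lp k) *[M] m) = 0[N]"
   using M.smult_assoc1[OF pc(2,1) mc] pp_comp[OF w wt' index_top[OF w] c(2) tl] by simp
  thus False using nz by simp
 qed
 thus ?thesis using u M.sub_mem[OF M.cyc_sub[OF mc]] by blast
qed

text \<open>The last assumption describes what is left of \<open>M\<close> just below the standard module \<open>Am\<close>.\<close>

lemma stdgen_rel_inj:
 fixes M :: "('a, 'm) module"
 assumes M: "left_module A M" and w: "(k, l) : I" and g: "stdgen M k l m" and D: "submodule D A M" "m : D"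
  and r: "rel_inj M {0[M]} D" and below: "(k, l - 1) : I ==> wt M (e (k, l - 1)) D <= {0[M]}"
 shows "rel_inj M (lmod.cyc A M m) D"
proof (rule rel_injI)
 interpret M: lmod A M using M by simp
 have mc: "m : car M" by (rule stdgen_mem[OF g])
 note C = M.cyc_sub[OF mc]
 fix s u x assume su: "(s, u) : I" "(s, Suc u) : I" and x: "x : wt M (e (s, u)) D" and p: "pp s u (Suc u) *[M] x : M.cyc m"
 have xD: "x : D" "x : car M" "e (s, u) *[M] x = x" using x M.sub_mem[OF D(1)] by (auto simp: wt_def)
 have pw: "pp s u (Suc u) *[M] x : wt M (e (s, Suc u)) (M.cyc m)" using pp_wt[OF M D(1) su _ xD(1)] p by (simp add: wt_def)
 show "x : M.cyc m"
 proof (cases "pp s u (Suc u) *[M] x = 0[M]")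
  case True
  thus ?thesis using rel_injD[OF r su x] subD(2)[OF C] by simp
 next
  case False
  obtain c where c: "s = k" "l <= Suc u" "c : car K" "pp s u (Suc u) *[M] x = sc c *[M] (pp k l (Suc u) *[M] m)"
   using stdgen_wt[OF M w su(2) g pw False] by blast
  show ?thesis
  proof (cases "l <= u")
   case True
   have ku: "(k, u) : I" "(k, Suc u) : I" using su c(1) by simp_all
   have pc: "pp k l u : car A" "pp k u (Suc u) : car A" using w ku True by simp_all
   have pm: "pp k l u *[M] m : car M" "e (k, u) *[M] (pp k l u *[M] m) = pp k l u *[M] m" "pp k l u *[M] m : M.cyc m"
    using pc mc pp_wt[OF M C w ku(1) True M.cyc_self[OF mc]] by (simp_all add: wt_def)
   define b where "b = sc c *[M] (pp k l u *[M] m)"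
   have b: "b : M.cyc m" "b : car M" using subD(5)[OF C _ pm(3)] c(3) pm(1) by (simp_all add: b_def)
   have eb: "e (k, u) *[M] b = b" unfolding b_def using sc_smult[OF M c(3) e_closed[OF ku(1)] pm(1)] pm(2) by simp
   have pb: "pp k u (Suc u) *[M] b = pp k u (Suc u) *[M] x"
    unfolding b_def sc_smult[OF M c(3) pc(2) pm(1), symmetric] using M.smult_assoc1[OF pc(2,1) mc] pp_comp[OF w ku True] c(1,4) by simp
   have bD: "b : D" using b(1) M.cyc_least[OF D] by blast
   have "x -[M] b : wt M (e (k, u)) D"
    using M.sub_minus[OF D(1) xD(1) bD] M.smult_r_diff[OF e_closed[OF ku(1)] xD(2) b(2)] eb xD(3) c(1) by (simp add: wt_def)
   moreover have "pp k u (Suc u) *[M] (x -[M] b) : {0[M]}"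
    using M.smult_r_diff[OF pc(2) xD(2) b(2)] pb M.diff_zero_iff[of "pp k u (Suc u) *[M] x"] pc(2) xD(2) by simp
   ultimately have "x -[M] b : {0[M]}" by (rule rel_injD[OF r ku])
   hence "x = b" using M.diff_zero_iff[OF xD(2) b(2)] by simp
   thus ?thesis using b(1) by simp
  next
   case False
   hence "u = l - 1" using c(2) by simp
   hence "x = 0[M]" using below su(1) x c(1) by auto
   thus ?thesis using subD(2)[OF C] by simp
  qed
 qed
qed

lemma stdgen_cyc_low:
 fixes M :: "('a, 'm) module"
 assumes g: "stdgen M k l m" and M: "left_module A M" and z: "(s, t) : I" "t < l"
 shows "wt M (e (s, t)) (lmod.cyc A M m) <= {0[M]}"
proof -
 interpret M: lmod A M using M by simp
 show ?thesis
 proof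
  fix y assume "y : wt M (e (s, t)) (M.cyc m)"
  then obtain a where "a : car A" "y = e (s, t) *[M] (a *[M] m)" by (auto simp: wt_def M.cyc_def)
  thus "y : {0[M]}" using g z by (simp add: stdgen_def)
 qed
qed

text \<open>Levels below that of the generator vanish, and the structure maps are injective on the
  lines spanned by its images because the image at the top level is not zero.\<close>

lemma std_like_facts:
 assumes D: "std_like D x" and x: "x : I"
 shows "fd K A D" "rel_inj D {0[D]} (car D)" "!!z. [|z : I; snd z < snd x|] ==> wt D (e z) (car D) <= {0[D]}"
proof -
 obtain k l where kl: "x = (k, l)" by (cases x)
 have w: "(k, l) : I" using x kl by simp
 show fD: "fd K A D" using D by (simp add: std_like_def)
 interpret D: lmod A D by (rule fd_lmod[OF fD])
 note Dl = D.left
 obtain d where d: "stdgen D k l d" "car D <= D.cyc d" using D kl by (auto simp: std_like_def)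
 have C: "car D = D.cyc d" using d(2) subD(1)[OF D.cyc_sub[OF stdgen_mem[OF d(1)]]] by blast
 show "wt D (e z) (car D) <= {0[D]}" if "z : I" "snd z < snd x" for z
  using stdgen_cyc_low[OF d(1) Dl, of "fst z" "snd z"] that kl unfolding C by simp
 show "rel_inj D {0[D]} (car D)"
 proof (rule rel_injI)
  fix s u y assume su: "(s, u) : I" "(s, Suc u) : I" and y: "y : wt D (e (s, u)) (car D)" and p: "pp s u (Suc u) *[D] y : {0[D]}"
  show "y : {0[D]}"
  proof (rule ccontr)
   assume n: "y ~: {0[D]}"
   obtain c where c: "s = k" "l <= u" "c : car K" "y = sc c *[D] (pp k l u *[D] d)"
    using stdgen_wt[OF Dl w su(1) d(1) y[unfolded C]] n by blast
   have ku: "(k, u) : I" "(k, Suc u) : I" using su c(1) by simp_all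
   have pc: "pp k l u : car A" "pp k u (Suc u) : car A" "pp k l (Suc u) : car A" using w ku c(2) by simp_all
   have dc: "d : car D" by (rule stdgen_mem[OF d(1)])
   have pd: "pp k l u *[D] d : car D" "pp k l (Suc u) *[D] d : car D" using pc dc by simp_all
   have "sc c *[D] (pp k l (Suc u) *[D] d) = pp k u (Suc u) *[D] y"
    unfolding c(4) sc_smult[OF Dl c(3) pc(2) pd(1), symmetric] using D.smult_assoc1[OF pc(2,1) dc] pp_comp[OF w ku c(2)] by simp
   hence z: "sc c *[D] (pp k l (Suc u) *[D] d) : {0[D]}" using p c(1) by simp
   have "c ~= 0[K]"
   proof
    assume "c = 0[K]"
    thus False using c(4) n pd(1) by simp
   qed
   hence "pp k l (Suc u) *[D] d = 0[D]" using sc_cancel[OF Dl D.sub_zero c(3) _ pd(2) z] by simp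
   moreover have "l <= Suc u" using c(2) by simp
   ultimately show False using stdgen_pp_nonzero[OF Dl w ku(2) _ d(1)] by blast
  qed
 qed
qed

end

section \<open>Tilting modules inside injective hulls\<close>

context adr
begin

text \<open>If a nonzero \<open>h\<close> of weight \<open>(k, l)\<close> were killed by a structure
  map, the socle would lie in \<open>A h\<close>. A socle vector has weight \<open>(i, l_i)\<close>,
  and by \<open>lift\<close> every product \<open>e (i, l_i) a e (k, l)\<close> factors through that
  structure map, so the vector would be zero.\<close>

lemma hull_rel_inj:
 assumes H: "injective_hull A H (S (i, lp i))" and i: "(i, lp i) : I"
 shows "rel_inj H {0[H]} (car H)"
proof (rule rel_injI, rule ccontr)
 obtain Z where Z: "fd K A H" "injective A H" "submodule Z A H" "simple_mod A (restr H Z)"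
  "wd (i, lp i) H Z = 1" "!!U. [|submodule U A H; U ~= {0[H]}|] ==> Z <= U"
  using hull_facts[OF H i] by metis
 interpret H: lmod A H by (rule fd_lmod[OF Z(1)])
 fix k l h assume w: "(k, l) : I" "(k, Suc l) : I" and h: "h : wt H (e (k, l)) (car H)"
  and p: "pp k l (Suc l) *[H] h : {0[H]}" and n: "h ~: {0[H]}"
 have hc: "h : car H" "e (k, l) *[H] h = h" using h by (simp_all add: wt_def)
 have "H.cyc h ~= {0[H]}" using H.cyc_self[OF hc(1)] n by blast
 hence Zh: "Z <= H.cyc h" by (rule Z(6)[OF H.cyc_sub[OF hc(1)]])
 have "wt H (e (i, lp i)) Z ~= {0[H]}" using wt_eq_zero_iff[OF Z(1,3) i] Z(5) by simp
 then obtain z where z: "z : wt H (e (i, lp i)) Z" "z ~= 0[H]" using wt_zero_mem[OF H.left Z(3) i] by blast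
 then obtain a where a: "a : car A" "z = a *[H] h" using Zh by (auto simp: wt_def H.cyc_def)
 obtain b where b: "b : car A" "e (i, lp i) \<otimes>[A] (a \<otimes>[A] e (k, l)) = b \<otimes>[A] pp k l (Suc l)" using lift[OF i w a(1)] by blast
 have pc: "pp k l (Suc l) : car A" using w by simp
 have "z = e (i, lp i) *[H] (a *[H] (e (k, l) *[H] h))" using z(1) a hc by (simp add: wt_def)
 also have "... = (e (i, lp i) \<otimes>[A] (a \<otimes>[A] e (k, l))) *[H] h" using a(1) w i hc(1) by (simp add: H.smult_assoc1)
 also have "... = b *[H] (pp k l (Suc l) *[H] h)" unfolding b(2) by (rule H.smult_assoc1[OF b(1) pc hc(1)])
 finally show False using p b(1) z(2) by simp
qed

end

locale adr_tilt = adr K A I e S lp pp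
 for K :: "('k, 'e) ring_scheme" (structure) and A :: "('k, 'a) module" (structure)
  and I :: "(nat \<times> nat) set" and e and S :: "nat \<times> nat => ('a, 's) module" and lp pp +
 fixes H :: "nat \<times> nat => ('a, 'h) module" and D :: "nat \<times> nat => ('a, 'd) module" and T :: "nat \<times> nat => ('a, 't) module"
 assumes H_hull: "x : I ==> injective_hull A (H x) (S x)"
  and D_std: "x : I ==> std_like (D x) x"
  and T_tilt: "x : I ==> is_tilting A I adr_le D (%y. nab (H y) y) x (T x)"
begin

lemma T_fd: "x : I ==> fd K A (T x)" using T_tilt fg_imp_fd unfolding is_tilting_def by blast
lemma T_left: "x : I ==> left_module A (T x)" by (rule fd_left[OF T_fd])
lemma T_lmod: "x : I ==> lmod A (T x)" by (rule fd_lmod[OF T_fd])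
lemma T_indec: "x : I ==> indecomposable A (T x)" using T_tilt unfolding is_tilting_def by blast
lemma H_injective: "x : I ==> injective A (H x)" using H_hull unfolding injective_hull_def by blast
lemma H_fd: "x : I ==> fd K A (H x)" by (rule fg_imp_fd[OF H_injective[unfolded injective_def, THEN conjunct1]])
lemma H_left: "x : I ==> left_module A (H x)" by (rule fd_left[OF H_fd])

text \<open>The consequences of the standard filtration that are kept. All levels up to
  \<open>l\<close> lie in the standard submodule generated by \<open>v\<close>, since the other
  standard factors have indices of higher level.\<close>

definition tgen :: "nat => nat => 't => bool" where
 "tgen k l v \<longleftrightarrow> stdgen (T (k, l)) k l v & rel_inj (T (k, l)) {0[T (k, l)]} (car (T (k, l))) &
  (ALL z:I. snd z <= l --> wt (T (k, l)) (e z) (car (T (k, l))) <= lmod.cyc A (T (k, l)) v)"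

text \<open>Injectivity of the structure maps is inherited from the standard submodule and from the
  filtered quotient. A weight of level at most \<open>l\<close> vanishes in the quotient, hence lies
  in the submodule.\<close>

lemma tgen_ex:
 assumes x: "(k, l) : I" shows "EX v. tgen k l v"
proof -
 let ?T = "T (k, l)" and ?D = "D (k, l)" let ?X = "{j : I. adr_le j (k, l) & j ~= (k, l)}"
 have up: "l < snd j" if "j : ?X" for j using that by (auto simp: adr_le_def)
 obtain f where f: "f : lhom A ?D ?T" "inj_on f (car ?D)" "filtered_by A D ?X (quot ?T (f ` car ?D))"
  using T_tilt[OF x] unfolding is_tilting_def by blast
 note df = std_like_facts[OF D_std[OF x] x]
 interpret DT: two_mods A ?D ?T using df(1) T_left[OF x] by (simp add: fd_def)
 note Tl = DT.N.left
 obtain d where d: "stdgen ?D k l d" "car ?D <= DT.M.cyc d" using D_std[OF x] by (auto simp: std_like_def)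
 have dc: "d : car ?D" by (rule stdgen_mem[OF d(1)])
 have fz: "y = 0[?D]" if "y : car ?D" "f y = 0[?T]" for y using that DT.lhom_inj_iff[OF f(1)] f(2) by simp
 have "pp k l (lp k) : car A" using x index_top[OF x] index[OF x] by simp
 hence "f (pp k l (lp k) *[?D] d) ~= 0[?T]" using fz[of "pp k l (lp k) *[?D] d"] dc d(1) by (auto simp: stdgen_def)
 hence g: "stdgen ?T k l (f d)" by (rule stdgen_hom[OF DT.M.left Tl f(1) x d(1)])
 let ?U = "f ` car ?D"
 have U: "submodule ?U A ?T" by (rule DT.lhom_image[OF f(1) DT.M.sub_carrier])
 have Uc: "?U <= DT.N.cyc (f d)"
 proof
  fix y assume "y : ?U"
  then obtain a where "a : car A" "y = f (a *[?D] d)" using d(2) by (auto simp: DT.M.cyc_def)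
  thus "y : DT.N.cyc (f d)" using lhom_smult[OF f(1) _ dc] by (simp add: DT.N.cyc_def)
 qed
 let ?Q = "quot ?T ?U"
 have Ql: "left_module A ?Q" by (rule DT.N.quot_left[OF U])
 have DX: "left_module A (D j) & rel_inj (D j) {0[D j]} (car (D j))" if "j : ?X" for j
  using std_like_facts[OF D_std, of j] that by (simp add: fd_def)
 have q: "DT.N.qmap ?U : lhom A (restr ?T (car ?T)) ?Q" using DT.N.qmap_lhom[OF U] by (simp add: restr_carrier)
 have "{x : car ?T. DT.N.qmap ?U x = 0[?Q]} = ?U"
  using DT.N.qmap_zero[OF U] subD(1)[OF U] by blast
 hence r1: "rel_inj ?T ?U (car ?T)"
  using rel_inj_preimage[OF Tl Ql DT.N.sub_carrier q filtered_rel_inj[OF Ql DX f(3)]] by simp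
 have r2: "rel_inj ?T {0[?T]} ?U"
 proof (rule rel_injI)
  fix s t m assume w: "(s, t) : I" "(s, Suc t) : I" and m: "m : wt ?T (e (s, t)) ?U" and p: "pp s t (Suc t) *[?T] m : {0[?T]}"
  obtain y where y: "y : car ?D" "m = f y" "e (s, t) *[?T] m = m" using m by (auto simp: wt_def)
  have pc: "pp s t (Suc t) : car A" using w by simp
  have "f (e (s, t) *[?D] y) = f y" using lhom_smult[OF f(1) e_closed[OF w(1)] y(1)] y(2,3) by simp
  hence "e (s, t) *[?D] y = y" by (rule inj_onD[OF f(2)]) (use w(1) y(1) in simp_all)
  moreover have "pp s t (Suc t) *[?D] y : {0[?D]}" using fz[of "pp s t (Suc t) *[?D] y"] lhom_smult[OF f(1) pc y(1)] p y(1,2) pc by simp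
  ultimately have "y : {0[?D]}" using rel_injD[OF df(2) w, of y] y(1) by (simp add: wt_def)
  thus "m : {0[?T]}" using y(2) DT.lhom_zero[OF f(1)] by simp
 qed
 have r: "rel_inj ?T {0[?T]} (car ?T)"
  by (rule rel_inj_trans[OF DT.N.sub_carrier Tl r2 r1]) (use subD(2)[OF U] in simp)
 have "wt ?T (e z) (car ?T) <= DT.N.cyc (f d)" if z: "z : I" "snd z <= l" for z
 proof
  fix m assume m: "m : wt ?T (e z) (car ?T)"
  hence mc: "m : car ?T" "e z *[?T] m = m" by (simp_all add: wt_def)
  have "left_module A (D j) & wt (D j) (e z) (car (D j)) <= {0[D j]}" if "j : ?X" for j
   using std_like_facts[OF D_std, of j] that z up[OF that] by (simp add: fd_def)
  hence "wt ?Q (e z) (car ?Q) <= {0[?Q]}" by (rule filtered_wt_zero[OF Ql _ z(1) f(3)])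
  moreover have "DT.N.qmap ?U m : wt ?Q (e z) (car ?Q)"
   using lhom_mem[OF DT.N.qmap_lhom[OF U] mc(1)] lhom_smult[OF DT.N.qmap_lhom[OF U] e_closed[OF z(1)] mc(1)] mc(2) by (simp add: wt_def)
  ultimately have "DT.N.qmap ?U m = 0[?Q]" by blast
  thus "m : DT.N.cyc (f d)" using DT.N.qmap_zero[OF U mc(1)] Uc by blast
 qed
 with g r show ?thesis unfolding tgen_def by blast
qed

definition tv :: "nat => nat => 't" where "tv k l = (SOME v. tgen k l v)"

lemma tv_facts:
 assumes x: "(k, l) : I"
 shows T_gen: "stdgen (T (k, l)) k l (tv k l)" and T_rel_inj: "rel_inj (T (k, l)) {0[T (k, l)]} (car (T (k, l)))"
  and T_wt: "!!z. [|z : I; snd z <= l|] ==> wt (T (k, l)) (e z) (car (T (k, l))) <= lmod.cyc A (T (k, l)) (tv k l)"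
proof -
 have *: "tgen k l (tv k l)" unfolding tv_def by (rule someI_ex[OF tgen_ex[OF x]])
 show "stdgen (T (k, l)) k l (tv k l)" "rel_inj (T (k, l)) {0[T (k, l)]} (car (T (k, l)))"
  using * unfolding tgen_def by blast+
 show "wt (T (k, l)) (e z) (car (T (k, l))) <= lmod.cyc A (T (k, l)) (tv k l)" if "z : I" "snd z <= l" for z
  using * that unfolding tgen_def by blast
qed

lemma T_wt_low:
 assumes x: "(k, l) : I" and z: "z : I" "snd z < l"
 shows "wt (T (k, l)) (e z) (car (T (k, l))) <= {0[T (k, l)]}"
proof
 fix m assume m: "m : wt (T (k, l)) (e z) (car (T (k, l)))"
 hence "m : wt (T (k, l)) (e z) (lmod.cyc A (T (k, l)) (tv k l))" using T_wt[OF x z(1)] z(2) by (auto simp: wt_def)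
 thus "m : {0[T (k, l)]}" using stdgen_cyc_low[OF T_gen[OF x] T_left[OF x], of "fst z" "snd z"] z by auto
qed

text \<open>The concrete model of the tilting module \<open>T(i, j)\<close>.\<close>

definition XX :: "nat => nat => 'h set" where "XX i j = killed (H (i, lp i)) {z : I. z = (i, j - 1)}"

lemma XX_submodule: "(i, j) : I ==> submodule (XX i j) A (H (i, lp i))"
 unfolding XX_def by (rule killed_submodule[OF H_left[OF index_top]]) auto

text \<open>If every map to \<open>H (i, l_i)\<close> killed the top-level image of the generator,
  then by \<open>hom_vanish_dim\<close> the submodule generated by it would have no weight
  \<open>(i, l_i)\<close>, although it contains that vector. The image avoids
  \<open>L(i, j - 1)\<close> because levels below \<open>j\<close> do not occur in
  \<open>T (i, j)\<close>.\<close>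

lemma embed:
 assumes x: "(i, j) : I"
 shows "EX f:lhom A (T (i, j)) (restr (H (i, lp i)) (XX i j)). f (pp i j (lp i) *[T (i, j)] tv i j) ~= 0[H (i, lp i)]"
proof -
 let ?T = "T (i, j)" and ?H = "H (i, lp i)" let ?p = "pp i j (lp i) *[?T] tv i j"
 note xt = index_top[OF x]
 interpret TH: two_mods A ?T ?H using T_left[OF x] H_left[OF xt] by simp
 note Tl = TH.M.left
 have vc: "tv i j : car ?T" by (rule stdgen_mem[OF T_gen[OF x]])
 have jl: "j <= lp i" using index[OF x] by simp
 have pw: "?p : wt ?T (e (i, lp i)) (car ?T)" by (rule pp_wt[OF Tl TH.M.sub_carrier x xt jl vc])
 hence pc: "?p : car ?T" by (simp add: wt_def)
 let ?N = "TH.M.cyc ?p" note N = TH.M.cyc_sub[OF pc]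
 have "EX f:lhom A ?T ?H. f ?p ~= 0[?H]"
 proof (rule ccontr)
  assume n: "~ ?thesis"
  have "f y = 0[?H]" if f: "f : lhom A ?T ?H" and y: "y : ?N" for f y
  proof -
   obtain a where a: "a : car A" "y = a *[?T] ?p" using y by (auto simp: TH.M.cyc_def)
   have "f ?p = 0[?H]" using n f by blast
   thus ?thesis using lhom_smult[OF f a(1) pc] a by simp
  qed
  hence "{f : lhom A ?T ?H. ALL y:?N. f y = 0[?H]} = {f : lhom A ?T ?H. ALL y:{0[?T]}. f y = 0[?H]}"
   using TH.lhom_zero by auto
  hence "wd (i, lp i) ?T ?N = wd (i, lp i) ?T {0[?T]}"
   using hom_vanish_dim[OF H_hull[OF xt] xt T_fd[OF x] N] hom_vanish_dim[OF H_hull[OF xt] xt T_fd[OF x] TH.M.sub_zero] by simp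
  hence "wt ?T (e (i, lp i)) {0[?T]} = wt ?T (e (i, lp i)) ?N"
   using subD(2)[OF N] by (intro wdim_mono(2)[OF T_fd[OF x] TH.M.sub_zero N _ e_closed[OF xt]]) simp_all
  moreover have "?p : wt ?T (e (i, lp i)) ?N" using pw TH.M.cyc_self[OF pc] by (simp add: wt_def)
  ultimately have "?p = 0[?T]" by (auto simp: wt_def)
  thus False using T_gen[OF x] by (simp add: stdgen_def)
 qed
 then obtain f where f: "f : lhom A ?T ?H" "f ?p ~= 0[?H]" by blast
 have "f ` car ?T <= XX i j"
  unfolding XX_def
 proof (rule subset_killed[OF TH.N.left _ TH.lhom_image[OF f(1) TH.M.sub_carrier]])
  fix z assume "z : {z : I. z = (i, j - 1)}"
  hence z: "z : I" "snd z < j" using index[OF x] by auto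
  show "wt ?H (e z) (f ` car ?T) <= {0[?H]}"
  proof
   fix y assume "y : wt ?H (e z) (f ` car ?T)"
   then obtain u where u: "u : car ?T" "y = f u" "e z *[?H] y = y" by (auto simp: wt_def)
   have "e z *[?T] u = 0[?T]" using T_wt_low[OF x z] wt_e[OF Tl TH.M.sub_carrier z(1) u(1)] by blast
   thus "y : {0[?H]}" using lhom_smult[OF f(1) e_closed[OF z(1)] u(1)] u(2,3) TH.lhom_zero[OF f(1)] by simp
  qed
 qed auto
 hence "f : lhom A ?T (restr ?H (XX i j))" by (rule lhom_image_target[OF f(1)])
 with f(2) show ?thesis by blast
qed

end

context adr_tilt
begin

text \<open>\<open>f\<close> is injective on the standard submodule \<open>C\<close>, with image
  \<open>C'\<close>, and the inverse \<open>\<phi>\<close> has to be extended from \<open>C'\<close>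
  to \<open>X\<close>. In \<open>X x T\<close> put \<open>N = C' x T\<close>. The map
  \<open>\<psi> (y, t) = t - \<phi> y\<close> on \<open>N\<close> has the graph of
  \<open>\<phi>\<close> as kernel, and the costandard filtration of \<open>T\<close> pulls back to a
  chain from this graph to \<open>N\<close>. A complement \<open>W\<close> of \<open>N\<close>
  relative to the graph is the graph of an extension.\<close>

lemma pull_back:
 assumes x: "(i, j) : I" and f: "f : lhom A (T (i, j)) (restr (H (i, lp i)) (XX i j))"
  and nz: "f (pp i j (lp i) *[T (i, j)] tv i j) ~= 0[H (i, lp i)]"
 shows "EX g:lhom A (restr (H (i, lp i)) (XX i j)) (T (i, j)). g (f (tv i j)) = tv i j"
proof -
 let ?T = "T (i, j)" and ?H = "H (i, lp i)" let ?X = "restr ?H (XX i j)" let ?v = "tv i j"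
 note xt = index_top[OF x] and sX = XX_submodule[OF x]
 interpret H: lmod A ?H by (rule fd_lmod[OF H_fd[OF xt]])
 have fX: "fd K A ?X" by (rule fd_sub[OF H_fd[OF xt] sX])
 interpret TX: two_mods A ?T ?X using T_left[OF x] fX by (simp add: fd_def)
 note Tl = TX.M.left and Xl = TX.N.left
 have vc: "?v : car ?T" by (rule stdgen_mem[OF T_gen[OF x]])
 have nz': "f (pp i j (lp i) *[?T] ?v) ~= 0[?X]" using nz by simp
 have v': "f ?v : car ?X" by (rule lhom_mem[OF f vc])
 have gX: "stdgen ?X i j (f ?v)" by (rule stdgen_hom[OF Tl Xl f x T_gen[OF x] nz'])
 define C where "C = TX.M.cyc ?v"
 define C' where "C' = TX.N.cyc (f ?v)"
 have C: "submodule C A ?T" "?v : C" unfolding C_def by (rule TX.M.cyc_sub[OF vc], rule TX.M.cyc_self[OF vc])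
 have C': "submodule C' A ?X" "f ?v : C'" unfolding C'_def by (rule TX.N.cyc_sub[OF v'], rule TX.N.cyc_self[OF v'])
 have C'c: "C' <= car ?X" by (rule subD(1)[OF C'(1)])
 have Cc: "C <= car ?T" by (rule subD(1)[OF C(1)])
 have fC: "f ` C = C'"
 proof -
  have "f ` C = (%a. f (a *[?T] ?v)) ` car A" unfolding C_def TX.M.cyc_def image_image ..
  also have "... = C'" unfolding C'_def TX.N.cyc_def by (rule image_cong[OF refl lhom_smult[OF f _ vc]])
  finally show ?thesis .
 qed
 interpret CC: two_mods A "restr ?T C" "restr ?X C'"
  using TX.M.sub_left[OF C(1)] TX.N.sub_left[OF C'(1)] by simp
 have fr: "restrict f C : lhom A (restr ?T C) (restr ?X C')" by (rule lhom_restrict[OF f C(1)]) (simp add: fC)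
 have "inj_on (restrict f C) (car (restr ?T C))"
  unfolding CC.lhom_inj_iff[OF fr]
 proof (intro ballI impI)
  fix u assume "u : car (restr ?T C)" "restrict f C u = 0[restr ?X C']"
  hence "u : TX.M.cyc ?v" "f u = 0[?X]" by (simp_all add: C_def)
  thus "u = 0[restr ?T C]" using stdgen_inj[OF T_fd[OF x] Xl f x T_gen[OF x] nz'] by simp
 qed
 hence b: "bij_betw (restrict f C) (car (restr ?T C)) (car (restr ?X C'))" using fC by (simp add: bij_betw_def)
 define \<phi> where "\<phi> = restrict (the_inv_into (car (restr ?T C)) (restrict f C)) (car (restr ?X C'))"
 have phi: "\<phi> : lhom A (restr ?X C') (restr ?T C)" unfolding \<phi>_def by (rule CC.lhom_inverse[OF fr b])
 have phif: "\<phi> (f u) = u" if u: "u : C" for u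
 proof -
  have "f u : C'" using u fC by blast
  hence "\<phi> (f u) = the_inv_into C (restrict f C) (restrict f C u)" using u by (simp add: \<phi>_def)
  also have "... = u" using b u by (intro the_inv_into_f_f) (simp_all add: bij_betw_def)
  finally show ?thesis .
 qed
 let ?M = "mprod ?X ?T" let ?N = "C' \<times> car ?T"
 have fM: "fd K A ?M" by (rule mprod_fd(1)[OF fX T_fd[OF x]])
 interpret M: lmod A ?M by (rule fd_lmod[OF fM])
 have N: "submodule ?N A ?M"
  by (rule M.submoduleI) (use C'c subD(2,4,5)[OF C'(1)] in auto)
 have phic: "\<phi> y : car ?T" if "y : C'" for y using lhom_mem[OF phi, of y] that Cc by auto
 interpret NT: two_mods A "restr ?M ?N" ?T using M.sub_left[OF N] Tl by simp
 define \<psi> where "\<psi> = (\<lambda>y\<in>?N. snd y -[?T] \<phi> (fst y))"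
 have psi: "\<psi> : lhom A (restr ?M ?N) ?T"
 proof (rule lhomI)
  fix y z assume a: "y : car (restr ?M ?N)" "z : car (restr ?M ?N)"
  hence m: "fst y : C'" "fst z : C'" "snd y : car ?T" "snd z : car ?T" by auto
  have yz: "y +[?M] z : ?N" using subD(4)[OF N, of y z] a by simp
  have "\<phi> (fst y +[?X] fst z) = \<phi> (fst y) +[?T] \<phi> (fst z)" using lhom_add[OF phi, of "fst y" "fst z"] m by simp
  thus "\<psi> (y +[restr ?M ?N] z) = \<psi> y +[?T] \<psi> z"
   using yz a m phic by (simp add: \<psi>_def a_minus_def TX.M.M.minus_add TX.M.M.a_ac)
 next
  fix r y assume a: "r : car A" "y : car (restr ?M ?N)"
  hence m: "fst y : C'" "snd y : car ?T" by auto
  have ry: "r *[?M] y : ?N" using subD(5)[OF N a(1), of y] a by simp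
  have "\<phi> (r *[?X] fst y) = r *[?T] \<phi> (fst y)" using lhom_smult[OF phi a(1), of "fst y"] m by simp
  thus "\<psi> (r *[restr ?M ?N] y) = r *[?T] \<psi> y"
   using ry a m phic by (simp add: \<psi>_def TX.M.smult_r_diff)
 qed (use phic in \<open>auto simp: \<psi>_def\<close>)
 have nl: "left_module A (nab (H y) y)" if "y : I" for y by (rule nab_left[OF H_left[OF that]])
 have fil: "filtered_by A (%y. nab (H y) y) I ?T" using T_tilt[OF x] unfolding is_tilting_def by (elim conjE)
 obtain r F where "filt_chain (%y. nab (H y) y) I ?T r F" using filtered_chain[OF Tl nl fil] by blast
 note F = filt_chainD[OF this]
 define F' where "F' a = {y : ?N. \<psi> y : F a}" for a
 have F': "submodule (F' a) A ?M" if "a <= r" for a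
 proof -
  have "submodule (F' a) A (restr ?M ?N)" using NT.lhom_preimage[OF psi F(3)[OF that]] by (simp add: F'_def)
  thus ?thesis using M.sub_restr_iff[OF N] by simp
 qed
 have Fr: "F' r = ?N" using lhom_mem[OF psi] F(2) by (auto simp: F'_def)
 have HrX: "rel_inj ?X {0[?X]} (car ?X)"
 proof (rule rel_injI)
  fix k l m assume a: "(k, l) : I" "(k, Suc l) : I" "m : wt ?X (e (k, l)) (car ?X)" "pp k l (Suc l) *[?X] m : {0[?X]}"
  hence "m : wt ?H (e (k, l)) (car ?H)" using H.sub_mem[OF sX] by (simp add: wt_def)
  thus "m : {0[?X]}" using rel_injD[OF hull_rel_inj[OF H_hull[OF xt] xt] a(1,2), of m] a(4) by simp
 qed
 have below: "wt ?X (e (i, j - 1)) (car ?X) <= {0[?X]}" if "(i, j - 1) : I"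
 proof
  fix m assume "m : wt ?X (e (i, j - 1)) (car ?X)"
  hence m: "m : XX i j" "e (i, j - 1) *[?H] m = m" by (simp_all add: wt_def)
  show "m : {0[?X]}" using killed_wt[OF H.left m(1)[unfolded XX_def] _ m(2)] that by simp
 qed
 \<comment> \<open>Here the choice of \<open>XX\<close> enters: \<open>X\<close> has no weight
   \<open>(i, j - 1)\<close>, so no vector is carried to a nonzero multiple of the generator of
   \<open>C'\<close> from the level just below it.\<close>
 have rX: "rel_inj ?X C' (car ?X)"
  unfolding C'_def by (rule stdgen_rel_inj[OF Xl x gX TX.N.sub_carrier v' HrX below])
 have rM: "rel_inj ?M (F' r) (car ?M)"
  unfolding Fr
 proof (rule rel_injI)
  fix k l m assume a: "(k, l) : I" "(k, Suc l) : I" "m : wt ?M (e (k, l)) (car ?M)" "pp k l (Suc l) *[?M] m : ?N"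
  hence "fst m : wt ?X (e (k, l)) (car ?X)" "pp k l (Suc l) *[?X] fst m : C'" by (auto simp: wt_def)
  hence "fst m : C'" by (rule rel_injD[OF rX a(1,2)])
  thus "m : ?N" using a(3) by (auto simp: wt_def)
 qed
 have chain: "F' a <= F' (Suc a) & (EX y:I. EX q:lhom A (restr ?M (F' (Suc a))) (nab (H y) y).
   q ` F' (Suc a) = car (nab (H y) y) & F' a = {z : F' (Suc a). q z = 0[H y]})" if a: "a < r" for a
 proof -
  obtain y q where y: "y : I" and q: "q : lhom A (restr ?T (F (Suc a))) (nab (H y) y)" "q ` F (Suc a) = car (nab (H y) y)"
   "F a = {z : F (Suc a). q z = 0[H y]}" using F(4)[OF a] by auto
  have Sa: "Suc a <= r" using a by simp
  have sub: "submodule (F' (Suc a)) A (restr ?M ?N)" using F'[OF Sa] M.sub_restr_iff[OF N] by (auto simp: F'_def)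
  have p: "restrict \<psi> (F' (Suc a)) : lhom A (restr ?M (F' (Suc a))) (restr ?T (F (Suc a)))"
   using lhom_restrict[OF psi sub, of "F (Suc a)"] by (simp add: F'_def image_subset_iff)
  let ?q = "compose (F' (Suc a)) q (restrict \<psi> (F' (Suc a)))"
  have q': "?q : lhom A (restr ?M (F' (Suc a))) (nab (H y) y)"
   using lhom_comp[OF p q(1) M.sub_left[OF F'[OF Sa]]] by simp
  have qe: "?q z = q (\<psi> z)" if "z : F' (Suc a)" for z using that by (simp add: compose_eq)
  have sur: "?q ` F' (Suc a) = car (nab (H y) y)"
  proof
   show "?q ` F' (Suc a) <= car (nab (H y) y)" using lhom_mem[OF q'] by auto
   show "car (nab (H y) y) <= ?q ` F' (Suc a)"
   proof
    fix w assume "w : car (nab (H y) y)"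
    then obtain t where t: "t : F (Suc a)" "w = q t" using q(2) by blast
    have tc: "t : car ?T" by (rule TX.M.sub_mem[OF F(3)[OF Sa] t(1)])
    have z: "\<phi> 0[?X] = 0[?T]" using phif[OF subD(2)[OF C(1)]] TX.lhom_zero[OF f] by simp
    have zN: "(0[?X], t) : ?N" using tc subD(2)[OF C'(1)] by simp
    have "\<psi> (0[?X], t) = t" unfolding \<psi>_def restrict_apply'[OF zN] using z tc by simp
    hence "(0[?X], t) : F' (Suc a)" "q (\<psi> (0[?X], t)) = w" using zN t unfolding F'_def by simp_all
    thus "w : ?q ` F' (Suc a)" using qe by (intro image_eqI[of _ _ "(0[?X], t)"]) simp_all
   qed
  qed
  have ker: "F' a = {z : F' (Suc a). ?q z = 0[H y]}"
  proof (rule Set.set_eqI)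
   fix z show "z : F' a \<longleftrightarrow> z : {z : F' (Suc a). ?q z = 0[H y]}"
   proof (cases "z : F' (Suc a)")
    case True thus ?thesis using qe[OF True] q(3) by (simp add: F'_def)
   next
    case False thus ?thesis using q(3) by (auto simp: F'_def)
   qed
  qed
  from ker have "F' a <= F' (Suc a)" by blast
  thus ?thesis using y q' sur ker by blast
 qed
 have "EX W. submodule W A ?M & W <= car ?M & W \<inter> F' r = F' 0 & car ?M <= W <+>\<^bsub>?M\<^esub> F' r"
  by (rule relative_complement[where H = H, OF fM H_injective F' M.sub_carrier _ rM chain])
   (use subD(1)[OF N] Fr in simp_all)
 then obtain W where W: "submodule W A ?M" "W \<inter> ?N = F' 0" "car ?M <= W <+>\<^bsub>?M\<^esub> ?N" unfolding Fr by blast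
 have F0: "F' 0 = {y : ?N. \<psi> y = 0[?T]}" by (simp add: F'_def F(1))
 have graph: "(f u, u) : W" if u: "u : C" for u
 proof -
  have m: "f u : C'" "u : car ?T" using u fC Cc by auto
  hence uN: "(f u, u) : ?N" by simp
  have "\<psi> (f u, u) = 0[?T]" unfolding \<psi>_def restrict_apply'[OF uN] using phif[OF u] TX.M.diff_zero_iff[OF m(2,2)] by simp
  thus ?thesis using W(2) F0 uN by blast
 qed
 let ?W = "restr ?M W"
 interpret WX: two_mods A ?W ?X using M.sub_left[OF W(1)] Xl by simp
 let ?f1 = "restrict (restrict fst (car ?X \<times> car ?T)) W" and ?f2 = "restrict (restrict snd (car ?X \<times> car ?T)) W"
 have f1: "?f1 : lhom A ?W ?X" and f2: "?f2 : lhom A ?W ?T"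
  by (rule lhom_restrict_source[OF mprod_fd(2)[OF fX T_fd[OF x]] W(1)], rule lhom_restrict_source[OF mprod_fd(3)[OF fX T_fd[OF x]] W(1)])
 have Wc: "w : car ?X \<times> car ?T" if "w : W" for w using M.sub_mem[OF W(1) that] by simp
 have f1s: "?f1 ` car ?W = car ?X"
 proof
  show "?f1 ` car ?W <= car ?X" using lhom_mem[OF f1] by blast
  show "car ?X <= ?f1 ` car ?W"
  proof
   fix y assume y: "y : car ?X"
   have "(y, 0[?T]) : W <+>\<^bsub>?M\<^esub> ?N" using W(3) y by auto
   then obtain w z where wz: "w : W" "z : ?N" "(y, 0[?T]) = w +[?M] z" unfolding M.mem_set_add by blast
   obtain u where u: "u : C" "fst z = f u" using wz(2) fC by (auto simp: image_iff)
   have sW: "w +[?M] (f u, u) : W" by (rule subD(4)[OF W(1) wz(1) graph[OF u(1)]])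
   moreover have "fst (w +[?M] (f u, u)) = y" using wz(3) u(2) by simp
   ultimately have "?f1 (w +[?M] (f u, u)) = y" using Wc[OF sW] by (simp only: restrict_apply')
   thus "y : ?f1 ` car ?W" using sW by (intro image_eqI[of _ _ "w +[?M] (f u, u)"]) simp_all
  qed
 qed
 \<comment> \<open>\<open>W\<close> projects onto \<open>X\<close>, and an element of
   \<open>W\<close> over zero lies in \<open>N\<close>, hence in the graph of \<open>\<phi>\<close>,
   so its second component is zero.\<close>
 obtain g where g: "g : lhom A ?X ?T" "!!w. w : car ?W ==> g (?f1 w) = ?f2 w"
 proof (rule WX.lhom_factor[OF f1 f1s Tl f2])
  fix w assume w: "w : car ?W" "?f1 w = 0[?X]"
  have wc: "w : car ?X \<times> car ?T" using Wc w(1) by simp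
  have w1: "fst w = 0[?X]" using w wc by simp
  have wN: "w : ?N" using wc w1 subD(2)[OF C'(1)] by (auto simp: mem_Times_iff)
  hence "\<psi> w = 0[?T]" using W(2) F0 w(1) by auto
  moreover have "\<phi> 0[?X] = 0[?T]" using phif[OF subD(2)[OF C(1)]] TX.lhom_zero[OF f] by simp
  ultimately have "snd w = 0[?T]" unfolding \<psi>_def restrict_apply'[OF wN] w1 using wc by auto
  thus "?f2 w = 0[?T]" using w(1) wc by simp
 qed (rule that)
 have "g (f ?v) = ?v" using g(2)[of "(f ?v, ?v)"] graph[OF C(2)] Wc[OF graph[OF C(2)]] by simp
 with g(1) show ?thesis by blast
qed

text \<open>\<open>f g\<close> fixes \<open>f v\<close> and with it the socle of the hull, which
  lies in the submodule generated by \<open>f v\<close>. So \<open>f g\<close> is injective, hence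
  bijective, and \<open>f\<close> is onto. \<open>g f\<close> fixes \<open>v\<close> and is not
  nilpotent, so by Fitting's lemma it is bijective and \<open>f\<close> is injective.\<close>

lemma T_iso:
 assumes x: "(i, j) : I"
 shows "EX f:lhom A (T (i, j)) (restr (H (i, lp i)) (XX i j)). bij_betw f (car (T (i, j))) (car (restr (H (i, lp i)) (XX i j)))"
proof -
 let ?T = "T (i, j)" and ?H = "H (i, lp i)" let ?X = "restr ?H (XX i j)" let ?v = "tv i j"
 note xt = index_top[OF x] and sX = XX_submodule[OF x]
 interpret H: lmod A ?H by (rule fd_lmod[OF H_fd[OF xt]])
 have fX: "fd K A ?X" by (rule fd_sub[OF H_fd[OF xt] sX])
 interpret TX: two_mods A ?T ?X using T_left[OF x] fX by (simp add: fd_def)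
 interpret XX': two_mods A ?X ?X ..
 obtain f where f: "f : lhom A ?T ?X" "f (pp i j (lp i) *[?T] ?v) ~= 0[?H]" using embed[OF x] by blast
 obtain g where g: "g : lhom A ?X ?T" "g (f ?v) = ?v" using pull_back[OF x f] by blast
 have vc: "?v : car ?T" by (rule stdgen_mem[OF T_gen[OF x]])
 have pc: "pp i j (lp i) : car A" using x xt index[OF x] by simp
 have fv: "f ?v : car ?X" by (rule lhom_mem[OF f(1) vc])
 have vz: "f ?v ~= 0[?H]" using f(2) lhom_smult[OF f(1) pc vc] H.smult_r_null[OF pc] by auto
 let ?fg = "compose (car ?X) f g"
 have fg: "?fg : lhom A ?X ?X" by (rule lhom_comp[OF g(1) f(1) TX.N.left])
 have fgv: "?fg (f ?v) = f ?v" using fv g(2) by (simp add: compose_eq)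
 obtain Z where Z: "wd (i, lp i) ?H Z = 1" "submodule Z A ?H" "!!U. [|submodule U A ?H; U ~= {0[?H]}|] ==> Z <= U"
  using hull_facts[OF H_hull[OF xt] xt] by metis
 have fvH: "f ?v : car ?H" using fv H.sub_mem[OF sX] by simp
 have "inj_on ?fg (car ?X)"
  unfolding XX'.lhom_inj_iff[OF fg]
 proof (intro ballI impI, rule ccontr)
  fix y assume y: "y : car ?X" "?fg y = 0[?X]" "y ~= 0[?X]"
  let ?U = "{y : car ?X. ?fg y = 0[?X]}"
  have "submodule ?U A ?H" using XX'.lhom_kernel[OF fg] H.sub_restr_iff[OF sX] by simp
  moreover have "?U ~= {0[?H]}" using y by auto
  ultimately have ZU: "Z <= ?U" by (rule Z(3))
  have "H.cyc (f ?v) ~= {0[?H]}" using H.cyc_self[OF fvH] vz by blast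
  hence Zv: "Z <= H.cyc (f ?v)" by (rule Z(3)[OF H.cyc_sub[OF fvH]])
  have "z = 0[?H]" if z: "z : Z" for z
  proof -
   obtain a where a: "a : car A" "z = a *[?H] f ?v" using z Zv by (auto simp: H.cyc_def)
   hence "?fg z = z" using lhom_smult[OF fg a(1) fv] fgv by simp
   moreover have "?fg z = 0[?X]" using ZU z by blast
   ultimately show ?thesis by simp
  qed
  hence "wt ?H (e (i, lp i)) Z <= {0[?H]}" by (auto simp: wt_def)
  hence "wt ?H (e (i, lp i)) Z = {0[?H]}" using wt_zero_mem[OF H.left Z(2) xt] by blast
  thus False using wt_eq_zero_iff[OF H_fd[OF xt] Z(2) xt] Z(1) by simp
 qed
 hence "?fg ` car ?X = car ?X" using endo_inj_iff_surj[OF fX fg] by simp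
 hence sur: "car ?X <= f ` car ?T" using lhom_mem[OF g(1)] by (auto simp: compose_def image_iff)
 let ?gf = "compose (car ?T) g f"
 have gf: "?gf : lhom A ?T ?T" by (rule lhom_comp[OF f(1) g(1) TX.M.left])
 have gfv: "(?gf ^^ m) ?v = ?v" for m by (induction m) (use vc g(2) in \<open>simp_all add: compose_eq\<close>)
 have "?v ~= 0[?T]" using vz TX.lhom_zero[OF f(1)] by auto
 hence "bij_betw ?gf (car ?T) (car ?T)" using fitting[OF T_fd[OF x] T_indec[OF x] gf] gfv vc by metis
 hence "inj_on ?gf (car ?T)" by (simp add: bij_betw_def)
 hence "inj_on f (car ?T)" by (auto simp: inj_on_def compose_def)
 moreover have "f ` car ?T = car ?X" using sur lhom_mem[OF f(1)] by blast
 ultimately show ?thesis using f(1) unfolding bij_betw_def by blast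
qed

end

section \<open>Hom spaces into tilting modules and the Ringel dual\<close>

context adr_tilt
begin

text \<open>The composite structure map \<open>p\<close> embeds \<open>e (i, l) M\<close> into
  \<open>e (i, l_i) M\<close>, and its image is the whole weight \<open>(i, l_i)\<close> of the
  submodule generated by \<open>e (i, l) M\<close>. To see the latter, let \<open>Y\<close> be the
  submodule of all \<open>m\<close> for which \<open>e (i, l_i) a m\<close> lies in that image for
  every \<open>a\<close>; it contains the generators by \<open>wt_decomp\<close>.\<close>

lemma top_wt_span:
 fixes M :: "('a, 'm) module"
 assumes M: "fd K A M" and r: "rel_inj M {0[M]} (car M)" and w: "(i, l) : I"
 shows "wd (i, lp i) M (span_in A M (wt M (e (i, l)) (car M))) = wd (i, l) M (car M)"
proof -
 interpret M: lmod A M by (rule fd_lmod[OF M])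
 note Ml = M.left and wt' = index_top[OF w]
 interpret kM: lmod K "kmod A M" by (rule fd_kmod[OF M])
 have ll: "l <= lp i" using index[OF w] by simp
 let ?W = "wt M (e (i, l)) (car M)" and ?p = "pp i l (lp i)"
 let ?N = "span_in A M ?W"
 let ?X = "wt M (e (i, lp i)) ?N" let ?Y = "restr (kmod A M) ?W" let ?Z = "restr (kmod A M) ?X"
 have Wc: "?W <= car M" by (auto simp: wt_def)
 have N: "submodule ?N A M" by (rule M.span_sub[OF Wc])
 have pc: "?p : car A" using w wt' ll by simp
 have sW: "submodule ?W K (kmod A M)" by (rule wt_sub[OF Ml fd_kmod_sub[OF M M.sub_carrier] e_closed[OF w]])
 have sN: "submodule (?X) K (kmod A M)" by (rule wt_sub[OF Ml fd_kmod_sub[OF M N] e_closed[OF wt']])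
 note W' = subD[OF sW]
 define Y where "Y = {m : car M. ALL a:car A. e (i, lp i) *[M] (a *[M] m) : (%u. ?p *[M] u) ` ?W}"
 have YI: "m : Y" if "m : car M" "!!a. a : car A ==> EX u:?W. e (i, lp i) *[M] (a *[M] m) = ?p *[M] u" for m
  using that unfolding Y_def by blast
 have YD: "EX u:?W. e (i, lp i) *[M] (a *[M] m) = ?p *[M] u" if "m : Y" "a : car A" for m a
  using that unfolding Y_def by blast
 have Yc: "Y <= car M" by (auto simp: Y_def)
 have addp: "?p *[M] u +[M] ?p *[M] u' = ?p *[M] (u +[M] u') & u +[M] u' : ?W" if "u : ?W" "u' : ?W" for u u'
  using W'(4)[OF that] M.smult_r_distr[OF pc, of u u'] subsetD[OF Wc that(1)] subsetD[OF Wc that(2)] by simp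
 have Y: "submodule Y A M"
  unfolding Y_def
 proof (rule M.colon_submodule)
  show "0[M] : (%u. ?p *[M] u) ` ?W" using pc W'(2) by (intro image_eqI[of _ _ "0[M]"]) simp_all
  fix x y assume "x : (%u. ?p *[M] u) ` ?W" "y : (%u. ?p *[M] u) ` ?W"
  then obtain u u' where "u : ?W" "x = ?p *[M] u" "u' : ?W" "y = ?p *[M] u'" by blast
  thus "x +[M] y : (%u. ?p *[M] u) ` ?W" using addp[of u u'] by auto
 qed (use wt' in auto)
 have "?W <= Y"
 proof
  fix m assume m: "m : ?W"
  hence mc: "m : car M" using Wc by blast
  show "m : Y"
  proof (rule YI[OF mc])
   fix a assume a: "a : car A"
   obtain c y where c: "c : car K" "y : car M"
    "e (i, lp i) *[M] (a *[M] m) = (if i = i & l <= lp i then sc c *[M] (?p *[M] m) else 0[M]) +[M] y"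
    "y = 0[M] | (EX t' b. t' < l & t' <= lp i & (i, t') : I & b : car A & y = pp i t' (lp i) *[M] (e (i, t') *[M] (b *[M] m)))"
    by (rule wt_decomp[OF Ml m w wt' a])
   have u1: "sc c *[M] m : ?W" using W'(5)[OF c(1), of m] m by simp
   have "EX u:?W. y = ?p *[M] u" using c(4)
   proof
    assume "y = 0[M]" thus ?thesis using pc W'(2) by (intro bexI[of _ "0[M]"]) simp_all
   next
    assume "EX t' b. t' < l & t' <= lp i & (i, t') : I & b : car A & y = pp i t' (lp i) *[M] (e (i, t') *[M] (b *[M] m))"
    then obtain t b where t: "t < l" "(i, t) : I" "b : car A" "y = pp i t (lp i) *[M] (e (i, t) *[M] (b *[M] m))" by blast
    define z where "z = e (i, t) *[M] (b *[M] m)"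
    have zc: "z : car M" using t mc by (simp add: z_def)
    have tl: "t <= l" using t(1) by simp
    \<comment> \<open>A term that comes from a lower level \<open>t\<close> of the same column
      \<open>i\<close> also passes through level \<open>l\<close>.\<close>
    have "y = ?p *[M] (pp i t l *[M] z)"
     using M.smult_assoc1[OF pc pp_closed[OF t(2) w tl] zc] pp_comp[OF t(2) w wt' tl ll] t(4) by (simp add: z_def)
    thus ?thesis using pp_wt[OF Ml M.sub_carrier t(2) w tl zc] by blast
   qed
   then obtain u where u: "u : ?W" "y = ?p *[M] u" by blast
   have "e (i, lp i) *[M] (a *[M] m) = ?p *[M] (sc c *[M] m +[M] u)"
    using c(3) ll u(2) sc_smult[OF Ml c(1) pc mc] addp[OF u1 u(1)] by simp
   thus "EX u:?W. e (i, lp i) *[M] (a *[M] m) = ?p *[M] u" using addp[OF u1 u(1)] by blast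
  qed
 qed
 hence NY: "?N <= Y" by (rule M.span_least[OF Y])
 let ?F = "\<lambda>m\<in>?W. ?p *[M] m"
 have Fim: "?p *[M] m : ?X" if "m : ?W" for m
  by (rule pp_wt[OF Ml N w wt' ll]) (use that M.span_superset[of ?W] in blast)
 have F: "?F : lhom K (?Y) (?Z)"
 proof (rule lhomI)
  fix m m' assume m: "m : car (?Y)" "m' : car (?Y)"
  hence "m : ?W" "m' : ?W" by simp_all
  thus "?F (m +[?Y] m') = ?F m +[?Z] ?F m'" using addp[of m m'] by simp
 next
  fix c m assume c: "c : car K" and m: "m : car (?Y)"
  hence "m : ?W" "m : car M" "sc c *[M] m : ?W" using W'(5)[OF c, of m] Wc by auto
  thus "?F (c *[?Y] m) = c *[?Z] ?F m" using sc_smult[OF Ml c pc, of m] by simp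
 qed (use Fim in auto)
 have lW: "left_module K (?Y)" and lN: "left_module K (?Z)"
  by (rule kM.sub_left[OF sW], rule kM.sub_left[OF sN])
 interpret WN: two_mods K "?Y" "?Z"
  using lW lN by simp
 have b: "bij_betw ?F (car (?Y)) (car (?Z))"
  unfolding bij_betw_def
 proof
  show "inj_on ?F (car (?Y))"
   unfolding WN.lhom_inj_iff[OF F]
  proof (intro ballI impI)
   fix m assume m: "m : car (?Y)" "?F m = 0[?Z]"
   hence "m : ?W" "?p *[M] m : {0[M]}" by simp_all
   thus "m = 0[?Y]" using rel_inj_pp[OF Ml M.sub_carrier r w wt' ll] by simp
  qed
  have "y : ?F ` ?W" if y: "y : ?X" for y
  proof -
   have yN: "y : ?N" "e (i, lp i) *[M] y = y" using y by (simp_all add: wt_def)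
   hence "y : Y" "y : car M" using NY Yc by blast+
   then obtain u where "u : ?W" "y = ?p *[M] u" using YD[of y "1[A]"] yN(2) by auto
   thus ?thesis by (intro image_eqI[of _ _ u]) simp_all
  qed
  thus "?F ` car (?Y) = car (?Z)"
   using lhom_mem[OF F] by auto
 qed
 have "flen K (?Z)" using kM.flen_sub(1)[OF _ sN] M by (simp add: fd_def)
 thus ?thesis using flen_transfer(2)[OF lW lN F b] by (simp add: kdim_def)
qed

text \<open>With \<open>T (i, j)\<close> realized in the hull, the maps to it are the maps to the
  hull that kill the submodule generated by \<open>e (i, j - 1) M\<close>. They are counted by
  \<open>hom_vanish_dim\<close> and \<open>top_wt_span\<close>. For \<open>j = 1\<close> there is no
  such weight and nothing is subtracted.\<close>

lemma T_hom_dim: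
 fixes M :: "('a, 'm) module"
 assumes x: "(i, j) : I" and M: "fd K A M" and r: "rel_inj M {0[M]} (car M)"
 shows "len K (homk A M (T (i, j))) + (if (i, j - 1) : I then wd (i, j - 1) M (car M) else 0) = wd (i, lp i) M (car M)"
proof -
 let ?H = "H (i, lp i)" note xt = index_top[OF x]
 interpret MH: two_mods A M ?H using H_left[OF xt] M by (simp add: fd_def)
 note Ml = MH.M.left and Hl = MH.N.left
 let ?S = "\<Union>z\<in>{z : I. z = (i, j - 1)}. wt M (e z) (car M)" let ?N = "span_in A M ?S"
 have Sc: "?S <= car M" by (auto simp: wt_def)
 have N: "submodule ?N A M" by (rule MH.M.span_sub[OF Sc])
 note sX = XX_submodule[OF x]
 have "f ` car M <= XX i j \<longleftrightarrow> (ALL y:?N. f y = 0[?H])" if f: "f : lhom A M ?H" for f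
 proof
  assume a: "f ` car M <= XX i j"
  have "?S <= {y : car M. f y = 0[?H]}"
  proof
   fix u assume "u : ?S"
   then obtain z where z: "z : {z : I. z = (i, j - 1)}" "u : car M" "e z *[M] u = u" by (auto simp: wt_def)
   have zL: "z : I" using z(1) by blast
   have fu: "f u : killed ?H {z : I. z = (i, j - 1)}" using a z(2) unfolding XX_def by blast
   have "e z *[?H] f u = f u" using lhom_smult[OF f e_closed[OF zL] z(2)] z(3) by simp
   hence "f u = 0[?H]" by (rule killed_wt[OF Hl fu z(1)])
   thus "u : {y : car M. f y = 0[?H]}" using z(2) by simp
  qed
  hence "?N <= {y : car M. f y = 0[?H]}" by (rule MH.M.span_least[OF MH.lhom_kernel[OF f]])
  thus "ALL y:?N. f y = 0[?H]" by blast
 next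
  assume a: "ALL y:?N. f y = 0[?H]"
  show "f ` car M <= XX i j"
  proof
   fix y assume "y : f ` car M"
   then obtain m where m: "m : car M" "y = f m" by blast
   have "e z *[?H] (b *[?H] y) = 0[?H]" if z: "z : I" "z = (i, j - 1)" and b: "b : car A" for z b
   proof -
    have bm: "b *[M] m : car M" using b m(1) by simp
    have "e z *[M] (b *[M] m) : ?S" using wt_e[OF Ml MH.M.sub_carrier z(1) bm] z by blast
    hence "f (e z *[M] (b *[M] m)) = 0[?H]" using a MH.M.span_superset[of ?S] by blast
    thus ?thesis using lhom_smult[OF f e_closed[OF z(1)] bm] lhom_smult[OF f b m(1)] m(2) by simp
   qed
   thus "y : XX i j" using lhom_mem[OF f m(1)] m(2) unfolding XX_def killed_def by blast
  qed
 qed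
 hence eq: "{f : lhom A M ?H. f ` car M <= XX i j} = {f : lhom A M ?H. ALL y:?N. f y = 0[?H]}" by blast
 obtain f where f: "f : lhom A (T (i, j)) (restr ?H (XX i j))" "bij_betw f (car (T (i, j))) (car (restr ?H (XX i j)))"
  using T_iso[OF x] by blast
 have "len K (homk A M (T (i, j))) = len K (homk A M (restr ?H (XX i j)))"
  by (rule homk_target_iso[OF M T_fd[OF x] fd_sub[OF H_fd[OF xt] sX] f])
 also have "... = len K (restr (homk A M ?H) {f : lhom A M ?H. ALL y:?N. f y = 0[?H]})"
  unfolding homk_restr[OF subD(1)[OF sX]] eq ..
 finally have 1: "len K (homk A M (T (i, j))) + wd (i, lp i) M ?N = wd (i, lp i) M (car M)"
  using hom_vanish_dim[OF H_hull[OF xt] xt M N] by simp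
 have "wd (i, lp i) M ?N = (if (i, j - 1) : I then wd (i, j - 1) M (car M) else 0)"
 proof (cases "(i, j - 1) : I")
  case True
  hence "?S = wt M (e (i, j - 1)) (car M)" by auto
  thus ?thesis using top_wt_span[OF M r True] True by simp
 next
  case False
  hence "?S <= {0[M]}" by auto
  hence "?N <= {0[M]}" by (rule MH.M.span_least[OF MH.M.sub_zero])
  hence "?N = {0[M]}" using subD(2)[OF N] by blast
  moreover have "wt M (e (i, lp i)) {0[M]} = {0[M]}" using xt by (auto simp: wt_def)
  ultimately show ?thesis using wt_eq_zero_iff[OF M N xt] False by simp
 qed
 with 1 show ?thesis by simp
qed

text \<open>The weight \<open>(k, l)\<close> of \<open>T (k, l)\<close> is the line spanned by
  \<open>tv k l\<close>, so an endomorphism acts on it by a scalar. Non-isomorphy follows since an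
  isomorphism preserves the lowest level that occurs and the index at which it occurs.\<close>

lemma T_summands: assumes fin: "finite I" shows "summands K A I T"
proof (intro summands.intro summands_axioms.intro fdalg_axioms fin)
 fix x assume x: "x : I"
 show "fd K A (T x)" "indecomposable A (T x)" by (rule T_fd[OF x], rule T_indec[OF x])
next
 fix x f assume "x : I" "f : lhom A (T x) (T x)"
 then obtain k l where kl: "x = (k, l)" and x: "(k, l) : I" and f: "f : lhom A (T (k, l)) (T (k, l))" by (cases x) auto
 let ?T = "T (k, l)" and ?v = "tv k l"
 interpret T: lmod A ?T by (rule T_lmod[OF x])
 have v: "?v : car ?T" "e (k, l) *[?T] ?v = ?v" "?v ~= 0[?T]"
  using T_gen[OF x] pp_id[OF x] x index[OF x] index_top[OF x] by (auto simp: stdgen_def wt_def)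
 have fv: "f ?v : wt ?T (e (k, l)) (car ?T)"
  using lhom_mem[OF f v(1)] lhom_smult[OF f e_closed[OF x] v(1)] v(2) by (simp add: wt_def)
 hence fvc: "f ?v : wt ?T (e (k, l)) (T.cyc ?v)" using T_wt[OF x x] by (auto simp: wt_def)
 have "EX c:car K. f ?v = sc c *[?T] ?v"
 proof (cases "f ?v = 0[?T]")
  case True
  show ?thesis using True v(1) by (intro bexI[of _ "0[K]"]) simp_all
 next
  case False
  then obtain c where "c : car K" "f ?v = sc c *[?T] (pp k l l *[?T] ?v)"
   using stdgen_wt[OF T.left x x T_gen[OF x] fvc] by blast
  thus ?thesis using pp_id[OF x] v(2) by auto
 qed
 then obtain c where c: "c : car K" "f ?v = sc c *[?T] ?v" by blast
 let ?g = "\<lambda>v\<in>car ?T. f v -[?T] sc c *[?T] v"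
 have scc: "sc c : car A" using c(1) by simp
 have g0: "?g 0[?T] = 0[?T]"
 proof -
  interpret TT: two_mods A ?T ?T ..
  show ?thesis using TT.lhom_zero[OF f] scc by simp
 qed
 have gv: "?g ?v = 0[?T]" using v(1) c(2) scc T.diff_zero_iff[of "sc c *[?T] ?v" "sc c *[?T] ?v"] by simp
 have "~ inj_on ?g (car ?T)"
 proof
  assume i: "inj_on ?g (car ?T)"
  have "?v = 0[?T]" by (rule inj_onD[OF i _ v(1) T.M.zero_closed]) (unfold g0 gv, rule refl)
  thus False using v(3) by simp
 qed
 hence "~ bij_betw ?g (car ?T) (car ?T)" by (simp add: bij_betw_def)
 thus "EX c:car K. ~ bij_betw (\<lambda>v\<in>car (T x). f v -[T x] sc c *[T x] v) (car (T x)) (car (T x))"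
  unfolding kl using c(1) by blast
next
 fix x y assume xy: "x : I" "y : I" "isomorphic A (T x) (T y)"
 have half: "snd b <= snd a & (snd a = snd b --> fst a = fst b)" if ab: "a : I" "b : I" "isomorphic A (T a) (T b)" for a b
 proof -
  obtain k l s t where e: "a = (k, l)" "b = (s, t)" by (cases a, cases b)
  have x: "(k, l) : I" and y: "(s, t) : I" using ab e by auto
  obtain f where f: "f : lhom A (T (k, l)) (T (s, t))" "bij_betw f (car (T (k, l))) (car (T (s, t)))"
   using ab(3) e by (auto simp: isomorphic_def)
  interpret TT: two_mods A "T (k, l)" "T (s, t)" using T_lmod[OF x] T_lmod[OF y] by (simp add: two_mods_def)
  have v: "tv k l : car (T (k, l))" "e (k, l) *[T (k, l)] tv k l = tv k l" "tv k l ~= 0[T (k, l)]"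
   using T_gen[OF x] x index[OF x] index_top[OF x] by (auto simp: stdgen_def wt_def)
  have fw: "f (tv k l) : wt (T (s, t)) (e (k, l)) (car (T (s, t)))"
   using lhom_mem[OF f(1) v(1)] lhom_smult[OF f(1) e_closed[OF x] v(1)] v(2) by (simp add: wt_def)
  have fn: "f (tv k l) ~= 0[T (s, t)]" using TT.lhom_inj_iff[OF f(1)] f(2) v(1,3) by (auto simp: bij_betw_def)
  have tl: "t <= l"
  proof (rule ccontr)
   assume "~ t <= l"
   thus False using T_wt_low[OF y x] fw fn by auto
  qed
  moreover have "k = s" if "l = t"
  proof -
   have "f (tv k l) : wt (T (s, t)) (e (k, l)) (TT.N.cyc (tv s t))" using fw T_wt[OF y x] that by (auto simp: wt_def)
   thus ?thesis using stdgen_wt[OF TT.N.left y x T_gen[OF y] _ fn] by blast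
  qed
  ultimately show ?thesis using e by simp
 qed
 have "isomorphic A (T y) (T x)" by (rule isomorphic_sym[OF T_left[OF xy(1)] T_left[OF xy(2)] xy(3)])
 thus "x = y" using half[OF xy] half[OF xy(2,1)] by (simp add: prod_eq_iff)
qed

text \<open>The multiplicity is the dimension of \<open>Hom(T y, T (k, l))\<close>, and
  \<open>T_hom_dim\<close> applies with the tilting module \<open>T y\<close> as source.\<close>

lemma ringel_multiplicity:
 assumes fin: "finite I" and x: "(k, l) : I" and y: "y : I"
 shows "multiplicity_of (ringel_dual A I T) (ringel_proj A I T (k, l)) (ringel_simple A I T y) +
  (if (k, l - 1) : I then wd (k, l - 1) (T y) (car (T y)) else 0) = wd (k, lp k) (T y) (car (T y))"
proof -
 have "rel_inj (T y) {0[T y]} (car (T y))" using T_rel_inj[of "fst y" "snd y"] y by simp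
 thus ?thesis
  using T_hom_dim[OF x T_fd[OF y]] summands.multiplicity_hom[OF T_summands[OF fin] y T_fd[OF x]]
  by (simp add: ringel_dual_def ringel_proj_def ringel_simple_def)
qed

end

section \<open>The standard and costandard modules of the statement match the models\<close>

context adr
begin

text \<open>The least submodule to factor out is generated by the levels below \<open>l\<close>; the
  remaining forbidden weights have level \<open>l\<close> and are then zero in the quotient by
  \<open>rel_wt\<close>. The submodule \<open>U'\<close> witnesses that the top-level image of the
  generator survives.\<close>

lemma standard_std_like:
 fixes P :: "nat \<times> nat => ('a, 'm) module"
 assumes M: "fd K A (P (k, l))" and x: "(k, l) : I" and m: "m : wt (P (k, l)) (e (k, l)) (car (P (k, l)))" and gen: "car (P (k, l)) <= lmod.cyc A (P (k, l)) m"
  and U': "submodule U' A (P (k, l))" "pp k l (lp k) *[P (k, l)] m ~: U'" "!!s t. [|(s, t) : I; t < l|] ==> wt (P (k, l)) (e (s, t)) (car (P (k, l))) <= U'"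
 shows "std_like (standard A I adr_le S P (k, l)) (k, l)"
proof -
 let ?M = "P (k, l)"
 interpret M: lmod A ?M by (rule fd_lmod[OF M])
 note Ml = M.left
 let ?J = "{j : I. adr_le j (k, l)}"
 have mc: "m : car ?M" "e (k, l) *[?M] m = m" using m by (simp_all add: wt_def)
 define S0 where "S0 = (\<Union>z\<in>{z : I. snd z < l}. wt ?M (e z) (car ?M))"
 define U0 where "U0 = span_in A ?M S0"
 have "S0 <= car ?M" by (auto simp: S0_def wt_def)
 hence U0: "submodule U0 A ?M" unfolding U0_def by (rule M.span_sub)
 have S0U: "S0 <= U0" unfolding U0_def by (rule M.span_superset)
 have below: "e (s, t) *[?M] (b *[?M] m) : U0" if "(s, t) : I" "t < l" "b : car A" for s t b
 proof -
  have "e (s, t) *[?M] (b *[?M] m) : S0"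
   using wt_e[OF Ml M.sub_carrier that(1), of "b *[?M] m"] that mc(1) unfolding S0_def by fastforce
  thus ?thesis using S0U by blast
 qed
 have quot_wt: "wt (quot ?M U) (e z) (car (quot ?M U)) = {0[quot ?M U]} \<longleftrightarrow> wt ?M (e z) (car ?M) <= U" if U: "submodule U A ?M" and z: "z : I" for U z
 proof -
  let ?W = "wt ?M (e z) (car ?M)" and ?o = "0[quot ?M U]"
  have eq: "wt (quot ?M U) (e z) (car (quot ?M U)) = M.qmap U ` ?W"
   using wt_image[OF M.qmap_lhom[OF U] M.sub_carrier e_closed[OF z] e_idem[OF z] Ml] M.qmap_surj[OF U] by simp
  have "M.qmap U ` ?W = {?o} \<longleftrightarrow> (ALL y:?W. M.qmap U y = ?o)" using wt_zero_mem[OF Ml M.sub_carrier z] by blast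
  moreover have "M.qmap U y = ?o \<longleftrightarrow> y : U" if "y : ?W" for y using M.qmap_zero[OF U, of y] that by (simp add: wt_def)
  ultimately show ?thesis unfolding eq subset_eq by (simp cong: ball_cong)
 qed
 have ok_iff: "comp_factors_among A S ?J (quot ?M U) \<longleftrightarrow> (ALL z:I - ?J. wt ?M (e z) (car ?M) <= U)" if U: "submodule U A ?M" for U
  using comp_factors_among_iff[OF fd_quot[OF M U], of ?J] quot_wt[OF U] by auto
 have least: "U0 <= U" if "submodule U A ?M" "comp_factors_among A S ?J (quot ?M U)" for U
 proof -
  have a: "ALL z:I - ?J. wt ?M (e z) (car ?M) <= U" using that ok_iff by simp
  have "S0 <= U"
  proof
   fix y assume "y : S0"
   then obtain z where z: "z : I" "snd z < l" "y : wt ?M (e z) (car ?M)" by (auto simp: S0_def)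
   hence "z : I - ?J" by (auto simp: adr_le_def)
   thus "y : U" using a z(3) by blast
  qed
  thus ?thesis unfolding U0_def by (rule M.span_least[OF that(1)])
 qed
 have "wt ?M (e z) (car ?M) <= U0" if z: "z : I - ?J" for z
 proof
  obtain s t where st: "z = (s, t)" by (cases z)
  have w: "(s, t) : I" "(s, t) ~= (k, l)" "t <= l" using z st by (auto simp: adr_le_def)
  fix y assume y: "y : wt ?M (e z) (car ?M)"
  then obtain a where a: "a : car A" "y = a *[?M] m" using gen by (auto simp: wt_def M.cyc_def)
  have ey: "e (s, t) *[?M] (a *[?M] m) = y" using y a st by (simp add: wt_def)
  show "y : U0"
  proof (rule rel_wt[OF Ml U0 m x w(1) a(1)])
   show "!!s t b. [|(s, t) : I; t < l; b : car A|] ==> e (s, t) *[?M] (b *[?M] m) : U0" by (rule below)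
  qed (use ey w in auto)
 qed
 hence "comp_factors_among A S ?J (quot ?M U0)" using ok_iff[OF U0] by simp
 hence "(LEAST U. submodule U A ?M & comp_factors_among A S ?J (quot ?M U)) = U0"
  using U0 least by (intro Least_equality) blast+
 hence st: "standard A I adr_le S P (k, l) = quot ?M U0" by (simp add: standard_def)
 note q = M.qmap_lhom[OF U0] and Ql = M.quot_left[OF U0]
 interpret Q: lmod A "quot ?M U0" using Ql by simp
 let ?d = "M.qmap U0 m"
 have dc: "?d : car (quot ?M U0)" by (rule lhom_mem[OF q mc(1)])
 have pc: "pp k l (lp k) : car A" using x index_top[OF x] index[OF x] by simp
 have "U0 <= U'" unfolding U0_def
  by (rule M.span_least[OF U'(1)]) (use U'(3) in \<open>fastforce simp: S0_def\<close>)
 hence "M.qmap U0 (pp k l (lp k) *[?M] m) ~= 0[quot ?M U0]" using M.qmap_zero[OF U0] U'(2) pc mc(1) by blast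
 hence "pp k l (lp k) *[quot ?M U0] ?d ~= 0[quot ?M U0]" using lhom_smult[OF q pc mc(1)] by simp
 moreover have "e (s, t) *[quot ?M U0] (b *[quot ?M U0] ?d) = 0[quot ?M U0]" if b: "(s, t) : I" "t < l" "b : car A" for s t b
 proof -
  have bm: "b *[?M] m : car ?M" using b(3) mc(1) by simp
  have "e (s, t) *[quot ?M U0] (b *[quot ?M U0] ?d) = M.qmap U0 (e (s, t) *[?M] (b *[?M] m))"
   using lhom_smult[OF q e_closed[OF b(1)] bm] lhom_smult[OF q b(3) mc(1)] by simp
  also have "... = 0[quot ?M U0]" using M.qmap_zero[OF U0 M.smult_closed[OF e_closed[OF b(1)] bm]] below[OF b] by simp
  finally show ?thesis .
 qed
 moreover have "?d : wt (quot ?M U0) (e (k, l)) (car (quot ?M U0))" using dc lhom_smult[OF q e_closed[OF x] mc(1)] mc(2) by (simp add: wt_def)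
 ultimately have "stdgen (quot ?M U0) k l ?d" unfolding stdgen_def by blast
 moreover have "car (quot ?M U0) <= Q.cyc ?d"
 proof
  fix w assume "w : car (quot ?M U0)"
  then obtain y where y: "y : car ?M" "w = M.qmap U0 y" using M.qmap_surj[OF U0] by blast
  then obtain a where "a : car A" "y = a *[?M] m" using gen by (auto simp: M.cyc_def)
  thus "w : Q.cyc ?d" using lhom_smult[OF q _ mc(1)] y(2) by (simp add: Q.cyc_def)
 qed
 ultimately show ?thesis unfolding st std_like_def using fd_quot[OF M U0] by auto
qed

lemma costandard_nab:
 assumes H: "fd K A (H y)"
 shows "costandard A I adr_le S H y = nab (H y) y"
proof -
 interpret H: lmod A "H y" by (rule fd_lmod[OF H])
 let ?J = "{j : I. adr_le j y}" and ?Z = "{z : I. z ~= y & snd z <= snd y}"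
 have JZ: "I - ?J = ?Z" by (auto simp: adr_le_def)
 note Hl = H.left
 have Z: "?Z <= I" by auto
 have ok_iff: "comp_factors_among A S ?J (restr (H y) U) \<longleftrightarrow> (ALL z:?Z. wt (H y) (e z) U = {0[H y]})" if U: "submodule U A (H y)" for U
  using comp_factors_among_iff[OF fd_sub[OF H U], of ?J] unfolding JZ by auto
 have K: "submodule (killed (H y) ?Z) A (H y)" by (rule killed_submodule[OF Hl Z])
 have "(GREATEST U. submodule U A (H y) & comp_factors_among A S ?J (restr (H y) U)) = killed (H y) ?Z"
 proof (rule Greatest_equality)
  have "wt (H y) (e z) (killed (H y) ?Z) = {0[H y]}" if z: "z : ?Z" for z
  proof -
   have "w = 0[H y]" if "w : wt (H y) (e z) (killed (H y) ?Z)" for w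
   proof -
    from that have w: "w : killed (H y) ?Z" "e z *[H y] w = w" unfolding wt_def by blast+
    show ?thesis by (rule killed_wt[OF Hl w(1) z w(2)])
   qed
   moreover have "z : I" using z by blast
   ultimately show ?thesis using wt_zero_mem[OF Hl K] by blast
  qed
  thus "submodule (killed (H y) ?Z) A (H y) & comp_factors_among A S ?J (restr (H y) (killed (H y) ?Z))"
   using K ok_iff[OF K] by blast
 next
  fix U assume U: "submodule U A (H y) & comp_factors_among A S ?J (restr (H y) U)"
  hence "ALL z:?Z. wt (H y) (e z) U = {0[H y]}" using ok_iff by blast
  thus "U <= killed (H y) ?Z" using U by (intro subset_killed[OF Hl Z]) blast+
 qed
 thus ?thesis by (simp add: costandard_def nab_def)
qed

end

section \<open>The ADR algebra satisfies the abstract assumptions\<close>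

context summands
begin

lemma hat_add:
 assumes x: "x : I" and w: "w : I" and f: "f : lhom A (V w) (V x)" "g : lhom A (V w) (V x)"
 shows "hat w x (\<lambda>v\<in>car (V w). f v +[V x] g v) = hat w x f +[E] hat w x g"
 unfolding E_simps
proof (rule ext)
 fix u show "hat w x (\<lambda>v\<in>car (V w). f v +[V x] g v) u = (\<lambda>u\<in>car G. hat w x f u +[G] hat w x g u) u"
  using lhom_add[OF inc_lhom[OF x], of "f (u w)" "g (u w)"] lhom_mem[OF f(1)] lhom_mem[OF f(2)] G_mem[OF _ w]
  by (cases "u : car G") (simp_all add: hat_def)
qed

lemma hat_zero:
 assumes x: "x : I" and w: "w : I" and f: "!!v. v : car (V w) ==> f v = 0[V x]"
 shows "hat w x f = 0[E]"
proof -
 interpret two_mods A "V x" G using V_left[OF x] G_left by simp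
 show ?thesis unfolding hat_def E_simps by (rule restrict_ext) (simp add: f G_mem[OF _ w] lhom_zero[OF inc_lhom[OF x]])
qed

lemma hat_sc:
 assumes x: "x : I" and w: "w : I" and f: "f : lhom A (V w) (V x)" and c: "c : car K"
 shows "hat w x (\<lambda>v\<in>car (V w). sc c *[V x] f v) = (c *[E] 1[E]) \<otimes>[E] hat w x f"
proof -
 interpret E: fdalg K E by (rule E_fdalg)
 have sc: "sc c : car A" using c by simp
 have "(c *[E] 1[E]) \<otimes>[E] hat w x f = c *[E] hat w x f" using hat_lhom[OF w x f] by (intro E.sc_mult[OF c]) (simp only: E_simps)
 also have "... = hat w x (\<lambda>v\<in>car (V w). sc c *[V x] f v)"
  unfolding E_simps
 proof (rule ext)
  fix u show "(\<lambda>u\<in>car G. sc c *[G] hat w x f u) u = hat w x (\<lambda>v\<in>car (V w). sc c *[V x] f v) u"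
   using lhom_smult[OF inc_lhom[OF x] sc, of "f (u w)"] lhom_mem[OF f] G_mem[OF _ w]
   by (cases "u : car G") (simp_all add: hat_def)
 qed
 finally show ?thesis by simp
qed

lemma hat_eps: "[|w : I; x : I; f : lhom A (V w) (V x)|] ==> eps w \<otimes>[E] (hat w x f \<otimes>[E] eps x) = hat w x f"
 unfolding E_simps eps_def hat_def compose_def
 by (rule ext) (simp add: restrict_def G_mem inc_closed lhom_mem)

text \<open>Identifies \<open>Hom(G, V z)\<close> with the projective module of the idempotent
  \<open>eps z\<close>, so that \<open>pgen_dim\<close> computes Hom spaces from it.\<close>

lemma HG_prj:
 assumes z: "z : I" shows "fdalg.pgen E (eps z) (HG (V z)) (prj z)"
proof -
 interpret E: fdalg K E by (rule E_fdalg)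
 have p: "prj z : lhom A G (V z)" by (rule prj_lhom[OF z])
 have pe: "compose (car G) (prj z) (eps z) = prj z"
  by (rule extensionalityI[of _ "car G"]) (use z G_mem in \<open>auto simp: compose_eq eps_def prj_def inc_closed\<close>)
 have "EX s:car E. f = s *[HG (V z)] prj z" if f: "f : car (HG (V z))" for f
 proof (rule bexI[of _ "compose (car G) (inc z) f"])
  have fl: "f : lhom A G (V z)" using f by simp
  show c: "compose (car G) (inc z) f : car E" using lhom_comp[OF fl inc_lhom[OF z] G_left] by simp
  have "f = compose (car G) (prj z) (compose (car G) (inc z) f)"
  proof (rule extensionalityI[of _ "car G"])
   fix u assume u: "u : car G"
   have "f u : car (V z)" by (rule lhom_mem[OF fl u])
   thus "f u = compose (car G) (prj z) (compose (car G) (inc z) f) u" using u z by (simp add: compose_eq inc_closed)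
  qed (use lhom_ext[OF fl] in simp_all)
  thus "f = compose (car G) (inc z) f *[HG (V z)] prj z" by simp
 qed
 moreover have "a \<otimes>[E] eps z = 0[E]" if a: "a : car E" "a *[HG (V z)] prj z = 0[HG (V z)]" for a
 proof -
  interpret VG: two_mods A "V z" G using V_left[OF z] G_left by simp
  have al: "a : lhom A G G" using a(1) by simp
  have "eps z (a u) = 0[G]" if u: "u : car G" for u
  proof -
   have au: "a u : car G" by (rule lhom_mem[OF al u])
   have "compose (car G) (prj z) a u = 0[V z]" using a(2) u by simp
   hence "a u z = 0[V z]" using u au by (simp add: compose_eq)
   thus ?thesis using VG.lhom_zero[OF inc_lhom[OF z]] au by (simp add: eps_def)
  qed
  thus ?thesis unfolding E_simps compose_def by (rule restrict_ext)
 qed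
 ultimately show ?thesis
  unfolding E.pgen_def using HG_left[OF V_left[OF z]] eps_lhom[OF z] eps_idem[OF z] p pe by simp
qed

end

sublocale base \<subseteq> V: summands K A "adr_index A n P" "adr_summand A P" by (rule V_summands)

context base
begin

lemma adr_eqs: "adr_alg A n P = V.E" "adr_proj A n P x = V.HG (VV x)" "adr_simple A n P = V.SE"
 by (simp_all add: adr_alg_def adr_gen_def adr_proj_def adr_simple_def V.SE_def fun_eq_iff)

text \<open>On modules this acts from level \<open>l\<close> to the higher level \<open>l'\<close>,
  opposite to the direction of the projection, because the algebra is the opposite of the
  endomorphism ring.\<close>

definition pp where "pp k l l' = V.hat (k, l') (k, l) (prmap k l l')"

text \<open>A vector of weight \<open>e_i\<close> is the image of the generator of
  \<open>P_i\<close>, and every homomorphic image of \<open>P_i\<close> has Loewy length at most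
  \<open>l_i\<close>.\<close>

lemma wt_soc_full:
 assumes i: "i : {1..n}" and M: "left_module A M" and m: "m : wt M (ei i) (car M)"
 shows "m : wt M (ei i) (soc_pow A M (lp i))"
proof -
 interpret Pi: lmod A "P i" by (rule P_lmod[OF i])
 have mc: "m : car M" "ei i *[M] m = m" using m by (simp_all add: wt_def)
 obtain g where g: "g : lhom A (P i) M" "g (pg i) = m" using pgen_hom[OF ei_facts(1)[OF i] M mc] .
 interpret PM: two_mods A "P i" M using M by (simp add: Pi.left)
 have "g ` rad_pow A (P i) (lp i) <= soc_pow A M 0" using W.loewy_zero[OF P_fd[OF i]] PM.lhom_zero[OF g(1)] by simp
 hence "g ` car (P i) <= soc_pow A M (lp i)" using W.rad_soc[OF P_fd[OF i] M g(1), of "lp i" 0] by simp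
 thus ?thesis using pg_facts(1)[OF i] g(2) mc(2) by (auto simp: wt_def)
qed

lemma top_index: "(i, l) : I ==> (i, lp i) : I" by (simp add: index_iff)

text \<open>For \<open>decomp\<close>: by \<open>hom_nonrad\<close> a map between summands is a
  scalar multiple of the canonical projection plus a map \<open>f0\<close> into the radical. The
  radical of \<open>P_k/Rad^l P_k\<close> lies in \<open>Soc_(l - 1)\<close>, so \<open>f0\<close>
  factors through the source cut down to level \<open>min t (l - 1)\<close>. For
  \<open>lift\<close>: the summand at \<open>(i, l_i)\<close> is isomorphic to \<open>P_i\<close>,
  so maps from it lift along the projections.\<close>

lemma V_adr: "adr K V.E I V.eps V.SE lp pp"
proof (intro adr.intro adr_axioms.intro V.E_walg)
 fix k l assume "(k, l) : I"
 thus "1 <= l & l <= lp k" by (simp add: index_iff)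
next
 fix k l l' assume "(k, l) : I" "1 <= l'" "l' <= lp k"
 thus "(k, l') : I" by (simp add: index_iff)
next
 fix k l l' assume w: "(k, l) : I" "(k, l') : I" "l <= l'"
 note h = V.hat_lhom[OF w(2,1) prmap_lhom[OF w]]
 show "pp k l l' : car V.E" using h by (simp add: pp_def)
 have "compose (car (VV (k, l'))) (prmap k l l') (\<lambda>v\<in>car (VV (k, l')). v) = prmap k l l'"
  by (rule extensionalityI[of _ "car (VV (k, l'))"]) (use lhom_ext[OF prmap_lhom[OF w]] in \<open>simp_all add: compose_eq\<close>)
 thus "V.eps (k, l') \<otimes>[V.E] pp k l l' = pp k l l'"
  unfolding pp_def V.eps_hat[OF w(2)] V.hat_mult[OF w(2,2) lhom_id[OF VV_left[OF w(2)]]] by simp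
next
 fix k l l' l'' assume w: "(k, l) : I" "(k, l') : I" "(k, l'') : I" "l <= l'" "l' <= l''"
 have le: "l <= l''" using w by simp
 note p = prmap_lhom[OF w(2,3,5)] and p' = prmap_lhom[OF w(1,2,4)]
 have "compose (car (VV (k, l''))) (prmap k l l') (prmap k l' l'') = prmap k l l''"
  by (rule Vhom_eqI[OF w(3) lhom_comp[OF p p' VV_left[OF w(3)]] prmap_lhom[OF w(1,3) le]])
   (simp add: compose_eq[OF vg_closed[OF w(3)]] prmap_vg[OF w(2,3,5)] prmap_vg[OF w(1,2,4)] prmap_vg[OF w(1,3) le])
 thus "pp k l' l'' \<otimes>[V.E] pp k l l' = pp k l l''" unfolding pp_def V.hat_mult[OF w(3,2) p] by simp
next
 fix k l assume w: "(k, l) : I"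
 have "prmap k l l = (\<lambda>v\<in>car (VV (k, l)). v)"
  by (rule Vhom_eqI[OF w prmap_lhom[OF w w order_refl] lhom_id[OF VV_left[OF w]]]) (simp add: prmap_vg[OF w w] vg_closed[OF w])
 thus "pp k l l = V.eps (k, l)" unfolding pp_def V.eps_hat[OF w] by simp
next
 fix s t k l r assume w: "(s, t) : I" and x: "(k, l) : I" and r: "r : car V.E"
 let ?V = "VV (s, t)" and ?X = "VV (k, l)"
 interpret X: lmod A ?X by (rule VV_lmod[OF x])
 obtain f where f: "f : lhom A ?V ?X" "V.eps (s, t) \<otimes>[V.E] (r \<otimes>[V.E] V.eps (k, l)) = V.hat (s, t) (k, l) f"
  using V.sandwich[OF w x, of r] r by simp
 have fv: "f (vg (s, t)) : car ?X" by (rule lhom_mem[OF f(1) vg_closed[OF w]])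
 interpret VX: lmod K "homk A ?V ?X" using homk_left[OF VV_left[OF w] VV_left[OF x]] by simp
 \<comment> \<open>The canonical projection where there is one and zero otherwise, so that both
   cases of \<open>decomp\<close> are treated together.\<close>
 define q where "q = (if s = k & l <= t then prmap k l t else (\<lambda>v\<in>car ?V. 0[?X]))"
 have q: "q : lhom A ?V ?X" using prmap_lhom[OF x _, of t] w VX.M.zero_closed by (auto simp: q_def)
 have "EX c:car K. f (vg (s, t)) -[?X] sc c *[?X] q (vg (s, t)) : VR (k, l)"
 proof (cases "f (vg (s, t)) : VR (k, l)")
  case True
  show ?thesis using True fv lhom_mem[OF q vg_closed[OF w]] by (intro bexI[of _ "0[K]"]) simp_all
 next
  case False
  note h = hom_nonrad[OF w x f(1) False]
  have "q (vg (s, t)) = vg (k, l)" using h(1,2) prmap_vg[OF x _ h(2)] w by (simp add: q_def)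
  thus ?thesis using h(3) by simp
 qed
 then obtain c where c: "c : car K" "f (vg (s, t)) -[?X] sc c *[?X] q (vg (s, t)) : VR (k, l)" by blast
 have scc: "sc c : car A" using c(1) by simp
 define f1 where "f1 = (\<lambda>v\<in>car ?V. sc c *[?X] q v)"
 have f1: "f1 : lhom A ?V ?X" using VX.smult_closed[OF c(1), of q] q by (simp add: f1_def)
 define f0 where "f0 = f -[homk A ?V ?X] f1"
 have f0: "f0 : lhom A ?V ?X" using VX.M.minus_closed[of f f1] f(1) f1 by (simp add: f0_def)
 have "f0 +[homk A ?V ?X] f1 = f" using VX.diff_add_cancel[of f f1] f(1) f1 by (simp only: f0_def homk_simps)
 hence fe: "f = (\<lambda>v\<in>car ?V. f0 v +[?X] f1 v)" by simp
 have "f (vg (s, t)) = f0 (vg (s, t)) +[?X] f1 (vg (s, t))" by (subst fe) (simp add: vg_closed[OF w])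
 hence f0v: "f0 (vg (s, t)) : VR (k, l)"
  using c(2) X.add_diff_cancel[of "f0 (vg (s, t))" "f1 (vg (s, t))"] lhom_mem[OF f0 vg_closed[OF w]] lhom_mem[OF f1 vg_closed[OF w]] vg_closed[OF w]
  by (simp add: f1_def)
 interpret E: fdalg K V.E by (rule V.E_fdalg)
 have h1: "V.hat (s, t) (k, l) f1 = (if s = k & l <= t then (c *[V.E] 1[V.E]) \<otimes>[V.E] pp k l t else 0[V.E])"
 proof (cases "s = k & l <= t")
  case True
  thus ?thesis using V.hat_sc[OF x w q c(1)] by (simp only: f1_def pp_def q_def if_True simp_thms)
 next
  case False
  have "V.hat (s, t) (k, l) f1 = 0[V.E]" by (rule V.hat_zero[OF x w]) (use scc in \<open>simp add: f1_def q_def if_not_P[OF False]\<close>)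
  thus ?thesis unfolding if_not_P[OF False] .
 qed
 have b: "V.hat (s, t) (k, l) f0 : car V.E" using V.hat_lhom[OF w x f0] by simp
 have main: "V.eps (s, t) \<otimes>[V.E] (r \<otimes>[V.E] V.eps (k, l)) =
  (if s = k & l <= t then (c *[V.E] 1[V.E]) \<otimes>[V.E] pp k l t else 0[V.E]) +[V.E] V.hat (s, t) (k, l) f0"
 proof -
  have fe': "f = (\<lambda>v\<in>car ?V. f1 v +[?X] f0 v)"
   by (subst fe) (rule restrict_ext, rule X.M.a_comm[OF lhom_mem[OF f0] lhom_mem[OF f1]])
  have "V.hat (s, t) (k, l) f = V.hat (s, t) (k, l) f1 +[V.E] V.hat (s, t) (k, l) f0" by (subst fe') (rule V.hat_add[OF x w f1 f0])
  thus ?thesis unfolding f(2) h1 .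
 qed
 have "V.hat (s, t) (k, l) f0 = 0[V.E] | (EX t' a'. t' < l & t' <= t & (s, t') : I & a' : car V.E &
  V.hat (s, t) (k, l) f0 = pp s t' t \<otimes>[V.E] (V.eps (s, t') \<otimes>[V.E] (a' \<otimes>[V.E] V.eps (k, l))))"
 proof (cases "l = 1")
  case True
  have "f0 (vg (s, t)) : soc_pow A ?X 0" using f0v VR_soc[OF x] True by auto
  hence "f0 (vg (s, t)) = 0[?X]" by simp
  hence f00: "f0 = (\<lambda>v\<in>car ?V. 0[?X])"
   using VX.M.zero_closed by (intro Vhom_eqI[OF w f0]) (simp_all add: vg_closed[OF w])
  have "V.hat (s, t) (k, l) f0 = 0[V.E]" by (rule V.hat_zero[OF x w]) (simp add: f00)
  thus ?thesis by simp
 next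
  case False
  define t' where "t' = min t (l - 1)"
  have t': "t' < l" "t' <= t" "(s, t') : I" using False w x by (auto simp: t'_def index_iff)
  have "f0 (vg (s, t)) : soc_pow A ?X t'"
  proof (cases "t <= l - 1")
   case True thus ?thesis using Vhom_val[OF w VV_left[OF x] f0] by (simp add: t'_def min_absorb1 wt_def)
  next
   case False thus ?thesis using f0v VR_soc[OF x] by (auto simp: t'_def)
  qed
  then obtain f' where f': "f' : lhom A (VV (s, t')) ?X" "f0 = compose (car ?V) f' (prmap s t' t)"
   using Vhom_factor[OF w t'(3,2) VV_left[OF x] f0] by blast
  have "V.hat (s, t) (k, l) f0 = pp s t' t \<otimes>[V.E] (V.eps (s, t') \<otimes>[V.E] (V.hat (s, t') (k, l) f' \<otimes>[V.E] V.eps (k, l)))"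
   unfolding V.hat_eps[OF t'(3) x f'(1)] pp_def V.hat_mult[OF w t'(3) prmap_lhom[OF t'(3) w t'(2)]] f'(2) ..
  moreover have "V.hat (s, t') (k, l) f' : car V.E" using V.hat_lhom[OF t'(3) x f'(1)] by simp
  ultimately show ?thesis using t' by blast
 qed
 thus "EX c:car K. EX b:car V.E.
   V.eps (s, t) \<otimes>[V.E] (r \<otimes>[V.E] V.eps (k, l)) = (if s = k & l <= t then (c *[V.E] 1[V.E]) \<otimes>[V.E] pp k l t else 0[V.E]) +[V.E] b &
   (b = 0[V.E] | (EX t' a'. t' < l & t' <= t & (s, t') : I & a' : car V.E &
    b = pp s t' t \<otimes>[V.E] (V.eps (s, t') \<otimes>[V.E] (a' \<otimes>[V.E] V.eps (k, l)))))"
  using main by (intro bexI[OF _ c(1)] bexI[OF _ b] conjI)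
next
 fix i k l r assume i: "(i, lp i) : I" and w: "(k, l) : I" "(k, Suc l) : I" and r: "r : car V.E"
 have ii: "i : {1..n}" using i by (simp add: index_iff)
 let ?X = "VV (k, l)" and ?Y = "VV (k, Suc l)"
 obtain f where f: "f : lhom A (VV (i, lp i)) ?X" "V.eps (i, lp i) \<otimes>[V.E] (r \<otimes>[V.E] V.eps (k, l)) = V.hat (i, lp i) (k, l) f"
  using V.sandwich[OF i w(1), of r] r by simp
 have sl: "l <= Suc l" by simp
 note p = prmap_lhom[OF w sl]
 interpret Y: lmod A ?Y by (rule VV_lmod[OF w(2)])
 have fv: "f (vg (i, lp i)) : car ?X" "ei i *[?X] f (vg (i, lp i)) = f (vg (i, lp i))"
  using Vhom_val[OF i VV_left[OF w(1)] f(1)] lhom_mem[OF f(1) vg_closed[OF i]] by (simp_all add: wt_def)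
 have "f (vg (i, lp i)) : prmap k l (Suc l) ` car ?Y" unfolding prmap_surj[OF w sl] by (rule fv(1))
 then obtain u where u': "f (vg (i, lp i)) = prmap k l (Suc l) u" "u : car ?Y" by (rule imageE)
 note u = u'(1)[symmetric] u'(2)
 let ?u = "ei i *[?Y] u"
 have "?u : wt ?Y (ei i) (car ?Y)"
  using u(2) ii Y.smult_assoc1[of "ei i" "ei i" u] by (simp add: wt_def)
 note m = wt_soc_full[OF ii VV_left[OF w(2)] this]
 obtain f' where f': "f' : lhom A (VV (i, lp i)) ?Y" "f' (vg (i, lp i)) = ?u" by (rule Vhom_ex[OF i VV_left[OF w(2)] m])
 have "f = compose (car (VV (i, lp i))) (prmap k l (Suc l)) f'"
  by (rule Vhom_eqI[OF i f(1) lhom_comp[OF f'(1) p VV_left[OF i]]])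
   (simp add: compose_eq[OF vg_closed[OF i]] f'(2) lhom_smult[OF p W.e_closed[OF ii] u(2)] u(1) fv(2))
 hence "V.hat (i, lp i) (k, l) f = V.hat (i, lp i) (k, Suc l) f' \<otimes>[V.E] pp k l (Suc l)"
  unfolding pp_def V.hat_mult[OF i w(2) f'(1)] by simp
 thus "EX b:car V.E. V.eps (i, lp i) \<otimes>[V.E] (r \<otimes>[V.E] V.eps (k, l)) = b \<otimes>[V.E] pp k l (Suc l)"
  unfolding f(2) using V.hat_lhom[OF i w(2) f'(1)] by (intro bexI[of _ "V.hat (i, lp i) (k, Suc l) f'"]) simp_all
qed

end

sublocale base \<subseteq> R: adr K "summands.E A (adr_index A n P) (adr_summand A P)" "adr_index A n P"
 "summands.eps (adr_index A n P) (adr_summand A P)" "summands.SE A (adr_index A n P) (adr_summand A P)" lp pp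
 by (rule V_adr)

context base
begin

text \<open>On \<open>Hom(G, V)\<close> the structure maps act by composition with the canonical
  projections, which are onto.\<close>

lemma proj_rel_inj:
 assumes z: "(s, t) : I" shows "R.rel_inj (V.HG (VV (s, t))) {0[V.HG (VV (s, t))]} (car (V.HG (VV (s, t))))"
proof (rule R.rel_injI)
 fix k l f assume w: "(k, l) : I" "(k, Suc l) : I" and f: "f : wt (V.HG (VV (s, t))) (V.eps (k, l)) (car (V.HG (VV (s, t))))"
  and p: "pp k l (Suc l) *[V.HG (VV (s, t))] f : {0[V.HG (VV (s, t))]}"
 obtain h where h: "h : lhom A (VV (k, l)) (VV (s, t))" "f = compose (car V.G) h (V.prj (k, l))" by (rule V.HG_wt[OF w(1) f])
 have sl: "l <= Suc l" by simp
 have fl: "f : lhom A V.G (VV (s, t))" using f by (simp add: wt_def)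
 have h0: "h v = 0[VV (s, t)]" if v: "v : car (VV (k, l))" for v
 proof -
  have "v : prmap k l (Suc l) ` car (VV (k, Suc l))" unfolding prmap_surj[OF w sl] by (rule v)
  then obtain u where u: "v = prmap k l (Suc l) u" "u : car (VV (k, Suc l))" by (rule imageE)
  let ?u = "V.inc (k, Suc l) u"
  have uc: "?u : car V.G" by (rule V.inc_closed[OF w(2) u(2)])
  have "compose (car V.G) f (pp k l (Suc l)) ?u = 0[VV (s, t)]" using p uc by simp
  moreover have "pp k l (Suc l) ?u = V.inc (k, l) v" using uc u w(2) by (simp add: pp_def V.hat_def)
  ultimately have "f (V.inc (k, l) v) = 0[VV (s, t)]" using uc by (simp add: compose_eq)
  thus ?thesis using h(2) V.inc_closed[OF w(1) v] v w(1) by (simp add: compose_eq)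
 qed
 have "f = (\<lambda>u\<in>car V.G. 0[VV (s, t)])"
  unfolding h(2) compose_def by (rule restrict_ext) (simp add: h0 V.G_mem[OF _ w(1)])
 thus "f : {0[V.HG (VV (s, t))]}" by simp
qed

text \<open>The witness \<open>U'\<close> consists of the maps into the radical: maps from levels
  below \<open>l\<close> are never onto, whereas the canonical projection from the top level
  is.\<close>

lemma standard_ok:
 assumes x: "x : I" shows "R.std_like (adr_standard A n P x) x"
proof -
 obtain k l where kl: "x = (k, l)" by (cases x)
 have w: "(k, l) : I" using x kl by simp
 note wt' = top_index[OF w]
 have ll: "l <= lp k" using w by (simp add: index_iff)
 let ?X = "VV (k, l)" let ?M = "V.HG ?X"
 interpret X: lmod A ?X by (rule VV_lmod[OF w])
 have fM: "fd K V.E ?M" by (rule V.HG_fd[OF VV_fd[OF w]])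
 interpret M: lmod V.E ?M by (rule R.fd_lmod[OF fM])
 note pg = V.HG_prj[OF w, unfolded R.pgen_def]
 note R' = subD[OF VR_submodule[OF w]]
 define U where "U = {f : lhom A V.G ?X. ALL u:car V.G. f u : VR (k, l)}"
 have U: "submodule U V.E ?M"
 proof (rule M.submoduleI)
  show "U <= car ?M" by (auto simp: U_def)
  have "0[?M] : car ?M" by (rule M.M.zero_closed)
  thus "0[?M] : U" using R'(2) by (simp add: U_def)
 next
  fix f g assume "f : U" "g : U"
  thus "f +[?M] g : U" using M.M.a_closed[of f g] R'(4) by (simp add: U_def)
 next
  fix r f assume r: "r : car V.E" and f: "f : U"
  hence "r *[?M] f : car ?M" by (intro M.smult_closed) (simp_all add: U_def)
  moreover have "f (r u) : VR (k, l)" if "u : car V.G" for u using f lhom_mem[of r A V.G V.G u] r that by (simp add: U_def)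
  ultimately show "r *[?M] f : U" by (simp add: U_def compose_eq)
 qed
 have "pp k l (lp k) *[?M] V.prj (k, l) ~: U"
 proof
  let ?u = "V.inc (k, lp k) (vg (k, lp k))"
  have uc: "?u : car V.G" by (rule V.inc_closed[OF wt' vg_closed[OF wt']])
  assume "pp k l (lp k) *[?M] V.prj (k, l) : U"
  hence "compose (car V.G) (V.prj (k, l)) (pp k l (lp k)) ?u : VR (k, l)" using uc by (simp add: U_def)
  moreover have "pp k l (lp k) ?u = V.inc (k, l) (vg (k, l))"
   using uc vg_closed[OF wt'] wt' prmap_vg[OF w wt' ll] by (simp add: pp_def V.hat_def)
  ultimately have "vg (k, l) : VR (k, l)" using uc V.inc_closed[OF w vg_closed[OF w]] vg_closed[OF w] w by (simp add: compose_eq)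
  thus False using vg_not_VR[OF w] by simp
 qed
 moreover have "wt ?M (V.eps (s, t)) (car ?M) <= U" if st: "(s, t) : I" "t < l" for s t
 proof
  fix f assume f: "f : wt ?M (V.eps (s, t)) (car ?M)"
  obtain h where h: "h : lhom A (VV (s, t)) ?X" "f = compose (car V.G) h (V.prj (s, t))" by (rule V.HG_wt[OF st(1) f])
  have hv: "h (vg (s, t)) : VR (k, l)" using hom_nonrad(2)[OF st(1) w h(1)] st(2) by (rule_tac ccontr) simp
  have "h v : VR (k, l)" if v: "v : car (VV (s, t))" for v
  proof -
   obtain a where a: "a : car A" "v = a *[VV (s, t)] vg (s, t)" using vg_gen[OF st(1) v] by blast
   show ?thesis unfolding a(2) lhom_smult[OF h(1) a(1) vg_closed[OF st(1)]] by (rule R'(5)[OF a(1) hv])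
  qed
  thus "f : U" using f V.G_mem[OF _ st(1)] by (simp add: U_def h(2) wt_def compose_eq)
 qed
 moreover have "V.prj (k, l) : wt ?M (V.eps (k, l)) (car ?M)" using pg by (simp add: wt_def)
 moreover have "car ?M <= M.cyc (V.prj (k, l))" using pg unfolding M.cyc_def by blast
 ultimately have "R.std_like (standard V.E I adr_le V.SE (%x. V.HG (VV x)) (k, l)) (k, l)"
  using fM U by (intro R.standard_std_like[where P = "%x. V.HG (VV x)" and U' = U and m = "V.prj (k, l)"] w) blast+
 thus ?thesis by (simp add: adr_standard_def adr_eqs kl standard_def)
qed

text \<open>The dimension of \<open>Hom(VV (i, j), VV z)\<close>, read once over the ADR algebra and
  once over \<open>A\<close>.\<close>

lemma VP_wd: "[|(i, j) : I; z : I|] ==> R.wd (i, j) (V.HG (VV z)) (car (V.HG (VV z))) = W.wd i (VV z) (soc_pow A (VV z) j)"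
 using V.wt_hom_dim[OF _ V.V_fd, of "(i, j)" z] Vhom_dim[OF _ V.V_fd, of i j z] by simp

lemma wd_soc_0: "left_module A M ==> i : {1..n} ==> fd K A M ==> W.wd i M {0[M]} = 0"
proof -
 assume a: "left_module A M" "i : {1..n}" "fd K A M"
 interpret M: lmod A M using a(1) by simp
 have "wt M (ei i) {0[M]} = {0[M]}" using a(2) by (auto simp: wt_def)
 thus "W.wd i M {0[M]} = 0" using W.wt_eq_zero_iff[OF a(3) M.sub_zero a(2)] by simp
qed

lemma V_wd:
 assumes x: "(k, l) : I" and i: "i : {1..n}"
 shows "W.wd i (VV (k, l)) (car (VV (k, l))) + W.wd i (P k) (rad_pow A (P k) l) = W.wd i (P k) (car (P k))"
proof -
 have k: "k : {1..n}" using x by (simp add: index_iff)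
 interpret Pk: lmod A "P k" by (rule P_lmod[OF k])
 have "{y : car (P k). vq (k, l) y = 0[VV (k, l)]} = rad_pow A (P k) l"
  using vq_zero[OF x] Pk.sub_mem[OF W.rad_sub[OF P_left[OF k]]] by blast
 thus ?thesis
  using wdim_additive[OF P_fd[OF k] VV_left[OF x] vq_lhom[OF x] Pk.sub_carrier W.e_closed[OF i] W.e_idem[OF i]] vq_surj[OF x] by simp
qed

text \<open>\<open>P_k/Rad^(l_k) P_k\<close> is isomorphic to \<open>P_k\<close>, and the socle
  weights are compared as dimensions of Hom spaces from \<open>P_i/Rad^j P_i\<close>.\<close>

lemma V_top_soc:
 assumes k: "k : {1..n}" and i: "i : {1..n}" and j: "j < lp i"
 shows "W.wd i (VV (k, lp k)) (soc_pow A (VV (k, lp k)) j) = W.wd i (P k) (soc_pow A (P k) j)"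
proof -
 have x: "(k, lp k) : I" using k lp_pos[OF k] by (simp add: index_iff)
 show ?thesis
 proof (cases "j = 0")
  case True
  show ?thesis unfolding True soc_pow.simps(1) wd_soc_0[OF VV_left[OF x] i VV_fd[OF x]] wd_soc_0[OF P_left[OF k] i P_fd[OF k]] ..
 next
  case False
  hence ij: "(i, j) : I" using i j by (simp add: index_iff)
  interpret PV: two_mods A "P k" "VV (k, lp k)" using P_left[OF k] VV_left[OF x] by simp
  have "inj_on (vq (k, lp k)) (car (P k))"
   unfolding PV.lhom_inj_iff[OF vq_lhom[OF x]] using vq_zero[OF x] W.loewy_zero[OF P_fd[OF k]] by simp
  hence b: "bij_betw (vq (k, lp k)) (car (P k)) (car (VV (k, lp k)))" using vq_surj[OF x] by (simp add: bij_betw_def)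
  show ?thesis
   using homk_target_iso[OF VV_fd[OF ij] P_fd[OF k] VV_fd[OF x] vq_lhom[OF x] b] Vhom_dim[OF ij P_fd[OF k]] Vhom_dim[OF ij VV_fd[OF x]] by simp
 qed
qed

end

section \<open>Multiplicities in the projective modules of the Ringel dual\<close>

locale base_tilt = base K A n L P Q
 for K :: "('k, 'e) ring_scheme" (structure) and A :: "('k, 'a) module" (structure) and n
  and L :: "nat => ('a, 'l) module" and P :: "nat => ('a, 'p) module" and Q :: "nat => ('a, 'q) module" +
 fixes H :: "nat \<times> nat => ('p adr_carrier => 'p adr_carrier, 'h) module"
  and T :: "nat \<times> nat => ('p adr_carrier => 'p adr_carrier, 't) module"
 assumes adr_hulls: "x : adr_index A n P ==> injective_hull (adr_alg A n P) (H x) (adr_simple A n P x)"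
  and tilting: "x : adr_index A n P ==> is_tilting (adr_alg A n P) (adr_index A n P) adr_le
    (adr_standard A n P) (adr_costandard A n P H) x (T x)"
begin

lemma adr_costandard_nab: "y : I ==> adr_costandard A n P H y = R.nab (H y) y"
 unfolding adr_costandard_def adr_eqs
 by (rule R.costandard_nab) (use adr_hulls in \<open>simp add: injective_hull_def injective_def adr_eqs R.fg_imp_fd\<close>)

lemma filtered_by_cong: "(!!j. j : I ==> D j = D' j) ==> filtered_by R D I M = filtered_by R D' I M"
 unfolding filtered_by_def by (metis (no_types, lifting))

text \<open>Replaces the notions of the statement by the models: standard modules through
  \<open>standard_ok\<close>, costandard modules through \<open>adr_costandard_nab\<close>.\<close>

lemma tilt_ok: "adr_tilt K V.E I V.eps V.SE lp pp H (adr_standard A n P) T"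
proof (intro adr_tilt.intro adr_tilt_axioms.intro V_adr)
 fix x assume x: "x : I"
 show "injective_hull V.E (H x) (V.SE x)" using adr_hulls[OF x] by (simp add: adr_eqs)
 show "R.std_like (adr_standard A n P x) x" by (rule standard_ok[OF x])
 have "filtered_by V.E (adr_costandard A n P H) I (T x) = filtered_by V.E (%y. R.nab (H y) y) I (T x)"
  by (rule filtered_by_cong) (rule adr_costandard_nab)
 thus "is_tilting V.E I adr_le (adr_standard A n P) (%y. R.nab (H y) y) x (T x)"
  using tilting[OF x] unfolding is_tilting_def adr_eqs by simp
qed

end

sublocale base_tilt \<subseteq> X: adr_tilt K "summands.E A (adr_index A n P) (adr_summand A P)" "adr_index A n P"
 "summands.eps (adr_index A n P) (adr_summand A P)" "summands.SE A (adr_index A n P) (adr_summand A P)" lp pp H "adr_standard A n P" T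
 by (rule tilt_ok)

context base_tilt
begin

text \<open>Maps from the projective module at \<open>z\<close> count the weight \<open>z\<close> of
  \<open>T (i, j)\<close>. As this projective module has injective structure maps,
  \<open>T_hom_dim\<close> counts them as well.\<close>

lemma T_wd:
 assumes z: "z : I" and x: "(i, j) : I"
 shows "R.wd z (T (i, j)) (car (T (i, j))) + W.wd i (VV z) (soc_pow A (VV z) (j - 1)) = W.wd i (VV z) (car (VV z))"
proof -
 have i: "i : {1..n}" using x by (simp add: index_iff)
 note xt = top_index[OF x] and fV = V.V_fd[OF z]
 have 1: "len K (homk V.E (V.HG (VV z)) (T (i, j))) = R.wd z (T (i, j)) (car (T (i, j)))"
  by (rule R.pgen_dim[OF V.HG_prj[OF z] X.T_fd[OF x]])
 have r: "R.rel_inj (V.HG (VV z)) {0[V.HG (VV z)]} (car (V.HG (VV z)))" using proj_rel_inj[of "fst z" "snd z"] z by (simp only: prod.collapse)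
 have "wt (VV z) (ei i) (soc_pow A (VV z) (lp i)) = wt (VV z) (ei i) (car (VV z))"
  by (rule equalityI[OF wt_mono[OF subD(1)[OF W.soc_sub[OF V.V_left[OF z]]]] subsetI])
   (rule wt_soc_full[OF i V.V_left[OF z]])
 hence 2: "R.wd (i, lp i) (V.HG (VV z)) (car (V.HG (VV z))) = W.wd i (VV z) (car (VV z))" using VP_wd[OF xt z] by simp
 have 3: "(if (i, j - 1) : I then R.wd (i, j - 1) (V.HG (VV z)) (car (V.HG (VV z))) else 0) = W.wd i (VV z) (soc_pow A (VV z) (j - 1))"
 proof (cases "(i, j - 1) : I")
  case True thus ?thesis using VP_wd[OF True z] by simp
 next
  case False
  hence "j - 1 = 0" using x by (auto simp: index_iff)
  thus ?thesis using False wd_soc_0[OF V.V_left[OF z] i fV] by (simp only: soc_pow.simps(1) if_False)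
 qed
 show ?thesis using X.T_hom_dim[OF x V.HG_fd[OF fV] r] unfolding 1 2 3 .
qed

abbreviation rmult where "rmult k l i j \<equiv> multiplicity_of (ringel_dual (adr_alg A n P) I T)
 (ringel_proj (adr_alg A n P) I T (k, l)) (ringel_simple (adr_alg A n P) I T (i, j))"

text \<open>The case \<open>j = 1\<close> of the left side of (B2). Here \<open>T (i, 1)\<close> is
  the whole hull \<open>H (i, l_i)\<close> up to isomorphism, with \<open>[V_z : L_i]\<close> as its
  weight at \<open>z\<close>.\<close>

lemma rmult_1:
 assumes k: "k : {1..n}" and i: "i : {1..n}" and l: "1 <= l" "l <= lp k"
 shows "rmult k l i 1 = W.wd i (P k) (rad_pow A (P k) (l - 1))"
proof -
 have x: "(k, l) : I" and y: "(i, 1) : I" using k i l lp_pos[OF i] by (simp_all add: index_iff)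
 have t: "R.wd z (T (i, 1)) (car (T (i, 1))) = W.wd i (VV z) (car (VV z))" if "z : I" for z
 proof -
  have "W.wd i (VV z) (soc_pow A (VV z) (1 - 1)) = 0" using wd_soc_0[OF V.V_left[OF that] i V.V_fd[OF that]] by simp
  thus ?thesis using T_wd[OF that y] by simp
 qed
 have top: "W.wd i (VV (k, lp k)) (car (VV (k, lp k))) = W.wd i (P k) (car (P k))"
  using V_wd[OF top_index[OF x] i] wd_soc_0[OF P_left[OF k] i P_fd[OF k]] W.loewy_zero[OF P_fd[OF k]] by simp
 have m: "rmult k l i 1 + (if (k, l - 1) : I then R.wd (k, l - 1) (T (i, 1)) (car (T (i, 1))) else 0) = W.wd i (P k) (car (P k))"
  using X.ringel_multiplicity[OF V.finite_index x y] t[OF top_index[OF x]] top by (simp only: adr_eqs)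
 show ?thesis
 proof (cases "(k, l - 1) : I")
  case True
  thus ?thesis using m t[OF True] V_wd[OF True i] by simp
 next
  case False
  hence "l = 1" using x by (auto simp: index_iff)
  thus ?thesis using m False by simp
 qed
qed

text \<open>The case \<open>l = 1\<close> of the left side of (B2): nothing is subtracted in
  \<open>ringel_multiplicity\<close>, and \<open>P_k\<close> enters as
  \<open>P_k/Rad^(l_k) P_k\<close>.\<close>

lemma rmult_2:
 assumes k: "k : {1..n}" and i: "i : {1..n}" and j: "1 <= j" "j <= lp i"
 shows "rmult k 1 i j + W.wd i (P k) (soc_pow A (P k) (j - 1)) = W.wd i (P k) (car (P k))"
proof -
 have x: "(k, 1) : I" and y: "(i, j) : I" using k i j lp_pos[OF k] by (simp_all add: index_iff)
 have "(k, 1 - 1) ~: I" by (simp add: index_iff)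
 hence m: "rmult k 1 i j = R.wd (k, lp k) (T (i, j)) (car (T (i, j)))"
  using X.ringel_multiplicity[OF V.finite_index x y] by (simp add: adr_eqs)
 have top: "W.wd i (VV (k, lp k)) (car (VV (k, lp k))) = W.wd i (P k) (car (P k))"
  using V_wd[OF top_index[OF x] i] wd_soc_0[OF P_left[OF k] i P_fd[OF k]] W.loewy_zero[OF P_fd[OF k]] by simp
 show ?thesis using T_wd[OF top_index[OF x] y] V_top_soc[OF k i, of "j - 1"] j unfolding m top by simp
qed

end

section \<open>Two-sided ideals, a criterion for rigidity, radical powers under
  homomorphisms\<close>

context fdalg
begin

lemma ideal_if:
 assumes I: "submodule I A (reg A)" and r: "!!a x. [|x : I; a : car A|] ==> x \<otimes>[A] a : I"
 shows "ideal I A"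
proof (rule idealI[OF A.ring_axioms])
 interpret M: lmod A "reg A" using reg_left by simp
 note i = subD[OF I]
 have neg: "-[A] x : I" if x: "x : I" for x
 proof -
  have xc: "x : car A" using i(1) x by auto
  have "-[A] x = (-[A] 1[A]) \<otimes>[A] x" using xc by (simp add: A.l_minus)
  thus ?thesis using i(5)[of "-[A] 1[A]" x] x by simp
 qed
 show "subgroup I (add_monoid A)"
  by (rule subgroup.intro) (use i(1,2,4) neg in \<open>auto simp: a_inv_def[symmetric]\<close>)
 show "a \<otimes>[A] x : I" if "x : I" "a : car A" for a x using i(5)[OF that(2,1)] by simp
qed (rule r)

end

context walg
begin

lemma rad_le_soc:
 assumes M: "fd K A M" and j: "j <= loewy_length A M"
 shows "rad_pow A M j <= soc_pow A M (loewy_length A M - j)"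
proof -
 have id: "(\<lambda>x\<in>car M. x) : lhom A M M" by (rule lhom_id[OF fd_left[OF M]])
 have im: "(\<lambda>x\<in>car M. x) ` U = U" if "U <= car M" for U using that by (auto simp: image_iff subset_eq)
 have "soc_pow A M (loewy_length A M) = car M" using soc_pow_full_iff[OF M] by simp
 hence "(\<lambda>x\<in>car M. x) ` rad_pow A M j <= soc_pow A M (loewy_length A M - j)"
  using rad_soc[OF M fd_left[OF M] id, of j "loewy_length A M - j"] j im[of "car M"] by simp
 thus ?thesis unfolding im[OF subD(1)[OF rad_sub[OF fd_left[OF M]]]] .
qed

lemma rigid_if:
 assumes M: "fd K A M" and wd: "!!i j. [|i : I; j < loewy_length A M|] ==> wd i M (soc_pow A M j) = wd i M (rad_pow A M (loewy_length A M - j))"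
 shows "rigid A M"
 unfolding rigid_def
proof (intro allI impI)
 fix j assume j: "j <= loewy_length A M"
 show "rad_pow A M j = soc_pow A M (loewy_length A M - j)"
 proof (cases "j = 0")
  case True
  thus ?thesis using soc_pow_full_iff[OF M, of "loewy_length A M"] by simp
 next
  case False
  note Ml = fd_left[OF M]
  show ?thesis
  proof (rule wd_determines[OF M rad_sub[OF Ml] soc_sub[OF Ml] rad_le_soc[OF M j]])
   fix i assume "i : I"
   thus "wd i M (soc_pow A M (loewy_length A M - j)) <= wd i M (rad_pow A M j)"
    using wd[of i "loewy_length A M - j"] j False by simp
  qed
 qed
qed

lemma rad_pow_hom:
 assumes M: "fd K A M" and N: "fd K A N" and f: "f : lhom A M N" and s: "f ` car M <= rad_pow A N s"
 shows "f ` rad_pow A M j <= rad_pow A N (j + s)"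
proof (induction j)
 case 0 thus ?case using s by simp
next
 case (Suc j)
 interpret MN: two_mods A M N using M N by (simp add: fd_def)
 note rN = rad_sub[OF MN.N.left, of "Suc (j + s)"] and rM = rad_sub[OF MN.M.left, of j]
 have "rad_pow A M (Suc j) <= {x : car M. f x : rad_pow A N (Suc (j + s))}"
  unfolding rad_pow_Suc_le_iff[OF M MN.lhom_preimage[OF f rN]]
 proof (intro ballI)
  fix a x assume a: "a : J" and x: "x : rad_pow A M j"
  have xc: "x : car M" by (rule MN.M.sub_mem[OF rM x])
  have "f x : rad_pow A N (j + s)" using Suc.IH x by blast
  hence "f (a *[M] x) : rad_pow A N (Suc (j + s))" using rad_pow_Suc_mem[OF N a] lhom_smult[OF f J_carrier[OF a] xc] by simp
  thus "a *[M] x : {x : car M. f x : rad_pow A N (Suc (j + s))}" using xc J_carrier[OF a] by simp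
 qed
 thus ?case by auto
qed

lemma J_left: "[|a : car A; b : J|] ==> a \<otimes>[A] b : J" and J_right: "[|a : J; b : car A|] ==> a \<otimes>[A] b : J"
proof -
 have *: "a \<otimes>[A] b : J" if ab: "a : car A" "b : car A" "a : J | b : J" for a b
 proof -
  have "(a \<otimes>[A] b) *[S i] v = 0[S i]" if i: "i : I" and v: "v : car (S i)" for i v
  proof -
   interpret Si: lmod A "S i" using S_simple[OF i] by (simp add: simple_mod_def)
   note k = J_kills[OF S_simple[OF i]]
   show ?thesis using ab(3) Si.smult_assoc1[OF ab(1,2) v] k[of b v] k[of a "b *[S i] v"] ab(1,2) v by auto
  qed
  thus ?thesis using ab(1,2) by (simp add: J_def)
 qed
 show "[|a : car A; b : J|] ==> a \<otimes>[A] b : J" "[|a : J; b : car A|] ==> a \<otimes>[A] b : J"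
  using *[of a b] J_carrier by blast+
qed

end

section \<open>Consequences of (B1) and (B2)\<close>

locale base_B = base_tilt K A n L P Q H T
 for K :: "('k, 'e) ring_scheme" (structure) and A :: "('k, 'a) module" (structure) and n
  and L :: "nat => ('a, 'l) module" and P :: "nat => ('a, 'p) module" and Q :: "nat => ('a, 'q) module"
  and H :: "nat \<times> nat => ('p adr_carrier => 'p adr_carrier, 'h) module"
  and T :: "nat \<times> nat => ('p adr_carrier => 'p adr_carrier, 't) module" +
 assumes B1: "i : {1..n} ==> lp i = lq i"
  and B2: "[|i : {1..n}; k : {1..n}; j : {1..lp i}; l : {1..lp k}|] ==> rmult k l i j =
   multiplicity_of (s_alg A n Q) (s_proj A n Q (k, lp k - l + 1)) (s_simple A n Q (i, lp i - j + 1))"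
begin

abbreviation a where "a i k s \<equiv> W.wd i (P k) (rad_pow A (P k) s)"
abbreviation b where "b i k s \<equiv> W.wd i (P k) (soc_pow A (P k) s)"
abbreviation q where "q i k s \<equiv> W.wd k (Q i) (rad_pow A (Q i) s)"
abbreviation c where "c i k s \<equiv> W.wd k (Q i) (soc_pow A (Q i) s)"
abbreviation d where "d i k \<equiv> W.wd i (P k) (car (P k))"

text \<open>By \<open>multiplicity_hom\<close> the right side of (B2) is the dimension of a Hom
  space between socle terms of injective modules.\<close>

lemma B2_hom:
 assumes i: "i : {1..n}" and k: "k : {1..n}" and j: "j : {1..lp i}" and l: "l : {1..lp k}"
 shows "rmult k l i j = len K (homk A (restr (Q i) (soc_pow A (Q i) (lp i - j + 1))) (restr (Q k) (soc_pow A (Q k) (lp k - l + 1))))"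
proof -
 have x: "(i, lp i - j + 1) : s_index A n Q" using i j B1[OF i] by (auto simp: s_index_def)
 have f: "fd K A (s_summand A Q (k, lp k - l + 1))"
  using fd_sub[OF Q_fd[OF k] W.soc_sub[OF Q_left[OF k]]] by (simp add: s_summand_def del: soc_pow.simps)
 show ?thesis unfolding B2[OF i k j l]
  using summands.multiplicity_hom[OF C_summands x f] by (simp add: s_alg_def s_gen_def s_proj_def s_simple_def s_summand_def del: soc_pow.simps)
qed

lemma soc_top: "i : {1..n} ==> restr (Q i) (soc_pow A (Q i) (lp i)) = Q i"
 using W.soc_pow_full_iff[OF Q_fd, of i "lp i"] B1[of i] by (simp add: restr_carrier)

text \<open>(B2) with \<open>j = 1\<close> and \<open>l = s + 1\<close>. The left side is
  \<open>[Rad^s P_k : L_i]\<close> by \<open>rmult_1\<close>; on the right the source is all of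
  \<open>Q_i\<close> by (B1), so \<open>hom_soc_dim\<close> applies, and \<open>wd_soc_Q\<close>
  returns from \<open>P_k\<close> to \<open>Q_i\<close>.\<close>

lemma q_eq:
 assumes i: "i : {1..n}" and k: "k : {1..n}" and s: "s < lp k"
 shows "q i k (lp k - s) = c i k s"
proof -
 have l: "Suc s : {1..lp k}" and j: "1 : {1..lp i}" using s lp_pos[OF i] by auto
 have e: "lp k - Suc s + 1 = lp k - s" "lp i - 1 + 1 = lp i" using s lp_pos[OF i] by simp_all
 have "a i k s = len K (homk A (Q i) (restr (Q k) (soc_pow A (Q k) (lp k - s))))"
  using B2_hom[OF i k j l] rmult_1[OF k i, of "Suc s"] s unfolding e soc_top[OF i] by simp
 hence "a i k s + q i k (lp k - s) = d i k" using hom_soc_dim[OF k Q_fd[OF i], of "lp k - s"] wd_Q_eq[OF i k] by simp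
 thus ?thesis using wd_soc_Q[OF i k, of s] by simp
qed

text \<open>(B2) with \<open>l = 1\<close> and \<open>j = s + 1\<close>, where the target on the
  right is all of \<open>Q_k\<close>, so that \<open>hom_Q_dim\<close> applies.\<close>

lemma b_eq:
 assumes i: "i : {1..n}" and k: "k : {1..n}" and s: "s < lp i"
 shows "b i k s = a i k (lp i - s)"
proof -
 have j: "Suc s : {1..lp i}" and l: "1 : {1..lp k}" using s lp_pos[OF k] by auto
 have e: "lp i - Suc s + 1 = lp i - s" "lp k - 1 + 1 = lp k" using s lp_pos[OF k] by simp_all
 have "rmult k 1 i (Suc s) = c i k (lp i - s)"
  using B2_hom[OF i k j l] hom_Q_dim[OF k fd_sub[OF Q_fd[OF i] W.soc_sub[OF Q_left[OF i]]], of "lp i - s"]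
  unfolding e soc_top[OF k] by simp
 hence "c i k (lp i - s) + b i k s = d i k" using rmult_2[OF k i, of "Suc s"] s by simp
 thus ?thesis using wd_soc_Q[OF i k, of "lp i - s"] by simp
qed

text \<open>The hypothesis says that \<open>L_i\<close> occurs in
  \<open>Rad P_k / Rad^2 P_k\<close>; for \<open>i\<close> different from \<open>k\<close>,
  \<open>L_k\<close> then occurs in \<open>Soc_2 Q_i\<close> but not in the socle. By
  \<open>q_eq\<close> it occurs in \<open>Rad^(l_k - 2) Q_i\<close>, which lies in
  \<open>Soc_(l_i - l_k + 2) Q_i\<close>, so that \<open>l_k <= l_i\<close>. If \<open>l_i\<close>
  were larger, \<open>b_eq\<close> would make \<open>[Soc_(l_i - 2) P_k : L_i]\<close> smaller than
  \<open>[Rad P_k : L_i]\<close>, although this socle term contains \<open>Rad P_k\<close>.\<close>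

lemma arrow_equal:
 assumes i: "i : {1..n}" and k: "k : {1..n}" and ar: "a i k 2 < a i k 1"
 shows "lp i = lp k"
proof (cases "i = k")
 case False
 note sP = W.soc_sub[OF P_left[OF k]] and rP = W.rad_sub[OF P_left[OF k]]
 note sQ = W.soc_sub[OF Q_left[OF i]] and rQ = W.rad_sub[OF Q_left[OF i]]
 interpret Pk: lmod A "P k" by (rule P_lmod[OF k])
 have cd: "c i k t + a i k t = d i k" for t by (rule wd_soc_Q[OF i k])
 have c1: "c i k 1 = 0" using wd_soc_Q_1[OF i k] False by simp
 have c0: "c i k 0 = 0" using wd_soc_0[OF Q_left[OF i] k Q_fd[OF i]] by simp
 have a1: "a i k 1 = d i k" and c2: "0 < c i k 2" using cd[of 1] cd[of 2] c1 ar by simp_all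
 have lk: "2 <= lp k"
 proof (rule ccontr)
  assume "~ 2 <= lp k"
  hence "rad_pow A (P k) 1 = {0[P k]}" using W.rad_pow_zero_iff[OF P_fd[OF k], of 1] by simp
  hence "a i k 1 = 0" using wd_soc_0[OF P_left[OF k] i P_fd[OF k]] by (simp only:)
  thus False using ar by simp
 qed
 \<comment> \<open>\<open>q_eq\<close> requires \<open>2 < l_k\<close>; for \<open>l_k = 2\<close>
   the radical power in question is all of \<open>Q_i\<close>.\<close>
 have "0 < q i k (lp k - 2)"
 proof (cases "lp k = 2")
  case True thus ?thesis using wd_Q_eq[OF i k] a1 ar by simp
 next
  case False thus ?thesis using q_eq[OF i k, of 2] lk c2 by simp
 qed
 hence q0: "rad_pow A (Q i) (lp k - 2) ~= {0[Q i]}" and q1: "0 < q i k (lp k - 2)"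
  using wd_soc_0[OF Q_left[OF i] k Q_fd[OF i]] by (metis less_irrefl)+
 hence tl: "lp k - 2 < lp i" using W.rad_pow_zero_iff[OF Q_fd[OF i], of "lp k - 2"] B1[OF i] by simp
 have "rad_pow A (Q i) (lp k - 2) <= soc_pow A (Q i) (lp i - (lp k - 2))" using W.rad_le_soc[OF Q_fd[OF i], of "lp k - 2"] tl B1[OF i] by simp
 hence "q i k (lp k - 2) <= c i k (lp i - (lp k - 2))" by (rule wdim_mono(1)[OF Q_fd[OF i] rQ sQ _ W.e_closed[OF k]])
 hence "0 < c i k (lp i - (lp k - 2))" using q1 by simp
 hence "lp i - (lp k - 2) ~= 0" "lp i - (lp k - 2) ~= 1" using c0 c1 by (metis less_irrefl)+
 hence le1: "lp k <= lp i" using lk by simp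
 have "lp i <= lp k"
 proof (rule ccontr)
  assume n: "~ lp i <= lp k"
  have "b i k (lp i - 2) = a i k (lp i - (lp i - 2))" by (rule b_eq[OF i k]) (use n lk in simp)
  moreover have "lp i - (lp i - 2) = 2" using n lk by simp
  ultimately have b2: "b i k (lp i - 2) < d i k" using ar a1 by simp
  have "rad_pow A (P k) 1 <= soc_pow A (P k) (lp k - 1)" using W.rad_le_soc[OF P_fd[OF k], of 1] lk by simp
  also have "... <= soc_pow A (P k) (lp i - 2)" by (rule W.soc_pow_mono[OF P_left[OF k]]) (use n in simp)
  finally have "a i k 1 <= b i k (lp i - 2)" by (rule wdim_mono(1)[OF P_fd[OF k] rP sP _ W.e_closed[OF i]])
  thus False using b2 a1 by simp
 qed
 thus ?thesis using le1 by simp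
qed simp

text \<open>By \<open>arrow_equal\<close> the arrows of the quiver, hence its paths, join only
  vertices with equal Loewy length; this is that argument in terms of radical powers. Let
  \<open>y\<close> in \<open>Rad^s P_k\<close> have weight \<open>e_h\<close>. If \<open>l_h\<close>
  differs from \<open>l_k\<close>, then \<open>y\<close> is already in \<open>Rad^(s+1) P_k\<close>
  by induction. Otherwise \<open>L_i\<close> is not in the second radical layer of
  \<open>P_h\<close>, so \<open>e_i J\<close> sends the generator of \<open>P_h\<close> into
  \<open>Rad^2 P_h\<close>, and the map from \<open>P_h\<close> to \<open>P_k\<close> with value
  \<open>y\<close> carries this into \<open>Rad^(s+2) P_k\<close>.\<close>

lemma no_path:
 assumes k: "k : {1..n}"
 shows "!!i. [|i : {1..n}; lp i ~= lp k|] ==> wt (P k) (ei i) (car (P k)) <= rad_pow A (P k) (Suc s)"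
proof (induction s)
 case 0
 have r1: "rad_pow A (P k) (Suc 0) = rad A (P k)" by (simp add: restr_carrier)
 have "i ~= k" using 0 by blast
 hence "W.wd i (P k) (rad A (P k)) = d i k" using P_rad(3)[OF k 0(1)] by simp
 hence "wt (P k) (ei i) (rad A (P k)) = wt (P k) (ei i) (car (P k))"
  using W.rad_submodule[OF P_left[OF k]] lmod.sub_carrier[OF P_lmod[OF k]]
  by (intro wdim_mono(2)[OF P_fd[OF k] _ _ _ W.e_closed[OF 0(1)]]) (simp_all add: rad_def)
 thus ?case unfolding r1 by (auto simp: wt_def)
next
 case (Suc s)
 note i = Suc.prems
 interpret Pk: lmod A "P k" by (rule P_lmod[OF k])
 note Pl = Pk.left
 note r0 = W.rad_sub[OF Pl, of s]
 define B where "B = rad_pow A (P k) (Suc (Suc s))"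
 note rS = subD[OF W.rad_sub[OF Pl, of "Suc (Suc s)"], folded B_def]
 have eA: "ei i : car A" by (rule W.e_closed[OF i(1)])
 \<comment> \<open>Vectors \<open>y\<close> with \<open>e_i X y\<close> inside
   \<open>Rad^(s+2) P_k\<close>. As \<open>U J\<close> is a submodule, it contains
   \<open>Rad^s P_k\<close> once it contains the weight vectors; it follows that
   \<open>Rad^(s+1) P_k\<close> lies in \<open>U A\<close>.\<close>
 define U where "U X = {y : car (P k). ALL r:X. ei i *[P k] (r *[P k] y) : B}" for X
 have UI: "y : U X" if "y : car (P k)" "!!r. r : X ==> ei i *[P k] (r *[P k] y) : B" for X y
  using that unfolding U_def by blast
 have UD: "y : car (P k)" "!!r. r : X ==> ei i *[P k] (r *[P k] y) : B" if "y : U X" for X y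
  using that unfolding U_def by blast+
 have U: "submodule (U X) A (P k)" if "X <= car A" "!!r x. [|r : X; x : car A|] ==> r \<otimes>[A] x : X" for X
  unfolding U_def by (rule Pk.colon_submodule[OF eA that rS(2,4)])
 have UJ: "submodule (U W.J) A (P k)" using W.J_carrier W.J_right by (intro U) blast+
 have UA: "submodule (U (car A)) A (P k)" by (rule U) auto
 have wtU: "wt (P k) (ei h) (rad_pow A (P k) s) <= U W.J" if h: "h : {1..n}" for h
 proof
  fix y assume "y : wt (P k) (ei h) (rad_pow A (P k) s)"
  hence y: "y : rad_pow A (P k) s" "ei h *[P k] y = y" by (simp_all add: wt_def)
  have yc: "y : car (P k)" by (rule Pk.sub_mem[OF r0 y(1)])
  show "y : U W.J"
  proof (rule UI[OF yc])
   fix r assume r: "r : W.J"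
   have rc: "r : car A" by (rule W.J_carrier[OF r])
   show "ei i *[P k] (r *[P k] y) : B"
   proof (cases "lp h = lp k")
    case False
    have "y : wt (P k) (ei h) (car (P k))" using y(2) yc by (simp add: wt_def)
    hence "y : rad_pow A (P k) (Suc s)" using Suc.IH[OF h False] by blast
    hence "r *[P k] y : B" unfolding B_def by (rule W.rad_pow_Suc_mem[OF P_fd[OF k] r])
    thus ?thesis by (rule rS(5)[OF eA])
   next
    case True
    hence "lp i ~= lp h" using i(2) by simp
    hence "~ a i h 2 < a i h 1" using arrow_equal[OF i(1) h] by blast
    moreover have le: "rad_pow A (P h) 2 <= rad_pow A (P h) 1" by (rule W.rad_pow_antimono[OF P_fd[OF h]]) simp
    note rh = W.rad_sub[OF P_left[OF h]]
    ultimately have "a i h 2 = a i h 1" using wdim_mono(1)[OF P_fd[OF h] rh rh le eA] by simp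
    hence we: "wt (P h) (ei i) (rad_pow A (P h) 2) = wt (P h) (ei i) (rad_pow A (P h) 1)" by (rule wdim_mono(2)[OF P_fd[OF h] rh rh le eA])
    interpret Ph: lmod A "P h" by (rule P_lmod[OF h])
    note pgh = pg_facts[OF h]
    have "r *[P h] pg h : rad_pow A (P h) (Suc 0)" by (rule W.rad_pow_Suc_mem[OF P_fd[OF h] r]) (simp add: pgh)
    hence "r *[P h] pg h : rad_pow A (P h) 1" by (simp only: One_nat_def)
    hence "ei i *[P h] (r *[P h] pg h) : wt (P h) (ei i) (rad_pow A (P h) 1)"
     using subD(5)[OF rh eA] Ph.smult_assoc1[OF eA eA Ph.smult_closed[OF rc pgh(1)]] i(1)
     by (simp add: wt_def del: rad_pow.simps One_nat_def)
    hence m2: "ei i *[P h] (r *[P h] pg h) : rad_pow A (P h) 2" unfolding we[symmetric] by (simp only: wt_def mem_Collect_eq)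
    obtain f where f: "f : lhom A (P h) (P k)" "f (pg h) = y" using pgen_hom[OF ei_facts(1)[OF h] Pl yc y(2)] .
    have "f ` car (P h) <= rad_pow A (P k) s"
    proof
     fix z assume "z : f ` car (P h)"
     then obtain u where u: "u : car (P h)" "z = f u" by blast
     obtain g where g: "g : car A" "u = g *[P h] pg h" using pgh(3)[OF u(1)] by blast
     show "z : rad_pow A (P k) s" unfolding u(2) g(2) lhom_smult[OF f(1) g(1) pgh(1)] f(2) by (rule subD(5)[OF r0 g(1) y(1)])
    qed
    hence "f ` rad_pow A (P h) 2 <= rad_pow A (P k) (2 + s)" by (rule W.rad_pow_hom[OF P_fd[OF h] P_fd[OF k] f(1)])
    hence "f (ei i *[P h] (r *[P h] pg h)) : rad_pow A (P k) (2 + s)" using m2 by blast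
    moreover have "f (ei i *[P h] (r *[P h] pg h)) = ei i *[P k] (r *[P k] y)"
     using lhom_smult[OF f(1) eA Ph.smult_closed[OF rc pgh(1)]] lhom_smult[OF f(1) rc pgh(1)] f(2) by simp
    ultimately show ?thesis by (simp add: B_def del: rad_pow.simps)
   qed
  qed
 qed
 have "span_in A (P k) (\<Union>h\<in>{1..n}. wt (P k) (ei h) (rad_pow A (P k) s)) <= U W.J"
  by (rule Pk.span_least[OF UJ]) (use wtU in blast)
 hence rU: "rad_pow A (P k) s <= U W.J" unfolding W.span_weights[OF P_fd[OF k] r0] .
 have "rad_pow A (P k) (Suc s) <= U (car A)"
  unfolding W.rad_pow_Suc_le_iff[OF P_fd[OF k] UA]
 proof (intro ballI)
  fix r y assume r: "r : W.J" and "y : rad_pow A (P k) s"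
  hence yU: "y : U W.J" using rU by blast
  note yc = UD(1)[OF yU]
  show "r *[P k] y : U (car A)"
  proof (rule UI)
   fix g assume g: "g : car A"
   show "ei i *[P k] (g *[P k] (r *[P k] y)) : B"
    using UD(2)[OF yU W.J_left[OF g r]] Pk.smult_assoc1[OF g W.J_carrier[OF r] yc] by simp
  qed (use yc W.J_carrier[OF r] in simp)
 qed
 hence all: "wt (P k) (ei i) (car (P k)) <= U (car A)" using Suc.IH[OF i] by blast
 show ?case
 proof
  fix y assume y: "y : wt (P k) (ei i) (car (P k))"
  hence yc: "y : car (P k)" "ei i *[P k] y = y" by (simp_all add: wt_def)
  have "y : U (car A)" using y all by blast
  from UD(2)[OF this A.one_closed] show "y : rad_pow A (P k) (Suc (Suc s))" using yc by (simp add: B_def del: rad_pow.simps)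
 qed
qed

lemma no_path_zero:
 assumes "k : {1..n}" "i : {1..n}" "lp i ~= lp k"
 shows "wt (P k) (ei i) (car (P k)) <= {0[P k]}"
proof -
 have "rad_pow A (P k) (Suc (lp k)) = {0[P k]}" using W.rad_pow_zero_iff[OF P_fd[OF assms(1)], of "Suc (lp k)"] by (simp del: rad_pow.simps)
 thus ?thesis using no_path[OF assms, of "lp k"] by (simp only:)
qed

section \<open>Connectedness forces equal Loewy lengths\<close>

definition ann :: "nat set => 'a set" where
 "ann Y = {x : car A. ALL k:Y. ALL v:car (P k). x *[P k] v = 0[P k]}"

lemma annI: "x : car A ==> (!!k v. [|k : Y; v : car (P k)|] ==> x *[P k] v = 0[P k]) ==> x : ann Y"
 unfolding ann_def by blast
lemma annD: "x : ann Y ==> x : car A" "[|x : ann Y; k : Y; v : car (P k)|] ==> x *[P k] v = 0[P k]"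
 unfolding ann_def by blast+

lemma ann_ideal:
 assumes Y: "Y <= {1..n}"
 shows "submodule (ann Y) A (reg A)" "ideal (ann Y) A"
proof -
 interpret M: lmod A "reg A" using reg_left by simp
 have Pk: "lmod A (P k)" if "k : Y" for k using P_lmod Y that by blast
 show s: "submodule (ann Y) A (reg A)"
 proof (rule M.submoduleI)
  show "ann Y <= car (reg A)" using annD(1) by auto
  show "0[reg A] : ann Y" by (rule annI) (use lmod.smult_l_null[OF Pk] in simp_all)
  fix x y assume xy: "x : ann Y" "y : ann Y"
  note xc = annD(1)[OF xy(1)] annD(1)[OF xy(2)]
  have "(x +[A] y) *[P k] v = 0[P k]" if k: "k : Y" and v: "v : car (P k)" for k v
  proof -
   interpret Pk: lmod A "P k" by (rule Pk[OF k])
   show ?thesis using Pk.smult_l_distr[OF xc v] annD(2)[OF xy(1) k v] annD(2)[OF xy(2) k v] by simp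
  qed
  thus "x +[reg A] y : ann Y" using xc by (intro annI) simp_all
 next
  fix r x assume r: "r : car A" and x: "x : ann Y"
  note xc = annD(1)[OF x]
  have "(r \<otimes>[A] x) *[P k] v = 0[P k]" if k: "k : Y" and v: "v : car (P k)" for k v
  proof -
   interpret Pk: lmod A "P k" by (rule Pk[OF k])
   show ?thesis using Pk.smult_assoc1[OF r xc v] annD(2)[OF x k v] r by simp
  qed
  thus "r *[reg A] x : ann Y" using r xc by (intro annI) simp_all
 qed
 show "ideal (ann Y) A"
 proof (rule ideal_if[OF s])
  fix r x assume x: "x : ann Y" and r: "r : car A"
  note xc = annD(1)[OF x]
  have "(x \<otimes>[A] r) *[P k] v = 0[P k]" if k: "k : Y" and v: "v : car (P k)" for k v
  proof -
   interpret Pk: lmod A "P k" by (rule Pk[OF k])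
   show ?thesis using Pk.smult_assoc1[OF xc r v] annD(2)[OF x k Pk.smult_closed[OF r v]] by simp
  qed
  thus "x \<otimes>[A] r : ann Y" using r xc by (intro annI) simp_all
 qed
qed

text \<open>The \<open>e_h\<close> need not sum to \<open>1\<close>, as \<open>A\<close> need not be
  basic, but by \<open>span_weights\<close> the sets \<open>e_h A\<close> generate \<open>A\<close>
  as a left module.\<close>

lemma one_mem:
 assumes U: "submodule U A (reg A)" and w: "!!h x. [|h : {1..n}; x : car A|] ==> ei h \<otimes>[A] x : U"
 shows "U = car A"
proof -
 interpret M: lmod A "reg A" using reg_left by simp
 have "wt (reg A) (ei h) (car (reg A)) <= U" if h: "h : {1..n}" for h
 proof
  fix x assume "x : wt (reg A) (ei h) (car (reg A))"
  hence x: "x : car A" "ei h \<otimes>[A] x = x" by (simp_all add: wt_def)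
  show "x : U" using w[OF h x(1)] x(2) by simp
 qed
 hence "span_in A (reg A) (\<Union>h\<in>{1..n}. wt (reg A) (ei h) (car (reg A))) <= U" by (intro M.span_least[OF U]) blast
 hence "car A <= U" unfolding W.span_weights[OF reg_fd M.sub_carrier] by simp
 thus ?thesis using subD(1)[OF U] by auto
qed

text \<open>If \<open>x\<close> kills every \<open>P_h\<close>, a copy of \<open>A e_h\<close>, then
  \<open>x A e_h = 0\<close>. The elements \<open>y\<close> with \<open>x A y = 0\<close> form a
  left ideal that contains every \<open>e_h A\<close>, hence \<open>1\<close>.\<close>

lemma ann_all: "ann {1..n} = {0[A]}"
proof -
 interpret M: lmod A "reg A" using reg_left by simp
 have "x = 0[A]" if x: "x : ann {1..n}" for x
 proof -
  have xc: "x : car A" by (rule annD(1)[OF x])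
  let ?U = "{y : car A. ALL g:car A. (x \<otimes>[A] g) \<otimes>[A] y = 0[A]}"
  have U: "submodule ?U A (reg A)"
  proof (rule M.submoduleI)
   fix r y assume r: "r : car A" and y: "y : ?U"
   have "(x \<otimes>[A] g) \<otimes>[A] (r \<otimes>[A] y) = (x \<otimes>[A] (g \<otimes>[A] r)) \<otimes>[A] y" if "g : car A" for g
    using that r y xc by (simp add: A.m_assoc)
   thus "r *[reg A] y : ?U" using r y by simp
  qed (use xc in \<open>auto simp: A.r_distr\<close>)
  have "ei h \<otimes>[A] y : ?U" if h: "h : {1..n}" and y: "y : car A" for h y
  proof -
   interpret Ph: lmod A "P h" by (rule P_lmod[OF h])
   note pgh = pg_facts[OF h]
   have e: "ei h : car A" by (rule W.e_closed[OF h])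
   have "(x \<otimes>[A] g) \<otimes>[A] (ei h \<otimes>[A] y) = 0[A]" if g: "g : car A" for g
   proof -
    have xg: "x \<otimes>[A] g : car A" using xc g by simp
    have "(x \<otimes>[A] g) *[P h] pg h = 0[P h]"
     using Ph.smult_assoc1[OF xc g pgh(1)] annD(2)[OF x h Ph.smult_closed[OF g pgh(1)]] by simp
    hence "(x \<otimes>[A] g) \<otimes>[A] ei h = 0[A]" using ei_facts(1)[OF h] xg unfolding pgen_def by blast
    thus ?thesis using A.m_assoc[OF xg e y] y by simp
   qed
   thus ?thesis using e y by simp
  qed
  hence "?U = car A" by (rule one_mem[OF U])
  hence "1[A] : ?U" by simp
  hence "(x \<otimes>[A] 1[A]) \<otimes>[A] 1[A] = 0[A]" by blast
  thus ?thesis using xc by simp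
 qed
 moreover have "0[A] : ann {1..n}" using subD(2)[OF ann_ideal(1)[OF order_refl]] by simp
 ultimately show ?thesis by blast
qed

text \<open>Otherwise split the indices into the class \<open>X\<close> of those with Loewy length
  \<open>l_i\<close> and the rest \<open>Y\<close>. By \<open>no_path_zero\<close> each
  \<open>e_h A\<close> annihilates the projectives of the other class. So the ideals
  \<open>ann X\<close> and \<open>ann Y\<close> are nonzero and add up to \<open>A\<close>, and by
  \<open>ann_all\<close> they intersect in zero, contrary to connectedness.\<close>

lemma loewy_const:
 assumes con: "connected_alg A" and i: "i : {1..n}" and k: "k : {1..n}"
 shows "lp i = lp k"
proof (rule ccontr)
 assume ne: "lp i ~= lp k"
 interpret M: lmod A "reg A" using reg_left by simp
 define X where "X = {h : {1..n}. lp h = lp i}"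
 define Y where "Y = {h : {1..n}. lp h ~= lp i}"
 have XY: "X <= {1..n}" "Y <= {1..n}" "i : X" "k : Y" "X \<union> Y = {1..n}" using i k ne by (auto simp: X_def Y_def)
 have mem: "ei h \<otimes>[A] x : ann Z" if h: "h : {1..n}" and x: "x : car A" and Z: "Z <= {1..n}" "!!j. j : Z ==> lp h ~= lp j" for h x Z
 proof (rule annI)
  have e: "ei h : car A" by (rule W.e_closed[OF h])
  show "ei h \<otimes>[A] x : car A" using e x by simp
  fix j v assume j: "j : Z" and v: "v : car (P j)"
  have jn: "j : {1..n}" using j Z(1) by blast
  interpret Pj: lmod A "P j" by (rule P_lmod[OF jn])
  have xv: "x *[P j] v : car (P j)" using x v by simp
  have "ei h *[P j] (x *[P j] v) : wt (P j) (ei h) (car (P j))"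
   using Pj.smult_assoc1[OF e e xv] h xv by (simp add: wt_def)
  hence "ei h *[P j] (x *[P j] v) = 0[P j]" using no_path_zero[OF jn h Z(2)[OF j]] by blast
  thus "(ei h \<otimes>[A] x) *[P j] v = 0[P j]" using Pj.smult_assoc1[OF e x v] by simp
 qed
 note sX = ann_ideal(1)[OF XY(1)] and sY = ann_ideal(1)[OF XY(2)]
 have "ann X <+>\<^bsub>reg A\<^esub> ann Y = car A"
 proof (rule one_mem[OF M.sub_sum[OF sX sY]])
  fix h x assume h: "h : {1..n}" and x: "x : car A"
  show "ei h \<otimes>[A] x : ann X <+>\<^bsub>reg A\<^esub> ann Y"
  proof (cases "lp h = lp i")
   case True
   have "ei h \<otimes>[A] x : ann Y" by (rule mem[OF h x XY(2)]) (use True in \<open>auto simp: Y_def\<close>)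
   thus ?thesis using M.sum_upper2[OF sX sY] by blast
  next
   case False
   have "ei h \<otimes>[A] x : ann X" by (rule mem[OF h x XY(1)]) (use False in \<open>auto simp: X_def\<close>)
   thus ?thesis using M.sum_upper1[OF sX sY] by blast
  qed
 qed
 moreover have "ann X <+>\<^bsub>reg A\<^esub> ann Y = ann X <+>\<^bsub>A\<^esub> ann Y" by (simp add: set_add_def set_mult_def)
 ultimately have sum: "ann X <+>\<^bsub>A\<^esub> ann Y = car A" by simp
 have "ann X \<inter> ann Y = ann {1..n}" unfolding ann_def XY(5)[symmetric] by blast
 hence int: "ann X \<inter> ann Y = {0[A]}" using ann_all by simp
 have nz: "ann Z ~= {0[A]}" if h: "h : {1..n}" and Z: "Z <= {1..n}" "!!j. j : Z ==> lp h ~= lp j" for h Z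
 proof
  assume z: "ann Z = {0[A]}"
  interpret Ph: lmod A "P h" by (rule P_lmod[OF h])
  have e: "ei h : car A" by (rule W.e_closed[OF h])
  have "ei h \<otimes>[A] 1[A] : ann Z" using mem[OF h A.one_closed Z] .
  hence "ei h = 0[A]" using z e by simp
  hence "pg h = 0[P h]" using pg_facts(1,2)[OF h] by simp
  hence "y = 0[P h]" if "y : car (P h)" for y using pg_facts(3)[OF h that] by auto
  hence "car (P h) = {0[P h]}" using Ph.M.zero_closed by blast
  thus False using P_rad(2)[OF h] subD(1,2)[OF W.rad_submodule[OF P_left[OF h]]] by auto
 qed
 have "ann X ~= {0[A]}" by (rule nz[OF k XY(1)]) (use ne in \<open>auto simp: X_def\<close>)
 moreover have "ann Y ~= {0[A]}" by (rule nz[OF i XY(2)]) (auto simp: Y_def)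
 ultimately show False using con ann_ideal(2)[OF XY(1)] ann_ideal(2)[OF XY(2)] int sum unfolding connected_alg_def by blast
qed

lemma main:
 assumes con: "connected_alg A"
 shows "(ALL i:{1..n}. ALL k:{1..n}. lp i = lp k) & (ALL i:{1..n}. rigid A (P i)) & (ALL i:{1..n}. rigid A (Q i))"
proof (intro conjI ballI)
 show "lp i = lp k" if "i : {1..n}" "k : {1..n}" for i k by (rule loewy_const[OF con that])
 show "rigid A (P k)" if k: "k : {1..n}" for k
  by (rule W.rigid_if[OF P_fd[OF k]]) (use b_eq[OF _ k] loewy_const[OF con _ k] in simp)
 show "rigid A (Q i)" if i: "i : {1..n}" for i
  by (rule W.rigid_if[OF Q_fd[OF i]]) (use q_eq[OF i] loewy_const[OF con _ i] B1[OF i] in simp)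
qed

end

theorem theoremB:
  fixes K :: "'k ring" and A :: "('k, 'a) module" and n :: nat
    and L :: "nat \<Rightarrow> ('a, 'l) module"
    and P :: "nat \<Rightarrow> ('a, 'p) module"
    and Q :: "nat \<Rightarrow> ('a, 'q) module"
    and H :: "nat \<times> nat \<Rightarrow> ('p adr_carrier \<Rightarrow> 'p adr_carrier, 'h) module"
    and T :: "nat \<times> nat \<Rightarrow> ('p adr_carrier \<Rightarrow> 'p adr_carrier, 't) module"
  assumes algebra: "fd_algebra K A" and connected: "connected_alg A"
    and simples: "simple_modules A {1..n} L"
    and proj_covers: "\<forall>i\<in>{1..n}. projective_cover A (P i) (L i)"
    and inj_hulls: "\<forall>i\<in>{1..n}. injective_hull A (Q i) (L i)"
    and end_dim: "\<forall>i\<in>{1..n}. has_dim K (end_alg A (L i)) 1"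
    and adr_inj_hulls: "\<forall>x\<in>adr_index A n P. injective_hull (adr_alg A n P) (H x) (adr_simple A n P x)"
    and tilting: "\<forall>x\<in>adr_index A n P. is_tilting (adr_alg A n P) (adr_index A n P) adr_le
        (adr_standard A n P) (adr_costandard A n P H) x (T x)"
    and B1: "\<forall>i\<in>{1..n}. loewy_length A (P i) = loewy_length A (Q i)"
    and B2: "\<forall>i\<in>{1..n}. \<forall>k\<in>{1..n}.
        \<forall>j\<in>{1..loewy_length A (P i)}. \<forall>l\<in>{1..loewy_length A (P k)}.
        multiplicity_of (ringel_dual (adr_alg A n P) (adr_index A n P) T)
          (ringel_proj (adr_alg A n P) (adr_index A n P) T (k, l))
          (ringel_simple (adr_alg A n P) (adr_index A n P) T (i, j)) =
        multiplicity_of (s_alg A n Q)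
          (s_proj A n Q (k, loewy_length A (P k) - l + 1))
          (s_simple A n Q (i, loewy_length A (P i) - j + 1))"
  shows "(\<forall>i\<in>{1..n}. \<forall>k\<in>{1..n}. loewy_length A (P i) = loewy_length A (P k))
    \<and> (\<forall>i\<in>{1..n}. rigid A (P i))
    \<and> (\<forall>i\<in>{1..n}. rigid A (Q i))"
proof -
 have "base_B K A n L P Q H T"
  by (intro base_B.intro base_tilt.intro base.intro fdalg.intro base_axioms.intro base_tilt_axioms.intro base_B_axioms.intro algebra simples)
   (use proj_covers inj_hulls end_dim adr_inj_hulls tilting B1 B2 in blast)+
 thus ?thesis using base_B.main[OF _ connected] by blast
qed

end
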